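(* Let $S\subseteq\{\neg,\overline{\ \ },\wedge,\vee,\Box,\Diamond,\mathit{true},\mathit{false}\}$. If $S$ contains $\{\neg,\wedge,\Box\}$, $\{\neg,\wedge,\Diamond\}$, $\{\neg,\vee,\Box\}$, $\{\neg,\vee,\Diamond\}$, or $\{\overline{\ \ },\wedge,\vee,\Box,\Diamond\}$, then $\mathcal{L}(S)$ satisfiability is PSPACE-complete.
   Context: For $S$ a subset of the operators $\{\neg,\overline{\ \ },\wedge,\vee,\Box,\Diamond,\mathit{true},\mathit{false}\}$, $\mathcal{L}(S)$ is the set of modal formulas built from a countably infinite set of propositional variables using only operators in $S$. Here $\neg$ is general negation (applicable to any formula), $\overline{\ \ }$ is atomic negation (applicable only to propositional variables, giving $\overline{p}$), and $\mathit{true},\mathit{false}$ are constants. Semantics is standard Kripke semantics: a model $\langle W,R,\pi\rangle$ with $W$ non-empty, $R\subseteq W\times W$, $\pi$ a valuation; $\Box\phi$ holds at $w$ iff $\phi$ holds at all $R$-successors of $w$, $\Diamond\phi$ iff at some $R$-successor. $\mathcal{L}(S)$ satisfiability is the problem of deciding, given an $\mathcal{L}(S)$ formula, whether it is true at some world of some model (over the class of all frames). *)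

theory Defs
  imports Main "HOL-Computational_Algebra.Polynomial"
begin

section \<open>Modal formulas and their languages\<close>

datatype connective =
    ONeg      \<comment> \<open>general negation\<close>
  | OAtNeg    \<comment> \<open>atomic negation\<close>
  | OAnd | OOr | OBox | ODia | OTrue | OFalse

datatype fm =
    Atom nat
  | NAtom nat  \<comment> \<open>an atomically negated variable\<close>
  | FNeg fm
  | FAnd fm fm
  | FOr fm fm
  | FBox fm
  | FDia fm
  | FTrue
  | FFalse

primrec connectives :: "fm \<Rightarrow> connective set" where
  "connectives (Atom n) = {}"
| "connectives (NAtom n) = {OAtNeg}"
| "connectives (FNeg \<phi>) = insert ONeg (connectives \<phi>)"
| "connectives (FAnd \<phi> \<psi>) = insert OAnd (connectives \<phi> \<union> connectives \<psi>)"
| "connectives (FOr \<phi> \<psi>) = insert OOr (connectives \<phi> \<union> connectives \<psi>)"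
| "connectives (FBox \<phi>) = insert OBox (connectives \<phi>)"
| "connectives (FDia \<phi>) = insert ODia (connectives \<phi>)"
| "connectives FTrue = {OTrue}"
| "connectives FFalse = {OFalse}"

definition modal_lang :: "connective set \<Rightarrow> fm set" where
  "modal_lang S = {\<phi>. connectives \<phi> \<subseteq> S}"


section \<open>Kripke semantics\<close>

primrec holds :: "('w \<times> 'w) set \<Rightarrow> (nat \<Rightarrow> 'w \<Rightarrow> bool) \<Rightarrow> 'w \<Rightarrow> fm \<Rightarrow> bool" where
  "holds R \<pi> w (Atom n) \<longleftrightarrow> \<pi> n w"
| "holds R \<pi> w (NAtom n) \<longleftrightarrow> \<not> \<pi> n w"
| "holds R \<pi> w (FNeg \<phi>) \<longleftrightarrow> \<not> holds R \<pi> w \<phi>"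
| "holds R \<pi> w (FAnd \<phi> \<psi>) \<longleftrightarrow> holds R \<pi> w \<phi> \<and> holds R \<pi> w \<psi>"
| "holds R \<pi> w (FOr \<phi> \<psi>) \<longleftrightarrow> holds R \<pi> w \<phi> \<or> holds R \<pi> w \<psi>"
| "holds R \<pi> w (FBox \<phi>) \<longleftrightarrow> (\<forall>v. (w, v) \<in> R \<longrightarrow> holds R \<pi> v \<phi>)"
| "holds R \<pi> w (FDia \<phi>) \<longleftrightarrow> (\<exists>v. (w, v) \<in> R \<and> holds R \<pi> v \<phi>)"
| "holds R \<pi> w FTrue \<longleftrightarrow> True"
| "holds R \<pi> w FFalse \<longleftrightarrow> False"

definition kripke_frame :: "'w set \<Rightarrow> ('w \<times> 'w) set \<Rightarrow> bool" where
  "kripke_frame W R \<longleftrightarrow> W \<noteq> {} \<and> R \<subseteq> W \<times> W"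

definition satisfiable_over :: "'w itself \<Rightarrow> fm \<Rightarrow> bool" where
  "satisfiable_over T \<phi> \<longleftrightarrow>
     (\<exists>(W :: 'w set) R \<pi>. kripke_frame W R \<and> (\<exists>w\<in>W. holds R \<pi> w \<phi>))"

text \<open>
  HOL cannot quantify existentially over the type of worlds. Worlds are taken from
  \<open>nat\<close>; lemma \<open>satisfiable_if_satisfiable_over\<close> below shows that a model whose
  worlds come from any other type makes no further formula satisfiable.
\<close>

definition satisfiable :: "fm \<Rightarrow> bool" where
  "satisfiable \<phi> \<longleftrightarrow> satisfiable_over TYPE(nat) \<phi>"

primrec subformulas :: "fm \<Rightarrow> fm set" where
  "subformulas (Atom n) = {Atom n}"
| "subformulas (NAtom n) = {NAtom n, Atom n}"
| "subformulas (FNeg \<phi>) = insert (FNeg \<phi>) (subformulas \<phi>)"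
| "subformulas (FAnd \<phi> \<psi>) = insert (FAnd \<phi> \<psi>) (subformulas \<phi> \<union> subformulas \<psi>)"
| "subformulas (FOr \<phi> \<psi>) = insert (FOr \<phi> \<psi>) (subformulas \<phi> \<union> subformulas \<psi>)"
| "subformulas (FBox \<phi>) = insert (FBox \<phi>) (subformulas \<phi>)"
| "subformulas (FDia \<phi>) = insert (FDia \<phi>) (subformulas \<phi>)"
| "subformulas FTrue = {FTrue}"
| "subformulas FFalse = {FFalse}"

lemma finite_subformulas: "finite (subformulas \<phi>)"
  by (induction \<phi>) auto

lemma subformulas_refl: "\<phi> \<in> subformulas \<phi>"
  by (cases \<phi>) auto

lemma satisfiable_if_satisfiable_over:
  assumes "satisfiable_over TYPE('w) \<phi>"
  shows "satisfiable \<phi>"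
proof -
  from assms obtain W :: "'w set" and R \<pi> w
    where fr: "kripke_frame W R" and w: "w \<in> W" and sat: "holds R \<pi> w \<phi>"
    unfolding satisfiable_over_def by blast
  define th where "th v = {\<psi> \<in> subformulas \<phi>. holds R \<pi> v \<psi>}" for v
  have "range th \<subseteq> Pow (subformulas \<phi>)" by (auto simp: th_def)
  then have "finite (range th)"
    using finite_subformulas finite_subset by (metis finite_Pow_iff)
  then obtain e :: "fm set \<Rightarrow> nat" where e: "inj_on e (range th)"
    using finite_imp_inj_to_nat_seg by metis
  define c where "c v = e (th v)" for v
  have c_eq: "th u = th v" if "c u = c v" for u v
    using that e unfolding c_def by (auto dest: inj_onD)
  have c_holds: "holds R \<pi> u \<psi> \<longleftrightarrow> holds R \<pi> v \<psi>"
    if "c u = c v" "\<psi> \<in> subformulas \<phi>" for u v \<psi>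
  proof -
    have "\<psi> \<in> th u \<longleftrightarrow> \<psi> \<in> th v" using c_eq[OF that(1)] by simp
    then show ?thesis using that(2) by (simp add: th_def)
  qed
  define R' where "R' = {(c u, c v) | u v. (u, v) \<in> R}"
  define \<pi>' where "\<pi>' n x \<longleftrightarrow> (\<exists>v. x = c v \<and> \<pi> n v \<and> Atom n \<in> subformulas \<phi>)" for n x
  have atoms: "\<pi>' n (c v) \<longleftrightarrow> \<pi> n v" if n: "Atom n \<in> subformulas \<phi>" for n v
  proof
    assume "\<pi>' n (c v)"
    then obtain u where u: "c v = c u" "\<pi> n u" by (auto simp: \<pi>'_def)
    then show "\<pi> n v" using c_holds[OF u(1) n] by simp
  next
    assume "\<pi> n v"
    then show "\<pi>' n (c v)" using n by (auto simp: \<pi>'_def)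
  qed
  have "\<forall>v. holds R' \<pi>' (c v) \<psi> \<longleftrightarrow> holds R \<pi> v \<psi>"
    if "subformulas \<psi> \<subseteq> subformulas \<phi>" for \<psi>
    using that
  proof (induction \<psi>)
    case (Atom n)
    then show ?case using atoms by auto
  next
    case (NAtom n)
    then show ?case using atoms by auto
  next
    case (FBox \<psi>)
    then have IH: "\<forall>v. holds R' \<pi>' (c v) \<psi> \<longleftrightarrow> holds R \<pi> v \<psi>"
      and sub: "FBox \<psi> \<in> subformulas \<phi>" by auto
    have "holds R' \<pi>' (c v) (FBox \<psi>)" if "holds R \<pi> v (FBox \<psi>)" for v
    proof -
      have "holds R' \<pi>' x \<psi>" if x: "(c v, x) \<in> R'" for x
      proof -
        obtain u u' where u: "c v = c u" "x = c u'" "(u, u') \<in> R"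
          using x by (auto simp: R'_def)
        have "holds R \<pi> u (FBox \<psi>)"
          using c_holds[OF u(1) sub] \<open>holds R \<pi> v (FBox \<psi>)\<close> by blast
        then show ?thesis using u IH by auto
      qed
      then show ?thesis by simp
    qed
    moreover have "holds R \<pi> v (FBox \<psi>)" if "holds R' \<pi>' (c v) (FBox \<psi>)" for v
      using that IH by (auto simp: R'_def)
    ultimately show ?case by blast
  next
    case (FDia \<psi>)
    then have IH: "\<forall>v. holds R' \<pi>' (c v) \<psi> \<longleftrightarrow> holds R \<pi> v \<psi>"
      and sub: "FDia \<psi> \<in> subformulas \<phi>" by auto
    have "holds R \<pi> v (FDia \<psi>)" if "holds R' \<pi>' (c v) (FDia \<psi>)" for v
    proof -
      obtain x where x: "(c v, x) \<in> R'" "holds R' \<pi>' x \<psi>"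
        using \<open>holds R' \<pi>' (c v) (FDia \<psi>)\<close> by auto
      then obtain u u' where u: "c v = c u" "x = c u'" "(u, u') \<in> R"
        by (auto simp: R'_def)
      then have "holds R \<pi> u (FDia \<psi>)" using IH x(2) by auto
      then show ?thesis using c_holds[OF u(1) sub] by blast
    qed
    moreover have "holds R' \<pi>' (c v) (FDia \<psi>)" if "holds R \<pi> v (FDia \<psi>)" for v
      using that IH by (auto simp: R'_def)
    ultimately show ?case by blast
  qed auto
  then have "holds R' \<pi>' (c w) \<phi>" using sat by blast
  moreover have "kripke_frame (c ` W) R'"
    using fr by (auto simp: kripke_frame_def R'_def)
  ultimately show ?thesis
    using w unfolding satisfiable_def satisfiable_over_def by blast
qed


section \<open>Formulas as bit strings\<close>

text \<open>
  Formulas are written in prefix notation, each variable as a marker followed by its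
  index in binary; each token is then coded by a block of four bits.
\<close>

datatype token = TOp connective | TVar | TDigit bool

text \<open>Most significant digit first, no leading zeros; the index 0 has no digits.\<close>

fun bin :: "nat \<Rightarrow> bool list" where
  "bin n = (if n = 0 then [] else bin (n div 2) @ [odd n])"

declare bin.simps [simp del]

definition var_tokens :: "nat \<Rightarrow> token list" where
  "var_tokens n = TVar # map TDigit (bin n)"

primrec tokens :: "fm \<Rightarrow> token list" where
  "tokens (Atom n) = var_tokens n"
| "tokens (NAtom n) = TOp OAtNeg # var_tokens n"
| "tokens (FNeg \<phi>) = TOp ONeg # tokens \<phi>"
| "tokens (FAnd \<phi> \<psi>) = TOp OAnd # tokens \<phi> @ tokens \<psi>"
| "tokens (FOr \<phi> \<psi>) = TOp OOr # tokens \<phi> @ tokens \<psi>"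
| "tokens (FBox \<phi>) = TOp OBox # tokens \<phi>"
| "tokens (FDia \<phi>) = TOp ODia # tokens \<phi>"
| "tokens FTrue = [TOp OTrue]"
| "tokens FFalse = [TOp OFalse]"

fun token_code :: "token \<Rightarrow> bool list" where
  "token_code (TDigit b) = [False, False, False, b]"
| "token_code TVar = [False, False, True, False]"
| "token_code (TOp ONeg) = [True, False, False, False]"
| "token_code (TOp OAtNeg) = [True, False, False, True]"
| "token_code (TOp OAnd) = [True, False, True, False]"
| "token_code (TOp OOr) = [True, False, True, True]"
| "token_code (TOp OBox) = [True, True, False, False]"
| "token_code (TOp ODia) = [True, True, False, True]"
| "token_code (TOp OTrue) = [True, True, True, False]"
| "token_code (TOp OFalse) = [True, True, True, True]"

definition encode :: "fm \<Rightarrow> bool list" where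
  "encode \<phi> = concat (map token_code (tokens \<phi>))"

lemma bin_0: "bin 0 = []"
  by (subst bin.simps) simp

lemma bin_pos: "n > 0 \<Longrightarrow> bin n = bin (n div 2) @ [odd n]"
  by (subst bin.simps) simp

lemma bin_eq_Nil_iff: "bin n = [] \<longleftrightarrow> n = 0"
  by (cases "n = 0") (simp_all add: bin_0 bin_pos)

lemma bin_inj: "bin m = bin n \<Longrightarrow> m = n"
proof (induction m arbitrary: n rule: less_induct)
  case (less m)
  show ?case
  proof (cases "m > 0 \<and> n > 0")
    case True
    then have *: "bin (m div 2) = bin (n div 2)" "odd m = odd n"
      using less.prems bin_pos[of m] bin_pos[of n] by auto
    have "m div 2 = n div 2" using less.IH[OF _ *(1)] True by simp
    then show ?thesis using *(2) by presburger
  next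
    case False
    then show ?thesis using less.prems bin_eq_Nil_iff[of m] bin_eq_Nil_iff[of n] by (auto simp: bin_0)
  qed
qed

fun digit_free :: "token list \<Rightarrow> bool" where
  "digit_free (TDigit b # u) = False"
| "digit_free u = True"

lemma digit_free_tokens: "digit_free (tokens \<phi> @ u)"
  by (cases \<phi>) (auto simp: var_tokens_def)

lemma digits_append_inj:
  "map TDigit xs @ u = map TDigit ys @ v \<Longrightarrow> digit_free u \<Longrightarrow> digit_free v \<Longrightarrow> xs = ys \<and> u = v"
proof (induction xs arbitrary: ys)
  case Nil
  then show ?case by (cases ys) auto
next
  case (Cons x xs)
  then show ?case by (cases ys) auto
qed

lemma var_tokens_append_inj:
  assumes "var_tokens m @ u = var_tokens n @ v" "digit_free u" "digit_free v"
  shows "m = n \<and> u = v"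
proof -
  have "map TDigit (bin m) @ u = map TDigit (bin n) @ v"
    using assms(1) by (simp add: var_tokens_def)
  then have "bin m = bin n" "u = v" using digits_append_inj assms(2,3) by blast+
  then show ?thesis using bin_inj by blast
qed

lemma var_tokens_neq_TOp: "var_tokens n @ u \<noteq> TOp c # v" "TOp c # v \<noteq> var_tokens n @ u"
  by (auto simp: var_tokens_def)

lemma tokens_append_inj:
  "tokens \<phi> @ u = tokens \<psi> @ v \<Longrightarrow> digit_free u \<Longrightarrow> digit_free v \<Longrightarrow> \<phi> = \<psi> \<and> u = v"
proof (induction \<phi> arbitrary: \<psi> u v)
  case (Atom n)
  then show ?case
    by (cases \<psi>) (auto simp: var_tokens_neq_TOp dest: var_tokens_append_inj)
next
  case (NAtom n)
  then show ?case
    by (cases \<psi>) (auto simp: var_tokens_neq_TOp dest: var_tokens_append_inj)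
next
  case (FAnd \<phi>1 \<phi>2)
  show ?case
  proof (cases \<psi>)
    case (FAnd \<psi>1 \<psi>2)
    then have "tokens \<phi>1 @ (tokens \<phi>2 @ u) = tokens \<psi>1 @ (tokens \<psi>2 @ v)"
      using FAnd.prems by simp
    then have "\<phi>1 = \<psi>1 \<and> tokens \<phi>2 @ u = tokens \<psi>2 @ v"
      using FAnd.IH(1) digit_free_tokens by blast
    then show ?thesis using FAnd.IH(2) FAnd.prems FAnd by blast
  qed (use FAnd.prems in \<open>auto simp: var_tokens_neq_TOp\<close>)
next
  case (FOr \<phi>1 \<phi>2)
  show ?case
  proof (cases \<psi>)
    case (FOr \<psi>1 \<psi>2)
    then have "tokens \<phi>1 @ (tokens \<phi>2 @ u) = tokens \<psi>1 @ (tokens \<psi>2 @ v)"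
      using FOr.prems by simp
    then have "\<phi>1 = \<psi>1 \<and> tokens \<phi>2 @ u = tokens \<psi>2 @ v"
      using FOr.IH(1) digit_free_tokens by blast
    then show ?thesis using FOr.IH(2) FOr.prems FOr by blast
  qed (use FOr.prems in \<open>auto simp: var_tokens_neq_TOp\<close>)
next
  case (FNeg \<phi>)
  show ?case by (cases \<psi>) (use FNeg in \<open>auto simp: var_tokens_neq_TOp\<close>)
next
  case (FBox \<phi>)
  show ?case by (cases \<psi>) (use FBox in \<open>auto simp: var_tokens_neq_TOp\<close>)
next
  case (FDia \<phi>)
  show ?case by (cases \<psi>) (use FDia in \<open>auto simp: var_tokens_neq_TOp\<close>)
next
  case FTrue
  then show ?case by (cases \<psi>) (auto simp: var_tokens_neq_TOp)
next
  case FFalse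
  then show ?case by (cases \<psi>) (auto simp: var_tokens_neq_TOp)
qed

lemma token_code_length: "length (token_code t) = 4"
  by (cases t rule: token_code.cases) auto

lemma token_code_inj: "token_code s = token_code t \<Longrightarrow> s = t"
  by (cases s rule: token_code.cases; cases t rule: token_code.cases) auto

lemma token_code_neq_Nil: "token_code t \<noteq> []"
  using token_code_length[of t] by force

lemma concat_token_code_inj:
  "concat (map token_code ss) = concat (map token_code ts) \<Longrightarrow> ss = ts"
proof (induction ss arbitrary: ts)
  case Nil
  then show ?case by (cases ts) (simp_all add: token_code_neq_Nil)
next
  case (Cons s ss)
  then obtain t ts' where ts: "ts = t # ts'"
    by (cases ts) (simp_all add: token_code_neq_Nil)
  have "token_code s @ concat (map token_code ss) = token_code t @ concat (map token_code ts')"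
    using Cons.prems ts by simp
  then have "token_code s = token_code t" "concat (map token_code ss) = concat (map token_code ts')"
    using append_eq_append_conv[of "token_code s" "token_code t"] token_code_length by metis+
  then show ?case using ts Cons.IH token_code_inj by blast
qed

lemma inj_encode: "inj encode"
proof (rule injI)
  fix \<phi> \<psi> assume "encode \<phi> = encode \<psi>"
  then have "tokens \<phi> @ [] = tokens \<psi> @ []"
    unfolding encode_def by (simp add: concat_token_code_inj)
  then show "\<phi> = \<psi>" using tokens_append_inj[of \<phi> "[]" \<psi> "[]"] by simp
qed

definition modal_sat :: "connective set \<Rightarrow> bool list set" where
  "modal_sat S = encode ` {\<phi> \<in> modal_lang S. satisfiable \<phi>}"


section \<open>Deterministic multitape Turing machines\<close>

datatype move = MLeft | MStay | MRight

text \<open>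
  States are \<open>0, \<dots>, num_states - 1\<close> and symbols are \<open>0, \<dots>, num_symbols - 1\<close>.
  Symbol 0 is the blank, 1 is the left end marker, 2 and 3 are the bits; there may be more.
\<close>

record machine =
  num_tapes :: nat
  num_symbols :: nat
  num_states :: nat
  start_state :: nat
  accept_state :: nat
  reject_state :: nat
  delta :: "nat \<Rightarrow> nat list \<Rightarrow> nat \<times> (nat \<times> move) list"

definition turing_machine :: "machine \<Rightarrow> bool" where
  "turing_machine M \<longleftrightarrow>
     1 \<le> num_tapes M \<and> 4 \<le> num_symbols M \<and>
     start_state M < num_states M \<and> accept_state M < num_states M \<and>
     reject_state M < num_states M \<and> accept_state M \<noteq> reject_state M \<and>
     (\<forall>q < num_states M. \<forall>xs. length xs = num_tapes M \<and> (\<forall>x \<in> set xs. x < num_symbols M) \<longrightarrow>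
        (case delta M q xs of (q', as) \<Rightarrow>
           q' < num_states M \<and> length as = num_tapes M \<and> (\<forall>(y, m) \<in> set as. y < num_symbols M)))"

text \<open>
  A tape is infinite to the right only; it consists of its contents and the head position.
  A left move on cell 0 leaves the head where it is.
\<close>

type_synonym tape = "(nat \<Rightarrow> nat) \<times> nat"
type_synonym config = "nat \<times> tape list"

fun read_tape :: "tape \<Rightarrow> nat" where
  "read_tape (c, i) = c i"

fun move_head :: "move \<Rightarrow> nat \<Rightarrow> nat" where
  "move_head MLeft i = i - 1"
| "move_head MStay i = i"
| "move_head MRight i = i + 1"

fun act_tape :: "nat \<times> move \<Rightarrow> tape \<Rightarrow> tape" where
  "act_tape (y, m) (c, i) = (c(i := y), move_head m i)"

definition halted :: "machine \<Rightarrow> config \<Rightarrow> bool" where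
  "halted M c \<longleftrightarrow> fst c \<in> {accept_state M, reject_state M}"

definition tm_step :: "machine \<Rightarrow> config \<Rightarrow> config" where
  "tm_step M c =
     (if halted M c then c
      else case delta M (fst c) (map read_tape (snd c)) of
             (q', as) \<Rightarrow> (q', map2 act_tape as (snd c)))"

definition string_contents :: "bool list \<Rightarrow> nat \<Rightarrow> nat" where
  "string_contents x i =
     (if i = 0 then 1 else if i \<le> length x then (if x ! (i - 1) then 3 else 2) else 0)"

definition init_config :: "machine \<Rightarrow> bool list \<Rightarrow> config" where
  "init_config M x =
     (start_state M,
      (string_contents x, 0) # replicate (num_tapes M - 1) (string_contents [], 0))"

definition run :: "machine \<Rightarrow> bool list \<Rightarrow> nat \<Rightarrow> config" where
  "run M x t = (tm_step M ^^ t) (init_config M x)"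

definition decides :: "machine \<Rightarrow> bool list set \<Rightarrow> bool" where
  "decides M A \<longleftrightarrow>
     (\<forall>x. \<exists>t. fst (run M x t) = (if x \<in> A then accept_state M else reject_state M))"

text \<open>
  The visited cells of a tape form an initial segment, so bounding every head position by
  \<open>s\<close> says that at most \<open>s\<close> cells of each tape are used. The input tape is included, which
  makes no difference for polynomial bounds.
\<close>

definition runs_in_space :: "machine \<Rightarrow> (nat \<Rightarrow> nat) \<Rightarrow> bool" where
  "runs_in_space M s \<longleftrightarrow>
     (\<forall>x t. \<forall>(c, i) \<in> set (snd (run M x t)). i < s (length x))"

definition runs_in_time :: "machine \<Rightarrow> (nat \<Rightarrow> nat) \<Rightarrow> bool" where
  "runs_in_time M b \<longleftrightarrow> (\<forall>x. \<exists>t \<le> b (length x). halted M (run M x t))"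

text \<open>Output is on the last tape.\<close>

definition computes :: "machine \<Rightarrow> (bool list \<Rightarrow> bool list) \<Rightarrow> bool" where
  "computes M f \<longleftrightarrow>
     (\<forall>x. \<exists>t. halted M (run M x t) \<and> fst (last (snd (run M x t))) = string_contents (f x))"


section \<open>PSPACE-completeness\<close>

definition PSPACE :: "bool list set set" where
  "PSPACE = {A. \<exists>M (p :: nat poly). turing_machine M \<and> decides M A \<and> runs_in_space M (poly p)}"

definition polytime_computable :: "(bool list \<Rightarrow> bool list) \<Rightarrow> bool" where
  "polytime_computable f \<longleftrightarrow>
     (\<exists>M (p :: nat poly). turing_machine M \<and> computes M f \<and> runs_in_time M (poly p))"

definition polytime_reducible :: "bool list set \<Rightarrow> bool list set \<Rightarrow> bool" where
  "polytime_reducible A B \<longleftrightarrow> (\<exists>f. polytime_computable f \<and> (\<forall>x. x \<in> A \<longleftrightarrow> f x \<in> B))"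

definition PSPACE_complete :: "bool list set \<Rightarrow> bool" where
  "PSPACE_complete A \<longleftrightarrow> A \<in> PSPACE \<and> (\<forall>B \<in> PSPACE. polytime_reducible B A)"

end

theory Submission
  imports Defs "HOL-Library.Countable"
begin

text \<open>
  Hardness. As in the proof of Savitch's theorem, acceptance in space \<open>s\<close> is reachability within
  \<open>2 ^ d\<close> steps between configurations of polynomial size. A world carries a source, a target and a
  midpoint configuration; a universal bit selects one of the two halves of the path for the successor
  worlds, and at depth \<open>d\<close> source and target must be equal or adjacent. This is expressible by a formula of
  polynomial size over atoms, negated atoms, conjunction, disjunction, box and diamond, each of which
  can be simulated by every admissible set of connectives without duplicating subformulas.

  Membership. Satisfiability of a formula with \<open>n\<close> tokens is a game of \<open>n\<close> rounds: one player assigns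
  truth values to all subformulas at a world, the other demands a successor world for a false box or a
  true diamond, and the modal depth is below \<open>n\<close>. The game is a quantified Boolean problem with
  \<open>2 n\<^sup>2\<close> bits whose matrix is checked in polynomial time, and a counter over these bits evaluates it.

  Turing machines enter only through a small language of stack programs that is compiled to them.
\<close>

section \<open>A register language and its compilation to Turing machines\<close>

text \<open>Both directions must end in explicit Turing machines, which calls for flat algorithms.
  The reduction prints fixed strings, repeated a computed number of times, in which only a position
  varies; positions occur in unary inside variable names, so no arithmetic is printed. For
  membership, recursion over worlds would need a stack of partial results. Turning the game into a
  quantifier prefix over bits removes it: the value at the current assignment alone determines the
  assignment to try next, so one loop of polynomial-time passes suffices. The depth \<open>d\<close>
  is the number \<open>l * \<Lambda>\<close> of bits in a word: a run repeats no word before it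
  first accepts, so it accepts within \<open>2 ^ d\<close> steps. The leaves of the formula express
  exactly one step; halted configurations step to themselves, so paths of length exactly
  \<open>2 ^ d\<close> can be demanded. Programs keep the two resources apart: \<open>For\<close>
  alone gives polynomial time, and a single outer \<open>While\<close>, which is an item but not a
  program, gives exponential time in polynomial space.\<close>

text \<open>
  Each register is a stack kept on its own tape: the bottom is next to the end marker, the head
  rests on the top element. \<open>For r p\<close> runs \<open>p\<close> with the head of \<open>r\<close> moving from the top down to the
  marker, so inside the loop the stack in \<open>r\<close> is the part below the current element, inclusive.
\<close>

datatype prog =
    Skip
  | Push nat nat
  | Pop nat
  | Clr nat
  | Case nat "nat \<Rightarrow> prog"
  | Seq prog prog  (infixr \<open>;;\<close> 60)
  | For nat prog

type_synonym store = "nat \<Rightarrow> nat list"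

text \<open>The value 1 for an empty register is the end marker, on which the head then stands.\<close>

definition peek :: "store \<Rightarrow> nat \<Rightarrow> nat" where
  "peek s r = (case s r of [] \<Rightarrow> 1 | a # _ \<Rightarrow> a)"

fun loop :: "(store \<Rightarrow> store) \<Rightarrow> nat \<Rightarrow> nat list \<Rightarrow> store \<Rightarrow> store" where
  "loop f r [] s = s"
| "loop f r (a # l) s = loop f r l (f (s(r := a # l)))"

primrec sem :: "prog \<Rightarrow> store \<Rightarrow> store" where
  "sem Skip s = s"
| "sem (Push r b) s = s(r := b # s r)"
| "sem (Pop r) s = s(r := tl (s r))"
| "sem (Clr r) s = s(r := [])"
| "sem (Case r f) s = sem (f (peek s r)) s"
| "sem (p ;; q) s = sem q (sem p s)"
| "sem (For r p) s = (loop (sem p) r (s r) s)(r := s r)"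

fun loop_cost :: "(store \<Rightarrow> store) \<Rightarrow> (store \<Rightarrow> nat) \<Rightarrow> nat \<Rightarrow> nat list \<Rightarrow> store \<Rightarrow> nat" where
  "loop_cost f c r [] s = 0"
| "loop_cost f c r (a # l) s = c (s(r := a # l)) + 2 + loop_cost f c r l (f (s(r := a # l)))"

text \<open>The cost of \<open>For\<close> follows \<open>istep\<close>: two steps per pass, for the
  test and for moving the head down, one for the test at the end marker, and the length plus two for
  bringing the head back to the top.\<close>

primrec cost :: "prog \<Rightarrow> store \<Rightarrow> nat" where
  "cost Skip s = 1"
| "cost (Push r b) s = 2"
| "cost (Pop r) s = 1"
| "cost (Clr r) s = length (s r) + 1"
| "cost (Case r f) s = cost (f (peek s r)) s + 1"
| "cost (p ;; q) s = cost p s + cost q (sem p s) + 1"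
| "cost (For r p) s = loop_cost (sem p) (cost p) r (s r) s + length (s r) + 3"

primrec writes :: "prog \<Rightarrow> nat set" where
  "writes Skip = {}"
| "writes (Push r b) = {r}"
| "writes (Pop r) = {r}"
| "writes (Clr r) = {r}"
| "writes (Case r f) = (\<Union>a. writes (f a))"
| "writes (p ;; q) = writes p \<union> writes q"
| "writes (For r p) = writes p"

primrec fors :: "prog \<Rightarrow> nat set" where
  "fors Skip = {}"
| "fors (Push r b) = {}"
| "fors (Pop r) = {}"
| "fors (Clr r) = {}"
| "fors (Case r f) = (\<Union>a. fors (f a))"
| "fors (p ;; q) = fors p \<union> fors q"
| "fors (For r p) = insert r (fors p)"

text \<open>Symbols 0 and 1 are the blank and the end marker, so only larger ones may be stored.
  During a loop the head of \<open>r\<close> stands inside its stack; a write or another loop on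
  \<open>r\<close> would start from the wrong cell.\<close>

primrec wf_prog :: "nat \<Rightarrow> nat \<Rightarrow> prog \<Rightarrow> bool" where
  "wf_prog k K Skip \<longleftrightarrow> True"
| "wf_prog k K (Push r b) \<longleftrightarrow> r < k \<and> 2 \<le> b \<and> b < K"
| "wf_prog k K (Pop r) \<longleftrightarrow> r < k"
| "wf_prog k K (Clr r) \<longleftrightarrow> r < k"
| "wf_prog k K (Case r f) \<longleftrightarrow> r < k \<and> (\<forall>a. 1 \<le> a \<and> a < K \<longrightarrow> wf_prog k K (f a))"
| "wf_prog k K (p ;; q) \<longleftrightarrow> wf_prog k K p \<and> wf_prog k K q"
| "wf_prog k K (For r p) \<longleftrightarrow> r < k \<and> r \<notin> writes p \<and> r \<notin> fors p \<and> wf_prog k K p"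

definition valid_store :: "nat \<Rightarrow> store \<Rightarrow> bool" where
  "valid_store K s \<longleftrightarrow> (\<forall>r. \<forall>a \<in> set (s r). 2 \<le> a \<and> a < K)"

section \<open>Frame properties and valid stores\<close>

lemma loop_upd: "(loop f r l (s(r := x)))(r := y) = (loop f r l s)(r := y)"
  by (cases l) auto

lemma loop_other:
  assumes "\<And>s. f s q = s q" "q \<noteq> r"
  shows "loop f r l s q = s q"
  using assms by (induction l arbitrary: s) auto

lemma sem_unchanged: "r \<notin> writes p \<Longrightarrow> sem p s r = s r"
proof (induction p arbitrary: s)
  case (For x p)
  then show ?case by (cases "r = x") (auto intro!: loop_other)
qed auto

lemma valid_peek: "valid_store K s \<Longrightarrow> 2 \<le> K \<Longrightarrow> 1 \<le> peek s r \<and> peek s r < K"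
proof (cases "s r")
  case (Cons a l)
  assume "valid_store K s"
  then have "2 \<le> a \<and> a < K" using Cons unfolding valid_store_def by (metis list.set_intros(1))
  then show ?thesis using Cons by (simp add: peek_def)
qed (simp add: peek_def)

lemma valid_upd: "valid_store K s \<Longrightarrow> (\<forall>a \<in> set l. 2 \<le> a \<and> a < K) \<Longrightarrow> valid_store K (s(r := l))"
  by (auto simp: valid_store_def)

lemma valid_loop:
  assumes "\<And>s. valid_store K s \<Longrightarrow> valid_store K (f s)"
  shows "valid_store K s \<Longrightarrow> \<forall>a \<in> set l. 2 \<le> a \<and> a < K \<Longrightarrow> valid_store K (loop f r l s)"
proof (induction l arbitrary: s)
  case (Cons a l)
  then have "valid_store K (f (s(r := a # l)))" by (intro assms valid_upd) auto
  then show ?case using Cons by auto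
qed auto

lemma valid_sem:
  assumes K: "2 \<le> K"
  shows "wf_prog k K p \<Longrightarrow> valid_store K s \<Longrightarrow> valid_store K (sem p s)"
proof (induction p arbitrary: s)
  case (Push r b)
  have "\<forall>a \<in> set (b # s r). 2 \<le> a \<and> a < K" using Push by (auto simp: valid_store_def)
  then show ?case unfolding sem.simps by (rule valid_upd[OF Push.prems(2)])
next
  case (Clr r)
  have "\<forall>a \<in> set []. 2 \<le> a \<and> a < K" by simp
  then show ?case unfolding sem.simps by (rule valid_upd[OF Clr.prems(2)])
next
  case (Pop r)
  have "set (tl (s r)) \<subseteq> set (s r)" by (cases "s r") auto
  then have "\<forall>a \<in> set (tl (s r)). 2 \<le> a \<and> a < K" using Pop.prems(2) unfolding valid_store_def by blast
  then show ?case unfolding sem.simps by (rule valid_upd[OF Pop.prems(2)])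
next
  case (Case r f)
  then show ?case using valid_peek[OF Case.prems(2) K] by auto
next
  case (For r p)
  have *: "\<forall>a \<in> set (s r). 2 \<le> a \<and> a < K" using For.prems by (auto simp: valid_store_def)
  have "valid_store K (loop (sem p) r (s r) s)"
    using For * by (intro valid_loop) auto
  then show ?case unfolding sem.simps using * by (rule valid_upd)
qed auto

subsection \<open>Small steps on continuation lists\<close>

text \<open>\<open>Put\<close> is the second half of a push, after the head has moved;
  \<open>Next\<close> moves the head down between two passes of a loop; \<open>Return\<close> brings
  it back to the top afterwards. \<open>While\<close> repeats a program an unbounded number of times
  and serves only the space-bounded machine.\<close>

datatype item = Exec prog | Put nat nat | Next nat prog | Return nat | While nat prog

text \<open>A branch of \<open>Case\<close> is selected by an arbitrary number, but a machine has
  finitely many states. Clamping keeps the reachable continuations finite for all symbols read; on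
  valid stores it is the identity.\<close>

definition clamp :: "nat \<Rightarrow> nat \<Rightarrow> nat" where
  "clamp K v = (if 1 \<le> v \<and> v < K then v else 1)"

text \<open>A step yields the new continuation and the single tape on which it acts.\<close>

fun istep :: "nat \<Rightarrow> nat list \<Rightarrow> item list \<Rightarrow> item list \<times> nat \<times> nat \<times> move" where
  "istep K vs [] = ([], 0, vs ! 0, MStay)"
| "istep K vs (Exec Skip # cs) = (cs, 0, vs ! 0, MStay)"
| "istep K vs (Exec (Push r b) # cs) = (Put r b # cs, r, vs ! r, MRight)"
| "istep K vs (Put r b # cs) = (cs, r, b, MStay)"
| "istep K vs (Exec (Pop r) # cs) = (if vs ! r = 1 then (cs, r, 1, MStay) else (cs, r, 0, MLeft))"
| "istep K vs (Exec (Clr r) # cs) =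
     (if vs ! r = 1 then (cs, r, 1, MStay) else (Exec (Clr r) # cs, r, 0, MLeft))"
| "istep K vs (Exec (Case r f) # cs) = (Exec (f (clamp K (vs ! r))) # cs, 0, vs ! 0, MStay)"
| "istep K vs (Exec (p ;; q) # cs) = (Exec p # Exec q # cs, 0, vs ! 0, MStay)"
| "istep K vs (Exec (For r p) # cs) =
     (if vs ! r = 1 then Return r # cs else Exec p # Next r p # cs, 0, vs ! 0, MStay)"
| "istep K vs (Next r p # cs) = (Exec (For r p) # cs, r, vs ! r, MLeft)"
| "istep K vs (Return r # cs) =
     (if vs ! r = 0 then (cs, r, 0, MLeft) else (Return r # cs, r, vs ! r, MRight))"
| "istep K vs (While r p # cs) =
     (if vs ! r = 3 then Exec p # While r p # cs else cs, 0, vs ! 0, MStay)"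

definition astep :: "nat \<Rightarrow> item list \<times> tape list \<Rightarrow> item list \<times> tape list" where
  "astep K c = (case istep K (map read_tape (snd c)) (fst c) of
     (z, r, b, m) \<Rightarrow> (z, (snd c)[r := act_tape (b, m) (snd c ! r)]))"

definition cont :: "nat list \<Rightarrow> nat \<Rightarrow> nat" where
  "cont w i = (if i = 0 then 1 else if i \<le> length w then w ! (i - 1) else 0)"

text \<open>\<open>A r\<close> holds the elements of register \<open>r\<close> that a running loop has already passed.\<close>

definition tapes :: "nat \<Rightarrow> store \<Rightarrow> (nat \<Rightarrow> nat list) \<Rightarrow> tape list" where
  "tapes k s A = map (\<lambda>r. (cont (rev (s r) @ A r), length (s r))) [0..<k]"

lemma length_tapes [simp]: "length (tapes k s A) = k"
  by (simp add: tapes_def)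

lemma tapes_eq_Nil [simp]: "tapes k s A = [] \<longleftrightarrow> k = 0"
  by (simp add: tapes_def)

lemma cont_0 [simp]: "cont w 0 = 1"
  by (simp add: cont_def)

lemma cont_Suc [simp]: "n = length w \<Longrightarrow> cont (w @ b # v) (Suc n) = b"
  by (simp add: cont_def nth_append)

lemma cont_Suc_upd [simp]: "n = length w \<Longrightarrow> (cont (w @ b # v))(Suc n := b) = cont (w @ b # v)"
  by (rule fun_upd_idem) simp

lemma nth_tapes [simp]: "r < k \<Longrightarrow> tapes k s A ! r = (cont (rev (s r) @ A r), length (s r))"
  by (simp add: tapes_def)

lemma cont_read: "cont (rev l @ a) (length l) = (case l of [] \<Rightarrow> 1 | x # _ \<Rightarrow> x)"
  by (cases l) (auto simp: cont_def nth_append)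

lemma read_tapes [simp]: "r < k \<Longrightarrow> cont (rev (s r) @ A r) (length (s r)) = peek s r"
  by (simp add: cont_read peek_def)

lemma tapes_upd:
  "r < k \<Longrightarrow> (tapes k s A)[r := (cont (rev l @ a), length l)] = tapes k (s(r := l)) (A(r := a))"
  by (rule nth_equalityI) (auto simp: nth_list_update)

lemma tapes_cong: "(\<And>r. r < k \<Longrightarrow> s r = s' r \<and> A r = A' r) \<Longrightarrow> tapes k s A = tapes k s' A'"
  by (simp add: tapes_def)

lemma cont_append: "(cont w)(Suc (length w) := b) = cont (w @ [b])"
  by (rule ext) (auto simp: cont_def nth_append)

lemma cont_butlast: "(cont (w @ [b]))(Suc (length w) := 0) = cont w"
  by (rule ext) (auto simp: cont_def nth_append)

lemma astep_stay:
  "istep K (map read_tape T) z = (z', 0, map read_tape T ! 0, MStay) \<Longrightarrow> T \<noteq> [] \<Longrightarrow> astep K (z, T) = (z', T)"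
  by (cases "T ! 0") (auto simp: astep_def list_update_same_conv)

definition reaches :: "nat \<Rightarrow> nat \<Rightarrow> item list \<times> tape list \<Rightarrow> item list \<times> tape list \<Rightarrow> bool" where
  "reaches K n c d \<longleftrightarrow> (astep K ^^ n) c = d"

lemma reaches_0: "reaches K 0 c c"
  by (simp add: reaches_def)

lemma reaches_trans: "reaches K m c d \<Longrightarrow> reaches K n d e \<Longrightarrow> reaches K (m + n) c e"
  unfolding reaches_def by (subst add.commute) (simp add: funpow_add)

lemma reaches_step: "astep K c = d \<Longrightarrow> reaches K n d e \<Longrightarrow> reaches K (Suc n) c e"
  by (simp add: reaches_def funpow_swap1 funpow_Suc_right del: funpow.simps)

lemma reaches_1: "astep K c = d \<Longrightarrow> reaches K (Suc 0) c d"
  by (simp add: reaches_def)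

text \<open>No element is 0, so the first blank shows where the stack ends. The head overshoots onto
  it and steps back, which accounts for the two extra steps.\<close>

lemma Return_reaches_aux:
  assumes "r < length T" "T ! r = (cont w, i)" "i \<le> length w" "0 \<notin> set w"
  shows "reaches K (length w - i + 2) (Return r # cs, T) (cs, T[r := (cont w, length w)])"
  using assms
proof (induction "length w - i" arbitrary: i T)
  case 0
  have nz: "cont w i \<noteq> 0" using 0 by (auto simp: cont_def set_conv_nth)
  have "astep K (Return r # cs, T) = (Return r # cs, T[r := (cont w, Suc i)])"
    using 0 nz by (auto simp: astep_def)
  moreover have "astep K (Return r # cs, T[r := (cont w, Suc i)]) = (cs, T[r := (cont w, length w)])"
    using 0 by (auto simp: astep_def cont_def intro!: arg_cong[where f="list_update T r"])
  ultimately show ?case using 0 by (auto simp: numeral_2_eq_2 intro!: reaches_step reaches_0)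
next
  case (Suc d)
  have nz: "cont w i \<noteq> 0" using Suc.prems by (auto simp: cont_def set_conv_nth)
  have st: "astep K (Return r # cs, T) = (Return r # cs, T[r := (cont w, Suc i)])"
    using Suc.prems nz by (auto simp: astep_def)
  have "reaches K (length w - Suc i + 2) (Return r # cs, T[r := (cont w, Suc i)])
          (cs, T[r := (cont w, Suc i), r := (cont w, length w)])"
    using Suc by (intro Suc.hyps(1)) auto
  then have "reaches K (length w - Suc i + 2) (Return r # cs, T[r := (cont w, Suc i)])
          (cs, T[r := (cont w, length w)])" by simp
  from reaches_step[OF st this] show ?case using Suc.hyps(2) by (simp add: Suc_diff_Suc)
qed

lemma Return_reaches:
  assumes "r < k" "s r = []" "0 \<notin> set (A r)"
  shows "reaches K (length (A r) + 2) (Return r # cs, tapes k s A)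
           (cs, tapes k (s(r := rev (A r))) (A(r := [])))"
proof -
  have "reaches K (length (A r) - 0 + 2) (Return r # cs, tapes k s A)
          (cs, (tapes k s A)[r := (cont (A r), length (A r))])"
    using assms by (intro Return_reaches_aux) auto
  moreover have "(tapes k s A)[r := (cont (A r), length (A r))] = tapes k (s(r := rev (A r))) (A(r := []))"
    using tapes_upd[OF assms(1), of s A "rev (A r)" "[]"] by simp
  ultimately show ?thesis by simp
qed

text \<open>Induction on the part of the stack still to be passed. Moving the head down changes no
  cell; in terms of \<open>tapes\<close> it transfers the top from \<open>s r\<close> to
  \<open>A r\<close>, from where \<open>Return\<close> recovers the register. Since
  \<open>A r\<close> is nonempty during the loop, the body may only be assumed correct when it
  neither writes nor loops over \<open>r\<close>.\<close>

lemma loop_reaches: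
  assumes body: "\<And>s A cs. valid_store K s \<Longrightarrow> \<forall>x \<in> writes p \<union> fors p. A x = [] \<Longrightarrow>
        \<exists>n \<le> cost p s. reaches K n (Exec p # cs, tapes k s A) (cs, tapes k (sem p s) A)"
    and wf: "r < k" "r \<notin> writes p" "r \<notin> fors p" "wf_prog k K p" and K: "2 \<le> K"
  shows "valid_store K s \<Longrightarrow> s r = l \<Longrightarrow> \<forall>x \<in> writes p \<union> fors p. A x = [] \<Longrightarrow>
    \<exists>n \<le> loop_cost (sem p) (cost p) r l s + 1.
      reaches K n (Exec (For r p) # cs, tapes k s A)
        (Return r # cs, tapes k ((loop (sem p) r l s)(r := [])) (A(r := rev l @ A r)))"
proof (induction l arbitrary: s A)
  case Nil
  have "astep K (Exec (For r p) # cs, tapes k s A) = (Return r # cs, tapes k s A)"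
    using wf Nil by (intro astep_stay) (auto simp: peek_def)
  moreover have "tapes k ((loop (sem p) r [] s)(r := [])) (A(r := rev [] @ A r)) = tapes k s A"
    using Nil by (intro tapes_cong) auto
  ultimately show ?case using reaches_1 by (intro exI[of _ "Suc 0"]) (metis le_add2 One_nat_def)
next
  case (Cons a l)
  have upd: "s(r := a # l) = s" using Cons.prems by auto
  have a: "a \<noteq> 1" using Cons.prems by (auto simp: valid_store_def dest!: spec[of _ r])
  have st1: "astep K (Exec (For r p) # cs, tapes k s A) = (Exec p # Next r p # cs, tapes k s A)"
    using wf Cons a by (intro astep_stay) (auto simp: peek_def)
  obtain n where n: "n \<le> cost p s"
    and rn: "reaches K n (Exec p # Next r p # cs, tapes k s A) (Next r p # cs, tapes k (sem p s) A)"
    using body[OF Cons.prems(1,3)] by blast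
  define s1 where "s1 = sem p s"
  have s1r: "s1 r = a # l" using wf Cons.prems by (simp add: s1_def sem_unchanged)
  have v1: "valid_store K s1" using valid_sem[OF K] wf(4) Cons.prems(1) by (simp add: s1_def)
  have st2: "astep K (Next r p # cs, tapes k s1 A)
     = (Exec (For r p) # cs, tapes k (s1(r := l)) (A(r := a # A r)))"
    using wf(1) s1r tapes_upd[OF wf(1), of s1 A l "a # A r"] by (auto simp: astep_def)
  have "\<exists>n \<le> loop_cost (sem p) (cost p) r l (s1(r := l)) + 1.
      reaches K n (Exec (For r p) # cs, tapes k (s1(r := l)) (A(r := a # A r)))
        (Return r # cs, tapes k ((loop (sem p) r l (s1(r := l)))(r := []))
           ((A(r := a # A r))(r := rev l @ (A(r := a # A r)) r)))"
    using Cons.prems wf v1 by (intro Cons.IH) (auto intro!: valid_upd simp: valid_store_def dest!: spec[of _ r])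
  then obtain m where m: "m \<le> loop_cost (sem p) (cost p) r l (s1(r := l)) + 1"
    and rm: "reaches K m (Exec (For r p) # cs, tapes k (s1(r := l)) (A(r := a # A r)))
        (Return r # cs, tapes k ((loop (sem p) r l s1)(r := [])) (A(r := rev (a # l) @ A r)))"
    by (auto simp: loop_upd)
  have lc: "loop_cost (sem p) (cost p) r l (s1(r := l)) = loop_cost (sem p) (cost p) r l s1"
    by (cases l) auto
  have "reaches K (Suc (n + Suc m)) (Exec (For r p) # cs, tapes k s A)
        (Return r # cs, tapes k ((loop (sem p) r l s1)(r := [])) (A(r := rev (a # l) @ A r)))"
    by (rule reaches_step[OF st1 reaches_trans[OF rn[folded s1_def] reaches_step[OF st2 rm]]])
  moreover have "Suc (n + Suc m) \<le> loop_cost (sem p) (cost p) r (a # l) s + 1"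
    using n m lc upd by (simp add: s1_def)
  moreover have "loop (sem p) r (a # l) s = loop (sem p) r l s1" using upd by (simp add: s1_def)
  ultimately show ?case by metis
qed

lemma Clr_reaches:
  assumes "r < k" "A r = []"
  shows "valid_store K s \<Longrightarrow> s r = l \<Longrightarrow> reaches K (length l + 1) (Exec (Clr r) # cs, tapes k s A) (cs, tapes k (s(r := [])) A)"
proof (induction l arbitrary: s)
  case Nil
  have "astep K (Exec (Clr r) # cs, tapes k s A) = (cs, (tapes k s A)[r := (cont [], 0)])"
    using Nil(2) assms by (auto simp: astep_def peek_def cont_def fun_eq_iff intro!: arg_cong2[where f="list_update (tapes k s A)"])
  moreover have "(tapes k s A)[r := (cont [], 0)] = tapes k (s(r := [])) A"
    using tapes_upd[OF assms(1), of s A "[]" "[]"] assms(2) by (simp add: fun_upd_idem)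
  ultimately have "reaches K (Suc 0) (Exec (Clr r) # cs, tapes k s A) (cs, tapes k (s(r := [])) A)"
    by (intro reaches_1) (simp only:)
  then show ?case by (simp only: list.size One_nat_def add_0_left)
next
  case (Cons a l)
  have a: "a \<noteq> 1" using Cons.prems by (auto simp: valid_store_def dest!: spec[of _ r])
  have "astep K (Exec (Clr r) # cs, tapes k s A) = (Exec (Clr r) # cs, (tapes k s A)[r := (cont (rev l), length l)])"
    using Cons.prems assms a cont_butlast[of "rev l" a] by (auto simp: astep_def peek_def)
  moreover have "(tapes k s A)[r := (cont (rev l), length l)] = tapes k (s(r := l)) A"
    using tapes_upd[OF assms(1), of s A l "[]"] assms(2) by (simp add: fun_upd_idem)
  ultimately have st: "astep K (Exec (Clr r) # cs, tapes k s A) = (Exec (Clr r) # cs, tapes k (s(r := l)) A)" by simp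
  have "valid_store K (s(r := l))"
    using Cons.prems by (auto simp: valid_store_def dest!: spec[of _ r])
  then have "reaches K (length l + 1) (Exec (Clr r) # cs, tapes k (s(r := l)) A)
      (cs, tapes k ((s(r := l))(r := [])) A)"
    by (rule Cons.IH) (rule fun_upd_same)
  from reaches_step[OF st this] show ?case by (simp only: fun_upd_upd list.size add_Suc add_Suc_right add_0_right One_nat_def)
qed

text \<open>The condition on \<open>A\<close> says that the head of each register which
  \<open>p\<close> writes or loops over rests on its top; other registers may be in the middle of a
  loop.\<close>

lemma exec_reaches:
  assumes K: "2 \<le> K"
  shows "wf_prog k K p \<Longrightarrow> 0 < k \<Longrightarrow> valid_store K s \<Longrightarrow> \<forall>x \<in> writes p \<union> fors p. A x = [] \<Longrightarrow>
     \<exists>n \<le> cost p s. reaches K n (Exec p # cs, tapes k s A) (cs, tapes k (sem p s) A)"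
proof (induction p arbitrary: s A cs)
  case Skip
  have "astep K (Exec Skip # cs, tapes k s A) = (cs, tapes k s A)"
    by (rule astep_stay) (use Skip.prems in simp_all)
  from reaches_1[OF this] show ?case by (intro exI[of _ "Suc 0"]) simp
next
  case (Push r b)
  have r: "r < k" and A: "A r = []" using Push.prems by simp_all
  have st1: "astep K (Exec (Push r b) # cs, tapes k s A)
      = (Put r b # cs, (tapes k s A)[r := (cont (rev (s r)), Suc (length (s r)))])"
    using r A by (simp add: astep_def)
  have "(tapes k s A)[r := (cont (rev (s r) @ [b]), Suc (length (s r)))] = tapes k (s(r := b # s r)) A"
    using tapes_upd[OF r, of s A "b # s r" "[]"] fun_upd_idem[of A r "[]"] A by simp
  then have st2: "astep K (Put r b # cs, (tapes k s A)[r := (cont (rev (s r)), Suc (length (s r)))])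
      = (cs, tapes k (s(r := b # s r)) A)"
    using r cont_append[of "rev (s r)" b] by (simp add: astep_def)
  have "reaches K (Suc (Suc 0)) (Exec (Push r b) # cs, tapes k s A) (cs, tapes k (s(r := b # s r)) A)"
    by (rule reaches_step[OF st1 reaches_step[OF st2 reaches_0]])
  then show ?case by (intro exI[of _ "Suc (Suc 0)"]) (simp only: cost.simps sem.simps, simp)
next
  case (Pop r)
  have r: "r < k" and A: "A r = []" using Pop.prems by simp_all
  have "astep K (Exec (Pop r) # cs, tapes k s A) = (cs, tapes k (s(r := tl (s r))) A)"
  proof (cases "s r")
    case Nil
    then have "astep K (Exec (Pop r) # cs, tapes k s A) = (cs, (tapes k s A)[r := (cont [], 0)])"
      using r A fun_upd_idem[of "cont []" 0 1] by (simp add: astep_def)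
    then show ?thesis using Nil tapes_upd[OF r, of s A "[]" "[]"] fun_upd_idem[of A r "[]"] A by simp
  next
    case (Cons a l)
    then have "a \<noteq> 1" using Pop.prems(3) by (auto simp: valid_store_def dest!: spec[of _ r])
    then have "astep K (Exec (Pop r) # cs, tapes k s A) = (cs, (tapes k s A)[r := (cont (rev l), length l)])"
      using Cons r A cont_butlast[of "rev l" a] by (simp add: astep_def)
    then show ?thesis using Cons tapes_upd[OF r, of s A l "[]"] fun_upd_idem[of A r "[]"] A by simp
  qed
  from reaches_1[OF this] show ?case by (intro exI[of _ "Suc 0"]) (simp only: cost.simps sem.simps, simp)
next
  case (Clr r)
  then have "reaches K (length (s r) + 1) (Exec (Clr r) # cs, tapes k s A) (cs, tapes k (s(r := [])) A)"
    by (intro Clr_reaches) auto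
  then show ?case by (intro exI[of _ "length (s r) + 1"]) (simp only: cost.simps sem.simps, simp)
next
  case (Case r f)
  define a where "a = peek s r"
  have a: "1 \<le> a" "a < K" using valid_peek[OF Case.prems(3) K] by (auto simp: a_def)
  have st: "astep K (Exec (Case r f) # cs, tapes k s A) = (Exec (f a) # cs, tapes k s A)"
    using Case.prems a by (intro astep_stay) (auto simp: clamp_def a_def)
  have "\<exists>n \<le> cost (f a) s. reaches K n (Exec (f a) # cs, tapes k s A) (cs, tapes k (sem (f a) s) A)"
    using Case.prems a by (intro Case.IH) auto
  then obtain n where n: "n \<le> cost (f a) s" "reaches K n (Exec (f a) # cs, tapes k s A) (cs, tapes k (sem (f a) s) A)"
    by blast
  from reaches_step[OF st n(2)] n(1) show ?case
    by (intro exI[of _ "Suc n"]) (simp add: a_def)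
next
  case (Seq p q)
  have wf: "wf_prog k K p" "wf_prog k K q"
    and A: "\<forall>x \<in> writes p \<union> fors p. A x = []" "\<forall>x \<in> writes q \<union> fors q. A x = []"
    using Seq.prems by auto
  obtain n where n: "n \<le> cost p s" "reaches K n (Exec p # Exec q # cs, tapes k s A) (Exec q # cs, tapes k (sem p s) A)"
    using Seq.IH(1)[OF wf(1) Seq.prems(2,3) A(1)] by blast
  obtain m where m: "m \<le> cost q (sem p s)"
      "reaches K m (Exec q # cs, tapes k (sem p s) A) (cs, tapes k (sem q (sem p s)) A)"
    using Seq.IH(2)[OF wf(2) Seq.prems(2) valid_sem[OF K wf(1) Seq.prems(3)] A(2)] by blast
  have "astep K (Exec (p ;; q) # cs, tapes k s A) = (Exec p # Exec q # cs, tapes k s A)"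
    using Seq.prems by (intro astep_stay) auto
  from reaches_step[OF this reaches_trans[OF n(2) m(2)]] show ?case
    using n(1) m(1) by (intro exI[of _ "Suc (n + m)"]) simp
next
  case (For r p)
  have r: "r < k" "r \<notin> writes p" "r \<notin> fors p" and wf: "wf_prog k K p"
    and A: "\<forall>x \<in> writes p \<union> fors p. A x = []" and Ar: "A r = []"
    using For.prems by auto
  obtain n where n: "n \<le> loop_cost (sem p) (cost p) r (s r) s + 1"
    and rn: "reaches K n (Exec (For r p) # cs, tapes k s A)
        (Return r # cs, tapes k ((loop (sem p) r (s r) s)(r := [])) (A(r := rev (s r) @ A r)))"
    using loop_reaches[OF For.IH[OF wf For.prems(2)] r wf K For.prems(3) refl A] by blast
  have nz: "0 \<notin> set (s r)"
  proof
    assume "0 \<in> set (s r)"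
    then have "2 \<le> (0::nat)" using For.prems(3) unfolding valid_store_def by blast
    then show False by simp
  qed
  have rr: "reaches K (length (s r) + 2)
        (Return r # cs, tapes k ((loop (sem p) r (s r) s)(r := [])) (A(r := rev (s r) @ A r)))
        (cs, tapes k ((loop (sem p) r (s r) s)(r := s r)) (A(r := [])))"
  proof -
    let ?s = "(loop (sem p) r (s r) s)(r := [])" and ?A = "A(r := rev (s r) @ A r)"
    have "?A r = rev (s r)" using Ar by (simp only: fun_upd_same append_Nil2)
    then show ?thesis
      using Return_reaches[OF r(1), of ?s ?A K cs] nz
      by (simp only: fun_upd_same fun_upd_upd length_rev set_rev rev_rev_ident simp_thms)
  qed
  have AA: "A(r := []) = A" using Ar by (rule fun_upd_idem)
  have "reaches K (n + (length (s r) + 2)) (Exec (For r p) # cs, tapes k s A)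
      (cs, tapes k (sem (For r p) s) A)"
    using reaches_trans[OF rn rr] unfolding sem.simps AA .
  moreover have "n + (length (s r) + 2) \<le> cost (For r p) s" using n by simp
  ultimately show ?case by blast
qed

subsection \<open>Polynomial bounds\<close>

definition poly_bounded :: "(nat \<Rightarrow> nat) \<Rightarrow> bool" where
  "poly_bounded f \<longleftrightarrow> (\<exists>p :: nat poly. \<forall>n. f n \<le> poly p n)"

lemma poly_nat_mono: "x \<le> y \<Longrightarrow> poly p x \<le> poly p y" for p :: "nat poly"
  by (induction p) (auto intro!: add_mono mult_mono)

lemma poly_boundedI: "(\<And>n. f n \<le> poly p n) \<Longrightarrow> poly_bounded f"
  by (auto simp: poly_bounded_def)

lemma poly_bounded_poly [simp]: "poly_bounded (poly p)"
  by (rule poly_boundedI) (rule order_refl)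

lemma poly_bounded_const [simp]: "poly_bounded (\<lambda>_. c)"
  by (rule poly_boundedI[of _ "[:c:]"]) simp

lemma poly_bounded_id [simp]: "poly_bounded (\<lambda>n. n)"
  by (rule poly_boundedI[of _ "[:0, 1:]"]) simp

lemma poly_bounded_add: "poly_bounded f \<Longrightarrow> poly_bounded g \<Longrightarrow> poly_bounded (\<lambda>n. f n + g n)"
  unfolding poly_bounded_def by (metis add_mono poly_add)

lemma poly_bounded_Suc: "poly_bounded f \<Longrightarrow> poly_bounded (\<lambda>n. Suc (f n))"
  using poly_bounded_add[of f "\<lambda>_. 1"] by simp

lemma poly_bounded_mult: "poly_bounded f \<Longrightarrow> poly_bounded g \<Longrightarrow> poly_bounded (\<lambda>n. f n * g n)"
  unfolding poly_bounded_def by (metis mult_le_mono poly_mult)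

lemma poly_bounded_sum: "(\<And>a. a \<in> A \<Longrightarrow> poly_bounded (f a)) \<Longrightarrow> poly_bounded (\<lambda>n. \<Sum>a\<in>A. f a n)"
  by (induction A rule: infinite_finite_induct) (auto intro: poly_bounded_add)

text \<open>A bound of this shape can be built in unary by iterated loops over the input, as
  \<open>powers\<close> does. With a base of at least 2, a coefficient \<open>a\<close> is absorbed
  by \<open>a\<close> factors and a sum of two terms by one more factor.\<close>

lemma poly_bounded_le_power:
  assumes "poly_bounded f"
  shows "\<exists>e. \<forall>n. f n \<le> (n + 2) ^ e"
proof -
  obtain p where p: "\<And>n. f n \<le> poly p n" using assms by (auto simp: poly_bounded_def)
  have "\<exists>e. \<forall>n. poly p n \<le> (n + 2) ^ e"
  proof (induction p)
    case 0
    show ?case by simp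
  next
    case (pCons a p)
    then obtain e where e: "\<And>n. poly p n \<le> (n + 2) ^ e" by blast
    have "poly (pCons a p) n \<le> (n + 2) ^ (a + e + 2)" for n
    proof -
      have "a \<le> 2 ^ a" by (simp add: less_imp_le)
      also have "\<dots> \<le> (n + 2) ^ a" by (intro power_mono) auto
      finally have a: "a \<le> (n + 2) ^ a" .
      have o: "1 \<le> (n + 2) ^ i" for i by (rule one_le_power) simp
      define X where "X = (n + 2) ^ a * (n + 2) ^ (e + 1)"
      have "a * 1 \<le> X" unfolding X_def by (rule mult_mono[OF a o]) auto
      moreover have "n * poly p n \<le> (n + 2) * (n + 2) ^ e" by (rule mult_mono) (use e in auto)
      then have "n * poly p n \<le> (n + 2) ^ (e + 1)" by (simp only: power_add power_one_right mult.commute)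
      then have "1 * (n * poly p n) \<le> X" unfolding X_def by (rule mult_mono[OF o]) auto
      ultimately have "a + n * poly p n \<le> 2 * X" by simp
      also have "\<dots> \<le> (n + 2) * X" by (rule mult_right_mono) auto
      also have "\<dots> = (n + 2) ^ (a + e + 2)"
        by (simp only: X_def power_add power_one_right power2_eq_square ac_simps)
      finally show ?thesis by simp
    qed
    then show ?case by blast
  qed
  then show ?thesis using p le_trans by blast
qed

text \<open>An amortised cost: steps plus growth of the registers, when every loop register has
  length at most \<open>B\<close>. Hence 3 for \<open>Push\<close>, and 1 for \<open>Clr\<close>,
  whose other steps are paid by the shrinking register. The sum over the branches of
  \<open>Case\<close> stands for a maximum and keeps the bound visibly polynomial in
  \<open>B\<close>.\<close>

primrec bound :: "nat \<Rightarrow> prog \<Rightarrow> nat \<Rightarrow> nat" where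
  "bound K Skip B = 1"
| "bound K (Push r b) B = 3"
| "bound K (Pop r) B = 1"
| "bound K (Clr r) B = 1"
| "bound K (Case r f) B = (\<Sum>a \<in> {1..<K}. bound K (f a) B) + 1"
| "bound K (p ;; q) B = bound K p B + bound K q B + 1"
| "bound K (For r p) B = B * (bound K p B + 2) + B + 3"

lemma poly_bounded_bound: "poly_bounded (bound K p)"
  by (induction p) (auto intro!: poly_bounded_Suc poly_bounded_add poly_bounded_mult poly_bounded_sum)

section \<open>Amortised cost\<close>

definition total :: "nat \<Rightarrow> nat set \<Rightarrow> store \<Rightarrow> nat" where
  "total k F s = (\<Sum>r \<in> {..<k} - F. length (s r))"

lemma total_upd: "r < k \<Longrightarrow> r \<notin> F \<Longrightarrow> total k F (s(r := l)) + length (s r) = total k F s + length l"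
  unfolding total_def by (subst (1 2) sum.remove[of _ r]) (auto intro!: sum.cong)

lemma total_upd_mem: "r \<in> F \<Longrightarrow> total k F (s(r := l)) = total k F s"
  unfolding total_def by (rule sum.cong) auto

lemma loop_cost_bound:
  assumes body: "\<And>s. valid_store K s \<Longrightarrow> \<forall>x\<in>F. length (s x) \<le> B \<Longrightarrow>
      cost p s + total k F (sem p s) \<le> b + total k F s"
    and wf: "2 \<le> K" "wf_prog k K p" "writes p \<inter> F = {}" "r \<in> F"
  shows "valid_store K s \<Longrightarrow> \<forall>x\<in>F. length (s x) \<le> B \<Longrightarrow> \<forall>a \<in> set l. 2 \<le> a \<and> a < K \<Longrightarrow> length l \<le> B \<Longrightarrow>
    loop_cost (sem p) (cost p) r l s + total k F (loop (sem p) r l s) \<le> length l * (b + 2) + total k F s"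
proof (induction l arbitrary: s)
  case (Cons a l)
  let ?s = "s(r := a # l)"
  have v: "valid_store K ?s" by (rule valid_upd) (use Cons.prems in auto)
  have B: "\<forall>x\<in>F. length (?s x) \<le> B" using Cons.prems by auto
  have F: "sem p ?s x = ?s x" if "x \<in> F" for x using that wf(3) sem_unchanged by blast
  have 1: "cost p ?s + total k F (sem p ?s) \<le> b + total k F s"
    using body[OF v B] total_upd_mem[OF wf(4)] by (simp del: fun_upd_apply)
  have 2: "loop_cost (sem p) (cost p) r l (sem p ?s) + total k F (loop (sem p) r l (sem p ?s))
      \<le> length l * (b + 2) + total k F (sem p ?s)"
    using Cons.prems B F by (intro Cons.IH valid_sem[OF wf(1,2)] v) auto
  show ?case using 1 2 by simp
qed simp

text \<open>Potential argument with the total length of the registers outside \<open>F\<close> as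
  potential. \<open>F\<close> contains all loop registers and no written one, so the number of
  passes of every loop stays below \<open>B\<close> throughout.\<close>

lemma cost_bound:
  assumes K: "2 \<le> K"
  shows "wf_prog k K p \<Longrightarrow> valid_store K s \<Longrightarrow> fors p \<subseteq> F \<Longrightarrow> writes p \<inter> F = {} \<Longrightarrow>
    \<forall>x\<in>F. length (s x) \<le> B \<Longrightarrow> cost p s + total k F (sem p s) \<le> bound K p B + total k F s"
proof (induction p arbitrary: s)
  case (Push r b)
  then show ?case using total_upd[of r k F s "b # s r"] by (auto simp del: fun_upd_apply)
next
  case (Pop r)
  then show ?case using total_upd[of r k F s "tl (s r)"] by (auto simp del: fun_upd_apply)
next
  case (Clr r)
  then show ?case using total_upd[of r k F s "[]"] by (auto simp del: fun_upd_apply)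
next
  case (Case r f)
  let ?a = "peek s r"
  have a: "1 \<le> ?a" "?a < K" using valid_peek[OF Case.prems(2) K] by auto
  have "cost (f ?a) s + total k F (sem (f ?a) s) \<le> bound K (f ?a) B + total k F s"
  proof (rule Case.IH)
    show "writes (f ?a) \<inter> F = {}" using Case.prems(4) unfolding writes.simps by blast
    show "fors (f ?a) \<subseteq> F" using Case.prems(3) unfolding fors.simps by blast
  qed (use Case.prems a in auto)
  moreover have "bound K (f ?a) B \<le> (\<Sum>a \<in> {1..<K}. bound K (f a) B)"
    using a by (intro member_le_sum) auto
  ultimately show ?case by simp
next
  case (Seq p q)
  have "cost p s + total k F (sem p s) \<le> bound K p B + total k F s"
    using Seq.prems by (intro Seq.IH) auto
  moreover have "sem p s x = s x" if "x \<in> F" for x using that Seq.prems(4) by (intro sem_unchanged) auto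
  then have "cost q (sem p s) + total k F (sem q (sem p s)) \<le> bound K q B + total k F (sem p s)"
    using Seq.prems valid_sem[OF K, of k p s] by (intro Seq.IH) auto
  ultimately show ?case by simp
next
  case (For r p)
  have r: "r \<in> F" "length (s r) \<le> B" using For.prems by auto
  have "\<forall>a \<in> set (s r). 2 \<le> a \<and> a < K" using For.prems(2) unfolding valid_store_def by blast
  then have "loop_cost (sem p) (cost p) r (s r) s + total k F (loop (sem p) r (s r) s)
      \<le> length (s r) * (bound K p B + 2) + total k F s"
    using For K by (intro loop_cost_bound[where B=B] K) auto
  moreover have "length (s r) * (bound K p B + 2) \<le> B * (bound K p B + 2)"
    using r by (intro mult_right_mono) auto
  ultimately show ?case using r total_upd_mem[OF r(1), of k "loop (sem p) r (s r) s" "s r"]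
    by (simp del: fun_upd_apply)
qed auto

subsection \<open>The Turing machine of a program\<close>

primrec states :: "nat \<Rightarrow> prog \<Rightarrow> item list \<Rightarrow> item list set" where
  "states K Skip cs = {Exec Skip # cs}"
| "states K (Push r b) cs = {Exec (Push r b) # cs, Put r b # cs}"
| "states K (Pop r) cs = {Exec (Pop r) # cs}"
| "states K (Clr r) cs = {Exec (Clr r) # cs}"
| "states K (Case r f) cs = insert (Exec (Case r f) # cs) (\<Union>a \<in> {1..<K}. states K (f a) cs)"
| "states K (p ;; q) cs = insert (Exec (p ;; q) # cs) (states K p (Exec q # cs) \<union> states K q cs)"
| "states K (For r p) cs =
     {Exec (For r p) # cs, Next r p # cs, Return r # cs} \<union> states K p (Next r p # cs)"

lemma finite_states: "finite (states K p cs)"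
  by (induction p arbitrary: cs) auto

lemma Exec_in_states: "Exec p # cs \<in> states K p cs"
  by (cases p) auto

lemma istep_in_states:
  assumes "2 \<le> K"
  shows "z \<in> states K p cs \<Longrightarrow> fst (istep K vs z) \<in> insert cs (states K p cs)"
proof (induction p arbitrary: cs)
  case (Case r f)
  have "clamp K v \<in> {1..<K}" for v using assms by (auto simp: clamp_def)
  then show ?case using Case Exec_in_states by fastforce
next
  case (Seq p q)
  then show ?case using Exec_in_states by fastforce
next
  case (For r p)
  then show ?case using Exec_in_states by (fastforce split: if_splits)
qed auto

lemma Put_in_states: "wf_prog k K p \<Longrightarrow> Put r b # z \<in> states K p cs \<Longrightarrow> b < K"
proof (induction p arbitrary: cs)
  case (Case q f)
  then obtain a where "a \<in> {1..<K}" "Put r b # z \<in> states K (f a) cs" by auto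
  then show ?case using Case.IH[of "f a"] Case.prems by auto
qed auto

lemma istep_symbol:
  assumes "istep K vs z = (z', r, b, m)" "\<And>r b cs. z = Put r b # cs \<Longrightarrow> b < K"
    "r < length vs" "\<forall>v \<in> set vs. v < K" "2 \<le> K"
  shows "b < K"
  using assms by (cases "(K, vs, z)" rule: istep.cases) (auto split: if_splits)

definition machine_of :: "nat \<Rightarrow> nat \<Rightarrow> item list set \<Rightarrow> (item list \<Rightarrow> nat) \<Rightarrow> item list \<Rightarrow> nat \<Rightarrow> machine" where
  "machine_of k K Q e z0 res =
     \<lparr>num_tapes = k, num_symbols = K, num_states = card Q + 2, start_state = e z0,
      accept_state = card Q, reject_state = card Q + 1,
      delta = \<lambda>q vs. let stay = map (\<lambda>v. (v, MStay)) vs in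
        if q < card Q then
          let z = inv_into Q e q in
          if z = [] then (if vs ! res = 3 then card Q else card Q + 1, stay)
          else case istep K vs z of (z', r, b, m) \<Rightarrow> (e z', stay[r := (b, m)])
        else (q, stay)\<rparr>"

locale item_machine =
  fixes k K :: nat and Q :: "item list set" and e :: "item list \<Rightarrow> nat" and z0 :: "item list" and res :: nat
  assumes fin: "finite Q" and e: "bij_betw e Q {..<card Q}" and z0: "z0 \<in> Q" and res: "res < k" and K: "4 \<le> K"
    and Q: "\<And>z vs. z \<in> Q \<Longrightarrow> fst (istep K vs z) \<in> Q" and Put: "\<And>r b cs. Put r b # cs \<in> Q \<Longrightarrow> b < K"
begin

definition M :: machine where "M = machine_of k K Q e z0 res"

lemma M_simps [simp]: "num_tapes M = k" "num_symbols M = K" "num_states M = card Q + 2"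
    "start_state M = e z0" "accept_state M = card Q" "reject_state M = card Q + 1"
  by (simp_all add: M_def machine_of_def)

lemma e_less: "z \<in> Q \<Longrightarrow> e z < card Q"
  using e by (auto simp: bij_betw_def)

lemma inv_e [simp]: "z \<in> Q \<Longrightarrow> inv_into Q e (e z) = z"
  using e by (auto simp: bij_betw_def)

lemma inv_e_in: "q < card Q \<Longrightarrow> inv_into Q e q \<in> Q"
  using e by (metis bij_betw_def inv_into_into lessThan_iff)

lemma turing_machine_M: "turing_machine M"
proof -
  have "case delta M q vs of (q', as) \<Rightarrow>
      q' < card Q + 2 \<and> length as = k \<and> (\<forall>(y, m) \<in> set as. y < K)"
    if q: "q < card Q + 2" and vs: "length vs = k" "\<forall>v \<in> set vs. v < K" for q vs
  proof -
    let ?stay = "map (\<lambda>v. (v, MStay)) vs"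
    have stay: "\<forall>(y, m) \<in> set ?stay. y < K" using vs by auto
    show ?thesis
    proof (cases "q < card Q \<and> inv_into Q e q \<noteq> []")
      case True
      let ?z = "inv_into Q e q"
      obtain z' r b m where st: "istep K vs ?z = (z', r, b, m)" by (metis prod_cases4)
      have z': "z' \<in> Q" using Q[of ?z vs] inv_e_in True st by simp
      have zQ: "?z \<in> Q" using inv_e_in True by blast
      have b: "b < K" if "r < k"
      proof (rule istep_symbol[OF st])
        show "b' < K" if "inv_into Q e q = Put r' b' # cs" for r' b' cs
          using Put zQ that by metis
      qed (use that vs K in auto)
      have "\<forall>(y, m) \<in> set (?stay[r := (b, m)]). y < K"
      proof (cases "r < k")
        case True
        then show ?thesis using b stay set_update_subset_insert[of ?stay r "(b, m)"] by fastforce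
      next
        case False
        then have "?stay[r := (b, m)] = ?stay" using vs by (intro list_update_beyond) simp
        then show ?thesis using stay by simp
      qed
      then show ?thesis using True st e_less[OF z'] vs by (simp add: M_def machine_of_def)
    next
      case False
      then show ?thesis using q stay vs by (auto simp: M_def machine_of_def Let_def)
    qed
  qed
  then show ?thesis using res K e_less[OF z0] by (simp add: turing_machine_def)
qed

lemma act_stay: "act_tape (read_tape t, MStay) t = t"
  by (cases t) simp

lemma map2_stay: "map2 act_tape (map (\<lambda>v. (v, MStay)) (map read_tape T)) T = T"
  by (rule nth_equalityI) (simp_all add: act_stay del: map_map)

lemma map2_act:
  "map2 act_tape ((map (\<lambda>v. (v, MStay)) (map read_tape T))[r := a]) T = T[r := act_tape a (T ! r)]"
proof (rule nth_equalityI)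
  fix i assume "i < length (map2 act_tape ((map (\<lambda>v. (v, MStay)) (map read_tape T))[r := a]) T)"
  then show "map2 act_tape ((map (\<lambda>v. (v, MStay)) (map read_tape T))[r := a]) T ! i
      = T[r := act_tape a (T ! r)] ! i"
    by (cases "i = r") (simp_all add: act_stay)
qed simp

lemma tm_step_item:
  assumes "z \<in> Q" "z \<noteq> []"
  shows "tm_step M (e z, T) = (e (fst (astep K (z, T))), snd (astep K (z, T)))"
proof -
  obtain z' r b m where st: "istep K (map read_tape T) z = (z', r, b, m)" by (metis prod_cases4)
  have "delta M (e z) (map read_tape T) = (e z', (map (\<lambda>v. (v, MStay)) (map read_tape T))[r := (b, m)])"
    using assms e_less st by (simp add: M_def machine_of_def Let_def del: map_map)
  moreover have "\<not> halted M (e z, T)" using e_less[OF assms(1)] by (simp add: halted_def)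
  ultimately show ?thesis using st by (simp add: tm_step_def astep_def map2_act del: map_map)
qed

lemma tm_step_Nil:
  assumes "[] \<in> Q" "length T = k"
  shows "tm_step M (e [], T) = (if read_tape (T ! res) = 3 then card Q else card Q + 1, T)"
proof -
  have "\<not> halted M (e [], T)" using e_less[OF assms(1)] by (simp add: halted_def)
  then show ?thesis using assms e_less[OF assms(1)] res map2_stay[of T]
    by (auto simp: tm_step_def M_def machine_of_def Let_def)
qed

lemma astep_in_Q: "fst c \<in> Q \<Longrightarrow> fst (astep K c) \<in> Q"
  using Q[of "fst c" "map read_tape (snd c)"] by (auto simp: astep_def split: prod.split)

lemma length_astep: "length (snd (astep K c)) = length (snd c)"
  by (auto simp: astep_def split: prod.split)

lemma astep_Nil: "T \<noteq> [] \<Longrightarrow> astep K ([], T) = ([], T)"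
  by (rule astep_stay) auto

lemma astep_Nil_iterate: "T \<noteq> [] \<Longrightarrow> (astep K ^^ n) ([], T) = ([], T)"
  by (induction n) (auto simp: astep_Nil)

text \<open>\<open>reaches\<close> fixes only the configuration after \<open>n\<close> steps, while
  the items may be used up earlier, at time \<open>n0\<close>. From then on the small steps change
  nothing, so the tapes at \<open>n0\<close> are already the final ones, and the machine halts one
  step later. The second claim transfers space bounds: the machine shows no tapes other than those
  of the first \<open>n\<close> small steps.\<close>

lemma run_items:
  assumes T0: "length T0 = k" and rn: "reaches K n (z0, T0) ([], T1)"
  shows "\<exists>t \<le> n + 1. (tm_step M ^^ t) (e z0, T0)
            = (if read_tape (T1 ! res) = 3 then accept_state M else reject_state M, T1)"
    and "\<exists>j \<le> n. snd ((tm_step M ^^ t) (e z0, T0)) = snd ((astep K ^^ j) (z0, T0))"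
proof -
  define c where "c j = (astep K ^^ j) (z0, T0)" for j
  have cS: "c (Suc j) = astep K (c j)" for j by (simp add: c_def)
  have cQ: "fst (c j) \<in> Q" for j by (induction j) (auto simp: c_def z0 intro: astep_in_Q)
  have cl: "length (snd (c j)) = k" for j by (induction j) (auto simp: c_def T0 length_astep)
  have cn: "c n = ([], T1)" using rn by (simp add: c_def reaches_def)
  define n0 where "n0 = (LEAST j. fst (c j) = [])"
  have n0: "fst (c n0) = []" unfolding n0_def by (rule LeastI[of _ n]) (simp add: cn)
  have n0n: "n0 \<le> n" unfolding n0_def by (rule Least_le) (simp add: cn)
  have before: "fst (c j) \<noteq> []" if "j < n0" for j using that not_less_Least unfolding n0_def by blast
  have ne: "snd (c n0) \<noteq> []" using cl[of n0] res by auto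
  have "c n = (astep K ^^ (n - n0)) (c n0)"
    using n0n unfolding c_def by (metis comp_apply funpow_add le_add_diff_inverse2)
  also have "c n0 = ([], snd (c n0))" using n0 by (metis prod.collapse)
  also have "(astep K ^^ (n - n0)) \<dots> = \<dots>" by (rule astep_Nil_iterate[OF ne])
  finally have c0: "c n0 = ([], T1)" using cn \<open>c n0 = ([], snd (c n0))\<close> by simp
  have sim: "(tm_step M ^^ j) (e z0, T0) = (e (fst (c j)), snd (c j))" if "j \<le> n0" for j
    using that
  proof (induction j)
    case 0
    show ?case by (simp add: c_def)
  next
    case (Suc j)
    then have "(tm_step M ^^ Suc j) (e z0, T0) = tm_step M (e (fst (c j)), snd (c j))" by simp
    also have "\<dots> = (e (fst (c (Suc j))), snd (c (Suc j)))"
      using tm_step_item[OF cQ[of j] before, of "snd (c j)"] Suc.prems by (simp add: cS)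
    finally show ?case .
  qed
  let ?r = "(if read_tape (T1 ! res) = 3 then accept_state M else reject_state M, T1)"
  have NilQ: "[] \<in> Q" using cQ[of n0] c0 by simp
  have T1: "length T1 = k" using cl[of n0] c0 by simp
  have last: "(tm_step M ^^ Suc n0) (e z0, T0) = ?r"
    using sim[of n0] tm_step_Nil[OF NilQ T1] c0 by simp
  then show "\<exists>t \<le> n + 1. (tm_step M ^^ t) (e z0, T0) = ?r"
    using n0n by (intro exI[of _ "Suc n0"]) simp
  have stop: "(tm_step M ^^ j) ?r = ?r" for j
    by (induction j) (auto simp: tm_step_def halted_def)
  show "\<exists>j \<le> n. snd ((tm_step M ^^ t) (e z0, T0)) = snd ((astep K ^^ j) (z0, T0))"
  proof (cases "t \<le> n0")
    case True
    then show ?thesis using sim[of t] n0n by (intro exI[of _ t]) (simp add: c_def)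
  next
    case False
    then obtain d where "t = d + Suc n0" by (metis add.commute less_iff_Suc_add not_le add_Suc_right)
    then have "(tm_step M ^^ t) (e z0, T0) = ?r" using last stop[of d] by (simp only: funpow_add comp_apply)
    then show ?thesis using c0 n0n by (intro exI[of _ n0]) (simp add: c_def)
  qed
qed

end

definition bit :: "bool \<Rightarrow> nat" where "bit b = (if b then 3 else 2)"

text \<open>The first input bit is next to the end marker, which is the bottom of the stack; hence
  the reversal.\<close>

definition init_store :: "bool list \<Rightarrow> store" where
  "init_store x = (\<lambda>_. [])(0 := rev (map bit x))"

lemma valid_init_store: "4 \<le> K \<Longrightarrow> valid_store K (init_store x)"
  by (auto simp: valid_store_def init_store_def bit_def)

lemma string_contents_cont: "string_contents x = cont (map bit x)"
  by (rule ext) (auto simp: string_contents_def cont_def bit_def)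

lemma init_tapes:
  assumes "num_tapes M = k" "0 < k"
  shows "snd (init_config M x) = tapes k (\<lambda>_. []) ((\<lambda>_. [])(0 := map bit x))"
  using assms by (intro nth_equalityI) (auto simp: init_config_def nth_Cons string_contents_cont split: nat.split)

text \<open>A machine starts with its head on the end marker, below the whole input. This is the
  situation at the end of a loop over register 0, so \<open>Return 0\<close> as first item brings
  the input into the form of a register.\<close>

lemma Return_init:
  assumes "0 < k"
  shows "reaches K (length x + 2) (Return 0 # cs, tapes k (\<lambda>_. []) ((\<lambda>_. [])(0 := map bit x)))
     (cs, tapes k (init_store x) (\<lambda>_. []))"
proof -
  have "0 \<notin> set (map bit x)" by (auto simp: bit_def)
  then show ?thesis
    using Return_reaches[OF assms, of "\<lambda>_. []" "(\<lambda>_. [])(0 := map bit x)" K cs]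
    unfolding init_store_def fun_upd_same fun_upd_upd length_map by (simp add: fun_upd_idem)
qed

lemma ex_item_machine:
  assumes "finite Q" "z0 \<in> Q" "res < k" "4 \<le> K"
    and "\<And>z vs. z \<in> Q \<Longrightarrow> fst (istep K vs z) \<in> Q" "\<And>r b cs. Put r b # cs \<in> Q \<Longrightarrow> b < K"
  shows "\<exists>e. item_machine k K Q e z0 res"
proof -
  obtain e where "bij_betw e Q {0..<card Q}" using ex_bij_betw_finite_nat[OF assms(1)] by blast
  then show ?thesis using assms by (intro exI[of _ e]) (simp add: item_machine_def atLeast0LessThan)
qed

theorem polytime_prog:
  assumes wf: "wf_prog k K p" "4 \<le> K" "0 < k"
    and c: "poly_bounded c" "\<And>x. cost p (init_store x) \<le> c (length x)"
    and f: "\<And>x. sem p (init_store x) (k - 1) = rev (map bit (f x))"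
  shows "polytime_computable f"
proof -
  define Q where "Q = {[], [Return 0, Exec p]} \<union> states K p []"
  have Q: "fst (istep K vs z) \<in> Q" if "z \<in> Q" for z vs
    using that istep_in_states[of K z p "[]" vs] Exec_in_states[of p "[]" K] wf(2) by (auto simp: Q_def split: if_splits)
  have Put: "b < K" if "Put r b # cs \<in> Q" for r b cs
    using that Put_in_states[OF wf(1)] by (auto simp: Q_def)
  obtain e where im: "item_machine k K Q e [Return 0, Exec p] 0"
    using ex_item_machine[of Q "[Return 0, Exec p]" 0 k K] Q Put wf by (auto simp: Q_def finite_states)
  interpret item_machine k K Q e "[Return 0, Exec p]" 0 by (rule im)
  have run: "\<exists>t \<le> length x + 2 + c (length x) + 1. halted M (run M x t) \<and>
      fst (last (snd (run M x t))) = string_contents (f x)" for x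
  proof -
    let ?T0 = "tapes k (\<lambda>_. []) ((\<lambda>_. [])(0 := map bit x))"
    let ?T1 = "tapes k (sem p (init_store x)) (\<lambda>_. [])"
    have "\<exists>n \<le> cost p (init_store x). reaches K n ([Exec p], tapes k (init_store x) (\<lambda>_. [])) ([], ?T1)"
      by (rule exec_reaches) (use wf valid_init_store[OF wf(2)] in simp_all)
    then obtain n where n: "n \<le> cost p (init_store x)"
      and rn: "reaches K n ([Exec p], tapes k (init_store x) (\<lambda>_. [])) ([], ?T1)"
      by blast
    obtain t where t: "t \<le> length x + 2 + n + 1" and run: "(tm_step M ^^ t) (e [Return 0, Exec p], ?T0)
        = (if read_tape (?T1 ! 0) = 3 then accept_state M else reject_state M, ?T1)"
      using run_items(1)[OF length_tapes reaches_trans[OF Return_init[OF wf(3)] rn]] by blast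
    have "init_config M x = (e [Return 0, Exec p], ?T0)"
      using init_tapes[of M k x] wf(3) by (simp add: init_config_def prod_eq_iff)
    then have run: "run M x t = (if read_tape (?T1 ! 0) = 3 then accept_state M else reject_state M, ?T1)"
      using run by (simp add: run_def)
    then have "halted M (run M x t)" by (simp add: halted_def)
    moreover have "last ?T1 = ?T1 ! (k - 1)" using wf(3) by (subst last_conv_nth) auto
    then have "fst (last (snd (run M x t))) = string_contents (f x)"
      using wf(3) run f[of x] by (simp add: string_contents_cont)
    ultimately show ?thesis using t n c(2)[of x] by (intro exI[of _ t]) auto
  qed
  have "computes M f" unfolding computes_def using run by blast
  moreover have "poly_bounded (\<lambda>n. n + 2 + c n + 1)" using c by (intro poly_bounded_add) auto
  then obtain q where "\<And>n. n + 2 + c n + 1 \<le> poly q n" by (auto simp: poly_bounded_def)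
  then have "runs_in_time M (poly q)" unfolding runs_in_time_def using run by (blast intro: le_trans)
  ultimately show ?thesis using turing_machine_M by (auto simp: polytime_computable_def)
qed

section \<open>Space used by a loop of many passes\<close>

definition heads_le :: "nat \<Rightarrow> tape list \<Rightarrow> bool" where
  "heads_le h T \<longleftrightarrow> (\<forall>t \<in> set T. snd t \<le> h)"

definition stays_within :: "nat \<Rightarrow> nat \<Rightarrow> nat \<Rightarrow> item list \<times> tape list \<Rightarrow> bool" where
  "stays_within K h n c \<longleftrightarrow> (\<forall>j \<le> n. heads_le h (snd ((astep K ^^ j) c)))"

lemma heads_le_mono: "heads_le h T \<Longrightarrow> h \<le> h' \<Longrightarrow> heads_le h' T"
  by (auto simp: heads_le_def)

lemma heads_le_tapes: "(\<And>r. r < k \<Longrightarrow> length (s r) \<le> h) \<Longrightarrow> heads_le h (tapes k s A)"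
  by (auto simp: heads_le_def tapes_def)

lemma read_tapes_top: "cont (rev (s r)) (length (s r)) = peek s r"
  by (simp add: cont_def peek_def nth_append split: list.split)

lemma act_tape_head: "snd (act_tape (b, m) t) \<le> Suc (snd t)"
  by (cases t; cases m) auto

lemma heads_le_astep:
  assumes h: "heads_le h (snd c)"
  shows "heads_le (Suc h) (snd (astep K c))"
proof -
  obtain z r b m where st: "istep K (map read_tape (snd c)) (fst c) = (z, r, b, m)" by (metis prod_cases4)
  have "heads_le (Suc h) ((snd c)[r := act_tape (b, m) (snd c ! r)])"
    unfolding heads_le_def
  proof
    fix t assume t: "t \<in> set ((snd c)[r := act_tape (b, m) (snd c ! r)])"
    show "snd t \<le> Suc h"
    proof (cases "r < length (snd c)")
      case True
      then have "snd c ! r \<in> set (snd c)" by (rule nth_mem)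
      then have "snd (snd c ! r) \<le> h" using h unfolding heads_le_def by blast
      then have "snd (act_tape (b, m) (snd c ! r)) \<le> Suc h" using act_tape_head le_trans by (metis Suc_le_mono)
      moreover have "t = act_tape (b, m) (snd c ! r) \<or> t \<in> set (snd c)"
        using t set_update_subset_insert by fast
      ultimately show ?thesis using h unfolding heads_le_def by (metis le_SucI)
    next
      case False
      then have "t \<in> set (snd c)" using t by (simp only: list_update_beyond not_less)
      then show ?thesis using h unfolding heads_le_def by (metis le_SucI)
    qed
  qed
  then show ?thesis unfolding astep_def st by simp
qed

lemma stays_within_time:
  assumes "heads_le h (snd c)"
  shows "stays_within K (h + n) n c"
proof -
  have "heads_le (h + j) (snd ((astep K ^^ j) c))" for j
  proof (induction j)
    case (Suc j)
    then show ?case using heads_le_astep by simp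
  qed (use assms in simp)
  then have "heads_le (h + n) (snd ((astep K ^^ j) c))" if "j \<le> n" for j
    using heads_le_mono[of "h + j" _ "h + n"] that by simp
  then show ?thesis by (simp add: stays_within_def)
qed

lemma stays_within_trans:
  assumes "stays_within K h m c" "reaches K m c d" "stays_within K h n d"
  shows "stays_within K h (m + n) c"
  unfolding stays_within_def
proof (intro allI impI)
  fix j assume j: "j \<le> m + n"
  show "heads_le h (snd ((astep K ^^ j) c))"
  proof (cases "j \<le> m")
    case False
    then have "(astep K ^^ j) c = (astep K ^^ (j - m)) ((astep K ^^ m) c)"
      using funpow_add[of "j - m" m "astep K"] by simp
    moreover have "j - m \<le> n" using j by simp
    ultimately show ?thesis using assms(2,3) by (simp add: stays_within_def reaches_def)
  qed (use assms(1) in \<open>simp add: stays_within_def\<close>)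
qed

lemma stays_within_mono: "stays_within K h n c \<Longrightarrow> h \<le> h' \<Longrightarrow> stays_within K h' n c"
  unfolding stays_within_def using heads_le_mono by blast

lemma exec_within:
  assumes "2 \<le> K" "wf_prog k K p" "0 < k" "valid_store K s" "\<And>r. r < k \<Longrightarrow> length (s r) \<le> h"
    and "h + cost p s \<le> h'"
  shows "\<exists>n. reaches K n (Exec p # cs, tapes k s (\<lambda>_. [])) (cs, tapes k (sem p s) (\<lambda>_. []))
     \<and> stays_within K h' n (Exec p # cs, tapes k s (\<lambda>_. []))"
proof -
  have "\<exists>n \<le> cost p s. reaches K n (Exec p # cs, tapes k s (\<lambda>_. [])) (cs, tapes k (sem p s) (\<lambda>_. []))"
    by (rule exec_reaches[OF assms(1-4)]) simp
  then obtain n where n: "n \<le> cost p s"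
    and rn: "reaches K n (Exec p # cs, tapes k s (\<lambda>_. [])) (cs, tapes k (sem p s) (\<lambda>_. []))"
    by blast
  have "heads_le h (snd (Exec p # cs, tapes k s (\<lambda>_. [])))"
    unfolding snd_conv by (rule heads_le_tapes) (rule assms(5))
  from stays_within_time[OF this] have "stays_within K h' n (Exec p # cs, tapes k s (\<lambda>_. []))"
    by (rule stays_within_mono) (use n assms(6) in simp)
  then show ?thesis using rn by blast
qed

text \<open>The number \<open>J\<close> of passes may be exponential. Space does not accumulate
  because lengths are bounded afresh at the start of every pass, and within one pass a head moves at
  most as far as the pass has steps.\<close>

lemma while_within:
  assumes K: "2 \<le> K" and wf: "wf_prog k K p" "0 < k" "go < k"
    and S: "\<And>j. j < J \<Longrightarrow> peek (S j) go = 3 \<and> S (Suc j) = sem p (S j)" "peek (S J) go \<noteq> 3"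
    and v: "valid_store K (S 0)"
    and h: "\<And>j r. j \<le> J \<Longrightarrow> r < k \<Longrightarrow> length (S j r) \<le> h" "\<And>j. j < J \<Longrightarrow> cost p (S j) \<le> h"
  shows "\<exists>n. reaches K n ([While go p], tapes k (S 0) (\<lambda>_. [])) ([], tapes k (S J) (\<lambda>_. []))
     \<and> stays_within K (h + h + 1) n ([While go p], tapes k (S 0) (\<lambda>_. []))"
  using S v h
proof (induction J arbitrary: S)
  case 0
  have st: "astep K ([While go p], tapes k (S 0) (\<lambda>_. [])) = ([], tapes k (S 0) (\<lambda>_. []))"
    by (rule astep_stay) (use 0 wf in \<open>auto simp: read_tapes_top\<close>)
  have "heads_le h (snd ([While go p], tapes k (S 0) (\<lambda>_. [])))"
    unfolding snd_conv by (rule heads_le_tapes) (rule "0.prems"(4)[OF order_refl])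
  from stays_within_time[OF this, of K 1] have "stays_within K (h + h + 1) 1 ([While go p], tapes k (S 0) (\<lambda>_. []))"
    by (rule stays_within_mono) simp
  then show ?case using reaches_1[OF st] by auto
next
  case (Suc J)
  have st: "astep K ([While go p], tapes k (S 0) (\<lambda>_. [])) = ([Exec p, While go p], tapes k (S 0) (\<lambda>_. []))"
    by (rule astep_stay) (use Suc.prems(1)[of 0] wf in \<open>auto simp: read_tapes_top\<close>)
  have "heads_le h (snd ([While go p], tapes k (S 0) (\<lambda>_. [])))"
    unfolding snd_conv by (rule heads_le_tapes) (rule Suc.prems(4)[OF le0])
  from stays_within_time[OF this, of K 1] have 1: "stays_within K (h + h + 1) (Suc 0) ([While go p], tapes k (S 0) (\<lambda>_. []))"
    unfolding One_nat_def by (rule stays_within_mono) simp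
  have S1: "sem p (S 0) = S (Suc 0)" using Suc.prems(1)[of 0] by simp
  have "\<exists>n. reaches K n ([Exec p, While go p], tapes k (S 0) (\<lambda>_. [])) ([While go p], tapes k (sem p (S 0)) (\<lambda>_. []))
     \<and> stays_within K (h + h + 1) n ([Exec p, While go p], tapes k (S 0) (\<lambda>_. []))"
  proof (rule exec_within[OF K wf(1,2) Suc.prems(3)])
    show "length (S 0 r) \<le> h" if "r < k" for r using Suc.prems(4)[of 0 r] that by simp
    show "h + cost p (S 0) \<le> h + h + 1" using Suc.prems(5)[of 0] by simp
  qed
  then obtain n where n: "reaches K n ([Exec p, While go p], tapes k (S 0) (\<lambda>_. [])) ([While go p], tapes k (S (Suc 0)) (\<lambda>_. []))"
     "stays_within K (h + h + 1) n ([Exec p, While go p], tapes k (S 0) (\<lambda>_. []))" unfolding S1 by blast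
  have "\<exists>n. reaches K n ([While go p], tapes k (S (Suc 0)) (\<lambda>_. [])) ([], tapes k (S (Suc J)) (\<lambda>_. []))
     \<and> stays_within K (h + h + 1) n ([While go p], tapes k (S (Suc 0)) (\<lambda>_. []))"
  proof (rule Suc.IH[of "\<lambda>j. S (Suc j)"])
    show "peek (S (Suc j)) go = 3 \<and> S (Suc (Suc j)) = sem p (S (Suc j))" if "j < J" for j
      using Suc.prems(1)[of "Suc j"] that by (simp only: Suc_less_eq simp_thms)
    show "peek (S (Suc J)) go \<noteq> 3" by (rule Suc.prems(2))
    show "valid_store K (S (Suc 0))"
      using valid_sem[OF K wf(1) Suc.prems(3)] S1 by (simp only:)
    show "length (S (Suc j) r) \<le> h" if "j \<le> J" "r < k" for j r
      using Suc.prems(4)[of "Suc j" r] that by (simp only: Suc_le_mono simp_thms)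
    show "cost p (S (Suc j)) \<le> h" if "j < J" for j
      using Suc.prems(5)[of "Suc j"] that by (simp only: Suc_less_eq simp_thms)
  qed
  then obtain m where m: "reaches K m ([While go p], tapes k (S (Suc 0)) (\<lambda>_. [])) ([], tapes k (S (Suc J)) (\<lambda>_. []))"
     "stays_within K (h + h + 1) m ([While go p], tapes k (S (Suc 0)) (\<lambda>_. []))" by blast
  show ?case
    by (intro exI conjI, rule reaches_trans[OF reaches_1[OF st] reaches_trans[OF n(1) m(1)]],
      rule stays_within_trans[OF 1 reaches_1[OF st] stays_within_trans[OF n(2,1) m(2)]])
qed

theorem PSPACE_prog:
  assumes wf: "wf_prog k K p" "wf_prog k K q" "4 \<le> K" "0 < k" "go < k" "res < k"
    and c: "poly_bounded c"
    and run: "\<And>x. \<exists>J S. S 0 = sem p (init_store x) \<and> cost p (init_store x) \<le> c (length x) \<and>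
      (\<forall>j < J. peek (S j) go = 3 \<and> S (Suc j) = sem q (S j) \<and> cost q (S j) \<le> c (length x)) \<and>
      (\<forall>j \<le> J. \<forall>r < k. length (S j r) \<le> c (length x)) \<and>
      peek (S J) go \<noteq> 3 \<and> (peek (S J) res = 3 \<longleftrightarrow> x \<in> A)"
  shows "A \<in> PSPACE"
proof -
  let ?z = "[Return 0, Exec p, While go q]"
  define Q where "Q = {[], ?z, [While go q]} \<union> states K p [While go q] \<union> states K q [While go q]"
  have K2: "2 \<le> K" using wf by simp
  have Q: "fst (istep K vs z) \<in> Q" if zQ: "z \<in> Q" for z vs
  proof -
    consider "z = []" | "z = ?z" | "z = [While go q]" | "z \<in> states K p [While go q]" | "z \<in> states K q [While go q]"
      using zQ by (auto simp: Q_def)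
    then show ?thesis
      using istep_in_states[OF K2, of z _ "[While go q]" vs] Exec_in_states[of _ "[While go q]" K]
      by cases (auto simp: Q_def split: if_splits)
  qed
  have Put: "b < K" if "Put r b # cs \<in> Q" for r b cs
    using that Put_in_states[OF wf(1)] Put_in_states[OF wf(2)] by (auto simp: Q_def)
  obtain e where im: "item_machine k K Q e ?z res"
    using ex_item_machine[of Q ?z res k K] Q Put wf by (auto simp: Q_def finite_states)
  interpret item_machine k K Q e ?z res by (rule im)
  \<comment> \<open>Large enough for each of the three phases: the initial return takes
    \<open>length x + 2\<close> steps, \<open>p\<close> starts with heads up to
    \<open>length x\<close> and costs at most \<open>c\<close>, and the loop stays within
    \<open>2 * c + 1\<close>.\<close>
  define h where "h n = 2 * (n + c n) + 2" for n
  have main: "(\<exists>t. fst (run M x t) = (if x \<in> A then accept_state M else reject_state M)) \<and>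
      heads_le (h (length x)) (snd (run M x t'))" for x t'
  proof -
    obtain J S where S0: "S 0 = sem p (init_store x)" and cp: "cost p (init_store x) \<le> c (length x)"
      and S: "\<And>j. j < J \<Longrightarrow> peek (S j) go = 3 \<and> S (Suc j) = sem q (S j)" "\<And>j. j < J \<Longrightarrow> cost q (S j) \<le> c (length x)"
        "\<And>j r. j \<le> J \<Longrightarrow> r < k \<Longrightarrow> length (S j r) \<le> c (length x)"
        "peek (S J) go \<noteq> 3" "peek (S J) res = 3 \<longleftrightarrow> x \<in> A"
      using run[of x] by blast
    let ?T0 = "tapes k (\<lambda>_. []) ((\<lambda>_. [])(0 := map bit x))" and ?T1 = "tapes k (S J) (\<lambda>_. [])"
    let ?w = "[While go q]"
    have r0: "reaches K (length x + 2) (?z, ?T0) (Exec p # ?w, tapes k (init_store x) (\<lambda>_. []))"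
      by (rule Return_init[OF wf(4)])
    have "heads_le 0 (snd (?z, ?T0))" unfolding snd_conv by (rule heads_le_tapes) simp
    from stays_within_time[OF this, of K "length x + 2"]
    have s0: "stays_within K (h (length x)) (length x + 2) (?z, ?T0)"
      by (rule stays_within_mono) (simp add: h_def)
    have len: "length (init_store x r) \<le> length x" for r by (simp add: init_store_def)
    have hx: "length x + cost p (init_store x) \<le> h (length x)" using cp by (simp add: h_def)
    obtain n where rn: "reaches K n (Exec p # ?w, tapes k (init_store x) (\<lambda>_. [])) (?w, tapes k (S 0) (\<lambda>_. []))"
      and sn: "stays_within K (h (length x)) n (Exec p # ?w, tapes k (init_store x) (\<lambda>_. []))"
      using exec_within[OF K2 wf(1,4) valid_init_store[OF wf(3)] len hx, of ?w] unfolding S0 by blast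
    have v: "valid_store K (S 0)" using valid_sem[OF K2 wf(1) valid_init_store[OF wf(3)]] S0 by simp
    obtain m where rm: "reaches K m (?w, tapes k (S 0) (\<lambda>_. [])) ([], ?T1)"
      and sm: "stays_within K (c (length x) + c (length x) + 1) m (?w, tapes k (S 0) (\<lambda>_. []))"
      using while_within[OF K2 wf(2,4,5) S(1,4) v S(3,2)] by blast
    have sm: "stays_within K (h (length x)) m (?w, tapes k (S 0) (\<lambda>_. []))"
      using sm by (rule stays_within_mono) (simp add: h_def)
    let ?n = "length x + 2 + (n + m)"
    have rall: "reaches K ?n (?z, ?T0) ([], ?T1)" by (rule reaches_trans[OF r0 reaches_trans[OF rn rm]])
    have sall: "stays_within K (h (length x)) ?n (?z, ?T0)"
      by (rule stays_within_trans[OF s0 r0 stays_within_trans[OF sn rn sm]])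
    have init: "init_config M x = (e ?z, ?T0)"
      using init_tapes[of M k x] wf(4) by (simp add: init_config_def prod_eq_iff)
    obtain t where t: "run M x t = (if read_tape (?T1 ! res) = 3 then accept_state M else reject_state M, ?T1)"
      using run_items(1)[OF length_tapes rall] unfolding run_def init by blast
    have "read_tape (?T1 ! res) = 3 \<longleftrightarrow> x \<in> A" using S(5) wf(6) by (simp add: read_tapes_top)
    then have "fst (run M x t) = (if x \<in> A then accept_state M else reject_state M)"
      unfolding t fst_conv by presburger
    moreover obtain j where "j \<le> ?n" "snd (run M x t') = snd ((astep K ^^ j) (?z, ?T0))"
      using run_items(2)[OF length_tapes rall, of t'] unfolding run_def init by blast
    then have "heads_le (h (length x)) (snd (run M x t'))" using sall by (simp add: stays_within_def)
    ultimately show ?thesis by blast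
  qed
  have "poly_bounded (\<lambda>n. h n + 1)" unfolding h_def
    using c by (intro poly_bounded_add poly_bounded_mult) auto
  then obtain pp where "\<And>n. h n + 1 \<le> poly pp n" by (auto simp: poly_bounded_def)
  then have pp: "h n < poly pp n" for n by (simp add: less_eq_Suc_le)
  have "runs_in_space M (poly pp)"
    unfolding runs_in_space_def
  proof (intro allI ballI, clarify)
    fix x t d i assume "(d, i) \<in> set (snd (run M x t))"
    then have "i \<le> h (length x)" using main[of x t] unfolding heads_le_def by fastforce
    then show "i < poly pp (length x)" using pp[of "length x"] by simp
  qed
  moreover have "decides M A" unfolding decides_def using main by blast
  ultimately show ?thesis using turing_machine_M by (auto simp: PSPACE_def)
qed

section \<open>Reachability as a modal formula\<close>

fun big_and :: "fm list \<Rightarrow> fm \<Rightarrow> fm" where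
  "big_and [] \<phi> = \<phi>"
| "big_and (\<psi> # \<psi>s) \<phi> = FAnd \<psi> (big_and \<psi>s \<phi>)"

lemma holds_big_and [simp]:
  "holds R \<pi> w (big_and \<psi>s \<phi>) \<longleftrightarrow> (\<forall>\<psi> \<in> set \<psi>s. holds R \<pi> w \<psi>) \<and> holds R \<pi> w \<phi>"
  by (induction \<psi>s) auto

text \<open>Complete Shannon expansion of a Boolean function; the atom \<open>t\<close> only serves to write the constants.\<close>

fun truth_table :: "nat \<Rightarrow> nat list \<Rightarrow> (bool list \<Rightarrow> bool) \<Rightarrow> fm" where
  "truth_table t [] G = (if G [] then FOr (Atom t) (NAtom t) else FAnd (Atom t) (NAtom t))"
| "truth_table t (a # as) G =
     FOr (FAnd (Atom a) (truth_table t as (\<lambda>bs. G (True # bs))))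
         (FAnd (NAtom a) (truth_table t as (\<lambda>bs. G (False # bs))))"

lemma holds_truth_table [simp]: "holds R \<pi> w (truth_table t as G) \<longleftrightarrow> G (map (\<lambda>a. \<pi> a w) as)"
proof (induction as arbitrary: G)
  case (Cons a as)
  then show ?case by (cases "\<pi> a w") (simp_all only: truth_table.simps holds.simps list.map simp_thms)
qed simp

subsection \<open>Numbering the atoms\<close>

definition num :: "bool list \<Rightarrow> nat" where
  "num ds = foldl (\<lambda>a b. 2 * a + of_bool b) 0 ds"

lemma bin_num: "ds = [] \<or> hd ds \<Longrightarrow> bin (num ds) = ds"
proof (induction ds rule: rev_induct)
  case Nil
  then show ?case by (simp add: num_def bin_0)
next
  case (snoc b ds)
  have n: "num (ds @ [b]) = 2 * num ds + of_bool b" by (simp add: num_def)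
  have IH: "bin (num ds) = ds" using snoc by (cases ds) auto
  have pos: "num (ds @ [b]) > 0"
  proof (cases ds)
    case Nil
    then show ?thesis using snoc.prems n by simp
  next
    case (Cons c cs)
    then have "num ds \<noteq> 0" using IH bin_0 by (metis list.distinct(1))
    then show ?thesis using n by simp
  qed
  have "num (ds @ [b]) div 2 = num ds" "odd (num (ds @ [b])) = b" using n by auto
  then show ?case using bin_pos[OF pos] IH by simp
qed

text \<open>The index is prescribed through its digits: it contains \<open>i\<close> in unary, so
  printing an atom at position \<open>i\<close> repeats one digit \<open>i\<close> times, followed
  by digits that are the same for all positions. The additional leading 1 rules out a leading zero
  for \<open>i = 0\<close> and keeps the atom 0 free for other use.\<close>

definition var :: "nat \<Rightarrow> nat \<Rightarrow> nat" where
  "var i j = num (replicate (i + 1) True @ False # replicate j True)"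

lemma bin_var: "bin (var i j) = replicate (i + 1) True @ False # replicate j True"
  unfolding var_def by (rule bin_num) simp

lemma var_inj: "var i j = var i' j' \<longleftrightarrow> i = i' \<and> j = j'"
proof
  assume "var i j = var i' j'"
  then have eq: "replicate (i + 1) True @ False # replicate j True
      = replicate (i' + 1) True @ False # replicate j' True"
    by (metis bin_var)
  have tw: "length (takeWhile id (replicate a True @ False # bs)) = a" for a bs by (induction a) auto
  have "i + 1 = i' + 1" using arg_cong[OF eq, of "\<lambda>l. length (takeWhile id l)"] unfolding tw .
  moreover have "i + 1 + Suc j = i' + 1 + Suc j'" using arg_cong[OF eq, of length] by simp
  ultimately show "i = i' \<and> j = j'" by simp
qed simp

lemma var_pos: "var i j \<noteq> 0"
proof
  assume "var i j = 0"
  then show False using bin_var[of i j] bin_0 by simp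
qed

text \<open>
  Bit \<open>b\<close> of position \<open>i\<close> in the three words attached to a world: the source \<open>U\<close>, the target
  \<open>V\<close> and the midpoint \<open>Mid\<close>. The atom 0 says which half of the path the world is responsible for.
\<close>

definition uvar :: "nat \<times> nat \<Rightarrow> nat" where "uvar x = var (fst x) (3 * snd x)"
definition vvar :: "nat \<times> nat \<Rightarrow> nat" where "vvar x = var (fst x) (3 * snd x + 1)"
definition mvar :: "nat \<times> nat \<Rightarrow> nat" where "mvar x = var (fst x) (3 * snd x + 2)"

lemma var_distinct:
  "uvar x = uvar y \<longleftrightarrow> x = y" "vvar x = vvar y \<longleftrightarrow> x = y" "mvar x = mvar y \<longleftrightarrow> x = y"
  "uvar x \<noteq> vvar y" "vvar x \<noteq> uvar y" "uvar x \<noteq> mvar y" "mvar x \<noteq> uvar y" "vvar x \<noteq> mvar y" "mvar x \<noteq> vvar y"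
  "uvar x \<noteq> 0" "vvar x \<noteq> 0" "mvar x \<noteq> 0"
  by (cases x; cases y; simp add: uvar_def vvar_def mvar_def var_inj var_pos; presburger)+

section \<open>The path formula and its tree models\<close>

definition carry :: "fm \<Rightarrow> nat \<Rightarrow> nat \<Rightarrow> fm" where
  "carry l p q = FAnd (FOr (NAtom p) (FBox (FOr l (Atom q)))) (FOr (Atom p) (FBox (FOr l (NAtom q))))"

text \<open>The literal given to \<open>carry\<close> exempts the successors at which it holds.
  Where atom 0 is true the successor takes the first half, from the source to the midpoint; where it
  is false, the second half, from the midpoint to the target.\<close>

definition copy_bit :: "nat \<times> nat \<Rightarrow> fm" where
  "copy_bit x = FAnd (FAnd (carry (NAtom 0) (uvar x) (uvar x)) (carry (NAtom 0) (mvar x) (vvar x)))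
                     (FAnd (carry (Atom 0) (mvar x) (uvar x)) (carry (Atom 0) (vvar x) (vvar x)))"

definition both_halves :: fm where
  "both_halves = FAnd (FDia (Atom 0)) (FDia (NAtom 0))"

text \<open>The recursive occurrence is single, below a box that covers both halves. Doubling the
  length of the path thus adds one layer to the formula instead of doubling it.\<close>

fun tree :: "fm list \<Rightarrow> fm \<Rightarrow> nat \<Rightarrow> fm" where
  "tree loc leaf 0 = leaf"
| "tree loc leaf (Suc m) = FAnd both_halves (big_and loc (FBox (tree loc leaf m)))"

definition word_of :: "(nat \<times> nat) set \<Rightarrow> (nat \<times> nat \<Rightarrow> nat) \<Rightarrow> (nat \<Rightarrow> 'w \<Rightarrow> bool) \<Rightarrow> 'w \<Rightarrow> (nat \<times> nat) set" where
  "word_of I f \<pi> w = {x \<in> I. \<pi> (f x) w}"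

lemma holds_carry:
  "holds R \<pi> w (carry l p q) \<longleftrightarrow> (\<forall>v. (w, v) \<in> R \<longrightarrow> \<not> holds R \<pi> v l \<longrightarrow> (\<pi> q v \<longleftrightarrow> \<pi> p w))"
  unfolding carry_def by (cases "\<pi> p w") auto

lemma holds_copy_bit:
  "holds R \<pi> w (copy_bit x) \<longleftrightarrow>
   (\<forall>v. (w, v) \<in> R \<longrightarrow>
      (if \<pi> 0 v then (\<pi> (uvar x) v \<longleftrightarrow> \<pi> (uvar x) w) \<and> (\<pi> (vvar x) v \<longleftrightarrow> \<pi> (mvar x) w)
       else (\<pi> (uvar x) v \<longleftrightarrow> \<pi> (mvar x) w) \<and> (\<pi> (vvar x) v \<longleftrightarrow> \<pi> (vvar x) w)))"
  unfolding copy_bit_def holds.simps holds_carry if_bool_eq_conj by blast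

lemma word_of_eq: "word_of I f \<pi> v = word_of I g \<pi> w \<longleftrightarrow> (\<forall>x \<in> I. \<pi> (f x) v \<longleftrightarrow> \<pi> (g x) w)"
  unfolding word_of_def set_eq_iff mem_Collect_eq by blast

lemma holds_copy_bits:
  "(\<forall>x \<in> I. holds R \<pi> w (copy_bit x)) \<longleftrightarrow>
   (\<forall>v. (w, v) \<in> R \<longrightarrow>
      (if \<pi> 0 v then word_of I uvar \<pi> v = word_of I uvar \<pi> w \<and> word_of I vvar \<pi> v = word_of I mvar \<pi> w
       else word_of I uvar \<pi> v = word_of I mvar \<pi> w \<and> word_of I vvar \<pi> v = word_of I vvar \<pi> w))"
  unfolding holds_copy_bit word_of_eq if_bool_eq_conj by blast

lemma relpow_double: "(u, v) \<in> r ^^ (2 ^ Suc m) \<longleftrightarrow> (\<exists>z. (u, z) \<in> r ^^ (2 ^ m) \<and> (z, v) \<in> r ^^ (2 ^ m))"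
proof -
  have "r ^^ (2 ^ Suc m) = r ^^ (2 ^ m) O r ^^ (2 ^ m)"
    by (simp add: relpow_add[symmetric] mult_2)
  then show ?thesis by auto
qed

lemma tree_sound:
  assumes loc: "\<And>w. \<forall>\<psi> \<in> set loc. holds R \<pi> w \<psi> \<Longrightarrow> \<forall>x \<in> I. holds R \<pi> w (copy_bit x)"
    and leaf: "\<And>w. holds R \<pi> w leaf \<Longrightarrow> (word_of I uvar \<pi> w, word_of I vvar \<pi> w) \<in> r"
  shows "holds R \<pi> w (tree loc leaf m) \<Longrightarrow> (word_of I uvar \<pi> w, word_of I vvar \<pi> w) \<in> r ^^ (2 ^ m)"
proof (induction m arbitrary: w)
  case 0
  then show ?case using leaf by simp
next
  case (Suc m)
  have c: "\<forall>x \<in> I. holds R \<pi> w (copy_bit x)" using Suc.prems by (intro loc) simp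
  obtain v1 v2 where v: "(w, v1) \<in> R" "\<pi> 0 v1" "(w, v2) \<in> R" "\<not> \<pi> 0 v2"
    and t: "holds R \<pi> v1 (tree loc leaf m)" "holds R \<pi> v2 (tree loc leaf m)"
    using Suc.prems by (auto simp: both_halves_def)
  show ?case
    using Suc.IH[OF t(1)] Suc.IH[OF t(2)] v c[unfolded holds_copy_bits] relpow_double by metis
qed

text \<open>The model is the tree of midpoints of a given path: a world consists of the remaining
  depth, source, target and the half it stands for, and it has exactly two successors. The
  assumptions on \<open>loc\<close> and \<open>leaf\<close> range over all relations and valuations
  because those of the model are built inside the proof.\<close>

lemma tree_complete:
  fixes I :: "(nat \<times> nat) set"
  assumes r: "r \<subseteq> Pow I \<times> Pow I"
    and loc: "\<And>R \<pi> (w :: nat \<times> (nat \<times> nat) set \<times> (nat \<times> nat) set \<times> bool).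
      \<forall>x \<in> I. holds R \<pi> w (copy_bit x) \<Longrightarrow> \<forall>\<psi> \<in> set loc. holds R \<pi> w \<psi>"
    and leaf: "\<And>R \<pi> (w :: nat \<times> (nat \<times> nat) set \<times> (nat \<times> nat) set \<times> bool).
      (word_of I uvar \<pi> w, word_of I vvar \<pi> w) \<in> r \<Longrightarrow> holds R \<pi> w leaf"
    and uv: "(u, v) \<in> r ^^ (2 ^ m)"
  shows "\<exists>R \<pi> (w :: nat \<times> (nat \<times> nat) set \<times> (nat \<times> nat) set \<times> bool).
    holds R \<pi> w (tree loc leaf m) \<and> word_of I uvar \<pi> w = u \<and> word_of I vvar \<pi> w = v"
proof -
  define mid where "mid j u v = (SOME z. (u, z) \<in> r ^^ (2 ^ j) \<and> (z, v) \<in> r ^^ (2 ^ j))" for j u v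
  have mid: "(u, mid j u v) \<in> r ^^ (2 ^ j)" "(mid j u v, v) \<in> r ^^ (2 ^ j)" if "(u, v) \<in> r ^^ (2 ^ Suc j)" for j u v
    using someI_ex[of "\<lambda>z. (u, z) \<in> r ^^ (2 ^ j) \<and> (z, v) \<in> r ^^ (2 ^ j)"] that
    unfolding relpow_double mid_def by blast+
  \<comment> \<open>The path has length at least 1, so its ends lie in the domain and the range of
    \<open>r\<close>, which contain only subsets of \<open>I\<close>.\<close>
  have sub: "u \<subseteq> I \<and> v \<subseteq> I" if "(u, v) \<in> r ^^ (2 ^ j)" for j u v
  proof -
    obtain n where n: "(2::nat) ^ j = Suc n" by (metis Suc_pred' pos2 zero_less_power)
    have "u \<in> Domain r" using relpow_Suc_D2[of u v n r] that unfolding n by blast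
    moreover have "v \<in> Range r" using relpow_Suc_E[of u v n r] that unfolding n by blast
    ultimately show ?thesis using r by blast
  qed
  define R where "R = {((Suc j, u, v, b), (j, u, mid j u v, True)) | j u v (b :: bool). True}
    \<union> {((Suc j, u, v, b), (j, mid j u v, v, False)) | j u v b. True}"
  define \<pi> where "\<pi> n w = (case w of (j, u, v, b) \<Rightarrow>
      (\<exists>x \<in> I. n = uvar x \<and> x \<in> u) \<or> (\<exists>x \<in> I. n = vvar x \<and> x \<in> v) \<or>
      (\<exists>x \<in> I. n = mvar x \<and> x \<in> mid (j - 1) u v) \<or> n = 0 \<and> b)" for n and w :: "nat \<times> (nat \<times> nat) set \<times> (nat \<times> nat) set \<times> bool"
  have words: "word_of I uvar \<pi> (j, u, v, b) = I \<inter> u" "word_of I vvar \<pi> (j, u, v, b) = I \<inter> v"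
      "word_of I mvar \<pi> (j, u, v, b) = I \<inter> mid (j - 1) u v" for j u v b
    unfolding word_of_def \<pi>_def by (auto simp: var_distinct)
  have p0: "\<pi> 0 (j, u, v, b) = b" for j u v b
    unfolding \<pi>_def prod.case using var_distinct(10-12) by metis
  have "holds R \<pi> (j, u, v, b) (tree loc leaf j)" if "(u, v) \<in> r ^^ (2 ^ j)" for j u v b
    using that
  proof (induction j arbitrary: u v b)
    case 0
    then show ?case using sub[of u v 0] by (auto intro!: leaf simp: words Int_absorb1)
  next
    case (Suc j)
    let ?z = "mid j u v" and ?w = "(Suc j, u, v, b)"
    have succ: "(?w, w') \<in> R \<longleftrightarrow> w' = (j, u, ?z, True) \<or> w' = (j, ?z, v, False)" for w'
      by (auto simp: R_def)
    have "\<forall>x \<in> I. holds R \<pi> ?w (copy_bit x)"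
      unfolding holds_copy_bits succ by (auto simp: words p0)
    then have "\<forall>\<psi> \<in> set loc. holds R \<pi> ?w \<psi>" by (rule loc)
    moreover have "holds R \<pi> ?w both_halves"
      unfolding both_halves_def holds.simps succ using p0 by blast
    moreover have "holds R \<pi> w' (tree loc leaf j)" if "(?w, w') \<in> R" for w'
      using that mid[OF Suc.prems] Suc.IH unfolding succ by blast
    ultimately show ?case by simp
  qed
  from this[OF uv, of True] show ?thesis
    using words[of m u v True] sub[OF uv] by (metis Int_absorb1)
qed

subsection \<open>Configurations as words\<close>

text \<open>
  The letter at position \<open>i \<ge> 1\<close> records, for each tape, the symbol \<open>i - 1\<close> cells to the right
  of the head and the symbol \<open>i\<close> cells to its left (\<open>num_symbols M\<close> if there is no such cell). The
  tag 0 marks the first and 2 the last position. Relative to the head, one step shifts the tapes, so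
  a letter of the next word depends on its neighbours and the first letter only.
\<close>

type_synonym letter = "nat \<times> nat \<times> (nat \<times> nat) list"

definition letters :: "machine \<Rightarrow> letter set" where
  "letters M = {..<3} \<times> {..<num_states M} \<times>
     {cs. set cs \<subseteq> {..<num_symbols M} \<times> {..num_symbols M} \<and> length cs = num_tapes M}"

definition letter :: "machine \<Rightarrow> nat \<Rightarrow> config \<Rightarrow> nat \<Rightarrow> letter" where
  "letter M \<Lambda> C i = (if i = 1 then 0 else if i = \<Lambda> then 2 else 1, fst C,
     map (\<lambda>(c, h). (c (h + (i - 1)), if i \<le> h then c (h - i) else num_symbols M)) (snd C))"

text \<open>The arguments ending in \<open>a\<close>, \<open>b\<close>, \<open>c\<close> belong to
  the left neighbour, the letter itself and the right neighbour. Tag 0 identifies the first letter,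
  whose right component is the cell being overwritten with \<open>y\<close>. \<open>l0 = N\<close>
  means that the head is on cell 0, where a left move does nothing. At the last position the result
  is the constant enforced by \<open>fits\<close>.\<close>

fun next_cell :: "nat \<Rightarrow> nat \<Rightarrow> nat \<Rightarrow> nat \<Rightarrow> nat \<times> move \<Rightarrow> nat \<times> nat \<Rightarrow> nat \<times> nat \<Rightarrow> nat \<times> nat \<Rightarrow> nat \<times> nat" where
  "next_cell N ta tb l0 (y, m) (ra, la) (rb, lb) (rc, lc) =
     (if tb = 2 then (0, N)
      else if m = MStay \<or> m = MLeft \<and> l0 = N then (if tb = 0 then y else rb, lb)
      else if m = MRight then (rc, if tb = 0 then y else la)
      else (if tb = 0 then lb else if ta = 0 then y else ra, lc))"

lemma next_cell_stay:
  "tb \<noteq> 2 \<Longrightarrow> m = MStay \<or> m = MLeft \<and> l0 = N \<Longrightarrow>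
    next_cell N ta tb l0 (y, m) A B C = (if tb = 0 then y else fst B, snd B)"
  by (cases A; cases B; cases C) simp

lemma next_cell_right:
  "tb \<noteq> 2 \<Longrightarrow> m = MRight \<Longrightarrow> next_cell N ta tb l0 (y, m) A B C = (fst C, if tb = 0 then y else snd A)"
  by (cases A; cases B; cases C) simp

lemma next_cell_left:
  "tb \<noteq> 2 \<Longrightarrow> l0 \<noteq> N \<Longrightarrow> m = MLeft \<Longrightarrow> next_cell N ta tb l0 (y, m) A B C
    = (if tb = 0 then snd B else if ta = 0 then y else fst A, snd C)"
  by (cases A; cases B; cases C) simp

definition next_letter :: "machine \<Rightarrow> letter \<Rightarrow> letter \<Rightarrow> letter \<Rightarrow> letter \<Rightarrow> letter" where
  "next_letter M a0 a b c =
     (if fst (snd a0) \<in> {accept_state M, reject_state M} then b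
      else case delta M (fst (snd a0)) (map fst (snd (snd a0))) of
        (q, as) \<Rightarrow> (fst b, q,
          map (\<lambda>t. next_cell (num_symbols M) (fst a) (fst b) (snd (snd (snd a0) ! t)) (as ! t)
                (snd (snd a) ! t) (snd (snd b) ! t) (snd (snd c) ! t)) [0..<num_tapes M]))"

lemma finite_letters: "finite (letters M)"
  unfolding letters_def by (intro finite_cartesian_product finite_lists_length_eq) auto

text \<open>Needed at the left end of a word. For uniformity the formula also mentions the positions
  0 and \<Lambda> + 1, whose bits are left open; the first and the last letter must be computable
  without them.\<close>

lemma next_letter_first: "fst b = 0 \<Longrightarrow> next_letter M a0 a b c = next_letter M a0 a' b c"
proof -
  assume b: "fst b = 0"
  define g where "g N l0 ym rb rc = next_cell N 0 0 l0 ym (0, 0) rb rc" for N l0 ym rb rc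
  have "next_cell N ta 0 l0 ym ra rb rc = g N l0 ym rb rc" for N ta l0 ym ra rb rc
    unfolding g_def by (cases ym; cases ra; cases rb; cases rc) simp
  then show ?thesis unfolding next_letter_def b by simp
qed

lemma next_letter_last: "fst b = 2 \<Longrightarrow> next_letter M a0 a b c = next_letter M a0 a b c'"
proof -
  assume b: "fst b = 2"
  have "next_cell N ta 2 l0 ym ra rb rc = (0, N)" for N ta l0 ym ra rb rc
    by (cases ym; cases ra; cases rb; cases rc) simp
  then show ?thesis unfolding next_letter_def b by simp
qed

text \<open>The configurations that fit into words of length \<open>\<Lambda>\<close>.\<close>

definition fits :: "machine \<Rightarrow> nat \<Rightarrow> config \<Rightarrow> bool" where
  "fits M \<Lambda> C \<longleftrightarrow> fst C < num_states M \<and> length (snd C) = num_tapes M \<and>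
     (\<forall>t \<in> set (snd C). (\<forall>i. fst t i < num_symbols M) \<and> snd t < \<Lambda> - 1 \<and> (\<forall>i \<ge> \<Lambda> - 1. fst t i = 0))"

lemma fits_tape:
  assumes "fits M \<Lambda> C" "(c, h) \<in> set (snd C)"
  shows "c i < num_symbols M" "h < \<Lambda> - 1" "i \<ge> \<Lambda> - 1 \<Longrightarrow> c i = 0"
  using assms unfolding fits_def by (metis fst_conv snd_conv)+

lemma letter_in_letters: "fits M \<Lambda> C \<Longrightarrow> letter M \<Lambda> C i \<in> letters M"
proof -
  assume C: "fits M \<Lambda> C"
  let ?f = "\<lambda>(c, h). (c (h + (i - 1)), if i \<le> h then c (h - i) else num_symbols M)"
  have "?f t \<in> {..<num_symbols M} \<times> {..num_symbols M}" if "t \<in> set (snd C)" for t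
  proof -
    obtain c h where t: "t = (c, h)" by fastforce
    have "\<forall>i. c i < num_symbols M" using fits_tape(1)[OF C] that unfolding t by blast
    then show ?thesis unfolding t by (simp add: less_imp_le)
  qed
  then have "set (map ?f (snd C)) \<subseteq> {..<num_symbols M} \<times> {..num_symbols M}"
    unfolding set_map by (rule image_subsetI)
  then show ?thesis using C unfolding letters_def letter_def fits_def by simp
qed

text \<open>One case per effective head movement. The last letter is constant: when the
  configuration fits, the cell \<open>\<Lambda> - 1\<close> to the right of the head is blank and
  there is no cell \<Lambda> to its left.\<close>

lemma letter_step:
  assumes tm: "turing_machine M" and C: "fits M \<Lambda> C" and C': "fits M \<Lambda> (tm_step M C)"
    and i: "1 \<le> i" "i \<le> \<Lambda>" and \<Lambda>: "2 \<le> \<Lambda>"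
  shows "letter M \<Lambda> (tm_step M C) i = next_letter M (letter M \<Lambda> C 1) (letter M \<Lambda> C (i - 1))
           (letter M \<Lambda> C i) (letter M \<Lambda> C (i + 1))"
proof (cases "halted M C")
  case True
  then show ?thesis by (simp add: tm_step_def next_letter_def letter_def halted_def)
next
  case False
  obtain q T where CqT: "C = (q, T)" by fastforce
  obtain q' as where d: "delta M q (map read_tape T) = (q', as)" by fastforce
  have T: "length T = num_tapes M" "q < num_states M" using C by (auto simp: fits_def CqT)
  have rd: "map fst (snd (snd (letter M \<Lambda> C 1))) = map read_tape T"
    by (auto simp: letter_def CqT)
  have rT: "\<forall>x \<in> set (map read_tape T). x < num_symbols M"
  proof
    fix x assume "x \<in> set (map read_tape T)"
    then obtain t where t: "t \<in> set (snd C)" "x = read_tape t" unfolding CqT by auto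
    obtain c h where ch: "t = (c, h)" by fastforce
    show "x < num_symbols M" using fits_tape(1)[OF C t(1)[unfolded ch]] unfolding t(2) ch by simp
  qed
  have "\<forall>q < num_states M. \<forall>xs. length xs = num_tapes M \<and> (\<forall>x \<in> set xs. x < num_symbols M) \<longrightarrow>
        (case delta M q xs of (q', as) \<Rightarrow>
           q' < num_states M \<and> length as = num_tapes M \<and> (\<forall>(y, m) \<in> set as. y < num_symbols M))"
    using tm unfolding turing_machine_def by (elim conjE) assumption
  from this[THEN spec, THEN mp, OF T(2), THEN spec, THEN mp, OF conjI[OF trans[OF length_map T(1)] rT]]
  have "case delta M q (map read_tape T) of (q', as) \<Rightarrow>
           q' < num_states M \<and> length as = num_tapes M \<and> (\<forall>(y, m) \<in> set as. y < num_symbols M)"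
    .
  then have las: "length as = num_tapes M" unfolding d by simp
  have st: "tm_step M C = (q', map2 act_tape as T)"
    using False d by (simp add: tm_step_def CqT)
  have cell: "(case act_tape (as ! t) (T ! t) of (c, h) \<Rightarrow>
        (c (h + (i - 1)), if i \<le> h then c (h - i) else num_symbols M))
      = next_cell (num_symbols M) (if i - 1 = 1 then 0 else if i - 1 = \<Lambda> then 2 else 1)
          (if i = 1 then 0 else if i = \<Lambda> then 2 else 1)
          (snd (snd (snd (letter M \<Lambda> C 1)) ! t)) (as ! t)
          (snd (snd (letter M \<Lambda> C (i - 1))) ! t) (snd (snd (letter M \<Lambda> C i)) ! t)
          (snd (snd (letter M \<Lambda> C (i + 1))) ! t)" if t: "t < num_tapes M" for t
  proof -
    obtain c h where ch: "T ! t = (c, h)" by fastforce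
    obtain y m where ym: "as ! t = (y, m)" by fastforce
    have ltr: "snd (snd (letter M \<Lambda> C j)) ! t = (c (h + (j - 1)), if j \<le> h then c (h - j) else num_symbols M)" for j
      using t T ch by (simp add: letter_def CqT)
    have "(c, h) \<in> set T" using ch t T nth_mem by metis
    then have c: "c i < num_symbols M" for i using fits_tape(1)[OF C] by (simp add: CqT)
    define c' where "c' = c(h := y)"
    define h' where "h' = move_head m h"
    have act: "act_tape (y, m) (T ! t) = (c', h')" by (simp add: ch c'_def h'_def)
    have "map2 act_tape as T ! t = (c', h')" using t T las act ym by simp
    then have "(c', h') \<in> set (map2 act_tape as T)"
      using t T las nth_mem[of t "map2 act_tape as T"] by simp
    then have last: "h' < \<Lambda> - 1" "\<And>i. i \<ge> \<Lambda> - 1 \<Longrightarrow> c' i = 0"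
      using fits_tape(2,3)[OF C'] unfolding st snd_conv by blast+
    have tb: "(if i = 1 then 0 else if i = \<Lambda> then 2 else 1) \<noteq> (2 :: nat)"
        "((if i = 1 then 0 else if i = \<Lambda> then 2 else 1) = (0 :: nat)) = (i = 1)" if "i < \<Lambda>"
      using that by auto
    have ta: "((if i - 1 = 1 then 0 else if i - 1 = \<Lambda> then 2 else 1) = (0 :: nat)) = (i - 1 = 1)"
      by simp
    consider (l) "i = \<Lambda>" | (s) "i < \<Lambda>" "m = MStay \<or> m = MLeft \<and> h = 0" | (r) "i < \<Lambda>" "m = MRight"
      | (f) "i < \<Lambda>" "m = MLeft" "h > 0"
      using i by (cases m) force+
    then show ?thesis
    proof cases
      case l
      then show ?thesis using last \<Lambda> unfolding ym act ltr by simp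
    next
      case s
      have h': "h' = h" using s by (auto simp: h'_def)
      have stay: "m = MStay \<or> m = MLeft \<and> (if 1 \<le> h then c (h - 1) else num_symbols M) = num_symbols M"
        using s by auto
      have "c' (h + (i - 1)) = (if i = 1 then y else c (h + (i - 1)))"
        using i by (cases "i = 1") (auto simp: c'_def)
      moreover have "(if i \<le> h then c' (h - i) else num_symbols M) = (if i \<le> h then c (h - i) else num_symbols M)"
        using i by (auto simp: c'_def)
      ultimately show ?thesis
        unfolding ym act ltr prod.case snd_conv h' next_cell_stay[OF tb(1)[OF s(1)] stay] tb(2)[OF s(1)] by simp
    next
      case r
      have h': "h' = h + 1" using r by (simp add: h'_def)
      have "c' (h + 1 + (i - 1)) = c (h + (i + 1 - 1))" using i by (simp add: c'_def)
      moreover have "(if i \<le> h + 1 then c' (h + 1 - i) else num_symbols M)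
          = (if i = 1 then y else if i - 1 \<le> h then c (h - (i - 1)) else num_symbols M)"
        using i by (auto simp: c'_def)
      ultimately show ?thesis
        unfolding ym act ltr prod.case snd_conv h' next_cell_right[OF tb(1)[OF r(1)] r(2)] tb(2)[OF r(1)] by simp
    next
      case f
      have h': "h' = h - 1" using f by (simp add: h'_def)
      have l0: "(if 1 \<le> h then c (h - 1) else num_symbols M) \<noteq> num_symbols M" using c[of "h - 1"] f by simp
      have "c' (h - 1 + (i - 1)) = (if i = 1 then (if i \<le> h then c (h - i) else num_symbols M)
          else if i - 1 = 1 then y else c (h + (i - 1 - 1)))"
      proof -
        consider "i = 1" | "i = 2" | "i > 2" using i by linarith
        then show ?thesis
        proof cases
          case 3
          then have "h - 1 + (i - 1) = h + (i - 1 - 1)" "h + (i - 1 - 1) \<noteq> h"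
            "i - 1 \<noteq> 1" "i \<noteq> 1" using f by auto
          then show ?thesis using 3 by (simp add: c'_def)
        qed (use f in \<open>auto simp: c'_def\<close>)
      qed
      moreover have "(if i \<le> h - 1 then c' (h - 1 - i) else num_symbols M)
          = (if i + 1 \<le> h then c (h - (i + 1)) else num_symbols M)"
        using i f by (auto simp: c'_def)
      ultimately show ?thesis
        unfolding ym act ltr prod.case snd_conv h' next_cell_left[OF tb(1)[OF f(1)] l0 f(2)] tb(2)[OF f(1)] ta by simp
    qed
  qed
  have nh: "fst (snd (letter M \<Lambda> C 1)) \<notin> {accept_state M, reject_state M}" "fst (snd (letter M \<Lambda> C 1)) = q"
    using False by (auto simp: letter_def halted_def CqT)
  have "map (\<lambda>(c, h). (c (h + (i - 1)), if i \<le> h then c (h - i) else num_symbols M)) (map2 act_tape as T)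
      = map (\<lambda>t. next_cell (num_symbols M) (fst (letter M \<Lambda> C (i - 1))) (fst (letter M \<Lambda> C i))
          (snd (snd (snd (letter M \<Lambda> C 1)) ! t)) (as ! t)
          (snd (snd (letter M \<Lambda> C (i - 1))) ! t) (snd (snd (letter M \<Lambda> C i)) ! t)
          (snd (snd (letter M \<Lambda> C (i + 1))) ! t)) [0..<num_tapes M]"
  proof (rule nth_equalityI)
    fix t assume "t < length (map (\<lambda>(c, h). (c (h + (i - 1)), if i \<le> h then c (h - i) else num_symbols M)) (map2 act_tape as T))"
    then have t: "t < num_tapes M" using T las by simp
    have f: "fst (letter M \<Lambda> C j) = (if j = 1 then 0 else if j = \<Lambda> then 2 else 1)" for j by (simp add: letter_def)
    show "map (\<lambda>(c, h). (c (h + (i - 1)), if i \<le> h then c (h - i) else num_symbols M)) (map2 act_tape as T) ! t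
        = map (\<lambda>t. next_cell (num_symbols M) (fst (letter M \<Lambda> C (i - 1))) (fst (letter M \<Lambda> C i))
          (snd (snd (snd (letter M \<Lambda> C 1)) ! t)) (as ! t)
          (snd (snd (letter M \<Lambda> C (i - 1))) ! t) (snd (snd (letter M \<Lambda> C i)) ! t)
          (snd (snd (letter M \<Lambda> C (i + 1))) ! t)) [0..<num_tapes M] ! t"
      using cell[OF t] t T las unfolding f by simp
  qed (use T las in simp)
  then show ?thesis
    unfolding next_letter_def rd nh(2) d st using nh by (simp add: letter_def)
qed

section \<open>Runs within the space bound and their initial word\<close>

lemma run_Suc: "run M x (Suc t) = tm_step M (run M x t)"
  by (simp add: run_def)

lemma fits_init:
  assumes tm: "turing_machine M" and "length x < \<Lambda> - 1"
  shows "fits M \<Lambda> (init_config M x)"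
proof -
  have "4 \<le> num_symbols M" "start_state M < num_states M" "1 \<le> num_tapes M"
    using tm by (simp_all add: turing_machine_def)
  moreover have "string_contents y i < 4" for y i by (simp add: string_contents_def)
  then have "string_contents y i < num_symbols M" for y i using \<open>4 \<le> num_symbols M\<close> less_le_trans by blast
  moreover have "string_contents y i = 0" if "length y \<le> length x" "i \<ge> \<Lambda> - 1" for y i
    using that assms(2) by (simp add: string_contents_def)
  ultimately show ?thesis using assms(2) unfolding fits_def init_config_def by auto
qed

lemma fits_step:
  assumes tm: "turing_machine M" and C: "fits M \<Lambda> C"
    and h: "\<forall>t \<in> set (snd (tm_step M C)). snd t < \<Lambda> - 1"
  shows "fits M \<Lambda> (tm_step M C)"
proof (cases "halted M C")
  case True
  then show ?thesis using C by (simp add: tm_step_def)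
next
  case False
  obtain q T where CqT: "C = (q, T)" by fastforce
  obtain q' as where d: "delta M q (map read_tape T) = (q', as)" by fastforce
  have T: "length T = num_tapes M" "q < num_states M" using C by (auto simp: fits_def CqT)
  have tapes: "\<forall>i. fst t i < num_symbols M" "snd t < \<Lambda> - 1" "\<forall>i \<ge> \<Lambda> - 1. fst t i = 0" if "t \<in> set T" for t
    using C that unfolding fits_def CqT by simp_all
  have rT: "\<forall>x \<in> set (map read_tape T). x < num_symbols M"
  proof
    fix x assume "x \<in> set (map read_tape T)"
    then obtain t where t: "t \<in> set T" "x = read_tape t" by auto
    obtain c h where "t = (c, h)" by fastforce
    then show "x < num_symbols M" using tapes(1)[OF t(1)] unfolding t(2) by simp
  qed
  have "\<forall>q < num_states M. \<forall>xs. length xs = num_tapes M \<and> (\<forall>x \<in> set xs. x < num_symbols M) \<longrightarrow>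
        (case delta M q xs of (q', as) \<Rightarrow>
           q' < num_states M \<and> length as = num_tapes M \<and> (\<forall>(y, m) \<in> set as. y < num_symbols M))"
    using tm unfolding turing_machine_def by (elim conjE) assumption
  from this[THEN spec, THEN mp, OF T(2), THEN spec, THEN mp, OF conjI[OF trans[OF length_map T(1)] rT]]
  have as: "q' < num_states M" "length as = num_tapes M" "\<forall>(y, m) \<in> set as. y < num_symbols M"
    unfolding d by simp_all
  have st: "tm_step M C = (q', map2 act_tape as T)"
    using False d by (simp add: tm_step_def CqT)
  have "(\<forall>i. fst t i < num_symbols M) \<and> (\<forall>i \<ge> \<Lambda> - 1. fst t i = 0)" if mem: "t \<in> set (map2 act_tape as T)" for t
  proof -
    obtain z where "z \<in> set (zip as T)" "t = (case z of (a, t) \<Rightarrow> act_tape a t)"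
      using mem unfolding set_map by blast
    moreover obtain a t0 where "z = (a, t0)" by (cases z)
    ultimately have "(a, t0) \<in> set (zip as T)" "t = act_tape a t0" by simp_all
    then have a: "a \<in> set as" and t0: "t0 \<in> set T" and t: "t = act_tape a t0"
      by (auto dest: set_zip_leftD set_zip_rightD)
    obtain y m where ym: "a = (y, m)" by fastforce
    have y: "y < num_symbols M" using as(3) a ym by auto
    have "fst t = (fst t0)(snd t0 := y)" unfolding t ym by (cases t0) simp
    then show ?thesis using tapes[OF t0] y by simp
  qed
  then show ?thesis using as T h unfolding fits_def st by simp
qed

lemma fits_run:
  assumes "turing_machine M" "runs_in_space M s" "s (length x) \<le> \<Lambda> - 1" "length x < \<Lambda> - 1"
  shows "fits M \<Lambda> (run M x t)"
proof (induction t)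
  case 0
  then show ?case using fits_init assms by (simp add: run_def)
next
  case (Suc t)
  have "snd u < \<Lambda> - 1" if "u \<in> set (snd (run M x (Suc t)))" for u
  proof -
    have "case u of (c, i) \<Rightarrow> i < s (length x)" using assms(2) that unfolding runs_in_space_def by blast
    then show ?thesis using assms(3) by (simp add: case_prod_unfold)
  qed
  then show ?case using fits_step[OF assms(1) Suc] unfolding run_Suc by blast
qed

lemma halted_run:
  assumes "fst (run M x t) \<in> {accept_state M, reject_state M}" "t \<le> t'"
  shows "run M x t' = run M x t"
  using assms(2)
proof (induction t' rule: dec_induct)
  case (step n)
  then show ?case using assms(1) by (simp add: run_Suc tm_step_def halted_def)
qed simp

text \<open>One symbol per position determines the initial letter there: 6 for the first, 5 for the
  last, 2 and 3 for input bits, 4 for the blanks in between. As the head starts on cell 0, the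
  letter at position \<open>i + 1\<close> shows cell \<open>i\<close>.\<close>

definition wsyms :: "bool list \<Rightarrow> nat \<Rightarrow> nat list" where
  "wsyms x L = 6 # map bit x @ replicate L 4 @ [5]"

definition iletter :: "machine \<Rightarrow> nat \<Rightarrow> letter" where
  "iletter M a = (if a = 6 then 0 else if a = 5 then 2 else 1, start_state M,
     if a = 6 then replicate (num_tapes M) (1, num_symbols M)
     else (if a \<in> {2, 3} then a else 0, num_symbols M) # replicate (num_tapes M - 1) (0, num_symbols M))"

lemma letter_init:
  assumes tm: "turing_machine M" and \<Lambda>: "\<Lambda> = length x + L + 2" and i: "i < \<Lambda>"
  shows "letter M \<Lambda> (init_config M x) (i + 1) = iletter M (wsyms x L ! i)"
proof -
  have k: "1 \<le> num_tapes M" using tm by (simp add: turing_machine_def)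
  have l: "letter M \<Lambda> (init_config M x) (i + 1) = (if i = 0 then 0 else if i + 1 = \<Lambda> then 2 else 1, start_state M,
     (string_contents x i, num_symbols M) # replicate (num_tapes M - 1) (string_contents [] i, num_symbols M))"
    by (simp add: letter_def init_config_def)
  consider "i = 0" | "1 \<le> i" "i \<le> length x" | "length x < i" "i < length x + L + 1" | "i = length x + L + 1"
    using i \<Lambda> by linarith
  then show ?thesis
  proof cases
    case 1
    have "replicate (num_tapes M) z = z # replicate (num_tapes M - 1) z" for z :: "nat \<times> nat"
      using k by (cases "num_tapes M") auto
    then show ?thesis using 1 unfolding l by (simp add: iletter_def wsyms_def string_contents_def)
  next
    case 2
    then have "wsyms x L ! i = bit (x ! (i - 1))" by (auto simp: wsyms_def nth_Cons' nth_append)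
    then show ?thesis using 2 \<Lambda> unfolding l by (simp add: iletter_def bit_def string_contents_def)
  next
    case 3
    then have "wsyms x L ! i = 4" by (auto simp: wsyms_def nth_Cons' nth_append)
    then show ?thesis using 3 \<Lambda> unfolding l by (simp add: iletter_def string_contents_def)
  next
    case 4
    then have "wsyms x L ! i = 5" by (auto simp: wsyms_def nth_Cons' nth_append)
    then show ?thesis using 4 \<Lambda> unfolding l by (simp add: iletter_def string_contents_def)
  qed
qed

section \<open>The formula of a run\<close>

definition bits :: "nat \<Rightarrow> (nat \<times> nat) set \<Rightarrow> nat \<Rightarrow> bool list" where
  "bits l u i = map (\<lambda>b. (i, b) \<in> u) [0..<l]"

lemma length_bits [simp]: "length (bits l u i) = l"
  by (simp add: bits_def)

definition initf :: "machine \<Rightarrow> nat \<Rightarrow> (letter \<Rightarrow> bool list) \<Rightarrow> nat \<Rightarrow> nat \<Rightarrow> fm" where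
  "initf M l code a i = truth_table 0 (map (\<lambda>b. uvar (i + 1, b)) [0..<l]) (\<lambda>bs. bs = code (iletter M a))"

definition accf :: "machine \<Rightarrow> nat \<Rightarrow> (bool list \<Rightarrow> letter) \<Rightarrow> fm" where
  "accf M l dec = truth_table 0 (map (\<lambda>b. vvar (1, b)) [0..<l]) (\<lambda>bs. fst (snd (dec bs)) = accept_state M)"

text \<open>The truth table is exponential in \<open>5 * l\<close>, but \<open>l\<close> depends on
  the machine only, so its number of atoms and connectives is constant. It computes letter
  \<open>i + 1\<close> from the first letter and the letters \<open>i\<close> to
  \<open>i + 2\<close>.\<close>

definition stepf :: "machine \<Rightarrow> nat \<Rightarrow> (letter \<Rightarrow> bool list) \<Rightarrow> (bool list \<Rightarrow> letter) \<Rightarrow> nat \<Rightarrow> fm" where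
  "stepf M l code dec i = truth_table 0
     (map (\<lambda>b. uvar (1, b)) [0..<l] @ map (\<lambda>b. uvar (i, b)) [0..<l] @ map (\<lambda>b. uvar (i + 1, b)) [0..<l]
        @ map (\<lambda>b. uvar (i + 2, b)) [0..<l] @ map (\<lambda>b. vvar (i + 1, b)) [0..<l])
     (\<lambda>bs. drop (l + l + l + l) bs = code (next_letter M (dec (take l bs)) (dec (take l (drop l bs)))
        (dec (take l (drop (l + l) bs))) (dec (take l (drop (l + l + l) bs)))))"

text \<open>The overlapping copies make the positions 0 to \<Lambda> + 1 covered although the
  template is printed for only \<Lambda> positions. The repeated \<open>copy_bit (i, 0)\<close>
  closes the conjunction, for which \<open>big_and\<close> requires a last member.\<close>

definition locf :: "nat \<Rightarrow> nat \<Rightarrow> fm" where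
  "locf l i = big_and (map (\<lambda>b. copy_bit (i, b)) [0..<l])
     (big_and (map (\<lambda>b. copy_bit (i + 1, b)) [0..<l])
       (big_and (map (\<lambda>b. copy_bit (i + 2, b)) [0..<l]) (copy_bit (i, 0))))"

definition truef :: fm where "truef = FOr (Atom 0) (NAtom 0)"

definition reduction_formula ::
  "machine \<Rightarrow> nat \<Rightarrow> (letter \<Rightarrow> bool list) \<Rightarrow> (bool list \<Rightarrow> letter) \<Rightarrow> nat list \<Rightarrow> fm" where
  "reduction_formula M l code dec ws =
     big_and (map (\<lambda>i. initf M l code (ws ! i) i) [0..<length ws])
       (FAnd (accf M l dec)
         (tree (map (locf l) [0..<length ws]) (big_and (map (stepf M l code dec) [0..<length ws]) truef)
            (l * length ws)))"

locale simulation =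
  fixes M :: machine and \<Lambda> l :: nat and code :: "letter \<Rightarrow> bool list" and x :: "bool list"
  assumes tm: "turing_machine M" and fits: "\<And>t. fits M \<Lambda> (run M x t)" and \<Lambda>: "2 \<le> \<Lambda>"
    and code: "inj_on code (letters M)" "\<And>a. a \<in> letters M \<Longrightarrow> length (code a) = l" and l: "0 < l"
begin

definition dec :: "bool list \<Rightarrow> letter" where "dec = inv_into (letters M) code"

lemma dec_code: "a \<in> letters M \<Longrightarrow> dec (code a) = a"
  unfolding dec_def by (rule inv_into_f_f[OF code(1)])

definition idx :: "(nat \<times> nat) set" where "idx = {..\<Lambda> + 1} \<times> {..<l}"

definition wstep :: "((nat \<times> nat) set \<times> (nat \<times> nat) set) set" where
  "wstep = {(u, v). u \<subseteq> idx \<and> v \<subseteq> idx \<and> (\<forall>i < \<Lambda>. bits l v (i + 1) =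
     code (next_letter M (dec (bits l u 1)) (dec (bits l u i)) (dec (bits l u (i + 1))) (dec (bits l u (i + 2)))))}"

definition represents :: "(nat \<times> nat) set \<Rightarrow> config \<Rightarrow> bool" where
  "represents u C \<longleftrightarrow> (\<forall>i. 1 \<le> i \<and> i \<le> \<Lambda> \<longrightarrow> bits l u i = code (letter M \<Lambda> C i))"

lemma next_letter_cong:
  assumes "i < \<Lambda>" "0 < i \<Longrightarrow> a = letter M \<Lambda> C i" "i + 2 \<le> \<Lambda> \<Longrightarrow> c = letter M \<Lambda> C (i + 2)"
  shows "next_letter M a0 a (letter M \<Lambda> C (i + 1)) c
       = next_letter M a0 (letter M \<Lambda> C i) (letter M \<Lambda> C (i + 1)) (letter M \<Lambda> C (i + 2))"
proof -
  have 1: "fst (letter M \<Lambda> C (i + 1)) = 0" if "i = 0" using that by (simp add: letter_def)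
  have 2: "fst (letter M \<Lambda> C (i + 1)) = 2" if "\<not> i + 2 \<le> \<Lambda>"
    using that assms(1) \<Lambda> by (auto simp: letter_def)
  have "next_letter M a0 a (letter M \<Lambda> C (i + 1)) c = next_letter M a0 (letter M \<Lambda> C i) (letter M \<Lambda> C (i + 1)) c"
    using assms(2) next_letter_first[OF 1] by (cases "i = 0") auto
  also have "\<dots> = next_letter M a0 (letter M \<Lambda> C i) (letter M \<Lambda> C (i + 1)) (letter M \<Lambda> C (i + 2))"
    using assms(3) next_letter_last[OF 2] by (cases "i + 2 \<le> \<Lambda>") auto
  finally show ?thesis .
qed

lemma represents_next:
  assumes u: "represents u (run M x t)" and i: "i < \<Lambda>"
  shows "next_letter M (dec (bits l u 1)) (dec (bits l u i)) (dec (bits l u (i + 1))) (dec (bits l u (i + 2)))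
       = letter M \<Lambda> (run M x (Suc t)) (i + 1)"
proof -
  let ?L = "letter M \<Lambda> (run M x t)"
  have d: "dec (bits l u j) = ?L j" if "1 \<le> j" "j \<le> \<Lambda>" for j
    using u that dec_code[OF letter_in_letters[OF fits]] unfolding represents_def by simp
  have "letter M \<Lambda> (run M x (Suc t)) (i + 1) = next_letter M (?L 1) (?L i) (?L (i + 1)) (?L (i + 2))"
    unfolding run_Suc using letter_step[OF tm fits[of t] fits[of "Suc t", unfolded run_Suc], of "i + 1"] i \<Lambda> by simp
  moreover have "next_letter M (?L 1) (dec (bits l u i)) (?L (i + 1)) (dec (bits l u (i + 2)))
      = next_letter M (?L 1) (?L i) (?L (i + 1)) (?L (i + 2))"
    by (rule next_letter_cong[OF i]) (use d i in auto)
  ultimately show ?thesis using d[of 1] d[of "i + 1"] i \<Lambda> by simp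
qed

lemma represents_wstep:
  assumes "represents u (run M x t)" "(u, v) \<in> wstep"
  shows "represents v (run M x (Suc t))"
  unfolding represents_def
proof (intro allI impI)
  fix i assume i: "1 \<le> i \<and> i \<le> \<Lambda>"
  define j where "j = i - 1"
  have j: "i = j + 1" "j < \<Lambda>" using i unfolding j_def by arith+
  have "bits l v (j + 1) = code (next_letter M (dec (bits l u 1)) (dec (bits l u j)) (dec (bits l u (j + 1))) (dec (bits l u (j + 2))))"
    using assms(2) j(2) unfolding wstep_def by blast
  then show "bits l v i = code (letter M \<Lambda> (run M x (Suc t)) i)"
    unfolding represents_next[OF assms(1) j(2)] j(1) .
qed

lemma represents_relpow:
  "represents u (run M x 0) \<Longrightarrow> (u, v) \<in> wstep ^^ t \<Longrightarrow> represents v (run M x t)"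
proof (induction t arbitrary: v)
  case (Suc t)
  then obtain z where "(u, z) \<in> wstep ^^ t" "(z, v) \<in> wstep" by auto
  then show ?case using represents_wstep Suc by blast
qed simp

definition word :: "config \<Rightarrow> (nat \<times> nat) set" where
  "word C = {(i, b). 1 \<le> i \<and> i \<le> \<Lambda> \<and> b < l \<and> code (letter M \<Lambda> C i) ! b}"

lemma word_idx: "word C \<subseteq> idx"
  by (auto simp: word_def idx_def)

lemma represents_word: "represents (word (run M x t)) (run M x t)"
  unfolding represents_def
proof (intro allI impI)
  fix i assume i: "1 \<le> i \<and> i \<le> \<Lambda>"
  have len: "length (code (letter M \<Lambda> (run M x t) i)) = l" by (rule code(2)[OF letter_in_letters[OF fits]])
  show "bits l (word (run M x t)) i = code (letter M \<Lambda> (run M x t) i)"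
    by (rule nth_equalityI) (use len i in \<open>simp_all add: bits_def word_def\<close>)
qed

lemma word_wstep: "(word (run M x t), word (run M x (Suc t))) \<in> wstep"
proof -
  have "bits l (word (run M x (Suc t))) (i + 1) = code (letter M \<Lambda> (run M x (Suc t)) (i + 1))" if "i < \<Lambda>" for i
    using represents_word[of "Suc t"] that unfolding represents_def by simp
  then show ?thesis unfolding wstep_def using word_idx represents_next[OF represents_word[of t]] by simp
qed

lemma word_relpow: "(word (run M x 0), word (run M x t)) \<in> wstep ^^ t"
proof (induction t)
  case (Suc t)
  then show ?case using word_wstep[of t] by auto
qed simp

text \<open>Letters are compared instead of configurations: the word of one run also represents the
  other, and \<open>next_letter\<close> applied to the same bits yields both continuations, so no
  letter has to be decoded into tapes.\<close>

lemma letters_determine: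
  assumes "\<And>i. 1 \<le> i \<Longrightarrow> i \<le> \<Lambda> \<Longrightarrow> letter M \<Lambda> (run M x t) i = letter M \<Lambda> (run M x t') i"
  shows "1 \<le> i \<Longrightarrow> i \<le> \<Lambda> \<Longrightarrow> letter M \<Lambda> (run M x (t + j)) i = letter M \<Lambda> (run M x (t' + j)) i"
proof (induction j arbitrary: i)
  case 0
  then show ?case using assms by simp
next
  case (Suc j)
  define i' where "i' = i - 1"
  have i': "i = i' + 1" "i' < \<Lambda>" using Suc.prems unfolding i'_def by arith+
  have w: "represents (word (run M x (t + j))) (run M x (t' + j))"
    using represents_word[of "t + j"] Suc.IH unfolding represents_def by simp
  show ?case
    using represents_next[OF represents_word[of "t + j"] i'(2)] represents_next[OF w i'(2)] i'(1) by simp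
qed

text \<open>Pigeonhole on words: if the first acceptance came later, two times up to
  \<open>2 ^ (l * \<Lambda>)\<close> would show the same letters, and cutting out the part between
  them would give an earlier acceptance. Since halting is permanent, the run is still accepting at
  the exact time \<open>2 ^ (l * \<Lambda>)\<close>.\<close>

lemma accept_within:
  assumes "fst (run M x t) = accept_state M"
  shows "fst (run M x (2 ^ (l * \<Lambda>))) = accept_state M"
proof -
  define t0 where "t0 = (LEAST t. fst (run M x t) = accept_state M)"
  have t0: "fst (run M x t0) = accept_state M" unfolding t0_def using assms by (rule LeastI)
  have min: "fst (run M x t) \<noteq> accept_state M" if "t < t0" for t
    using that not_less_Least unfolding t0_def by blast
  have "t0 \<le> 2 ^ (l * \<Lambda>)"
  proof (rule ccontr)
    assume big: "\<not> t0 \<le> 2 ^ (l * \<Lambda>)"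
    define f where "f t = map (\<lambda>i. code (letter M \<Lambda> (run M x t) i)) [1..<\<Lambda> + 1]" for t
    define B where "B = {xs. set xs \<subseteq> {bs :: bool list. length bs = l} \<and> length xs = \<Lambda>}"
    have fb: "finite {bs :: bool list. length bs = l}" and cb: "card {bs :: bool list. length bs = l} = 2 ^ l"
      using finite_lists_length_eq[of "UNIV :: bool set" l] card_lists_length_eq[of "UNIV :: bool set" l] by simp_all
    have "finite B" unfolding B_def by (rule finite_lists_length_eq[OF fb])
    moreover have "card B = 2 ^ (l * \<Lambda>)"
      unfolding B_def using card_lists_length_eq[OF fb, of \<Lambda>] cb by (simp add: power_mult)
    moreover have "f ` {..2 ^ (l * \<Lambda>)} \<subseteq> B"
      using code(2)[OF letter_in_letters[OF fits]] unfolding f_def B_def by auto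
    ultimately have "\<not> inj_on f {..2 ^ (l * \<Lambda>)}"
      using card_inj_on_le[of f "{..2 ^ (l * \<Lambda>)}" B] by fastforce
    then obtain a b where ab: "a < b" "b \<le> 2 ^ (l * \<Lambda>)" "f a = f b"
      unfolding inj_on_def by (metis atMost_iff nat_neq_iff)
    have same: "letter M \<Lambda> (run M x a) i = letter M \<Lambda> (run M x b) i" if "1 \<le> i" "i \<le> \<Lambda>" for i
    proof -
      have "i \<in> set [1..<\<Lambda> + 1]" using that unfolding set_upt by simp
      then have "code (letter M \<Lambda> (run M x a) i) = code (letter M \<Lambda> (run M x b) i)"
        using ab(3) unfolding f_def map_eq_conv by blast
      then show ?thesis using inj_onD[OF code(1)] letter_in_letters[OF fits] by blast
    qed
    define j where "j = t0 - b"
    have j: "b + j = t0" "a + j < t0" using ab big unfolding j_def by simp_all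
    have "letter M \<Lambda> (run M x (a + j)) 1 = letter M \<Lambda> (run M x (b + j)) 1"
      by (rule letters_determine[OF same]) (use \<Lambda> in simp_all)
    then have "fst (run M x (a + j)) = fst (run M x t0)" unfolding j(1) by (simp add: letter_def)
    then show False using min[OF j(2)] t0 by simp
  qed
  then have "run M x (2 ^ (l * \<Lambda>)) = run M x t0" by (intro halted_run) (simp_all add: t0)
  then show ?thesis using t0 by simp
qed

lemma word_of_idx: "word_of idx f \<pi> w \<subseteq> idx"
  by (auto simp: word_of_def)

lemma map_word_of:
  "i \<le> \<Lambda> + 1 \<Longrightarrow> map (\<lambda>b. \<pi> (f (i, b)) w) [0..<l] = bits l (word_of idx f \<pi> w) i"
  unfolding bits_def by (rule map_cong[OF refl]) (simp add: word_of_def idx_def)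

lemma holds_initf:
  "i < \<Lambda> \<Longrightarrow> holds R \<pi> w (initf M l code a i) \<longleftrightarrow> bits l (word_of idx uvar \<pi> w) (i + 1) = code (iletter M a)"
  using map_word_of[of "i + 1" \<pi> uvar w] unfolding initf_def holds_truth_table by (simp add: comp_def)

lemma holds_accf:
  "holds R \<pi> w (accf M l dec) \<longleftrightarrow> fst (snd (dec (bits l (word_of idx vvar \<pi> w) 1))) = accept_state M"
  using map_word_of[of 1 \<pi> vvar w] \<Lambda> unfolding accf_def holds_truth_table by (simp add: comp_def)

lemma holds_stepf:
  assumes "i < \<Lambda>"
  shows "holds R \<pi> w (stepf M l code dec i) \<longleftrightarrow> bits l (word_of idx vvar \<pi> w) (i + 1) =
     code (next_letter M (dec (bits l (word_of idx uvar \<pi> w) 1)) (dec (bits l (word_of idx uvar \<pi> w) i))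
       (dec (bits l (word_of idx uvar \<pi> w) (i + 1))) (dec (bits l (word_of idx uvar \<pi> w) (i + 2))))"
proof -
  have m: "map (\<lambda>a. \<pi> a w) (map (\<lambda>b. f (j, b)) [0..<l]) = bits l (word_of idx f \<pi> w) j" if "j \<le> \<Lambda> + 1" for f j
    using map_word_of[OF that, of \<pi> f w] by (simp add: comp_def)
  have b: "1 \<le> \<Lambda> + 1" "i \<le> \<Lambda> + 1" "i + 1 \<le> \<Lambda> + 1" "i + 2 \<le> \<Lambda> + 1" using assms \<Lambda> by simp_all
  show ?thesis
    unfolding stepf_def holds_truth_table map_append m[OF b(1)] m[OF b(2)] m[OF b(3)] m[OF b(4)] by simp
qed

lemma holds_locf:
  "(\<forall>\<psi> \<in> set (map (locf l) [0..<\<Lambda>]). holds R \<pi> w \<psi>) \<longleftrightarrow> (\<forall>x \<in> idx. holds R \<pi> w (copy_bit x))"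
proof -
  have "holds R \<pi> w (locf l i) \<longleftrightarrow> (\<forall>b < l. holds R \<pi> w (copy_bit (i, b)) \<and> holds R \<pi> w (copy_bit (i + 1, b))
      \<and> holds R \<pi> w (copy_bit (i + 2, b)))" for i
    unfolding locf_def holds_big_and using l by auto
  then have "(\<forall>\<psi> \<in> set (map (locf l) [0..<\<Lambda>]). holds R \<pi> w \<psi>) \<longleftrightarrow> (\<forall>i < \<Lambda>. \<forall>b < l. holds R \<pi> w (copy_bit (i, b))
      \<and> holds R \<pi> w (copy_bit (i + 1, b)) \<and> holds R \<pi> w (copy_bit (i + 2, b)))"
    by auto
  also have "\<dots> \<longleftrightarrow> (\<forall>i \<le> \<Lambda> + 1. \<forall>b < l. holds R \<pi> w (copy_bit (i, b)))"
  proof safe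
    fix i b assume A: "\<forall>i < \<Lambda>. \<forall>b < l. holds R \<pi> w (copy_bit (i, b))
      \<and> holds R \<pi> w (copy_bit (i + 1, b)) \<and> holds R \<pi> w (copy_bit (i + 2, b))" and i: "i \<le> \<Lambda> + 1" and b: "b < l"
    show "holds R \<pi> w (copy_bit (i, b))"
    proof (cases "i < \<Lambda>")
      case False
      then have "i = (\<Lambda> - 1) + 1 \<or> i = (\<Lambda> - 1) + 2" "\<Lambda> - 1 < \<Lambda>" using i \<Lambda> by auto
      then show ?thesis using A b by metis
    qed (use A b in blast)
  qed auto
  also have "\<dots> \<longleftrightarrow> (\<forall>x \<in> idx. holds R \<pi> w (copy_bit x))" unfolding idx_def by auto
  finally show ?thesis .
qed

lemma holds_leaf:
  "holds R \<pi> w (big_and (map (stepf M l code dec) [0..<\<Lambda>]) truef)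
     \<longleftrightarrow> (word_of idx uvar \<pi> w, word_of idx vvar \<pi> w) \<in> wstep"
proof -
  have "holds R \<pi> w (big_and (map (stepf M l code dec) [0..<\<Lambda>]) truef)
      \<longleftrightarrow> (\<forall>i < \<Lambda>. holds R \<pi> w (stepf M l code dec i))" by (auto simp: truef_def)
  moreover have "word_of idx uvar \<pi> w \<subseteq> idx" "word_of idx vvar \<pi> w \<subseteq> idx" by (rule word_of_idx)+
  ultimately show ?thesis by (simp add: wstep_def holds_stepf)
qed

text \<open>From left to right, \<open>initf\<close> fixes the word at the root, and since
  \<open>next_letter\<close> is a function every path of \<open>wstep\<close> from there follows the
  run. From right to left, the words of the run form such a path; its tree model has worlds of
  another type, which \<open>satisfiable_if_satisfiable_over\<close> brings back to numbers.\<close>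

lemma satisfiable_reduction:
  assumes x: "\<Lambda> = length x + L + 2"
  shows "satisfiable (reduction_formula M l code dec (wsyms x L))
     \<longleftrightarrow> fst (run M x (2 ^ (l * \<Lambda>))) = accept_state M"
proof
  let ?ws = "wsyms x L" and ?m = "l * \<Lambda>"
  let ?loc = "map (locf l) [0..<\<Lambda>]" and ?leaf = "big_and (map (stepf M l code dec) [0..<\<Lambda>]) truef"
  have len: "length ?ws = \<Lambda>" by (simp add: wsyms_def x)
  have init: "(\<forall>i < \<Lambda>. holds R \<pi> w (initf M l code (?ws ! i) i)) \<longleftrightarrow> represents (word_of idx uvar \<pi> w) (run M x 0)"
    for R :: "('w \<times> 'w) set" and \<pi> w
  proof -
    have "(\<forall>i < \<Lambda>. holds R \<pi> w (initf M l code (?ws ! i) i))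
      \<longleftrightarrow> (\<forall>i < \<Lambda>. bits l (word_of idx uvar \<pi> w) (i + 1) = code (letter M \<Lambda> (run M x 0) (i + 1)))"
      by (simp add: holds_initf letter_init[OF tm x, simplified] run_def)
    also have "\<dots> \<longleftrightarrow> represents (word_of idx uvar \<pi> w) (run M x 0)"
    proof
      assume A: "\<forall>i < \<Lambda>. bits l (word_of idx uvar \<pi> w) (i + 1) = code (letter M \<Lambda> (run M x 0) (i + 1))"
      show "represents (word_of idx uvar \<pi> w) (run M x 0)"
        unfolding represents_def
      proof (intro allI impI)
        fix i assume i: "1 \<le> i \<and> i \<le> \<Lambda>"
        then have "i - 1 < \<Lambda>" by arith
        then show "bits l (word_of idx uvar \<pi> w) i = code (letter M \<Lambda> (run M x 0) i)"
          using A[rule_format, of "i - 1"] i by simp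
      qed
    qed (simp add: represents_def)
    finally show ?thesis .
  qed
  have form: "holds R \<pi> w (reduction_formula M l code dec ?ws) \<longleftrightarrow>
      (\<forall>i < \<Lambda>. holds R \<pi> w (initf M l code (?ws ! i) i)) \<and>
      holds R \<pi> w (accf M l dec) \<and> holds R \<pi> w (tree ?loc ?leaf ?m)" for R :: "('w \<times> 'w) set" and \<pi> w
    unfolding reduction_formula_def len by auto
  show "fst (run M x (2 ^ ?m)) = accept_state M" if sat: "satisfiable (reduction_formula M l code dec ?ws)"
  proof -
    obtain R :: "(nat \<times> nat) set" and \<pi> w where h: "holds R \<pi> w (reduction_formula M l code dec ?ws)"
      using sat unfolding satisfiable_def satisfiable_over_def by blast
    let ?u = "word_of idx uvar \<pi> w" and ?v = "word_of idx vvar \<pi> w"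
    note h = iffD1[OF form h]
    have u: "represents ?u (run M x 0)" by (rule iffD1[OF init conjunct1[OF h]])
    have t: "holds R \<pi> w (tree ?loc ?leaf ?m)" by (rule conjunct2[OF conjunct2[OF h]])
    have "(?u, ?v) \<in> wstep ^^ (2 ^ ?m)"
    proof (rule tree_sound[OF _ _ t])
      show "\<forall>x \<in> idx. holds R \<pi> w (copy_bit x)" if "\<forall>\<psi> \<in> set ?loc. holds R \<pi> w \<psi>" for w
        using iffD1[OF holds_locf that] .
      show "(word_of idx uvar \<pi> w, word_of idx vvar \<pi> w) \<in> wstep" if "holds R \<pi> w ?leaf" for w
        using iffD1[OF holds_leaf that] .
    qed
    then have "represents ?v (run M x (2 ^ ?m))" using represents_relpow[OF u] by blast
    then have "dec (bits l ?v 1) = letter M \<Lambda> (run M x (2 ^ ?m)) 1"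
      using dec_code[OF letter_in_letters[OF fits]] \<Lambda> unfolding represents_def by simp
    moreover have "fst (snd (dec (bits l ?v 1))) = accept_state M"
      by (rule iffD1[OF holds_accf conjunct1[OF conjunct2[OF h]]])
    ultimately show ?thesis by (simp add: letter_def)
  qed
  show "satisfiable (reduction_formula M l code dec ?ws)" if acc: "fst (run M x (2 ^ ?m)) = accept_state M"
  proof -
    let ?u = "word (run M x 0)" and ?v = "word (run M x (2 ^ ?m))"
    have r: "wstep \<subseteq> Pow idx \<times> Pow idx" unfolding wstep_def by auto
    obtain R \<pi> and w :: "nat \<times> (nat \<times> nat) set \<times> (nat \<times> nat) set \<times> bool" where
      t: "holds R \<pi> w (tree ?loc ?leaf ?m)" and u: "word_of idx uvar \<pi> w = ?u" and v: "word_of idx vvar \<pi> w = ?v"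
      using tree_complete[OF r iffD2[OF holds_locf] iffD2[OF holds_leaf] word_relpow[of "2 ^ ?m"]] by blast
    have "represents ?u (run M x 0)" by (rule represents_word)
    then have i: "\<forall>i < \<Lambda>. holds R \<pi> w (initf M l code (?ws ! i) i)" by (intro iffD2[OF init]) (simp only: u)
    have "dec (bits l ?v 1) = letter M \<Lambda> (run M x (2 ^ ?m)) 1"
      using represents_word[of "2 ^ ?m"] dec_code[OF letter_in_letters[OF fits]] \<Lambda> unfolding represents_def by simp
    then have a: "holds R \<pi> w (accf M l dec)" unfolding holds_accf v using acc by (simp add: letter_def)
    have h: "holds R \<pi> w (reduction_formula M l code dec ?ws)" by (intro iffD2[OF form] conjI i a t)
    have "kripke_frame UNIV R" by (simp add: kripke_frame_def)
    then have "satisfiable_over TYPE(nat \<times> (nat \<times> nat) set \<times> (nat \<times> nat) set \<times> bool) (reduction_formula M l code dec ?ws)"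
      unfolding satisfiable_over_def using h UNIV_I by blast
    then show ?thesis by (rule satisfiable_if_satisfiable_over)
  qed
qed

end

section \<open>Printing the reduction formula\<close>

subsection \<open>Translation into the available connectives\<close>

primrec translate :: "connective set \<Rightarrow> fm \<Rightarrow> fm" where
  "translate S (Atom n) = Atom n"
| "translate S (NAtom n) = (if ONeg \<in> S then FNeg (Atom n) else NAtom n)"
| "translate S (FNeg \<phi>) = FNeg (translate S \<phi>)"
| "translate S (FAnd \<phi> \<psi>) = (if OAnd \<in> S then FAnd (translate S \<phi>) (translate S \<psi>)
     else FNeg (FOr (FNeg (translate S \<phi>)) (FNeg (translate S \<psi>))))"
| "translate S (FOr \<phi> \<psi>) = (if OOr \<in> S then FOr (translate S \<phi>) (translate S \<psi>)
     else FNeg (FAnd (FNeg (translate S \<phi>)) (FNeg (translate S \<psi>))))"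
| "translate S (FBox \<phi>) = (if OBox \<in> S then FBox (translate S \<phi>) else FNeg (FDia (FNeg (translate S \<phi>))))"
| "translate S (FDia \<phi>) = (if ODia \<in> S then FDia (translate S \<phi>) else FNeg (FBox (FNeg (translate S \<phi>))))"
| "translate S FTrue = FTrue"
| "translate S FFalse = FFalse"

lemma holds_translate: "holds R \<pi> w (translate S \<phi>) \<longleftrightarrow> holds R \<pi> w \<phi>"
  by (induction \<phi> arbitrary: w) simp_all

lemma satisfiable_translate: "satisfiable (translate S \<phi>) \<longleftrightarrow> satisfiable \<phi>"
  by (simp add: satisfiable_def satisfiable_over_def holds_translate)

definition adequate :: "connective set \<Rightarrow> bool" where
  "adequate S \<longleftrightarrow> {ONeg, OAnd, OBox} \<subseteq> S \<or> {ONeg, OAnd, ODia} \<subseteq> S \<or>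
     {ONeg, OOr, OBox} \<subseteq> S \<or> {ONeg, OOr, ODia} \<subseteq> S \<or> {OAtNeg, OAnd, OOr, OBox, ODia} \<subseteq> S"

lemma translate_in_modal_lang:
  assumes "adequate S"
  shows "connectives \<phi> \<subseteq> {OAtNeg, OAnd, OOr, OBox, ODia} \<Longrightarrow> translate S \<phi> \<in> modal_lang S"
proof -
  have c: "ONeg \<in> S \<or> OAtNeg \<in> S" "ONeg \<in> S \<or> OAnd \<in> S \<and> OOr \<in> S \<and> OBox \<in> S \<and> ODia \<in> S"
      "OAnd \<in> S \<or> OOr \<in> S" "OBox \<in> S \<or> ODia \<in> S"
    using assms unfolding adequate_def by blast+
  show "connectives \<phi> \<subseteq> {OAtNeg, OAnd, OOr, OBox, ODia} \<Longrightarrow> translate S \<phi> \<in> modal_lang S"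
    unfolding modal_lang_def mem_Collect_eq
    by (induction \<phi>) (use c in auto)
qed

section \<open>Encodings of translated formulas as strings\<close>

definition enc :: "token list \<Rightarrow> bool list" where "enc ts = concat (map token_code ts)"

lemma enc_append [simp]: "enc (ts @ us) = enc ts @ enc us"
  by (simp add: enc_def)

lemma enc_Nil [simp]: "enc [] = []"
  by (simp add: enc_def)

lemma enc_Cons: "enc (t # us) = token_code t @ enc us"
  by (simp add: enc_def)

lemma encode_enc: "encode \<phi> = enc (tokens \<phi>)"
  by (simp add: encode_def enc_def)

text \<open>In prefix notation a simulated connective contributes only fixed strings before and
  between its operands. The strings for the two ways of expressing it are kept as parameters of all
  later concatenations.\<close>

definition preA :: "connective set \<Rightarrow> bool list" where
  "preA S = enc (if OAnd \<in> S then [TOp OAnd] else [TOp ONeg, TOp OOr, TOp ONeg])"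
definition midA :: "connective set \<Rightarrow> bool list" where
  "midA S = enc (if OAnd \<in> S then [] else [TOp ONeg])"
definition preO :: "connective set \<Rightarrow> bool list" where
  "preO S = enc (if OOr \<in> S then [TOp OOr] else [TOp ONeg, TOp OAnd, TOp ONeg])"
definition midO :: "connective set \<Rightarrow> bool list" where
  "midO S = enc (if OOr \<in> S then [] else [TOp ONeg])"
definition preB :: "connective set \<Rightarrow> bool list" where
  "preB S = enc (if OBox \<in> S then [TOp OBox] else [TOp ONeg, TOp ODia, TOp ONeg])"
definition preN :: "connective set \<Rightarrow> bool list" where
  "preN S = enc (if ONeg \<in> S then [TOp ONeg] else [TOp OAtNeg])"

definition encT :: "connective set \<Rightarrow> fm \<Rightarrow> bool list" where
  "encT S \<phi> = encode (translate S \<phi>)"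

lemma encT_And: "encT S (FAnd \<phi> \<psi>) = preA S @ encT S \<phi> @ midA S @ encT S \<psi>"
  by (simp add: encT_def preA_def midA_def encode_enc enc_Cons)

lemma encT_Or: "encT S (FOr \<phi> \<psi>) = preO S @ encT S \<phi> @ midO S @ encT S \<psi>"
  by (simp add: encT_def preO_def midO_def encode_enc enc_Cons)

lemma encT_Box: "encT S (FBox \<phi>) = preB S @ encT S \<phi>"
  by (simp add: encT_def preB_def encode_enc enc_Cons)

lemma encT_NAtom: "encT S (NAtom n) = preN S @ encT S (Atom n)"
  by (simp add: encT_def preN_def encode_enc enc_Cons)

lemma encT_big_and:
  "encT S (big_and \<phi>s \<psi>) = concat (map (\<lambda>\<phi>. preA S @ encT S \<phi> @ midA S) \<phi>s) @ encT S \<psi>"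
  by (induction \<phi>s) (simp_all add: encT_And)

text \<open>The recursive call of \<open>tree\<close> is the last operand throughout, so in prefix
  notation the nesting becomes plain repetition of one block, which a loop can print.\<close>

lemma encT_tree:
  "encT S (tree loc leaf m) = concat (replicate m (preA S @ encT S both_halves @ midA S @
     concat (map (\<lambda>\<phi>. preA S @ encT S \<phi> @ midA S) loc) @ preB S)) @ encT S leaf"
  by (induction m) (simp_all add: encT_And encT_big_and encT_Box)

subsection \<open>Templates\<close>

text \<open>\<open>None\<close> stands for \<open>i\<close> digits 1, where \<open>i\<close> is the position for which the template is printed.\<close>

definition one_digit :: "bool list" where "one_digit = [False, False, False, True]"

definition inst :: "nat \<Rightarrow> bool option list \<Rightarrow> bool list" where
  "inst i tpl = concat (map (\<lambda>u. case u of Some b \<Rightarrow> [b] | None \<Rightarrow> concat (replicate i one_digit)) tpl)"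

lemma inst_append [simp]: "inst i (t @ u) = inst i t @ inst i u"
  by (simp add: inst_def)

lemma inst_Some [simp]: "inst i (map Some bs) = bs"
  by (induction bs) (simp_all add: inst_def)

text \<open>The template may depend on the machine and on \<open>S\<close>, but not on the input or
  the position. Its mere existence suffices, since it is built into the printing program.\<close>

definition uniform :: "connective set \<Rightarrow> (nat \<Rightarrow> fm) \<Rightarrow> bool" where
  "uniform S T \<longleftrightarrow> (\<exists>tpl. \<forall>i. encT S (T i) = inst i tpl)"

lemma uniformI: "(\<And>i. encT S (T i) = inst i tpl) \<Longrightarrow> uniform S T"
  by (auto simp: uniform_def)

lemma uniform_const: "uniform S (\<lambda>_. \<phi>)"
  by (rule uniformI[of _ _ "map Some (encT S \<phi>)"]) simp

lemma uniform_And: "uniform S T \<Longrightarrow> uniform S U \<Longrightarrow> uniform S (\<lambda>i. FAnd (T i) (U i))"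
  unfolding uniform_def
proof (elim exE)
  fix t u assume "\<forall>i. encT S (T i) = inst i t" "\<forall>i. encT S (U i) = inst i u"
  then show "\<exists>tpl. \<forall>i. encT S (FAnd (T i) (U i)) = inst i tpl"
    by (intro exI[of _ "map Some (preA S) @ t @ map Some (midA S) @ u"]) (simp add: encT_And)
qed

lemma uniform_Or: "uniform S T \<Longrightarrow> uniform S U \<Longrightarrow> uniform S (\<lambda>i. FOr (T i) (U i))"
  unfolding uniform_def
proof (elim exE)
  fix t u assume "\<forall>i. encT S (T i) = inst i t" "\<forall>i. encT S (U i) = inst i u"
  then show "\<exists>tpl. \<forall>i. encT S (FOr (T i) (U i)) = inst i tpl"
    by (intro exI[of _ "map Some (preO S) @ t @ map Some (midO S) @ u"]) (simp add: encT_Or)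
qed

lemma uniform_Box: "uniform S T \<Longrightarrow> uniform S (\<lambda>i. FBox (T i))"
  unfolding uniform_def
proof (elim exE)
  fix t assume "\<forall>i. encT S (T i) = inst i t"
  then show "\<exists>tpl. \<forall>i. encT S (FBox (T i)) = inst i tpl"
    by (intro exI[of _ "map Some (preB S) @ t"]) (simp add: encT_Box)
qed

lemma uniform_NAtom: "uniform S (\<lambda>i. Atom (f i)) \<Longrightarrow> uniform S (\<lambda>i. NAtom (f i))"
  unfolding uniform_def
proof (elim exE)
  fix t assume "\<forall>i. encT S (Atom (f i)) = inst i t"
  then show "\<exists>tpl. \<forall>i. encT S (NAtom (f i)) = inst i tpl"
    by (intro exI[of _ "map Some (preN S) @ t"]) (simp add: encT_NAtom)
qed

text \<open>The run of leading ones in the name has length \<open>i + c + 1\<close>. Its first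
  \<open>i\<close> digits are split off as the variable part, and everything after them is the same
  for all positions.\<close>

lemma uniform_var: "uniform S (\<lambda>i. Atom (var (i + c) j))"
proof (rule uniformI)
  fix i
  have "map TDigit (bin (var (i + c) j)) = replicate i (TDigit True) @ map TDigit (replicate (c + 1) True @ False # replicate j True)"
    unfolding bin_var add.assoc[of i c 1] replicate_add by simp
  moreover have "enc (replicate i (TDigit True)) = concat (replicate i one_digit)"
    by (induction i) (simp_all add: enc_def one_digit_def)
  moreover have "inst i [None] = concat (replicate i one_digit)" by (simp add: inst_def)
  ultimately show "encT S (Atom (var (i + c) j)) = inst i (map Some (token_code TVar) @ [None] @
       map Some (enc (map TDigit (replicate (c + 1) True @ False # replicate j True))))"
    unfolding inst_append inst_Some encT_def translate.simps encode_enc tokens.simps var_tokens_def enc_Cons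
    by (simp only: enc_append)
qed

lemma uniform_vars:
  "uniform S (\<lambda>i. Atom (uvar (i + c, b)))" "uniform S (\<lambda>i. Atom (vvar (i + c, b)))" "uniform S (\<lambda>i. Atom (mvar (i + c, b)))"
  unfolding uvar_def vvar_def mvar_def fst_conv snd_conv by (rule uniform_var)+

lemma uniform_vars0:
  "uniform S (\<lambda>i. Atom (uvar (i, b)))" "uniform S (\<lambda>i. Atom (vvar (i, b)))" "uniform S (\<lambda>i. Atom (mvar (i, b)))"
  using uniform_vars[where c=0] by simp_all

lemma uniform_truth_table:
  "(\<And>f. f \<in> set fs \<Longrightarrow> uniform S (\<lambda>i. Atom (f i))) \<Longrightarrow> uniform S (\<lambda>i. truth_table t (map (\<lambda>f. f i) fs) G)"
proof (induction fs arbitrary: G)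
  case Nil
  show ?case by (simp add: uniform_const)
next
  case (Cons f fs)
  then show ?case
    unfolding list.map truth_table.simps
    by (intro uniform_Or uniform_And uniform_NAtom Cons.IH) simp_all
qed

lemma uniform_big_and:
  "(\<And>f. f \<in> set fs \<Longrightarrow> uniform S f) \<Longrightarrow> uniform S g \<Longrightarrow> uniform S (\<lambda>i. big_and (map (\<lambda>f. f i) fs) (g i))"
  by (induction fs) (simp_all add: uniform_And)

lemma uniform_initf: "uniform S (initf M l code a)"
proof -
  have "uniform S (\<lambda>i. truth_table 0 (map (\<lambda>f. f i) (map (\<lambda>b i. uvar (i + 1, b)) [0..<l])) (\<lambda>bs. bs = code (iletter M a)))"
    by (rule uniform_truth_table) (auto intro: uniform_vars(1)[where c=1, simplified])
  then show ?thesis unfolding initf_def[abs_def] by (simp add: comp_def)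
qed

lemma uniform_stepf: "uniform S (stepf M l code dec)"
proof -
  let ?fs = "map (\<lambda>b i. uvar (1, b)) [0..<l] @ map (\<lambda>b i. uvar (i, b)) [0..<l] @ map (\<lambda>b i. uvar (i + 1, b)) [0..<l]
        @ map (\<lambda>b i. uvar (i + 2, b)) [0..<l] @ map (\<lambda>b i. vvar (i + 1, b)) [0..<l]"
  have "uniform S (\<lambda>i. truth_table 0 (map (\<lambda>f. f i) ?fs) G)" for G
  proof (rule uniform_truth_table)
    fix f assume "f \<in> set ?fs"
    then have "(\<exists>b. f = (\<lambda>i. uvar (1, b))) \<or> (\<exists>b. f = (\<lambda>i. uvar (i, b))) \<or> (\<exists>b. f = (\<lambda>i. uvar (i + 1, b)))
        \<or> (\<exists>b. f = (\<lambda>i. uvar (i + 2, b))) \<or> (\<exists>b. f = (\<lambda>i. vvar (i + 1, b)))"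
      unfolding set_append set_map by blast
    then show "uniform S (\<lambda>i. Atom (f i))"
      by (elim disjE exE; hypsubst; intro uniform_vars uniform_vars0 uniform_const)
  qed
  then show ?thesis unfolding stepf_def[abs_def] by (simp add: comp_def)
qed

lemma uniform_copy_bit: "uniform S (\<lambda>i. copy_bit (i + c, b))"
  unfolding copy_bit_def carry_def
  by (intro uniform_And uniform_Or uniform_Box uniform_NAtom uniform_vars uniform_const)

lemma uniform_locf: "uniform S (locf l)"
proof -
  have u: "uniform S (\<lambda>i. big_and (map (\<lambda>b. copy_bit (i + c, b)) [0..<l]) (g i))" if "uniform S g" for c g
    using uniform_big_and[of "map (\<lambda>b i. copy_bit (i + c, b)) [0..<l]" S g] uniform_copy_bit[of S c] that
    by (auto simp: comp_def)
  have "uniform S (\<lambda>i. big_and (map (\<lambda>b. copy_bit (i + 0, b)) [0..<l])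
     (big_and (map (\<lambda>b. copy_bit (i + 1, b)) [0..<l])
       (big_and (map (\<lambda>b. copy_bit (i + 2, b)) [0..<l]) (copy_bit (i + 0, 0)))))"
    by (intro u uniform_copy_bit)
  then show ?thesis unfolding locf_def[abs_def] by simp
qed

subsection \<open>Cost of programs in stages\<close>

text \<open>A loop bound must not change inside the loop, but it may be computed by an earlier stage.\<close>

definition tame :: "nat \<Rightarrow> nat \<Rightarrow> prog \<Rightarrow> bool" where
  "tame k K p \<longleftrightarrow> wf_prog k K p \<and>
     (\<exists>q :: nat poly. \<forall>s. valid_store K s \<longrightarrow> cost p s + total k {} (sem p s) \<le> poly q (total k {} s))"

lemma length_le_total: "r < k \<Longrightarrow> length (s r) \<le> total k {} s"
  unfolding total_def by (rule member_le_sum) auto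

text \<open>\<open>cost_bound\<close> is applied with the loop registers as \<open>F\<close>: they
  keep their contents, and their lengths are at most the total length.\<close>

lemma tame_simple:
  assumes K: "2 \<le> K" and wf: "wf_prog k K p" and f: "fors p \<subseteq> {..<k}" "writes p \<inter> fors p = {}"
  shows "tame k K p"
proof -
  obtain q where q: "\<And>n. bound K p n + n \<le> poly q n"
    using poly_bounded_add[OF poly_bounded_bound poly_bounded_id] unfolding poly_bounded_def by blast
  have "cost p s + total k {} (sem p s) \<le> poly q (total k {} s)" if v: "valid_store K s" for s
  proof -
    let ?F = "fors p"
    have split: "total k {} t = total k ?F t + (\<Sum>r \<in> ?F. length (t r))" for t
      unfolding total_def using sum.subset_diff[OF f(1), of "\<lambda>r. length (t r)"] by simp
    have "(\<Sum>r \<in> ?F. length (sem p s r)) = (\<Sum>r \<in> ?F. length (s r))"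
      using f(2) by (intro sum.cong refl arg_cong[where f=length] sem_unchanged) blast
    moreover have "cost p s + total k ?F (sem p s) \<le> bound K p (total k {} s) + total k ?F s"
      by (rule cost_bound[OF K wf v]) (use f length_le_total in auto)
    ultimately have "cost p s + total k {} (sem p s) \<le> bound K p (total k {} s) + total k {} s"
      using split[of s] split[of "sem p s"] by linarith
    then show ?thesis using q le_trans by blast
  qed
  then show ?thesis using wf unfolding tame_def by blast
qed

lemma tame_Seq:
  assumes "2 \<le> K" "tame k K p" "tame k K q"
  shows "tame k K (p ;; q)"
proof -
  obtain f g :: "nat poly" where f: "\<And>s. valid_store K s \<Longrightarrow> cost p s + total k {} (sem p s) \<le> poly f (total k {} s)"
    and g: "\<And>s. valid_store K s \<Longrightarrow> cost q s + total k {} (sem q s) \<le> poly g (total k {} s)"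
    and wf: "wf_prog k K p" "wf_prog k K q"
    using assms(2,3) unfolding tame_def by blast
  have "cost (p ;; q) s + total k {} (sem (p ;; q) s) \<le> poly (f + g \<circ>\<^sub>p f + 1) (total k {} s)"
    if v: "valid_store K s" for s
  proof -
    have "total k {} (sem p s) \<le> poly f (total k {} s)" using f[OF v] by simp
    then have "poly g (total k {} (sem p s)) \<le> poly (g \<circ>\<^sub>p f) (total k {} s)"
      unfolding poly_pcompose by (rule poly_nat_mono)
    then show ?thesis using f[OF v] g[OF valid_sem[OF assms(1) wf(1) v]] by simp
  qed
  then show ?thesis unfolding tame_def wf_prog.simps using wf by blast
qed

lemma total_init_store: "0 < k \<Longrightarrow> total k {} (init_store x) = length x"
  using total_upd[of 0 k "{}" "\<lambda>_. []" "rev (map bit x)"] by (simp add: init_store_def total_def)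

lemma tame_cost:
  assumes "tame k K p" "4 \<le> K" "0 < k"
  shows "\<exists>q :: nat poly. \<forall>x. cost p (init_store x) + total k {} (sem p (init_store x)) \<le> poly q (length x)"
proof -
  obtain q :: "nat poly" where "\<And>s. valid_store K s \<Longrightarrow> cost p s + total k {} (sem p s) \<le> poly q (total k {} s)"
    using assms(1) unfolding tame_def by blast
  from this[OF valid_init_store[OF assms(2)]] show ?thesis unfolding total_init_store[OF assms(3)] by blast
qed

lemma loop_induct:
  assumes "P l s" "\<And>a l s. P (a # l) s \<Longrightarrow> P l (f (s(r := a # l)))"
  shows "P [] (loop f r l s)"
  using assms(1)
proof (induction l arbitrary: s)
  case (Cons a l)
  from Cons.IH[OF assms(2)[OF Cons.prems]] show ?case by simp
qed simp

subsection \<open>The printing program\<close>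

text \<open>
  Register 0 holds the input, 1 the current position in unary, 2 scratch space, 3 the word of
  symbols of the initial configuration, 4 and 5 unary loop bounds, \<open>6 + j\<close> the unary number
  \<open>(n + 2) ^ j\<close>, and \<open>out\<close> the output.
\<close>

fun emit :: "nat \<Rightarrow> bool list \<Rightarrow> prog" where
  "emit out [] = Skip"
| "emit out (b # bs) = Push out (bit b) ;; emit out bs"

text \<open>Register 1 grows from position to position, so \<open>tame_simple\<close> forbids a loop
  over it. The loops run over register 4 instead, which is at least as long, and idle once their
  source is empty. Register 2 holds the number meanwhile, so that it can be moved back.\<close>

definition unary :: "nat \<Rightarrow> prog" where
  "unary out =
     For 4 (Case 1 (\<lambda>v. if v = 1 then Skip else Pop 1 ;; Push 2 2 ;; emit out one_digit)) ;;
     For 4 (Case 2 (\<lambda>v. if v = 1 then Skip else Pop 2 ;; Push 1 2))"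

fun prt :: "nat \<Rightarrow> bool option list \<Rightarrow> prog" where
  "prt out [] = Skip"
| "prt out (Some b # t) = Push out (bit b) ;; prt out t"
| "prt out (None # t) = unary out ;; prt out t"

definition at_positions :: "nat \<Rightarrow> (nat \<Rightarrow> bool option list) \<Rightarrow> prog" where
  "at_positions out tp = For 3 (Case 3 (\<lambda>a. prt out (tp a)) ;; Push 1 2) ;; Clr 1"

definition print_prog :: "nat \<Rightarrow> (nat \<Rightarrow> bool option list) \<Rightarrow> bool list \<Rightarrow> bool list \<Rightarrow> bool option list \<Rightarrow>
    bool list \<Rightarrow> bool option list \<Rightarrow> bool list \<Rightarrow> prog" where
  "print_prog out tI eA a tL b tS eT = at_positions out tI ;; emit out eA ;;
     For 5 (emit out a ;; at_positions out (\<lambda>_. tL) ;; emit out b) ;;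
     at_positions out (\<lambda>_. tS) ;; emit out eT"

primrec powers :: "nat \<Rightarrow> prog" where
  "powers 0 = Push 6 2"
| "powers (Suc j) = powers j ;; For (6 + j) (For 0 (Push (7 + j) 2) ;; Push (7 + j) 2 ;; Push (7 + j) 2)"

text \<open>The word is pushed from its end, because a loop visits a stack from the top: the first
  position has to come up first. A loop over register 0 likewise delivers the last input bit
  first.\<close>

definition fill :: "nat \<Rightarrow> prog" where
  "fill e = Push 3 5 ;; For (6 + e) (Push 3 4) ;; For 0 (Case 0 (\<lambda>b. if b = 3 then Push 3 3 else Push 3 2)) ;; Push 3 6"

primrec pushes :: "nat \<Rightarrow> prog" where
  "pushes 0 = Skip"
| "pushes (Suc l) = Push 5 2 ;; pushes l"

definition bounds :: "nat \<Rightarrow> prog" where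
  "bounds l = For 3 (Push 4 2 ;; pushes l)"

section \<open>Effect of the printing program\<close>

lemma sem_emit: "sem (emit out bs) s = s(out := rev (map bit bs) @ s out)"
  by (induction bs arbitrary: s) (simp_all del: fun_upd_apply add: fun_upd_same)

text \<open>The loops may make more passes than there are elements to move, so the invariants state
  that \<open>min i d\<close> elements have been moved after \<open>d\<close> passes.\<close>

lemma sem_unary:
  assumes o: "5 < out" and s: "s 1 = replicate i 2" "s 2 = []" "i \<le> length (s 4)"
  shows "sem (unary out) s = s(out := rev (map bit (concat (replicate i one_digit))) @ s out)"
proof -
  define n where "n = length (s 4)"
  define p1 where "p1 = Case 1 (\<lambda>v. if v = 1 then Skip else Pop 1 ;; Push 2 2 ;; emit out one_digit)"
  define p2 where "p2 = Case 2 (\<lambda>v. if v = 1 then Skip else Pop 2 ;; Push 1 2)"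
  define P1 where "P1 l t \<longleftrightarrow> length l \<le> n \<and> t 1 = replicate (i - (n - length l)) 2 \<and> t 2 = replicate (min i (n - length l)) 2 \<and>
      t out = rev (map bit (concat (replicate (min i (n - length l)) one_digit))) @ s out" for l :: "nat list" and t
  define s1 where "s1 = sem (For 4 p1) s"
  have "P1 [] (loop (sem p1) 4 (s 4) s)"
  proof (rule loop_induct)
    show "P1 (s 4) s" using s by (simp add: P1_def n_def)
    fix a l t assume P: "P1 (a # l) t"
    define d where "d = n - length (a # l)"
    have d: "n - length l = Suc d" "length l \<le> n" using P by (auto simp: P1_def d_def)
    have t: "t 1 = replicate (i - d) 2" "t 2 = replicate (min i d) 2"
      "t out = rev (map bit (concat (replicate (min i d) one_digit))) @ s out"
      using P unfolding P1_def d_def[symmetric] by blast+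
    show "P1 l (sem p1 (t(4 := a # l)))"
    proof (cases "i - d")
      case 0
      have "sem p1 (t(4 := a # l)) = t(4 := a # l)" using t(1) 0 by (simp add: p1_def peek_def)
      moreover have "min i d = i" "min i (Suc d) = i" "i - Suc d = 0" using 0 by auto
      ultimately show ?thesis using t 0 d o by (simp add: P1_def)
    next
      case (Suc j)
      have m: "min i d = d" "min i (Suc d) = Suc d" "i - Suc d = j" using Suc by auto
      have "peek (t(4 := a # l)) 1 = 2" using t(1) Suc by (simp add: peek_def)
      then have "sem p1 (t(4 := a # l)) = sem (Pop 1 ;; Push 2 2 ;; emit out one_digit) (t(4 := a # l))"
        by (simp add: p1_def)
      then have e: "sem p1 (t(4 := a # l)) 1 = replicate j 2" "sem p1 (t(4 := a # l)) 2 = 2 # t 2"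
          "sem p1 (t(4 := a # l)) out = rev (map bit one_digit) @ t out"
        using t(1) Suc o by (simp_all add: sem_emit)
      have "replicate (Suc d) one_digit = replicate d one_digit @ [one_digit]" by (simp add: replicate_append_same)
      then show ?thesis unfolding P1_def d m e t(2,3) using d by simp
    qed
  qed
  then have s1: "s1 1 = []" "s1 2 = replicate i 2" "s1 out = rev (map bit (concat (replicate i one_digit))) @ s out"
    using o s(3) by (simp_all add: s1_def P1_def n_def min_absorb1)
  have s14: "s1 4 = s 4" by (simp add: s1_def)
  define P2 where "P2 l t \<longleftrightarrow> length l \<le> n \<and> t 2 = replicate (i - (n - length l)) (2 :: nat) \<and> t 1 = replicate (min i (n - length l)) 2"
    for l :: "nat list" and t :: store
  have "P2 [] (loop (sem p2) 4 (s1 4) s1)"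
  proof (rule loop_induct)
    show "P2 (s1 4) s1" using s1 s14 by (simp add: P2_def n_def)
    fix a l t assume P: "P2 (a # l) t"
    define d where "d = n - length (a # l)"
    have d: "n - length l = Suc d" "length l \<le> n" using P by (auto simp: P2_def d_def)
    have t: "t 2 = replicate (i - d) 2" "t 1 = replicate (min i d) 2"
      using P unfolding P2_def d_def[symmetric] by blast+
    show "P2 l (sem p2 (t(4 := a # l)))"
    proof (cases "i - d")
      case 0
      have "sem p2 (t(4 := a # l)) = t(4 := a # l)" using t(1) 0 by (simp add: p2_def peek_def)
      moreover have "min i d = i" "min i (Suc d) = i" "i - Suc d = 0" using 0 by auto
      ultimately show ?thesis using t 0 d by (simp add: P2_def)
    next
      case (Suc j)
      have m: "min i d = d" "min i (Suc d) = Suc d" "i - Suc d = j" using Suc by auto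
      have "peek (t(4 := a # l)) 2 = 2" using t(1) Suc by (simp add: peek_def)
      then have "sem p2 (t(4 := a # l)) = sem (Pop 2 ;; Push 1 2) (t(4 := a # l))"
        by (simp add: p2_def)
      then have e: "sem p2 (t(4 := a # l)) 2 = replicate j 2" "sem p2 (t(4 := a # l)) 1 = 2 # t 1"
        using t(1) Suc by simp_all
      show ?thesis unfolding P2_def d m e t(2) using d by simp
    qed
  qed
  then have s2: "sem (For 4 p2) s1 2 = []" "sem (For 4 p2) s1 1 = replicate i 2"
    using s(3) by (simp_all add: P2_def n_def min_absorb1)
  have u: "sem (unary out) s = sem (For 4 p2) s1" by (simp add: unary_def p1_def p2_def s1_def)
  have w: "writes (For 4 p1) \<subseteq> {1, 2, out}" "writes (For 4 p2) \<subseteq> {1, 2}"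
    by (auto simp: p1_def p2_def one_digit_def split: if_splits)
  show ?thesis
  proof
    fix q
    consider "q = 1" | "q = 2" | "q = out" "q \<noteq> 1" "q \<noteq> 2" | "q \<noteq> 1" "q \<noteq> 2" "q \<noteq> out" by blast
    then show "sem (unary out) s q = (s(out := rev (map bit (concat (replicate i one_digit))) @ s out)) q"
    proof cases
      case 3
      then have "sem (For 4 p2) s1 q = s1 q" by (intro sem_unchanged) (use w in blast)
      then show ?thesis using 3 s1 unfolding u by simp
    next
      case 4
      then have "sem (For 4 p2) s1 q = s1 q" "s1 q = s q" unfolding s1_def by (intro sem_unchanged; use w in blast)+
      then show ?thesis using 4 unfolding u by simp
    qed (use s s2 o in \<open>simp_all add: u\<close>)
  qed
qed

lemma sem_prt:
  assumes o: "5 < out"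
  shows "s 1 = replicate i 2 \<Longrightarrow> s 2 = [] \<Longrightarrow> i \<le> length (s 4) \<Longrightarrow>
    sem (prt out tpl) s = s(out := rev (map bit (inst i tpl)) @ s out)"
proof (induction tpl arbitrary: s)
  case Nil
  then show ?case by (simp add: inst_def)
next
  case (Cons u tpl)
  show ?case
  proof (cases u)
    case None
    let ?s = "s(out := rev (map bit (concat (replicate i one_digit))) @ s out)"
    have "sem (prt out (u # tpl)) s = sem (prt out tpl) ?s"
      using sem_unary[OF o Cons.prems] None by (simp only: prt.simps sem.simps)
    also have "\<dots> = ?s(out := rev (map bit (inst i tpl)) @ ?s out)"
      using Cons.prems o by (intro Cons.IH) simp_all
    also have "\<dots> = s(out := rev (map bit (inst i (u # tpl))) @ s out)" by (simp add: None inst_def)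
    finally show ?thesis .
  next
    case (Some b)
    let ?s = "s(out := bit b # s out)"
    have "sem (prt out (u # tpl)) s = sem (prt out tpl) ?s" by (simp only: Some prt.simps sem.simps)
    also have "\<dots> = ?s(out := rev (map bit (inst i tpl)) @ ?s out)"
      using Cons.prems o by (intro Cons.IH) simp_all
    also have "\<dots> = s(out := rev (map bit (inst i (u # tpl))) @ s out)" by (simp add: Some inst_def)
    finally show ?thesis .
  qed
qed

lemma writes_fors_emit: "writes (emit out bs) \<subseteq> {out}" "fors (emit out bs) = {}"
  by (induction bs) auto

lemma writes_fors_prt: "writes (prt out tpl) \<subseteq> {1, 2, out}" "fors (prt out tpl) \<subseteq> {4}"
proof -
  have "writes (unary out) \<subseteq> {1, 2, out}" "fors (unary out) \<subseteq> {4}" for out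
    by (auto simp: unary_def one_digit_def split: if_splits)
  then have "writes (prt out tpl) \<subseteq> {1, 2, out} \<and> fors (prt out tpl) \<subseteq> {4}"
    by (induction out tpl rule: prt.induct) simp_all
  then show "writes (prt out tpl) \<subseteq> {1, 2, out}" "fors (prt out tpl) \<subseteq> {4}" by blast+
qed

lemma writes_fors_at_positions: "writes (at_positions out tp) \<subseteq> {1, 2, out}" "fors (at_positions out tp) \<subseteq> {3, 4}"
  unfolding at_positions_def using writes_fors_prt by fastforce+

definition printed :: "(nat \<Rightarrow> bool option list) \<Rightarrow> nat list \<Rightarrow> bool list" where
  "printed tp w = concat (map (\<lambda>i. inst i (tp (w ! i))) [0..<length w])"

lemma sem_at_positions:
  assumes o: "5 < out" and s: "s 1 = []" "s 2 = []" "length (s 3) \<le> length (s 4)"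
  shows "sem (at_positions out tp) s = s(out := rev (map bit (printed tp (s 3))) @ s out)"
proof -
  define w where "w = s 3"
  define n where "n = length w"
  define body where "body = Case 3 (\<lambda>a. prt out (tp a)) ;; Push 1 2"
  define pr where "pr d = concat (map (\<lambda>i. inst i (tp (w ! i))) [0..<d])" for d
  define P where "P l t \<longleftrightarrow> length l \<le> n \<and> l = drop (n - length l) w \<and> t 1 = replicate (n - length l) (2 :: nat) \<and> t 2 = [] \<and>
      t 4 = s 4 \<and> t out = rev (map bit (pr (n - length l))) @ s out" for l :: "nat list" and t :: store
  have P: "P [] (loop (sem body) 3 w s)"
  proof (rule loop_induct)
    show "P w s" using s by (simp add: P_def n_def pr_def)
    fix a l t assume P: "P (a # l) t"
    define d where "d = n - length (a # l)"
    have len: "length (a # l) \<le> n" using P unfolding P_def by blast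
    have d: "n - length l = Suc d" "length l \<le> n" "d < n" using len by (auto simp: d_def)
    have t: "a # l = drop d w" "t 1 = replicate d 2" "t 2 = []" "t 4 = s 4"
      "t out = rev (map bit (pr d)) @ s out"
      using P unfolding P_def d_def[symmetric] by blast+
    have dr: "drop d w = w ! d # drop (Suc d) w" using d(3) unfolding n_def by (rule Cons_nth_drop_Suc[symmetric])
    then have a: "a = w ! d" "l = drop (Suc d) w" using t(1) by simp_all
    let ?t = "t(3 := a # l)"
    have "peek ?t 3 = a" by (simp add: peek_def)
    moreover have "sem (prt out (tp a)) ?t = ?t(out := rev (map bit (inst d (tp a))) @ ?t out)"
      using t d(3) s(3) o by (intro sem_prt) (simp_all add: n_def w_def)
    ultimately have "sem body ?t = (?t(out := rev (map bit (inst d (tp a))) @ ?t out))(1 := 2 # t 1)"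
      using o by (simp add: body_def)
    moreover have "pr (Suc d) = pr d @ inst d (tp a)" by (simp add: pr_def a)
    ultimately show "P l (sem body ?t)"
      unfolding P_def d(1) using t d(2) a(2) o by simp
  qed
  have w: "writes body \<subseteq> {1, 2, out}" unfolding body_def using writes_fors_prt(1) by fastforce
  have e: "sem (at_positions out tp) s = ((loop (sem body) 3 w s)(3 := w))(1 := [])"
    by (simp add: at_positions_def body_def w_def del: fun_upd_apply)
  show ?thesis
  proof
    fix q
    show "sem (at_positions out tp) s q = (s(out := rev (map bit (printed tp (s 3))) @ s out)) q"
    proof (cases "q \<in> {1, 2, 3, out}")
      case True
      then show ?thesis using P o s unfolding e P_def printed_def pr_def n_def w_def[symmetric] by (auto simp: w_def)
    next
      case False
      then have "loop (sem body) 3 w s q = s q" by (intro loop_other sem_unchanged) (use w in auto)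
      then show ?thesis using False unfolding e by simp
    qed
  qed
qed

lemma sem_print_prog:
  assumes o: "5 < out" and s: "s 1 = []" "s 2 = []" "length (s 3) \<le> length (s 4)"
  shows "sem (print_prog out tI eA a tL b tS eT) s out =
     rev (map bit (printed tI (s 3) @ eA @ concat (replicate (length (s 5)) (a @ printed (\<lambda>_. tL) (s 3) @ b)) @
        printed (\<lambda>_. tS) (s 3) @ eT)) @ s out"
proof -
  define body where "body = emit out a ;; at_positions out (\<lambda>_. tL) ;; emit out b"
  define z where "z = a @ printed (\<lambda>_. tL) (s 3) @ b"
  define s1 where "s1 = s(out := rev (map bit (printed tI (s 3) @ eA)) @ s out)"
  define n where "n = length (s 5)"
  have 1: "sem (at_positions out tI ;; emit out eA) s = s1"
    using sem_at_positions[OF o s] by (simp add: sem_emit s1_def)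
  define P where "P l t \<longleftrightarrow> length l \<le> n \<and> t 1 = [] \<and> t 2 = [] \<and> t 3 = s 3 \<and> t 4 = s 4 \<and>
      t out = rev (map bit (concat (replicate (n - length l) z))) @ s1 out" for l :: "nat list" and t :: store
  have P: "P [] (loop (sem body) 5 (s 5) s1)"
  proof (rule loop_induct)
    show "P (s 5) s1" using s o by (simp add: P_def n_def s1_def)
    fix c l t assume P: "P (c # l) t"
    define d where "d = n - length (c # l)"
    have d: "n - length l = Suc d" "length l \<le> n" using P by (auto simp: P_def d_def)
    have t: "t 1 = []" "t 2 = []" "t 3 = s 3" "t 4 = s 4" "t out = rev (map bit (concat (replicate d z))) @ s1 out"
      using P unfolding P_def d_def[symmetric] by blast+
    let ?t = "t(5 := c # l)"
    let ?u = "?t(out := rev (map bit a) @ ?t out)"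
    have "sem (at_positions out (\<lambda>_. tL)) ?u = ?u(out := rev (map bit (printed (\<lambda>_. tL) (?u 3))) @ ?u out)"
      by (rule sem_at_positions[OF o]) (use t s o in simp_all)
    then have "sem body ?t = ?t(out := rev (map bit z) @ ?t out)"
      using t o by (simp add: body_def sem_emit z_def)
    moreover have "replicate (Suc d) z = replicate d z @ [z]" by (simp add: replicate_append_same)
    ultimately show "P l (sem body ?t)" unfolding P_def d(1) using t d(2) o by simp
  qed
  define s2 where "s2 = sem (For 5 body) s1"
  have s15: "s1 5 = s 5" using o by (simp add: s1_def)
  then have s2: "s2 1 = []" "s2 2 = []" "s2 3 = s 3" "s2 4 = s 4" "s2 out = rev (map bit (concat (replicate n z))) @ s1 out"
    using P o unfolding s2_def P_def by simp_all
  have "sem (print_prog out tI eA a tL b tS eT) s = sem (emit out eT) (sem (at_positions out (\<lambda>_. tS)) s2)"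
    using 1 by (simp add: print_prog_def s2_def body_def)
  also have "sem (at_positions out (\<lambda>_. tS)) s2 = s2(out := rev (map bit (printed (\<lambda>_. tS) (s2 3))) @ s2 out)"
    by (rule sem_at_positions[OF o]) (use s s2 in simp_all)
  finally show ?thesis by (simp add: sem_emit s2 s1_def n_def z_def)
qed

text \<open>\<open>z\<close> is a register that the body reads and preserves, such as the input in a
  nested loop; for bodies that depend on nothing else, any preserved register serves.\<close>

lemma loop_append:
  assumes "\<And>a l t. t r = a # l \<Longrightarrow> t z = c \<Longrightarrow> f t q = h a @ t q \<and> f t z = c" "z \<noteq> r" "q \<noteq> r"
  shows "s z = c \<Longrightarrow> loop f r l s q = concat (map h (rev l)) @ s q"
proof (induction l arbitrary: s)
  case (Cons a l)
  have "f (s(r := a # l)) q = h a @ (s(r := a # l)) q \<and> f (s(r := a # l)) z = c"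
    using Cons.prems assms(2) by (intro assms(1)) simp_all
  then show ?case using Cons.IH assms(3) by simp
qed simp

lemma concat_map_replicate: "concat (map (\<lambda>_. replicate n a) l) = replicate (length l * n) a"
  by (induction l) (simp_all add: replicate_add)

lemma writes_powers: "writes (powers e) \<subseteq> {6..6 + e}"
  by (induction e) auto

lemma sem_powers:
  "(\<And>r. 6 \<le> r \<Longrightarrow> s r = []) \<Longrightarrow> sem (powers e) s (6 + e) = replicate ((length (s 0) + 2) ^ e) 2"
proof (induction e)
  case (Suc j)
  let ?t = "sem (powers j) s" and ?q = "7 + j"
  define body where "body = For 0 (Push ?q 2) ;; Push ?q 2 ;; Push ?q 2"
  have t: "?t (6 + j) = replicate ((length (s 0) + 2) ^ j) 2" by (rule Suc.IH) (rule Suc.prems)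
  have t0: "?t 0 = s 0" "?t ?q = []" using writes_powers[of j] Suc.prems[of ?q]
    by (simp_all add: sem_unchanged subset_iff) (subst sem_unchanged; fastforce)+
  have b: "sem body u ?q = replicate (length (s 0) + 2) 2 @ u ?q \<and> sem body u 0 = s 0" if "u 0 = s 0" for u
  proof -
    have "loop (sem (Push ?q 2)) 0 (u 0) u ?q = concat (map (\<lambda>_. replicate 1 2) (rev (u 0))) @ u ?q"
      by (rule loop_append[where z="?q + 1" and c="u (?q + 1)"]) simp_all
    then show ?thesis using that unfolding concat_map_replicate by (simp add: body_def)
  qed
  have "loop (sem body) (6 + j) (?t (6 + j)) ?t ?q
      = concat (map (\<lambda>_. replicate (length (s 0) + 2) 2) (rev (?t (6 + j)))) @ ?t ?q"
    by (rule loop_append[where z=0 and c="s 0"]) (use b t0 in simp_all)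
  then have "loop (sem body) (6 + j) (?t (6 + j)) ?t ?q = replicate ((length (s 0) + 2) ^ Suc j) 2"
    unfolding concat_map_replicate t0(2) by (simp add: t mult.commute)
  then show ?case by (simp add: body_def)
qed simp

lemma sem_fill:
  assumes "s 0 = rev (map bit x)" "s (6 + e) = replicate L 2" "s 3 = []"
  shows "sem (fill e) s 3 = wsyms x L"
proof -
  define s1 where "s1 = sem (Push 3 5) s"
  define s2 where "s2 = sem (For (6 + e) (Push 3 4)) s1"
  let ?p = "Case 0 (\<lambda>b. if b = 3 then Push 3 3 else Push 3 2)"
  have "loop (sem (Push 3 4)) (6 + e) (s1 (6 + e)) s1 3 = concat (map (\<lambda>_. replicate 1 4) (rev (s1 (6 + e)))) @ s1 3"
    by (rule loop_append[where z=1 and c="s1 1"]) simp_all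
  then have s2: "s2 3 = replicate L 4 @ [5]"
    unfolding concat_map_replicate using assms by (simp add: s2_def s1_def)
  have s20: "s2 0 = rev (map bit x)" using assms by (simp add: s2_def s1_def sem_unchanged loop_other)
  have "loop (sem ?p) 0 (s2 0) s2 3 = concat (map (\<lambda>b. [if b = 3 then 3 else 2]) (rev (s2 0))) @ s2 3"
    by (rule loop_append[where z=1 and c="s2 1"]) (auto simp: peek_def)
  moreover have "concat (map (\<lambda>b. [if b = 3 then 3 else 2]) (map bit x)) = map bit x"
    by (induction x) (simp_all add: bit_def)
  ultimately have "sem (For 0 ?p) s2 3 = map bit x @ replicate L 4 @ [5]" using s20 s2 by simp
  then show ?thesis by (simp add: fill_def wsyms_def s1_def s2_def)
qed

lemma sem_pushes: "sem (pushes l) s = s(5 := replicate l 2 @ s 5)"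
  by (induction l arbitrary: s) (simp_all del: fun_upd_apply add: fun_upd_same replicate_app_Cons_same)

lemma sem_bounds:
  "length (sem (bounds l) s 4) = length (s 3) + length (s 4)" "length (sem (bounds l) s 5) = l * length (s 3) + length (s 5)"
proof -
  let ?p = "Push 4 2 ;; pushes l"
  have "loop (sem ?p) 3 (s 3) s 4 = concat (map (\<lambda>_. replicate 1 2) (rev (s 3))) @ s 4"
    by (rule loop_append[where z=1 and c="s 1"]) (simp_all add: sem_pushes)
  then show "length (sem (bounds l) s 4) = length (s 3) + length (s 4)"
    unfolding concat_map_replicate by (simp add: bounds_def)
  have "loop (sem ?p) 3 (s 3) s 5 = concat (map (\<lambda>_. replicate l 2) (rev (s 3))) @ s 5"
    by (rule loop_append[where z=1 and c="s 1"]) (simp_all add: sem_pushes)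
  then show "length (sem (bounds l) s 5) = l * length (s 3) + length (s 5)"
    unfolding concat_map_replicate by (simp add: bounds_def)
qed

lemma writes_fors_pushes: "writes (pushes l) \<subseteq> {5}" "fors (pushes l) = {}"
  by (induction l) auto

lemma wf_pushes: "5 < k \<Longrightarrow> 4 \<le> K \<Longrightarrow> wf_prog k K (pushes l)"
  by (induction l) auto

lemma wf_emit: "out < k \<Longrightarrow> 4 \<le> K \<Longrightarrow> wf_prog k K (emit out bs)"
  by (induction bs) (auto simp: bit_def)

lemma wf_prt: "5 < out \<Longrightarrow> out < k \<Longrightarrow> 4 \<le> K \<Longrightarrow> wf_prog k K (prt out tpl)"
proof -
  assume a: "5 < out" "out < k" "4 \<le> K"
  then have "wf_prog k K (unary out)" by (auto simp: unary_def one_digit_def bit_def split: if_splits)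
  with a show "wf_prog k K (prt out tpl)" by (induction out tpl rule: prt.induct) (auto simp: bit_def)
qed

lemma wf_at_positions: "5 < out \<Longrightarrow> out < k \<Longrightarrow> 4 \<le> K \<Longrightarrow> wf_prog k K (at_positions out tp)"
  unfolding at_positions_def using writes_fors_prt[of out] wf_prt[of out k K] by fastforce

lemma tame_print_prog:
  assumes o: "5 < out" "out < k" and K: "4 \<le> K"
  shows "tame k K (print_prog out tI eA a tL b tS eT)"
proof (rule tame_simple)
  note wf = writes_fors_at_positions[of out] writes_fors_emit[of out]
  have w: "writes (print_prog out tI eA a tL b tS eT) \<subseteq> {1, 2, out}" "fors (print_prog out tI eA a tL b tS eT) \<subseteq> {3, 4, 5}"
    unfolding print_prog_def writes.simps fors.simps using wf by blast+
  have "5 \<notin> writes (emit out a ;; at_positions out (\<lambda>_. tL) ;; emit out b)"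
    "5 \<notin> fors (emit out a ;; at_positions out (\<lambda>_. tL) ;; emit out b)"
    unfolding writes.simps fors.simps using wf(1)[of "\<lambda>_. tL"] wf(2)[of "\<lambda>_. tL"] wf(3)[of a] wf(3)[of b] wf(4) o by auto
  then show "wf_prog k K (print_prog out tI eA a tL b tS eT)"
    unfolding print_prog_def using o K wf_emit wf_at_positions by simp
  show "fors (print_prog out tI eA a tL b tS eT) \<subseteq> {..<k}" using w o by auto
  show "writes (print_prog out tI eA a tL b tS eT) \<inter> fors (print_prog out tI eA a tL b tS eT) = {}"
  proof -
    have "{1, 2, out} \<inter> {3, 4, 5} = {}" using o by auto
    then show ?thesis using w by blast
  qed
qed (use K in simp)

lemma tame_powers: "6 + e < k \<Longrightarrow> 4 \<le> K \<Longrightarrow> tame k K (powers e)"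
proof (induction e)
  case 0
  show ?case by (rule tame_simple) (use 0 in auto)
next
  case (Suc j)
  have "tame k K (For (6 + j) (For 0 (Push (7 + j) 2) ;; Push (7 + j) 2 ;; Push (7 + j) 2))"
    by (rule tame_simple) (use Suc.prems in auto)
  then show ?case unfolding powers.simps by (intro tame_Seq Suc.IH) (use Suc.prems in auto)
qed

lemma tame_fill: "6 + e < k \<Longrightarrow> 7 \<le> K \<Longrightarrow> tame k K (fill e)"
  by (rule tame_simple) (auto simp: fill_def split: if_splits)

lemma tame_bounds: "6 < k \<Longrightarrow> 4 \<le> K \<Longrightarrow> tame k K (bounds l)"
  using writes_fors_pushes[of l] wf_pushes[of k K l] by (intro tame_simple) (auto simp: bounds_def)

section \<open>PSPACE-hardness\<close>

text \<open>One-hot code. Its length enters the reduction as a constant of the machine, so a shorter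
  code would gain nothing.\<close>

lemma ex_code:
  assumes "finite A" "A \<noteq> {}"
  shows "\<exists>(code :: 'a \<Rightarrow> bool list) l. inj_on code A \<and> (\<forall>a \<in> A. length (code a) = l) \<and> 0 < l"
proof -
  obtain h where h: "bij_betw h A {0..<card A}" using ex_bij_betw_finite_nat[OF assms(1)] by blast
  define code where "code a = map (\<lambda>j. j = h a) [0..<card A]" for a
  have "inj_on code A"
  proof (rule inj_onI)
    fix a b assume ab: "a \<in> A" "b \<in> A" "code a = code b"
    have "h a < card A" using h ab(1) by (auto simp: bij_betw_def)
    then have "h a = h b" using arg_cong[OF ab(3), of "\<lambda>l. l ! h a"] by (simp add: code_def)
    then show "a = b" using h ab by (auto simp: bij_betw_def dest: inj_onD)
  qed
  moreover have "0 < card A" using assms by (simp add: card_gt_0_iff)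
  ultimately show ?thesis by (intro exI[of _ code] exI[of _ "card A"]) (simp add: code_def)
qed

lemma connectives_big_and:
  "connectives (big_and \<phi>s \<psi>) \<subseteq> A \<longleftrightarrow> (\<phi>s = [] \<or> OAnd \<in> A) \<and> (\<forall>\<phi> \<in> set \<phi>s. connectives \<phi> \<subseteq> A) \<and> connectives \<psi> \<subseteq> A"
  by (induction \<phi>s) auto

lemma connectives_truth_table: "connectives (truth_table t as G) \<subseteq> {OAtNeg, OAnd, OOr, OBox, ODia}"
  by (induction as arbitrary: G) auto

lemma connectives_tree:
  assumes "\<forall>\<phi> \<in> set loc. connectives \<phi> \<subseteq> {OAtNeg, OAnd, OOr, OBox, ODia}" "connectives leaf \<subseteq> {OAtNeg, OAnd, OOr, OBox, ODia}"
  shows "connectives (tree loc leaf m) \<subseteq> {OAtNeg, OAnd, OOr, OBox, ODia}"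
  using assms by (induction m) (auto simp: both_halves_def connectives_big_and)

lemma connectives_reduction_formula:
  "connectives (reduction_formula M l code dec ws) \<subseteq> {OAtNeg, OAnd, OOr, OBox, ODia}"
proof -
  have c: "connectives (copy_bit x) \<subseteq> {OAtNeg, OAnd, OOr, OBox, ODia}" for x
    by (auto simp: copy_bit_def carry_def)
  have "connectives (tree (map (locf l) [0..<length ws]) (big_and (map (stepf M l code dec) [0..<length ws]) truef) m)
      \<subseteq> {OAtNeg, OAnd, OOr, OBox, ODia}" for m
    by (rule connectives_tree)
      (use c connectives_truth_table in \<open>auto simp: connectives_big_and locf_def stepf_def truef_def simp del: truth_table.simps\<close>)
  then show ?thesis unfolding reduction_formula_def
    using connectives_truth_table by (simp add: connectives_big_and initf_def accf_def)
qed

theorem PSPACE_hard: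
  assumes S: "adequate S" and B: "B \<in> PSPACE"
  shows "polytime_reducible B (modal_sat S)"
proof -
  obtain M and p :: "nat poly" where tm: "turing_machine M" and dM: "decides M B" and sp: "runs_in_space M (poly p)"
    using B unfolding PSPACE_def by blast
  obtain e where e: "\<And>n. poly p n \<le> (n + 2) ^ e"
    using poly_bounded_le_power[OF poly_bounded_poly[of p]] by blast
  define L where "L x = (length x + 2) ^ e" for x :: "bool list"
  define \<Lambda> where "\<Lambda> x = length x + L x + 2" for x
  have fits: "fits M (\<Lambda> x) (run M x t)" for x t
    by (rule fits_run[OF tm sp]) (use e[of "length x"] in \<open>simp_all add: \<Lambda>_def L_def\<close>)
  have ne: "letters M \<noteq> {}" using letter_in_letters[OF fits] by blast
  obtain code :: "letter \<Rightarrow> bool list" and l where code: "inj_on code (letters M)"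
      "\<And>a. a \<in> letters M \<Longrightarrow> length (code a) = l" "0 < l"
    using ex_code[OF finite_letters ne] by metis
  define dec where "dec = inv_into (letters M) code"
  have sim: "simulation M (\<Lambda> x) l code x" for x
    using tm fits code by unfold_locales (auto simp: \<Lambda>_def)
  have dec: "simulation.dec M code = dec" unfolding dec_def by (rule simulation.dec_def[OF sim])
  define \<Phi> where "\<Phi> x = reduction_formula M l code dec (wsyms x (L x))" for x
  define f where "f x = encT S (\<Phi> x)" for x
  have correct: "x \<in> B \<longleftrightarrow> satisfiable (\<Phi> x)" for x
  proof -
    let ?t = "2 ^ (l * \<Lambda> x)"
    have s: "satisfiable (\<Phi> x) \<longleftrightarrow> fst (run M x ?t) = accept_state M"
      using simulation.satisfiable_reduction[OF sim \<Lambda>_def] unfolding dec \<Phi>_def .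
    obtain t where t: "fst (run M x t) = (if x \<in> B then accept_state M else reject_state M)"
      using dM unfolding decides_def by blast
    show ?thesis
    proof (cases "x \<in> B")
      case True
      then show ?thesis using s t simulation.accept_within[OF sim] by simp
    next
      case False
      have "fst (run M x ?t) \<noteq> accept_state M"
      proof
        assume a: "fst (run M x ?t) = accept_state M"
        \<comment> \<open>Rejection and acceptance may occur at different times; at the later of the
          two the run would have to be in both halting states.\<close>
        have "run M x (max t ?t) = run M x t" by (rule halted_run) (use t False in simp_all)
        moreover have "run M x (max t ?t) = run M x ?t" by (rule halted_run) (use a in simp_all)
        ultimately have "accept_state M = reject_state M" using a t False by simp
        then show False using tm unfolding turing_machine_def by blast
      qed
      then show ?thesis using False s by blast
    qed
  qed
  obtain tI where tI: "\<And>a i. encT S (initf M l code a i) = inst i (tI a)"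
    using uniform_initf[of S M l code] unfolding uniform_def by metis
  obtain tS where tS: "\<And>i. encT S (stepf M l code dec i) = inst i tS"
    using uniform_stepf[of S M l code dec] unfolding uniform_def by metis
  obtain tL where tL: "\<And>i. encT S (locf l i) = inst i tL"
    using uniform_locf[of S l] unfolding uniform_def by metis
  define wrap where "wrap t = map Some (preA S) @ t @ map Some (midA S)" for t
  define out where "out = 7 + e"
  define pp where "pp = print_prog out (\<lambda>a. wrap (tI a)) (preA S @ encT S (accf M l dec) @ midA S)
    (preA S @ encT S both_halves @ midA S) (wrap tL) (preB S) (wrap tS) (encT S truef)"
  have f: "f x = printed (\<lambda>a. wrap (tI a)) (wsyms x (L x)) @ (preA S @ encT S (accf M l dec) @ midA S) @
      concat (replicate (l * length (wsyms x (L x)))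
        ((preA S @ encT S both_halves @ midA S) @ printed (\<lambda>_. wrap tL) (wsyms x (L x)) @ preB S)) @
      printed (\<lambda>_. wrap tS) (wsyms x (L x)) @ encT S truef" for x
    unfolding f_def \<Phi>_def reduction_formula_def encT_big_and encT_And encT_tree printed_def wrap_def
    by (simp add: comp_def tI tS tL)
  \<comment> \<open>Separate stages, because the loop registers of each stage are filled by the
    stages before it and must not change within it.\<close>
  define prog where "prog = powers e ;; fill e ;; bounds l ;; pp"
  define k where "k = out + 1"
  have o: "5 < out" by (simp add: out_def)
  have tame: "tame k 7 prog"
    unfolding prog_def pp_def
    by (intro tame_Seq tame_powers tame_fill tame_bounds tame_print_prog) (simp_all add: k_def out_def)
  have sem: "sem prog (init_store x) (k - 1) = rev (map bit (f x))" for x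
  proof -
    let ?s0 = "init_store x"
    define s1 where "s1 = sem (powers e) ?s0"
    define s2 where "s2 = sem (fill e) s1"
    define s3 where "s3 = sem (bounds l) s2"
    have s0: "?s0 0 = rev (map bit x)" "\<And>r. 1 \<le> r \<Longrightarrow> ?s0 r = []" by (simp_all add: init_store_def)
    have u1: "s1 r = ?s0 r" if "r \<notin> {6..6 + e}" for r
      unfolding s1_def by (rule sem_unchanged) (use writes_powers that in blast)
    have "s1 (6 + e) = replicate (L x) 2"
      using sem_powers[of ?s0 e] s0 unfolding s1_def L_def by simp
    then have w: "s2 3 = wsyms x (L x)"
      unfolding s2_def using u1 s0 by (intro sem_fill) simp_all
    have "writes (fill e) \<subseteq> {3}" by (auto simp: fill_def split: if_splits)
    then have u2: "s2 r = s1 r" if "r \<noteq> 3" for r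
      unfolding s2_def by (intro sem_unchanged) (use that in blast)
    have "writes (bounds l) \<subseteq> {4, 5}" unfolding bounds_def using writes_fors_pushes by auto
    then have u3: "s3 r = s2 r" if "r \<notin> {4, 5}" for r
      unfolding s3_def by (intro sem_unchanged) (use that in blast)
    have r: "s3 1 = []" "s3 2 = []" "s3 3 = wsyms x (L x)" "s3 out = []"
      using u1 u2 u3 s0 w by (simp_all add: out_def)
    have "s2 4 = []" "s2 5 = []" using u1 u2 s0 by simp_all
    then have b: "length (s3 4) = length (wsyms x (L x))" "length (s3 5) = l * length (wsyms x (L x))"
      using sem_bounds[of l s2] w by (simp_all add: s3_def)
    have "sem pp s3 out = rev (map bit (f x)) @ s3 out"
      unfolding pp_def f using sem_print_prog[OF o r(1,2)] r(3) b by simp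
    then show ?thesis using r(4) by (simp add: prog_def k_def s1_def s2_def s3_def)
  qed
  obtain q :: "nat poly" where q: "\<And>x. cost prog (init_store x) + total k {} (sem prog (init_store x)) \<le> poly q (length x)"
    using tame_cost[OF tame] by (auto simp: k_def)
  have "polytime_computable f"
  proof (rule polytime_prog)
    show "wf_prog k 7 prog" using tame unfolding tame_def by blast
    show "cost prog (init_store x) \<le> poly q (length x)" for x using q[of x] by simp
    show "sem prog (init_store x) (k - 1) = rev (map bit (f x))" for x by (rule sem)
  qed (simp_all add: k_def)
  moreover have "x \<in> B \<longleftrightarrow> f x \<in> modal_sat S" for x
  proof -
    have "translate S (\<Phi> x) \<in> modal_lang S"
      unfolding \<Phi>_def by (rule translate_in_modal_lang[OF S connectives_reduction_formula])
    then have "f x \<in> modal_sat S \<longleftrightarrow> satisfiable (translate S (\<Phi> x))"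
      unfolding f_def encT_def modal_sat_def using inj_encode by (auto dest: injD)
    then show ?thesis using correct satisfiable_translate by simp
  qed
  ultimately show ?thesis unfolding polytime_reducible_def by blast
qed

section \<open>Satisfiability as a game on labelled token strings\<close>

text \<open>
  One player labels every position of the token string with a truth value of the subformula that
  starts there; the other marks positions. A mark on a box labelled false or a diamond labelled true
  demands a labelling for a successor world; two marks on variables test that equal names have
  equal labels. The strings are read from right to left, so that each connective finds its operands
  on a stack. A cell consists of the token (\<open>None\<close> for an invalid code), its label, its mark and its
  label in the successor.
\<close>

type_synonym cell = "token option \<times> bool \<times> bool \<times> bool option"

primrec arity :: "connective \<Rightarrow> nat" where
  "arity ONeg = 1" | "arity OAtNeg = 1" | "arity OAnd = 2" | "arity OOr = 2"
| "arity OBox = 1" | "arity ODia = 1" | "arity OTrue = 0" | "arity OFalse = 0"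

primrec label_ok :: "connective \<Rightarrow> bool list \<Rightarrow> bool \<Rightarrow> bool" where
  "label_ok ONeg vs b \<longleftrightarrow> b = (\<not> vs ! 0)"
| "label_ok OAtNeg vs b \<longleftrightarrow> b = (\<not> vs ! 0)"
| "label_ok OAnd vs b \<longleftrightarrow> b = (vs ! 0 \<and> vs ! 1)"
| "label_ok OOr vs b \<longleftrightarrow> b = (vs ! 0 \<or> vs ! 1)"
| "label_ok OBox vs b \<longleftrightarrow> True"
| "label_ok ODia vs b \<longleftrightarrow> True"
| "label_ok OTrue vs b \<longleftrightarrow> b"
| "label_ok OFalse vs b \<longleftrightarrow> \<not> b"

text \<open>
  The mode tells what has just been read: 2 and 3 digits, the leftmost being 0 or 1, 4 a variable,
  and 1 anything else.
\<close>

fun scan_step :: "connective set \<Rightarrow> token option \<Rightarrow> bool \<Rightarrow> bool list \<times> nat \<Rightarrow> (bool list \<times> nat) option" where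
  "scan_step S None b (zs, m) = None"
| "scan_step S (Some (TDigit d)) b (zs, m) = Some (zs, if d then 3 else 2)"
| "scan_step S (Some TVar) b (zs, m) = (if m = 2 then None else Some (b # zs, 4))"
| "scan_step S (Some (TOp c)) b (zs, m) =
     (if c \<in> S \<and> m \<noteq> 2 \<and> m \<noteq> 3 \<and> (c = OAtNeg \<longrightarrow> m = 4) \<and> arity c \<le> length zs \<and> label_ok c (take (arity c) zs) b
      then Some (b # drop (arity c) zs, 1) else None)"

primrec scan :: "connective set \<Rightarrow> (token option \<times> bool) list \<Rightarrow> (bool list \<times> nat) option" where
  "scan S [] = Some ([], 1)"
| "scan S (x # xs) = Option.bind (scan S xs) (scan_step S (fst x) (snd x))"

definition scan_ok :: "connective set \<Rightarrow> (token option \<times> bool) list \<Rightarrow> bool" where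
  "scan_ok S xs \<longleftrightarrow> (\<exists>z m. scan S xs = Some ([z], m) \<and> m \<noteq> 2 \<and> m \<noteq> 3)"

text \<open>Read from the right, a successfully scanned string is a possibly unfinished run of
  digits followed by complete formulas, one per stack entry. Mode 2 records a leading zero, which no
  variable accepts, and mode 4 a bare variable on top, the only legal operand of atomic negation.
  Thus only genuine encodings pass.\<close>

lemma scan_parses:
  "scan S xs = Some (zs, m) \<Longrightarrow> \<exists>ds \<phi>s. map fst xs = map Some (map TDigit ds @ concat (map tokens \<phi>s)) \<and>
     (\<forall>\<phi> \<in> set \<phi>s. connectives \<phi> \<subseteq> S) \<and> length \<phi>s = length zs \<and>
     (if ds = [] then m = 1 \<or> m = 4 else m = (if hd ds then 3 else 2)) \<and>
     (m = 4 \<longrightarrow> (\<exists>n \<psi>s. \<phi>s = Atom n # \<psi>s))"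
proof (induction xs arbitrary: zs m)
  case Nil
  then show ?case by (intro exI[of _ "[]"]) simp
next
  case (Cons x xs)
  obtain t b where x: "x = (t, b)" by fastforce
  obtain ys n where s: "scan S xs = Some (ys, n)" and st: "scan_step S t b (ys, n) = Some (zs, m)"
    using Cons.prems x by (cases "scan S xs") auto
  obtain ds \<phi>s where IH: "map fst xs = map Some (map TDigit ds @ concat (map tokens \<phi>s))"
     "\<forall>\<phi> \<in> set \<phi>s. connectives \<phi> \<subseteq> S" "length \<phi>s = length ys"
     "if ds = [] then n = 1 \<or> n = 4 else n = (if hd ds then 3 else 2)"
     "n = 4 \<longrightarrow> (\<exists>n \<psi>s. \<phi>s = Atom n # \<psi>s)"
    using Cons.IH[OF s] by blast
  show ?case
  proof (cases t)
    case None
    then show ?thesis using st by simp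
  next
    case (Some tk)
    show ?thesis
    proof (cases tk)
      case (TDigit d)
      have z: "zs = ys" "m = (if d then 3 else 2)" using st Some TDigit by simp_all
      then have "m \<noteq> 4" by simp
      moreover have "map fst (x # xs) = map Some (map TDigit (d # ds) @ concat (map tokens \<phi>s))"
        using IH(1) x Some TDigit by simp
      ultimately show ?thesis using IH(2,3) z by (intro exI[of _ "d # ds"] exI[of _ \<phi>s]) simp
    next
      case TVar
      then have n: "n \<noteq> 2" and z: "zs = b # ys" "m = 4" using st Some by (auto split: if_splits)
      have "ds = [] \<or> hd ds" using IH(4) n by (auto split: if_splits)
      then have "tokens (Atom (num ds)) = TVar # map TDigit ds" by (simp add: var_tokens_def bin_num)
      then show ?thesis using IH z x Some TVar
        by (intro exI[of _ "[]"] exI[of _ "Atom (num ds) # \<phi>s"]) simp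
    next
      case (TOp c)
      have c: "c \<in> S" "n \<noteq> 2" "n \<noteq> 3" "c = OAtNeg \<longrightarrow> n = 4" "arity c \<le> length ys" "zs = b # drop (arity c) ys" "m = 1"
        using st Some TOp by (auto split: if_splits)
      have ds: "ds = []" using IH(4) c(2,3) by (auto split: if_splits)
      have toks: "map fst (x # xs) = map Some (TOp c # concat (map tokens \<phi>s))"
        using IH(1) x Some TOp ds by simp
      have "\<exists>\<psi>. tokens \<psi> @ concat (map tokens (drop (arity c) \<phi>s)) = TOp c # concat (map tokens \<phi>s) \<and> connectives \<psi> \<subseteq> S"
      proof (cases c)
        case ONeg
        then obtain \<phi> \<psi>s where "\<phi>s = \<phi> # \<psi>s" using c(5) IH(3) by (cases \<phi>s) auto
        then show ?thesis using ONeg c(1) IH(2) by (intro exI[of _ "FNeg \<phi>"]) simp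
      next
        case OAtNeg
        then obtain i \<psi>s where "\<phi>s = Atom i # \<psi>s" using c(4) IH(5) by blast
        then show ?thesis using OAtNeg c(1) by (intro exI[of _ "NAtom i"]) simp
      next
        case OAnd
        then obtain \<phi> \<psi> \<psi>s where "\<phi>s = \<phi> # \<psi> # \<psi>s" using c(5) IH(3) by (cases \<phi>s; cases "tl \<phi>s") auto
        then show ?thesis using OAnd c(1) IH(2) by (intro exI[of _ "FAnd \<phi> \<psi>"]) simp
      next
        case OOr
        then obtain \<phi> \<psi> \<psi>s where "\<phi>s = \<phi> # \<psi> # \<psi>s" using c(5) IH(3) by (cases \<phi>s; cases "tl \<phi>s") auto
        then show ?thesis using OOr c(1) IH(2) by (intro exI[of _ "FOr \<phi> \<psi>"]) simp
      next
        case OBox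
        then obtain \<phi> \<psi>s where "\<phi>s = \<phi> # \<psi>s" using c(5) IH(3) by (cases \<phi>s) auto
        then show ?thesis using OBox c(1) IH(2) by (intro exI[of _ "FBox \<phi>"]) simp
      next
        case ODia
        then obtain \<phi> \<psi>s where "\<phi>s = \<phi> # \<psi>s" using c(5) IH(3) by (cases \<phi>s) auto
        then show ?thesis using ODia c(1) IH(2) by (intro exI[of _ "FDia \<phi>"]) simp
      next
        case OTrue
        then show ?thesis using c(1) by (intro exI[of _ FTrue]) simp
      next
        case OFalse
        then show ?thesis using c(1) by (intro exI[of _ FFalse]) simp
      qed
      then obtain \<psi> where \<psi>: "tokens \<psi> @ concat (map tokens (drop (arity c) \<phi>s)) = TOp c # concat (map tokens \<phi>s)" "connectives \<psi> \<subseteq> S"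
        by blast
      have "\<forall>\<phi> \<in> set (drop (arity c) \<phi>s). connectives \<phi> \<subseteq> S" using IH(2) in_set_dropD by metis
      moreover have "map fst (x # xs) = map Some (concat (map tokens (\<psi> # drop (arity c) \<phi>s)))"
        unfolding toks using \<psi>(1) by simp
      ultimately show ?thesis using \<psi>(2) IH(3) c(6,7)
        by (intro exI[of _ "[]"] exI[of _ "\<psi> # drop (arity c) \<phi>s"]) simp
    qed
  qed
qed

section \<open>Consistent labellings\<close>

abbreviation len :: "fm \<Rightarrow> nat" where "len \<phi> \<equiv> length (tokens \<phi>)"

text \<open>Labels of digits, variables, boxes and diamonds are free: equal names are compared by
  the variable challenges, and modal labels are settled by the labels of the next world.\<close>

primrec consistent :: "fm \<Rightarrow> bool list \<Rightarrow> bool" where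
  "consistent (Atom n) l \<longleftrightarrow> True"
| "consistent (NAtom n) l \<longleftrightarrow> l ! 0 = (\<not> l ! 1)"
| "consistent (FNeg \<phi>) l \<longleftrightarrow> l ! 0 = (\<not> l ! 1) \<and> consistent \<phi> (tl l)"
| "consistent (FAnd \<phi> \<psi>) l \<longleftrightarrow> l ! 0 = (l ! 1 \<and> l ! (1 + len \<phi>)) \<and>
     consistent \<phi> (take (len \<phi>) (tl l)) \<and> consistent \<psi> (drop (len \<phi>) (tl l))"
| "consistent (FOr \<phi> \<psi>) l \<longleftrightarrow> l ! 0 = (l ! 1 \<or> l ! (1 + len \<phi>)) \<and>
     consistent \<phi> (take (len \<phi>) (tl l)) \<and> consistent \<psi> (drop (len \<phi>) (tl l))"
| "consistent (FBox \<phi>) l \<longleftrightarrow> consistent \<phi> (tl l)"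
| "consistent (FDia \<phi>) l \<longleftrightarrow> consistent \<phi> (tl l)"
| "consistent FTrue l \<longleftrightarrow> l ! 0"
| "consistent FFalse l \<longleftrightarrow> \<not> l ! 0"

lemma len_pos: "0 < len \<phi>"
  by (cases \<phi>) (simp_all add: var_tokens_def)

definition labelled :: "token list \<Rightarrow> bool list \<Rightarrow> (token option \<times> bool) list" where
  "labelled ts l = zip (map Some ts) l"

lemma labelled_Cons: "labelled (t # ts) (b # l) = (Some t, b) # labelled ts l"
  by (simp add: labelled_def)

lemma labelled_append: "length ts = length l \<Longrightarrow> labelled (ts @ us) (l @ k) = labelled ts l @ labelled us k"
  by (simp add: labelled_def)

lemma scan_digits:
  "length l = length ds \<Longrightarrow> scan S xs = Some (zs, m) \<Longrightarrow>
    scan S (labelled (map TDigit ds) l @ xs) = Some (zs, if ds = [] then m else if hd ds then 3 else 2)"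
proof (induction ds arbitrary: l)
  case (Cons d ds)
  then obtain b k where "l = b # k" "length k = length ds" by (cases l) auto
  then show ?case using Cons by (simp add: labelled_Cons)
qed (simp add: labelled_def)

lemma bin_leading: "bin n \<noteq> [] \<Longrightarrow> hd (bin n)"
proof (induction n rule: less_induct)
  case (less n)
  then have n: "0 < n" using bin_0 by (cases n) auto
  show ?case
  proof (cases "bin (n div 2) = []")
    case True
    then have "n = 1" using bin_eq_Nil_iff[of "n div 2"] n by auto
    then show ?thesis using bin_pos[OF n] True by simp
  next
    case False
    then show ?thesis using less.IH[of "n div 2"] n bin_pos[OF n] by simp
  qed
qed

definition end_mode :: "fm \<Rightarrow> nat" where
  "end_mode \<phi> = (case \<phi> of Atom n \<Rightarrow> 4 | _ \<Rightarrow> 1)"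

lemma end_mode_simps [simp]:
  "end_mode (Atom n) = 4" "end_mode (NAtom n) = 1" "end_mode (FNeg \<phi>) = 1" "end_mode (FAnd \<phi> \<psi>) = 1"
  "end_mode (FOr \<phi> \<psi>) = 1" "end_mode (FBox \<phi>) = 1" "end_mode (FDia \<phi>) = 1" "end_mode FTrue = 1" "end_mode FFalse = 1"
  by (simp_all add: end_mode_def)

lemma end_mode_neq: "end_mode \<phi> \<noteq> 2" "end_mode \<phi> \<noteq> 3"
  by (cases \<phi>; simp)+

text \<open>The tokens of \<open>\<phi>\<close> replace whatever follows by one more stack entry.
  Allowing an arbitrary scanned rest \<open>xs\<close> lets the induction treat the second operand
  first and then the first operand in front of it; excluding modes 2 and 3 means that no digits wait
  for a variable in between.\<close>

lemma scan_tokens: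
  "connectives \<phi> \<subseteq> S \<Longrightarrow> length l = len \<phi> \<Longrightarrow> scan S xs = Some (zs, m) \<Longrightarrow> m \<noteq> 2 \<Longrightarrow> m \<noteq> 3 \<Longrightarrow>
    (if consistent \<phi> l then scan S (labelled (tokens \<phi>) l @ xs) = Some (l ! 0 # zs, end_mode \<phi>)
     else scan S (labelled (tokens \<phi>) l @ xs) = None)"
proof (induction \<phi> arbitrary: l xs zs m)
  case (Atom n)
  then obtain b k where l: "l = b # k" "length k = length (bin n)" by (cases l) (auto simp: var_tokens_def)
  show ?case using scan_digits[OF l(2) Atom.prems(3)] bin_leading[of n] Atom.prems(4)
    by (simp add: l var_tokens_def labelled_Cons)
next
  case (NAtom n)
  then obtain a b k where l: "l = a # b # k" "length k = length (bin n)"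
    by (cases l; cases "tl l") (auto simp: var_tokens_def)
  show ?case using scan_digits[OF l(2) NAtom.prems(3)] bin_leading[of n] NAtom.prems(1,4)
    by (simp add: l var_tokens_def labelled_Cons)
next
  case (FNeg \<phi>)
  then obtain b k where l: "l = b # k" "length k = len \<phi>" by (cases l) auto
  then have "k \<noteq> []" using len_pos[of \<phi>] by auto
  then show ?case using FNeg.IH[of k xs zs m] FNeg.prems l
    by (auto simp: labelled_Cons end_mode_neq split: if_splits)
next
  case (FBox \<phi>)
  then obtain b k where l: "l = b # k" "length k = len \<phi>" by (cases l) auto
  then show ?case using FBox.IH[of k xs zs m] FBox.prems
    by (auto simp: labelled_Cons end_mode_neq split: if_splits)
next
  case (FDia \<phi>)
  then obtain b k where l: "l = b # k" "length k = len \<phi>" by (cases l) auto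
  then show ?case using FDia.IH[of k xs zs m] FDia.prems
    by (auto simp: labelled_Cons end_mode_neq split: if_splits)
next
  case (FAnd \<phi> \<psi>)
  then obtain b k where l: "l = b # k" "length k = len \<phi> + len \<psi>" by (cases l) auto
  define k1 k2 where "k1 = take (len \<phi>) k" and "k2 = drop (len \<phi>) k"
  have k: "k = k1 @ k2" "length k1 = len \<phi>" "length k2 = len \<psi>" using l by (simp_all add: k1_def k2_def)
  have "k1 \<noteq> []" using k len_pos[of \<phi>] by auto
  then have h: "l ! 1 = k1 ! 0" "l ! (1 + len \<phi>) = k2 ! 0"
    using k len_pos[of \<phi>] len_pos[of \<psi>] by (simp_all add: l nth_append)
  have e: "labelled (tokens (FAnd \<phi> \<psi>)) l @ xs = (Some (TOp OAnd), b) # labelled (tokens \<phi>) k1 @ (labelled (tokens \<psi>) k2 @ xs)"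
    using k by (simp add: l(1) labelled_Cons labelled_append)
  have c: "consistent (FAnd \<phi> \<psi>) l \<longleftrightarrow> b = (k1 ! 0 \<and> k2 ! 0) \<and> consistent \<phi> k1 \<and> consistent \<psi> k2"
    using k(2) unfolding consistent.simps h by (simp add: l(1) k(1))
  note IH2 = FAnd.IH(2)[OF _ k(3) FAnd.prems(3-5)]
  show ?case
  proof (cases "consistent \<psi> k2")
    case True
    have "scan S (labelled (tokens \<psi>) k2 @ xs) = Some (k2 ! 0 # zs, end_mode \<psi>)" using IH2 True FAnd.prems(1) by simp
    from FAnd.IH(1)[OF _ k(2) this end_mode_neq] show ?thesis
      using FAnd.prems(1) True unfolding e c by (cases "consistent \<phi> k1"; cases b; cases "k1 ! 0"; cases "k2 ! 0") (simp_all add: l(1) end_mode_neq)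
  next
    case False
    then have n: "scan S (labelled (tokens \<psi>) k2 @ xs) = None" using IH2 FAnd.prems(1) by simp
    have "scan S (ys @ (labelled (tokens \<psi>) k2 @ xs)) = None" for ys by (induction ys) (simp_all add: n)
    then show ?thesis using False unfolding e c by simp
  qed
next
  case (FOr \<phi> \<psi>)
  then obtain b k where l: "l = b # k" "length k = len \<phi> + len \<psi>" by (cases l) auto
  define k1 k2 where "k1 = take (len \<phi>) k" and "k2 = drop (len \<phi>) k"
  have k: "k = k1 @ k2" "length k1 = len \<phi>" "length k2 = len \<psi>" using l by (simp_all add: k1_def k2_def)
  have "k1 \<noteq> []" using k len_pos[of \<phi>] by auto
  then have h: "l ! 1 = k1 ! 0" "l ! (1 + len \<phi>) = k2 ! 0"
    using k len_pos[of \<phi>] len_pos[of \<psi>] by (simp_all add: l nth_append)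
  have e: "labelled (tokens (FOr \<phi> \<psi>)) l @ xs = (Some (TOp OOr), b) # labelled (tokens \<phi>) k1 @ (labelled (tokens \<psi>) k2 @ xs)"
    using k by (simp add: l(1) labelled_Cons labelled_append)
  have c: "consistent (FOr \<phi> \<psi>) l \<longleftrightarrow> b = (k1 ! 0 \<or> k2 ! 0) \<and> consistent \<phi> k1 \<and> consistent \<psi> k2"
    using k(2) unfolding consistent.simps h by (simp add: l(1) k(1))
  note IH2 = FOr.IH(2)[OF _ k(3) FOr.prems(3-5)]
  show ?case
  proof (cases "consistent \<psi> k2")
    case True
    have "scan S (labelled (tokens \<psi>) k2 @ xs) = Some (k2 ! 0 # zs, end_mode \<psi>)" using IH2 True FOr.prems(1) by simp
    from FOr.IH(1)[OF _ k(2) this end_mode_neq] show ?thesis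
      using FOr.prems(1) True unfolding e c by (cases "consistent \<phi> k1"; cases b; cases "k1 ! 0"; cases "k2 ! 0") (simp_all add: l(1) end_mode_neq)
  next
    case False
    then have n: "scan S (labelled (tokens \<psi>) k2 @ xs) = None" using IH2 FOr.prems(1) by simp
    have "scan S (ys @ (labelled (tokens \<psi>) k2 @ xs)) = None" for ys by (induction ys) (simp_all add: n)
    then show ?thesis using False unfolding e c by simp
  qed
next
  case FTrue
  then obtain b where "l = [b]" by (cases l) auto
  then show ?case using FTrue by (simp add: labelled_def)
next
  case FFalse
  then obtain b where "l = [b]" by (cases l) auto
  then show ?case using FFalse by (simp add: labelled_def)
qed

lemma scan_ok_tokens:
  assumes "connectives \<phi> \<subseteq> S" "length l = len \<phi>"
  shows "scan_ok S (labelled (tokens \<phi>) l) \<longleftrightarrow> consistent \<phi> l"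
  using scan_tokens[OF assms, of "[]" "[]" 1] by (auto simp: scan_ok_def labelled_def end_mode_neq split: if_splits)

lemma scan_ok_parses:
  assumes "scan_ok S xs"
  shows "\<exists>\<phi>. map fst xs = map Some (tokens \<phi>) \<and> connectives \<phi> \<subseteq> S"
proof -
  obtain z m where s: "scan S xs = Some ([z], m)" and m: "m \<noteq> 2" "m \<noteq> 3" using assms unfolding scan_ok_def by blast
  obtain ds \<phi>s where p: "map fst xs = map Some (map TDigit ds @ concat (map tokens \<phi>s))"
     "\<forall>\<phi> \<in> set \<phi>s. connectives \<phi> \<subseteq> S" "length \<phi>s = length [z]"
     "if ds = [] then m = 1 \<or> m = 4 else m = (if hd ds then 3 else 2)"
    using scan_parses[OF s] by blast
  obtain \<phi> where "\<phi>s = [\<phi>]" using p(3) by (cases \<phi>s) auto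
  moreover have "ds = []" using p(4) m by (auto split: if_splits)
  ultimately show ?thesis using p(1,2) by auto
qed

subsection \<open>Modal challenges\<close>

definition selectable :: "token option \<Rightarrow> bool \<Rightarrow> bool" where
  "selectable t b \<longleftrightarrow> t = Some (TOp OBox) \<and> \<not> b \<or> t = Some (TOp ODia) \<and> b"

definition clash :: "token option \<Rightarrow> bool \<Rightarrow> bool option \<Rightarrow> bool" where
  "clash t b q \<longleftrightarrow> t = Some (TOp OBox) \<and> b \<and> q = Some False \<or> t = Some (TOp ODia) \<and> \<not> b \<and> q = Some True"

definition unmet :: "token option \<Rightarrow> bool option \<Rightarrow> bool" where
  "unmet t q \<longleftrightarrow> t = Some (TOp OBox) \<and> q = Some True \<or> t = Some (TOp ODia) \<and> q = Some False"

text \<open>In prefix notation the operand of a box or diamond starts one position further right, so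
  the label to be compared is found in the following cell.\<close>

definition next_label :: "cell list \<Rightarrow> bool option" where
  "next_label xs = (case xs of [] \<Rightarrow> None | (t, b, c, p) # _ \<Rightarrow> p)"

text \<open>Of all marked positions that demand a successor only the rightmost one counts, as
  \<open>seen\<close> is false just there. Every list of marks is therefore a legal move and amounts
  to at most one demand, while clashes are checked at all positions.\<close>

fun modal_pass :: "cell list \<Rightarrow> bool \<times> bool" where
  "modal_pass [] = (False, False)"
| "modal_pass ((t, b, c, p) # xs) = (case modal_pass xs of (seen, bad) \<Rightarrow>
     (seen \<or> c \<and> selectable t b,
      bad \<or> clash t b (next_label xs) \<or> c \<and> selectable t b \<and> \<not> seen \<and> unmet t (next_label xs)))"

definition cells :: "token option list \<Rightarrow> bool list \<Rightarrow> bool list \<Rightarrow> bool list option \<Rightarrow> cell list" where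
  "cells ts l c p = map (\<lambda>i. (ts ! i, l ! i, c ! i, map_option (\<lambda>p. p ! i) p)) [0..<length ts]"

definition nth_next :: "cell list \<Rightarrow> nat \<Rightarrow> bool option" where
  "nth_next xs i = (if Suc i < length xs then snd (snd (snd (xs ! Suc i))) else None)"

lemma nth_next_simps: "nth_next (x # xs) (Suc i) = nth_next xs i" "nth_next (x # xs) 0 = next_label xs"
  by (auto simp: nth_next_def next_label_def split: list.split prod.split)

lemma ex_less_Suc: "(\<exists>i < Suc n. P i) \<longleftrightarrow> P 0 \<or> (\<exists>i < n. P (Suc i))"
  using less_Suc_eq_0_disj by auto

definition chosen :: "cell list \<Rightarrow> nat \<Rightarrow> bool" where
  "chosen xs i \<longleftrightarrow> i < length xs \<and> fst (snd (snd (xs ! i))) \<and> selectable (fst (xs ! i)) (fst (snd (xs ! i)))"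

definition clashes :: "cell list \<Rightarrow> bool" where
  "clashes xs \<longleftrightarrow> (\<exists>j < length xs. clash (fst (xs ! j)) (fst (snd (xs ! j))) (nth_next xs j))"

lemma modal_pass_Cons:
  "fst (modal_pass ((t, b, c, p) # xs)) \<longleftrightarrow> fst (modal_pass xs) \<or> c \<and> selectable t b"
  "snd (modal_pass ((t, b, c, p) # xs)) \<longleftrightarrow> snd (modal_pass xs) \<or> clash t b (next_label xs) \<or>
     c \<and> selectable t b \<and> \<not> fst (modal_pass xs) \<and> unmet t (next_label xs)"
  by (simp_all add: case_prod_unfold)

lemma clashes_Cons: "clashes ((t, b, c, p) # xs) \<longleftrightarrow> clash t b (next_label xs) \<or> clashes xs"
  unfolding clashes_def length_Cons ex_less_Suc by (simp add: nth_next_simps)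

lemma chosen_Cons: "chosen ((t, b, c, p) # xs) 0 \<longleftrightarrow> c \<and> selectable t b" "chosen (x # xs) (Suc i) \<longleftrightarrow> chosen xs i"
  by (simp_all add: chosen_def)

lemma modal_pass_seen: "fst (modal_pass xs) \<longleftrightarrow> (\<exists>i. chosen xs i)"
proof (induction xs)
  case Nil
  then show ?case by (simp add: chosen_def)
next
  case (Cons x xs)
  obtain t b c p where x: "x = (t, b, c, p)" by (metis prod_cases4)
  have "(\<exists>i. chosen (x # xs) i) \<longleftrightarrow> chosen (x # xs) 0 \<or> (\<exists>i. chosen (x # xs) (Suc i))"
    by (metis not0_implies_Suc)
  then show ?case using Cons.IH unfolding x chosen_Cons modal_pass_Cons by blast
qed

lemma modal_pass_unseen: "\<not> fst (modal_pass xs) \<Longrightarrow> snd (modal_pass xs) \<longleftrightarrow> clashes xs"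
proof (induction xs)
  case Nil
  then show ?case by (simp add: clashes_def)
next
  case (Cons x xs)
  obtain t b c p where x: "x = (t, b, c, p)" by (metis prod_cases4)
  show ?case using Cons unfolding x modal_pass_Cons clashes_Cons by blast
qed

lemma modal_pass_chosen:
  "fst (modal_pass xs) \<Longrightarrow> \<exists>i. chosen xs i \<and> (\<forall>i'. chosen xs i' \<longrightarrow> i' \<le> i) \<and> (snd (modal_pass xs) \<longleftrightarrow> clashes xs \<or> unmet (fst (xs ! i)) (nth_next xs i))"
proof (induction xs)
  case (Cons x xs)
  obtain t b c p where x: "x = (t, b, c, p)" by (metis prod_cases4)
  show ?case
  proof (cases "fst (modal_pass xs)")
    case True
    then obtain i where i: "chosen xs i" "\<forall>i'. chosen xs i' \<longrightarrow> i' \<le> i" "snd (modal_pass xs) \<longleftrightarrow> clashes xs \<or> unmet (fst (xs ! i)) (nth_next xs i)"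
      using Cons.IH by blast
    have "snd (modal_pass (x # xs)) \<longleftrightarrow> clashes (x # xs) \<or> unmet (fst ((x # xs) ! Suc i)) (nth_next (x # xs) (Suc i))"
      using i(3) True unfolding x modal_pass_Cons clashes_Cons nth_next_simps nth_Cons_Suc by blast
    moreover have "i' \<le> Suc i" if "chosen (x # xs) i'" for i'
      using that i(2) by (cases i') (simp_all add: chosen_Cons(2))
    ultimately show ?thesis using i(1) chosen_Cons(2) by blast
  next
    case False
    then have cs: "c \<and> selectable t b" using Cons.prems unfolding x modal_pass_Cons by blast
    have "snd (modal_pass (x # xs)) \<longleftrightarrow> clashes (x # xs) \<or> unmet (fst ((x # xs) ! 0)) (nth_next (x # xs) 0)"
      using False cs modal_pass_unseen[OF False] unfolding x modal_pass_Cons clashes_Cons nth_next_simps nth_Cons_0 fst_conv by blast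
    moreover have "i' \<le> 0" if "chosen (x # xs) i'" for i'
      using that False unfolding modal_pass_seen by (cases i') (simp_all add: chosen_Cons(2))
    ultimately show ?thesis using cs chosen_Cons(1) x by blast
  qed
qed simp

subsection \<open>Variable challenges\<close>

fun digits :: "token option list \<Rightarrow> bool list" where
  "digits (Some (TDigit d) # ts) = d # digits ts"
| "digits _ = []"

text \<open>
  The state consists of the number of marked variables found so far (at most 2), the name and label of the
  first one, the digits of the current name, and the verdict.
\<close>

fun var_step :: "token option \<Rightarrow> bool \<Rightarrow> bool \<Rightarrow> nat \<times> bool list \<times> bool \<times> bool list \<times> bool \<Rightarrow> nat \<times> bool list \<times> bool \<times> bool list \<times> bool" where
  "var_step (Some (TDigit d)) b c (n, old, lo, cur, bad) =
     (if n = 0 then (n, d # old, lo, cur, bad) else if n = 1 then (n, old, lo, d # cur, bad) else (n, old, lo, cur, bad))"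
| "var_step (Some TVar) b c (n, old, lo, cur, bad) =
     (if n = 0 then (if c then (1, old, b, cur, bad) else (0, [], lo, cur, bad))
      else if n = 1 then (if c then (2, [], lo, [], old = cur \<and> lo \<noteq> b) else (1, old, lo, [], bad))
      else (n, old, lo, cur, bad))"
| "var_step _ b c (n, old, lo, cur, bad) =
     (if n = 0 then (0, [], lo, cur, bad) else if n = 1 then (1, old, lo, [], bad) else (n, old, lo, cur, bad))"

fun var_pass :: "cell list \<Rightarrow> nat \<times> bool list \<times> bool \<times> bool list \<times> bool" where
  "var_pass [] = (0, [], False, [], False)"
| "var_pass ((t, b, c, p) # xs) = var_step t b c (var_pass xs)"

definition var_bad :: "cell list \<Rightarrow> bool" where
  "var_bad xs = snd (snd (snd (snd (var_pass xs))))"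

definition marked_var :: "cell list \<Rightarrow> nat \<Rightarrow> bool" where
  "marked_var xs i \<longleftrightarrow> i < length xs \<and> fst (xs ! i) = Some TVar \<and> fst (snd (snd (xs ! i)))"

definition name_at :: "cell list \<Rightarrow> nat \<Rightarrow> bool list" where
  "name_at xs i = digits (map fst (drop (Suc i) xs))"

definition label_at :: "cell list \<Rightarrow> nat \<Rightarrow> bool" where
  "label_at xs i = fst (snd (xs ! i))"

text \<open>The fourth component is irrelevant to variables but must not contain digits before the first mark.\<close>

definition var_inv :: "cell list \<Rightarrow> nat \<times> bool list \<times> bool \<times> bool list \<times> bool \<Rightarrow> bool" where
  "var_inv xs st \<longleftrightarrow> (case st of (n, old, lo, cur, bad) \<Rightarrow>
     (n = 0 \<and> (\<forall>i. \<not> marked_var xs i) \<and> old = digits (map fst xs) \<and> cur = [] \<and> \<not> bad) \<or>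
     (n = 1 \<and> (\<exists>j. marked_var xs j \<and> (\<forall>j'. marked_var xs j' \<longrightarrow> j' = j) \<and> old = name_at xs j \<and> lo = label_at xs j) \<and>
        cur = digits (map fst xs) \<and> \<not> bad) \<or>
     (n = 2 \<and> (\<exists>i j. i < j \<and> marked_var xs i \<and> marked_var xs j \<and>
        (bad \<longleftrightarrow> name_at xs i = name_at xs j \<and> label_at xs i \<noteq> label_at xs j))))"

lemma var_inv0:
  "\<forall>i. \<not> marked_var xs i \<Longrightarrow> var_inv xs (0, digits (map fst xs), lo, [], False)"
  unfolding var_inv_def by simp

lemma var_inv1:
  assumes "marked_var xs j" "\<And>j'. marked_var xs j' \<Longrightarrow> j' = j"
  shows "var_inv xs (1, name_at xs j, label_at xs j, digits (map fst xs), False)"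
  unfolding var_inv_def prod.case
  by (rule disjI2, rule disjI1) (use assms in blast)

lemma var_inv2:
  assumes "i < j" "marked_var xs i" "marked_var xs j"
    "bad \<longleftrightarrow> name_at xs i = name_at xs j \<and> label_at xs i \<noteq> label_at xs j"
  shows "var_inv xs (2, old, lo, cur, bad)"
  unfolding var_inv_def prod.case
  by (rule disjI2, rule disjI2) (use assms in blast)

lemma marked_var_Cons: "marked_var (x # xs) (Suc i) \<longleftrightarrow> marked_var xs i"
    "marked_var ((t, b, c, p) # xs) 0 \<longleftrightarrow> t = Some TVar \<and> c"
  by (simp_all add: marked_var_def)

lemma name_at_Cons: "name_at (x # xs) (Suc i) = name_at xs i" "name_at (x # xs) 0 = digits (map fst xs)"
  by (simp_all add: name_at_def)

lemma label_at_Cons: "label_at (x # xs) (Suc i) = label_at xs i" "label_at ((t, b, c, p) # xs) 0 = b"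
  by (simp_all add: label_at_def)

lemma ex_nat_Suc: "(\<exists>i. P i) \<longleftrightarrow> P 0 \<or> (\<exists>i. P (Suc i))"
proof
  assume "\<exists>i. P i"
  then obtain i where "P i" by blast
  then show "P 0 \<or> (\<exists>i. P (Suc i))" by (cases i) auto
qed auto

lemma all_nat_Suc: "(\<forall>i. P i) \<longleftrightarrow> P 0 \<and> (\<forall>i. P (Suc i))"
  using ex_nat_Suc[of "\<lambda>i. \<not> P i"] by blast

lemma var_step0:
  "\<not> (t = Some TVar \<and> c) \<Longrightarrow>
    var_step t b c (0, digits ts, lo, [], False) = (0, digits (t # ts), lo, [], False)"
  by (cases "(t, b, c, (0 :: nat, digits ts, lo, [] :: bool list, False))" rule: var_step.cases) simp_all

lemma var_step1:
  "\<not> (t = Some TVar \<and> c) \<Longrightarrow>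
    var_step t b c (1, old, lo, digits ts, False) = (1, old, lo, digits (t # ts), False)"
  by (cases "(t, b, c, (1 :: nat, old, lo, digits ts, False))" rule: var_step.cases) simp_all

lemma var_step2: "var_step t b c (2, old, lo, cur, bad) = (2, old, lo, cur, bad)"
  by (cases "(t, b, c, (2 :: nat, old, lo, cur, bad))" rule: var_step.cases) simp_all

lemma var_inv_Cons:
  assumes "var_inv xs st"
  shows "var_inv ((t, b, c, p) # xs) (var_step t b c st)"
proof -
  obtain n old lo cur bad where st: "st = (n, old, lo, cur, bad)" by (metis prod_cases5)
  let ?xs = "(t, b, c, p) # xs"
  consider (0) "n = 0" "\<forall>i. \<not> marked_var xs i" "old = digits (map fst xs)" "cur = []" "\<not> bad"
    | (1) j where "n = 1" "marked_var xs j" "\<forall>j'. marked_var xs j' \<longrightarrow> j' = j" "old = name_at xs j" "lo = label_at xs j"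
        "cur = digits (map fst xs)" "\<not> bad"
    | (2) i j where "n = 2" "i < j" "marked_var xs i" "marked_var xs j"
        "bad \<longleftrightarrow> name_at xs i = name_at xs j \<and> label_at xs i \<noteq> label_at xs j"
    using assms unfolding var_inv_def st prod.case by blast
  then show ?thesis
  proof cases
    case 0
    have none: "\<not> marked_var ?xs (Suc i)" for i unfolding marked_var_Cons(1) using 0(2) by blast
    show ?thesis
    proof (cases "t = Some TVar \<and> c")
      case True
      then have v: "var_step t b c st = (1, old, b, cur, bad)" using 0(1) st by simp
      have m: "marked_var ?xs 0" unfolding marked_var_Cons(2) by (rule True)
      have u: "j' = 0" if "marked_var ?xs j'" for j' using that none by (cases j') blast+
      have "digits (map fst ?xs) = []" using True by simp
      then have e: "old = digits (map fst xs)" "cur = digits (map fst ?xs)" "bad = False" using 0(3-5) by simp_all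
      show ?thesis using var_inv1[OF m u] unfolding v name_at_Cons label_at_Cons e .
    next
      case False
      then have "\<not> marked_var ?xs 0" unfolding marked_var_Cons(2) .
      then have all: "\<forall>i. \<not> marked_var ?xs i" by (rule iffD2[OF all_nat_Suc, OF conjI]) (intro allI none)
      have "var_step t b c st = (0, digits (map fst ?xs), lo, [], False)"
        using var_step0[OF False, of b "map fst xs" lo] 0(1,3-5) st by simp
      then show ?thesis using var_inv0[OF all] by (simp only:)
    qed
  next
    case 1
    have m: "marked_var ?xs (Suc j)" "old = name_at ?xs (Suc j)" "lo = label_at ?xs (Suc j)"
      unfolding marked_var_Cons(1) name_at_Cons(1) label_at_Cons(1) by (rule 1)+
    show ?thesis
    proof (cases "t = Some TVar \<and> c")
      case True
      then have v: "var_step t b c st = (2, [], lo, [], old = cur \<and> lo \<noteq> b)" using 1(1) st by simp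
      have "marked_var ?xs 0" unfolding marked_var_Cons(2) by (rule True)
      moreover have "(old = cur \<and> lo \<noteq> b) \<longleftrightarrow> name_at ?xs 0 = name_at ?xs (Suc j) \<and> label_at ?xs 0 \<noteq> label_at ?xs (Suc j)"
        unfolding name_at_Cons label_at_Cons 1(4,5,6) by metis
      ultimately show ?thesis unfolding v by (rule var_inv2[OF zero_less_Suc _ m(1)])
    next
      case False
      have u: "j' = Suc j" if "marked_var ?xs j'" for j'
      proof (cases j')
        case 0
        then show ?thesis using that False unfolding 0 marked_var_Cons(2) by blast
      next
        case (Suc i)
        then show ?thesis using that 1(3) unfolding Suc marked_var_Cons(1) by blast
      qed
      have "var_step t b c st = (1, old, lo, digits (map fst ?xs), False)"
        using var_step1[OF False, of b old lo "map fst xs"] 1(1,6,7) st by simp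
      then show ?thesis using var_inv1[OF m(1) u] unfolding m(2,3) by (simp only:)
    qed
  next
    case 2
    have "var_step t b c st = st"
      using var_step2 unfolding st 2(1) .
    moreover have "Suc i < Suc j \<and> marked_var ?xs (Suc i) \<and> marked_var ?xs (Suc j) \<and>
       (bad \<longleftrightarrow> name_at ?xs (Suc i) = name_at ?xs (Suc j) \<and> label_at ?xs (Suc i) \<noteq> label_at ?xs (Suc j))"
      unfolding marked_var_Cons(1) name_at_Cons(1) label_at_Cons(1) using 2(2-5) by blast
    ultimately show ?thesis unfolding st 2(1) using var_inv2[of "Suc i" "Suc j" ?xs bad old lo cur] by (simp only: simp_thms)
  qed
qed

lemma var_inv_pass: "var_inv xs (var_pass xs)"
proof (induction xs)
  case Nil
  show ?case by (simp add: var_inv_def marked_var_def)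
next
  case (Cons x xs)
  then show ?case using var_inv_Cons by (cases x) simp
qed

lemma var_bad_witness:
  assumes "var_bad xs"
  shows "\<exists>i j. marked_var xs i \<and> marked_var xs j \<and> name_at xs i = name_at xs j \<and> label_at xs i \<noteq> label_at xs j"
proof -
  obtain n old lo cur where st: "var_pass xs = (n, old, lo, cur, True)"
    using assms unfolding var_bad_def by (metis prod.collapse)
  show ?thesis using var_inv_pass[of xs] unfolding st var_inv_def prod.case by blast
qed

text \<open>By \<open>var_bad_witness\<close> a correct labelling is never blamed, whatever the
  marks; conversely a conflict is exposed by marking just its two occurrences. As marks are
  quantified universally, these two facts suffice, and a play with more marks may be judged by some
  two of them.\<close>

lemma var_bad_two:
  assumes ij: "i < j" "\<And>i'. marked_var xs i' \<longleftrightarrow> i' = i \<or> i' = j"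
    and d: "name_at xs i = name_at xs j" "label_at xs i \<noteq> label_at xs j"
  shows "var_bad xs"
proof -
  obtain n old lo cur bad where st: "var_pass xs = (n, old, lo, cur, bad)" by (metis prod_cases5)
  have inv: "var_inv xs (n, old, lo, cur, bad)" using var_inv_pass[of xs] unfolding st .
  consider "\<forall>i. \<not> marked_var xs i" | j0 where "\<forall>j'. marked_var xs j' \<longrightarrow> j' = j0"
    | a b where "a < b" "marked_var xs a" "marked_var xs b"
       "bad \<longleftrightarrow> name_at xs a = name_at xs b \<and> label_at xs a \<noteq> label_at xs b"
    using inv unfolding var_inv_def prod.case by blast
  then show ?thesis
  proof cases
    case 1
    then show ?thesis using ij(2) by blast
  next
    case 2
    then have "i = j0" "j = j0" using ij(2) by blast+
    then show ?thesis using ij(1) by simp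
  next
    case 3
    have "a = i \<or> a = j" "b = i \<or> b = j" using 3(2,3) ij(2) by blast+
    then have "a = i" "b = j" using 3(1) ij(1) by auto
    then show ?thesis using 3(4) d unfolding var_bad_def st by simp
  qed
qed

subsection \<open>The value of a play\<close>

text \<open>\<open>r\<close> is the value of the remaining rounds. It counts only if a successor has
  been demanded; otherwise those rounds describe no world.\<close>

definition block_value :: "connective set \<Rightarrow> cell list \<Rightarrow> bool \<Rightarrow> bool" where
  "block_value S xs r \<longleftrightarrow> scan_ok S (map (\<lambda>x. (fst x, fst (snd x))) xs) \<and> \<not> var_bad xs \<and>
     (fst (modal_pass xs) \<longrightarrow> \<not> snd (modal_pass xs) \<and> r)"

text \<open>A play lists, for each round, the labels and the marks that follow them.\<close>

primrec play_value :: "connective set \<Rightarrow> token option list \<Rightarrow> (bool list \<times> bool list) list \<Rightarrow> bool \<times> bool list option" where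
  "play_value S ts [] = (True, None)"
| "play_value S ts (x # rest) =
     (block_value S (cells ts (fst x) (snd x) (snd (play_value S ts rest))) (fst (play_value S ts rest)), Some (fst x))"

fun quantify :: "nat \<Rightarrow> nat \<Rightarrow> ((bool list \<times> bool list) list \<Rightarrow> bool) \<Rightarrow> bool" where
  "quantify N 0 G = G []"
| "quantify N (Suc j) G = (\<exists>T. length T = N \<and> (\<forall>C. length C = N \<longrightarrow> quantify N j (\<lambda>rest. G ((T, C) # rest))))"

lemma quantify_const: "quantify N j (\<lambda>_. A) = A"
proof (induction j)
  case (Suc j)
  have "\<exists>T :: bool list. length T = N" by (rule exI[of _ "replicate N False"]) simp
  then show ?case unfolding quantify.simps Suc by blast
qed simp

lemma quantify_conj: "quantify N j (\<lambda>x. A \<and> G x) \<longleftrightarrow> A \<and> quantify N j G"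
proof (cases A)
  case False
  then show ?thesis using quantify_const[of N j False] by simp
qed simp

lemma quantify_imp: "quantify N j (\<lambda>x. A \<longrightarrow> G x) \<longleftrightarrow> (A \<longrightarrow> quantify N j G)"
proof (cases A)
  case False
  then show ?thesis using quantify_const[of N j True] by simp
qed simp

definition wins :: "connective set \<Rightarrow> token option list \<Rightarrow> nat \<Rightarrow> bool list \<Rightarrow> bool list \<Rightarrow> bool" where
  "wins S ts j T C = quantify (length ts) j (\<lambda>rest. fst (play_value S ts ((T, C) # rest)))"

lemma length_cells [simp]: "length (cells ts T C p) = length ts"
  by (simp add: cells_def)

lemma nth_cells: "i < length ts \<Longrightarrow> cells ts T C p ! i = (ts ! i, T ! i, C ! i, map_option (\<lambda>p. p ! i) p)"
  by (simp add: cells_def)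

lemma cells_labels: "length T = length ts \<Longrightarrow> map (\<lambda>x. (fst x, fst (snd x))) (cells ts T C p) = zip ts T"
  by (rule nth_equalityI) (simp_all add: nth_cells)

lemma var_pass_cong:
  "var_pass xs = var_pass (map (\<lambda>x. (fst x, fst (snd x), fst (snd (snd x)), None)) xs)"
proof (induction xs)
  case (Cons x xs)
  then show ?case by (cases x) simp
qed simp

text \<open>The variable test looks at one world only. Erasing the labels of the next world makes it
  independent of the later rounds, so that it can be pulled out of their quantifiers.\<close>

lemma var_bad_cells: "var_bad (cells ts T C p) = var_bad (cells ts T C None)"
proof -
  have e: "map (\<lambda>x. (fst x, fst (snd x), fst (snd (snd x)), None)) (cells ts T C p)
      = map (\<lambda>x. (fst x, fst (snd x), fst (snd (snd x)), None :: bool option)) (cells ts T C None)"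
    by (simp add: cells_def)
  have "var_pass (cells ts T C p) = var_pass (cells ts T C None)"
    by (rule trans[OF var_pass_cong trans[OF arg_cong[OF e, of var_pass] var_pass_cong[symmetric]]])
  then show ?thesis unfolding var_bad_def by (simp only:)
qed

lemma chosen_cells: "chosen (cells ts T C p) i \<longleftrightarrow> i < length ts \<and> C ! i \<and> selectable (ts ! i) (T ! i)"
  by (auto simp: chosen_def nth_cells)

lemma nth_next_cells:
  "i < length ts \<Longrightarrow> nth_next (cells ts T C (Some P)) i = (if Suc i < length ts then Some (P ! Suc i) else None)"
  by (simp add: nth_next_def nth_cells)

definition no_clash :: "token option list \<Rightarrow> bool list \<Rightarrow> bool list \<Rightarrow> bool" where
  "no_clash ts T P \<longleftrightarrow> (\<forall>i < length ts. \<not> clash (ts ! i) (T ! i) (if Suc i < length ts then Some (P ! Suc i) else None))"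

lemma clashes_cells: "clashes (cells ts T C (Some P)) \<longleftrightarrow> \<not> no_clash ts T P"
  unfolding clashes_def no_clash_def length_cells not_all not_imp not_not
  by (rule ex_cong1, rule conj_cong[OF refl]) (simp only: nth_cells nth_next_cells fst_conv snd_conv)

lemma seen_cells: "fst (modal_pass (cells ts T C p)) \<longleftrightarrow> (\<exists>i. i < length ts \<and> C ! i \<and> selectable (ts ! i) (T ! i))"
  unfolding modal_pass_seen chosen_cells ..

lemma wins_unfold:
  assumes "length T = length ts"
  shows "wins S ts j T C \<longleftrightarrow> scan_ok S (zip ts T) \<and> \<not> var_bad (cells ts T C None) \<and>
    ((\<exists>i. i < length ts \<and> C ! i \<and> selectable (ts ! i) (T ! i)) \<longrightarrow>
      quantify (length ts) j (\<lambda>rest. \<not> snd (modal_pass (cells ts T C (snd (play_value S ts rest)))) \<and> fst (play_value S ts rest)))"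
  unfolding wins_def play_value.simps(2) fst_conv snd_conv block_value_def cells_labels[OF assms]
    var_bad_cells[of ts T C "snd _"] seen_cells quantify_conj quantify_imp ..

lemma wins_Suc:
  assumes "length T = length ts"
  shows "wins S ts (Suc j) T C \<longleftrightarrow> scan_ok S (zip ts T) \<and> \<not> var_bad (cells ts T C None) \<and>
    ((\<exists>i. i < length ts \<and> C ! i \<and> selectable (ts ! i) (T ! i)) \<longrightarrow>
      (\<exists>P. length P = length ts \<and> (\<forall>C'. length C' = length ts \<longrightarrow>
         \<not> snd (modal_pass (cells ts T C (Some P))) \<and> wins S ts j P C')))"
proof -
  have p: "snd (play_value S ts ((P, C') # rest)) = Some P" for P C' rest by simp
  show ?thesis unfolding wins_unfold[OF assms, of S "Suc j"] quantify.simps p quantify_conj wins_def[symmetric] ..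
qed

lemma wins_0:
  assumes "length T = length ts" "scan_ok S (zip ts T)" "\<not> var_bad (cells ts T C None)"
    "\<not> snd (modal_pass (cells ts T C None))"
  shows "wins S ts 0 T C"
  using assms unfolding wins_unfold[OF assms(1)] by simp

subsection \<open>Occurrences of subformulas\<close>

primrec modal_depth :: "fm \<Rightarrow> nat" where
  "modal_depth (Atom n) = 0"
| "modal_depth (NAtom n) = 0"
| "modal_depth (FNeg \<phi>) = modal_depth \<phi>"
| "modal_depth (FAnd \<phi> \<psi>) = max (modal_depth \<phi>) (modal_depth \<psi>)"
| "modal_depth (FOr \<phi> \<psi>) = max (modal_depth \<phi>) (modal_depth \<psi>)"
| "modal_depth (FBox \<phi>) = Suc (modal_depth \<phi>)"
| "modal_depth (FDia \<phi>) = Suc (modal_depth \<phi>)"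
| "modal_depth FTrue = 0"
| "modal_depth FFalse = 0"

lemma modal_depth_less: "modal_depth \<phi> < len \<phi>"
  by (induction \<phi>) (auto simp: var_tokens_def)

primrec labels :: "('w \<times> 'w) set \<Rightarrow> (nat \<Rightarrow> 'w \<Rightarrow> bool) \<Rightarrow> 'w \<Rightarrow> fm \<Rightarrow> bool list" where
  "labels R \<pi> w (Atom n) = \<pi> n w # replicate (length (bin n)) False"
| "labels R \<pi> w (NAtom n) = (\<not> \<pi> n w) # \<pi> n w # replicate (length (bin n)) False"
| "labels R \<pi> w (FNeg \<phi>) = holds R \<pi> w (FNeg \<phi>) # labels R \<pi> w \<phi>"
| "labels R \<pi> w (FAnd \<phi> \<psi>) = holds R \<pi> w (FAnd \<phi> \<psi>) # labels R \<pi> w \<phi> @ labels R \<pi> w \<psi>"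
| "labels R \<pi> w (FOr \<phi> \<psi>) = holds R \<pi> w (FOr \<phi> \<psi>) # labels R \<pi> w \<phi> @ labels R \<pi> w \<psi>"
| "labels R \<pi> w (FBox \<phi>) = holds R \<pi> w (FBox \<phi>) # labels R \<pi> w \<phi>"
| "labels R \<pi> w (FDia \<phi>) = holds R \<pi> w (FDia \<phi>) # labels R \<pi> w \<phi>"
| "labels R \<pi> w FTrue = [True]"
| "labels R \<pi> w FFalse = [False]"

lemma length_labels [simp]: "length (labels R \<pi> w \<phi>) = len \<phi>"
  by (induction \<phi>) (simp_all add: var_tokens_def)

lemma labels_0: "\<exists>l. labels R \<pi> w \<phi> = holds R \<pi> w \<phi> # l"
  by (cases \<phi>) simp_all

lemma nth_labels_0: "labels R \<pi> w \<phi> ! 0 = holds R \<pi> w \<phi>"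
  using labels_0[of R \<pi> w \<phi>] by auto

lemma consistent_labels: "consistent \<phi> (labels R \<pi> w \<phi>)"
  using len_pos by (induction \<phi>) (simp_all add: nth_labels_0 nth_append)

lemma digit_free_append: "digit_free u \<Longrightarrow> digit_free v \<Longrightarrow> digit_free (u @ v)"
  by (cases u rule: digit_free.cases) simp_all

lemma digit_free_tokens': "digit_free (tokens \<phi>)"
  using digit_free_tokens[of \<phi> "[]"] by simp

text \<open>A single \<open>\<psi>\<close> serves all worlds, so labels of different worlds can be
  compared at the same position. \<open>digit_free\<close> keeps the name of a variable from running
  into what follows it.\<close>

lemma occurrence:
  "i < len \<phi> \<Longrightarrow> (\<exists>d. tokens \<phi> ! i = TDigit d) \<or>
     (\<exists>\<psi> u. drop i (tokens \<phi>) = tokens \<psi> @ u \<and> digit_free u \<and> (\<forall>w. \<exists>r. drop i (labels R \<pi> w \<phi>) = labels R \<pi> w \<psi> @ r))"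
proof (induction \<phi> arbitrary: i)
  case (Atom n)
  show ?case
  proof (cases i)
    case 0
    then show ?thesis by (intro disjI2 exI[of _ "Atom n"] exI[of _ "[]"]) simp
  next
    case (Suc j)
    then show ?thesis using Atom by (simp add: var_tokens_def)
  qed
next
  case (NAtom n)
  consider "i = 0" | "i = 1" | j where "i = Suc (Suc j)" by (metis One_nat_def not0_implies_Suc)
  then show ?case
  proof cases
    case 1
    then show ?thesis by (intro disjI2 exI[of _ "NAtom n"] exI[of _ "[]"]) simp
  next
    case 2
    then show ?thesis by (intro disjI2 exI[of _ "Atom n"] exI[of _ "[]"]) simp
  next
    case 3
    then show ?thesis using NAtom by (simp add: var_tokens_def)
  qed
next
  case (FNeg \<phi>)
  show ?case
  proof (cases i)
    case 0
    then show ?thesis by (intro disjI2 exI[of _ "FNeg \<phi>"] exI[of _ "[]"]) simp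
  next
    case (Suc j)
    then show ?thesis using FNeg.IH[of j] FNeg.prems by simp
  qed
next
  case (FBox \<phi>)
  show ?case
  proof (cases i)
    case 0
    then show ?thesis by (intro disjI2 exI[of _ "FBox \<phi>"] exI[of _ "[]"]) simp
  next
    case (Suc j)
    then show ?thesis using FBox.IH[of j] FBox.prems by simp
  qed
next
  case (FDia \<phi>)
  show ?case
  proof (cases i)
    case 0
    then show ?thesis by (intro disjI2 exI[of _ "FDia \<phi>"] exI[of _ "[]"]) simp
  next
    case (Suc j)
    then show ?thesis using FDia.IH[of j] FDia.prems by simp
  qed
next
  case (FAnd \<phi> \<psi>)
  show ?case
  proof (cases i)
    case 0
    then show ?thesis by (intro disjI2 exI[of _ "FAnd \<phi> \<psi>"] exI[of _ "[]"]) simp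
  next
    case (Suc j)
    show ?thesis
    proof (cases "j < len \<phi>")
      case True
      from FAnd.IH(1)[OF this] show ?thesis
      proof (elim disjE exE conjE)
        fix d assume "tokens \<phi> ! j = TDigit d"
        then show ?thesis using Suc True by (simp add: nth_append)
      next
        fix \<chi> u assume o: "drop j (tokens \<phi>) = tokens \<chi> @ u" "digit_free u" "\<forall>w. \<exists>r. drop j (labels R \<pi> w \<phi>) = labels R \<pi> w \<chi> @ r"
        have "\<exists>r. drop i (labels R \<pi> w (FAnd \<phi> \<psi>)) = labels R \<pi> w \<chi> @ r" for w
        proof -
          obtain r where "drop j (labels R \<pi> w \<phi>) = labels R \<pi> w \<chi> @ r" using o(3) by blast
          then show ?thesis using Suc True by simp
        qed
        then show ?thesis using o(1,2) Suc True digit_free_append[OF o(2) digit_free_tokens'[of \<psi>]]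
          by (intro disjI2 exI[of _ \<chi>] exI[of _ "u @ tokens \<psi>"]) simp
      qed
    next
      case False
      then have "j - len \<phi> < len \<psi>" using FAnd.prems Suc by simp
      from FAnd.IH(2)[OF this] show ?thesis using Suc False by (simp add: nth_append)
    qed
  qed
next
  case (FOr \<phi> \<psi>)
  show ?case
  proof (cases i)
    case 0
    then show ?thesis by (intro disjI2 exI[of _ "FOr \<phi> \<psi>"] exI[of _ "[]"]) simp
  next
    case (Suc j)
    show ?thesis
    proof (cases "j < len \<phi>")
      case True
      from FOr.IH(1)[OF this] show ?thesis
      proof (elim disjE exE conjE)
        fix d assume "tokens \<phi> ! j = TDigit d"
        then show ?thesis using Suc True by (simp add: nth_append)
      next
        fix \<chi> u assume o: "drop j (tokens \<phi>) = tokens \<chi> @ u" "digit_free u" "\<forall>w. \<exists>r. drop j (labels R \<pi> w \<phi>) = labels R \<pi> w \<chi> @ r"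
        have "\<exists>r. drop i (labels R \<pi> w (FOr \<phi> \<psi>)) = labels R \<pi> w \<chi> @ r" for w
        proof -
          obtain r where "drop j (labels R \<pi> w \<phi>) = labels R \<pi> w \<chi> @ r" using o(3) by blast
          then show ?thesis using Suc True by simp
        qed
        then show ?thesis using o(1,2) Suc True digit_free_append[OF o(2) digit_free_tokens'[of \<psi>]]
          by (intro disjI2 exI[of _ \<chi>] exI[of _ "u @ tokens \<psi>"]) simp
      qed
    next
      case False
      then have "j - len \<phi> < len \<psi>" using FOr.prems Suc by simp
      from FOr.IH(2)[OF this] show ?thesis using Suc False by (simp add: nth_append)
    qed
  qed
next
  case FTrue
  then show ?case by (intro disjI2 exI[of _ FTrue] exI[of _ "[]"]) simp
next
  case FFalse
  then show ?case by (intro disjI2 exI[of _ FFalse] exI[of _ "[]"]) simp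
qed

lemma digits_tokens: "digit_free u \<Longrightarrow> digits (map Some (map TDigit ds @ u)) = ds"
proof (induction ds)
  case Nil
  then show ?case by (cases u rule: digit_free.cases) simp_all
qed simp

subsection \<open>Winning means satisfiable\<close>

text \<open>Offsets into one whole labelling instead of sublists: the truth lemma relates labellings
  of different worlds position by position.\<close>

primrec consistent_at :: "bool list \<Rightarrow> nat \<Rightarrow> fm \<Rightarrow> bool" where
  "consistent_at T k (Atom n) \<longleftrightarrow> True"
| "consistent_at T k (NAtom n) \<longleftrightarrow> T ! k = (\<not> T ! (k + 1))"
| "consistent_at T k (FNeg \<phi>) \<longleftrightarrow> T ! k = (\<not> T ! (k + 1)) \<and> consistent_at T (k + 1) \<phi>"
| "consistent_at T k (FAnd \<phi> \<psi>) \<longleftrightarrow> T ! k = (T ! (k + 1) \<and> T ! (k + 1 + len \<phi>)) \<and>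
     consistent_at T (k + 1) \<phi> \<and> consistent_at T (k + 1 + len \<phi>) \<psi>"
| "consistent_at T k (FOr \<phi> \<psi>) \<longleftrightarrow> T ! k = (T ! (k + 1) \<or> T ! (k + 1 + len \<phi>)) \<and>
     consistent_at T (k + 1) \<phi> \<and> consistent_at T (k + 1 + len \<phi>) \<psi>"
| "consistent_at T k (FBox \<phi>) \<longleftrightarrow> consistent_at T (k + 1) \<phi>"
| "consistent_at T k (FDia \<phi>) \<longleftrightarrow> consistent_at T (k + 1) \<phi>"
| "consistent_at T k FTrue \<longleftrightarrow> T ! k"
| "consistent_at T k FFalse \<longleftrightarrow> \<not> T ! k"

lemma consistent_consistent_at:
  "k + len \<phi> \<le> length T \<Longrightarrow> consistent \<phi> (take (len \<phi>) (drop k T)) = consistent_at T k \<phi>"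
proof (induction \<phi> arbitrary: k)
  case (NAtom n)
  then show ?case by (simp add: var_tokens_def)
next
  case (FNeg \<phi>)
  then show ?case using len_pos[of \<phi>] by (simp add: tl_take drop_Suc[symmetric] tl_drop)
next
  case (FBox \<phi>)
  then show ?case by (simp add: tl_take drop_Suc[symmetric] tl_drop)
next
  case (FDia \<phi>)
  then show ?case by (simp add: tl_take drop_Suc[symmetric] tl_drop)
next
  case (FAnd \<phi> \<psi>)
  let ?l = "take (len (FAnd \<phi> \<psi>)) (drop k T)"
  have t: "tl ?l = take (len \<phi> + len \<psi>) (drop (k + 1) T)" by (simp add: tl_take drop_Suc[symmetric] tl_drop)
  have "take (len \<phi>) (tl ?l) = take (len \<phi>) (drop (k + 1) T)" unfolding t by simp
  moreover have "drop (len \<phi>) (tl ?l) = take (len \<psi>) (drop (k + 1 + len \<phi>) T)" unfolding t by (simp add: drop_take add.commute)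
  moreover have "?l ! 0 = T ! k" "?l ! 1 = T ! (k + 1)" "?l ! (1 + len \<phi>) = T ! (k + 1 + len \<phi>)"
    using FAnd.prems len_pos[of \<phi>] len_pos[of \<psi>] by simp_all
  ultimately show ?case using FAnd.IH(1)[of "k + 1"] FAnd.IH(2)[of "k + 1 + len \<phi>"] FAnd.prems
    unfolding consistent.simps consistent_at.simps by simp
next
  case (FOr \<phi> \<psi>)
  let ?l = "take (len (FOr \<phi> \<psi>)) (drop k T)"
  have t: "tl ?l = take (len \<phi> + len \<psi>) (drop (k + 1) T)" by (simp add: tl_take drop_Suc[symmetric] tl_drop)
  have "take (len \<phi>) (tl ?l) = take (len \<phi>) (drop (k + 1) T)" unfolding t by simp
  moreover have "drop (len \<phi>) (tl ?l) = take (len \<psi>) (drop (k + 1 + len \<phi>) T)" unfolding t by (simp add: drop_take add.commute)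
  moreover have "?l ! 0 = T ! k" "?l ! 1 = T ! (k + 1)" "?l ! (1 + len \<phi>) = T ! (k + 1 + len \<phi>)"
    using FOr.prems len_pos[of \<phi>] len_pos[of \<psi>] by simp_all
  ultimately show ?case using FOr.IH(1)[of "k + 1"] FOr.IH(2)[of "k + 1 + len \<phi>"] FOr.prems
    unfolding consistent.simps consistent_at.simps by simp
qed simp_all

lemma drop_tokens_nth: "drop k ts = t # us \<Longrightarrow> k < length ts \<and> ts ! k = t \<and> drop (k + 1) ts = us"
  by (metis Cons_nth_drop_Suc Suc_eq_plus1 drop_eq_Nil list.distinct(1) list.inject not_le)

lemma name_at_cells: "length T = length ts \<Longrightarrow> name_at (cells ts T C p) i = digits (drop (Suc i) ts)"
proof -
  assume "length T = length ts"
  have "map fst (cells ts T C p) = ts" by (rule nth_equalityI) (simp_all add: nth_cells)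
  then show ?thesis unfolding name_at_def by (simp add: drop_map[symmetric])
qed

locale game =
  fixes S :: "connective set" and \<phi> :: fm
  assumes conn: "connectives \<phi> \<subseteq> S"
begin

definition ts :: "token option list" where "ts = map Some (tokens \<phi>)"

lemma length_ts [simp]: "length ts = len \<phi>"
  by (simp add: ts_def)

lemma nth_ts: "i < len \<phi> \<Longrightarrow> ts ! i = Some (tokens \<phi> ! i)"
  by (simp add: ts_def)

definition good :: "nat \<Rightarrow> bool list \<Rightarrow> bool" where
  "good j T \<longleftrightarrow> length T = len \<phi> \<and> (\<forall>C. length C = len \<phi> \<longrightarrow> wins S ts j T C)"

lemma good_wins: "good j T \<Longrightarrow> length C = len \<phi> \<Longrightarrow> wins S ts j T C"
  unfolding good_def by blast

lemma good_length: "good j T \<Longrightarrow> length T = len \<phi>"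
  unfolding good_def by blast

lemma good_consistent: "good j T \<Longrightarrow> consistent_at T 0 \<phi>"
proof -
  assume g: "good j T"
  have l: "length T = length ts" using good_length[OF g] by simp
  have "scan_ok S (zip ts T)"
    using good_wins[OF g, of "replicate (len \<phi>) False"] unfolding wins_unfold[OF l] by simp
  then have "consistent \<phi> T" using scan_ok_tokens[OF conn good_length[OF g]] by (simp add: labelled_def ts_def)
  then show ?thesis using consistent_consistent_at[of 0 \<phi> T] good_length[OF g] by simp
qed

text \<open>A good labelling survives every choice of marks, in particular marks on exactly these
  two occurrences.\<close>

lemma good_variables:
  assumes g: "good j T" and i: "i < len \<phi>" "i' < len \<phi>" "tokens \<phi> ! i = TVar" "tokens \<phi> ! i' = TVar"
    and n: "digits (drop (Suc i) ts) = digits (drop (Suc i') ts)"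
  shows "T ! i = T ! i'"
proof -
  have l: "length T = length ts" using good_length[OF g] by simp
  have *: "T ! i = T ! i'" if i: "i < i'" "i < len \<phi>" "i' < len \<phi>" "tokens \<phi> ! i = TVar" "tokens \<phi> ! i' = TVar"
    "digits (drop (Suc i) ts) = digits (drop (Suc i') ts)" for i i'
  proof (rule ccontr)
    assume ne: "T ! i \<noteq> T ! i'"
    define C where "C = map (\<lambda>k. k = i \<or> k = i') [0..<len \<phi>]"
    have "\<not> var_bad (cells ts T C None)"
      using good_wins[OF g, of C] unfolding wins_unfold[OF l] C_def by simp
    moreover have "var_bad (cells ts T C None)"
    proof (rule var_bad_two[OF i(1)])
      show "marked_var (cells ts T C None) k \<longleftrightarrow> k = i \<or> k = i'" for k
        using i by (auto simp: marked_var_def nth_cells C_def nth_ts)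
      show "name_at (cells ts T C None) i = name_at (cells ts T C None) i'"
        unfolding name_at_cells[OF l] by (rule i(6))
      show "label_at (cells ts T C None) i \<noteq> label_at (cells ts T C None) i'"
        using ne i by (simp add: label_at_def nth_cells)
    qed
    ultimately show False by blast
  qed
  show ?thesis using *[of i i'] *[of i' i] i n by (metis nat_neq_iff)
qed

text \<open>Marking only position \<open>k\<close> forces a reply. The reply \<open>P\<close> is
  fixed before the next marks, so it wins against all of them and is good in turn.\<close>

lemma good_challenge:
  assumes g: "good (Suc j) T" and k: "k < len \<phi>" "selectable (ts ! k) (T ! k)"
  shows "\<exists>P. good j P \<and> no_clash ts T P \<and> \<not> unmet (ts ! k) (if Suc k < len \<phi> then Some (P ! Suc k) else None)"
proof -
  have l: "length T = length ts" using good_length[OF g] by simp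
  define C where "C = map (\<lambda>i. i = k) [0..<len \<phi>]"
  have lC: "length C = len \<phi>" "C ! k" using k by (simp_all add: C_def)
  have "\<exists>i. i < length ts \<and> C ! i \<and> selectable (ts ! i) (T ! i)" using k lC by auto
  then obtain P where P: "length P = length ts"
    "\<And>C'. length C' = length ts \<Longrightarrow> \<not> snd (modal_pass (cells ts T C (Some P))) \<and> wins S ts j P C'"
    using good_wins[OF g lC(1)] unfolding wins_Suc[OF l] by blast
  let ?xs = "cells ts T C (Some P)"
  have bad: "\<not> snd (modal_pass ?xs)" using P(2)[of C] lC by simp
  have "fst (modal_pass ?xs)" unfolding seen_cells using k lC by auto
  from modal_pass_chosen[OF this] obtain i where i: "chosen ?xs i" "\<not> (clashes ?xs \<or> unmet (fst (?xs ! i)) (nth_next ?xs i))"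
    using bad by blast
  have "i < len \<phi>" "C ! i" using i(1) unfolding chosen_cells by simp_all
  then have "i = k" by (simp add: C_def)
  moreover have "no_clash ts T P" using i(2) clashes_cells by blast
  moreover have "good j P" using P unfolding good_def by simp
  moreover have "fst (?xs ! k) = ts ! k" using k by (simp add: nth_cells)
  moreover have "nth_next ?xs k = (if Suc k < len \<phi> then Some (P ! Suc k) else None)"
    using k by (simp add: nth_next_cells)
  ultimately show ?thesis using i(2) by (intro exI[of _ P]) simp
qed

text \<open>The number of rounds left is part of a world, so that it can be compared with the modal
  depth. All good labellings without a clash are successors: boxes labelled true and diamonds
  labelled false are respected by \<open>no_clash\<close>, and \<open>good_challenge\<close>
  provides witnesses for the opposite labels.\<close>

definition edges :: "((nat \<times> bool list) \<times> (nat \<times> bool list)) set" where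
  "edges = {((Suc j, T), (j, P)) | j T P. good j P \<and> no_clash ts T P}"

definition valuation :: "nat \<Rightarrow> nat \<times> bool list \<Rightarrow> bool" where
  "valuation n w \<longleftrightarrow> (\<exists>k < len \<phi>. tokens \<phi> ! k = TVar \<and> digits (drop (Suc k) ts) = bin n \<and> snd w ! k)"

text \<open>Induction on the subformula with position and labelling free. Consistency is assumed for
  all good labellings because the modal cases move on to other ones; \<open>digit_free\<close>
  guarantees that the digits after a variable are exactly its name.\<close>

lemma truth:
  "drop k (tokens \<phi>) = tokens \<psi> @ u \<Longrightarrow> digit_free u \<Longrightarrow> (\<And>j T. good j T \<Longrightarrow> consistent_at T k \<psi>) \<Longrightarrow>
    good j T \<Longrightarrow> modal_depth \<psi> \<le> j \<Longrightarrow> holds edges valuation (j, T) \<psi> \<longleftrightarrow> T ! k"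
proof (induction \<psi> arbitrary: k u j T)
  case (Atom n)
  have k: "k < len \<phi>" "tokens \<phi> ! k = TVar" "drop (k + 1) (tokens \<phi>) = map TDigit (bin n) @ u"
    using drop_tokens_nth[of k "tokens \<phi>" TVar] Atom.prems(1) by (simp_all add: var_tokens_def)
  have n: "digits (drop (Suc k) ts) = bin n"
    using digits_tokens[OF Atom.prems(2), of "bin n"] k(3) by (simp add: ts_def drop_map)
  show ?case
  proof
    assume "holds edges valuation (j, T) (Atom n)"
    then obtain k' where k': "k' < len \<phi>" "tokens \<phi> ! k' = TVar" "digits (drop (Suc k') ts) = bin n" "T ! k'"
      by (auto simp: valuation_def)
    have "T ! k' = T ! k" by (rule good_variables[OF Atom.prems(4) k'(1) k(1) k'(2) k(2)]) (simp only: k'(3) n)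
    then show "T ! k" using k'(4) by simp
  next
    assume "T ! k"
    then show "holds edges valuation (j, T) (Atom n)" using k n by (auto simp: valuation_def)
  qed
next
  case (NAtom n)
  have k: "k < len \<phi>" "drop (k + 1) (tokens \<phi>) = var_tokens n @ u"
    using drop_tokens_nth[of k "tokens \<phi>" "TOp OAtNeg"] NAtom.prems(1) by simp_all
  then have k': "k + 1 < len \<phi>" "tokens \<phi> ! (k + 1) = TVar" "drop (k + 1 + 1) (tokens \<phi>) = map TDigit (bin n) @ u"
    using drop_tokens_nth[of "k + 1" "tokens \<phi>" TVar] by (simp_all add: var_tokens_def)
  have n: "digits (drop (Suc (k + 1)) ts) = bin n"
    using digits_tokens[OF NAtom.prems(2), of "bin n"] k'(3) by (simp add: ts_def drop_map)
  have "valuation n (j, T) \<longleftrightarrow> T ! (k + 1)"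
  proof
    assume "valuation n (j, T)"
    then obtain i where i: "i < len \<phi>" "tokens \<phi> ! i = TVar" "digits (drop (Suc i) ts) = bin n" "T ! i"
      by (auto simp: valuation_def)
    have "T ! i = T ! (k + 1)" by (rule good_variables[OF NAtom.prems(4) i(1) k'(1) i(2) k'(2)]) (simp only: i(3) n)
    then show "T ! (k + 1)" using i(4) by simp
  next
    assume "T ! (k + 1)"
    then show "valuation n (j, T)" using k' n unfolding valuation_def by (intro exI[of _ "k + 1"]) simp
  qed
  then show ?case using NAtom.prems(3)[OF NAtom.prems(4)] by simp
next
  case (FNeg \<psi>)
  have k: "drop (k + 1) (tokens \<phi>) = tokens \<psi> @ u"
    using drop_tokens_nth[of k "tokens \<phi>" "TOp ONeg"] FNeg.prems(1) by simp
  have "holds edges valuation (j, T) \<psi> \<longleftrightarrow> T ! (k + 1)"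
    by (rule FNeg.IH[OF k FNeg.prems(2) _ FNeg.prems(4)]) (use FNeg.prems(3,5) in simp_all)
  then show ?case using FNeg.prems(3)[OF FNeg.prems(4)] by simp
next
  case (FAnd \<psi> \<chi>)
  have k: "drop (k + 1) (tokens \<phi>) = tokens \<psi> @ (tokens \<chi> @ u)"
    using drop_tokens_nth[of k "tokens \<phi>" "TOp OAnd"] FAnd.prems(1) by simp
  have "drop (k + 1 + len \<psi>) (tokens \<phi>) = drop (len \<psi>) (drop (k + 1) (tokens \<phi>))" by (simp add: add.commute)
  then have k2: "drop (k + 1 + len \<psi>) (tokens \<phi>) = tokens \<chi> @ u" unfolding k by simp
  have "holds edges valuation (j, T) \<psi> \<longleftrightarrow> T ! (k + 1)"
    by (rule FAnd.IH(1)[OF k digit_free_tokens _ FAnd.prems(4)]) (use FAnd.prems(3,5) in simp_all)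
  moreover have "holds edges valuation (j, T) \<chi> \<longleftrightarrow> T ! (k + 1 + len \<psi>)"
    by (rule FAnd.IH(2)[OF k2 FAnd.prems(2) _ FAnd.prems(4)]) (use FAnd.prems(3,5) in simp_all)
  ultimately show ?case using FAnd.prems(3)[OF FAnd.prems(4)] by simp
next
  case (FOr \<psi> \<chi>)
  have k: "drop (k + 1) (tokens \<phi>) = tokens \<psi> @ (tokens \<chi> @ u)"
    using drop_tokens_nth[of k "tokens \<phi>" "TOp OOr"] FOr.prems(1) by simp
  have "drop (k + 1 + len \<psi>) (tokens \<phi>) = drop (len \<psi>) (drop (k + 1) (tokens \<phi>))" by (simp add: add.commute)
  then have k2: "drop (k + 1 + len \<psi>) (tokens \<phi>) = tokens \<chi> @ u" unfolding k by simp
  have "holds edges valuation (j, T) \<psi> \<longleftrightarrow> T ! (k + 1)"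
    by (rule FOr.IH(1)[OF k digit_free_tokens _ FOr.prems(4)]) (use FOr.prems(3,5) in simp_all)
  moreover have "holds edges valuation (j, T) \<chi> \<longleftrightarrow> T ! (k + 1 + len \<psi>)"
    by (rule FOr.IH(2)[OF k2 FOr.prems(2) _ FOr.prems(4)]) (use FOr.prems(3,5) in simp_all)
  ultimately show ?case using FOr.prems(3)[OF FOr.prems(4)] by simp
next
  case (FBox \<psi>)
  have k: "k < len \<phi>" "tokens \<phi> ! k = TOp OBox" "drop (k + 1) (tokens \<phi>) = tokens \<psi> @ u"
    using drop_tokens_nth[of k "tokens \<phi>" "TOp OBox"] FBox.prems(1) by simp_all
  have k1: "Suc k < len \<phi>" using k(3) len_pos[of \<psi>] by (metis Suc_eq_plus1 append_is_Nil_conv drop_eq_Nil length_greater_0_conv not_le)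
  obtain i where j: "j = Suc i" using FBox.prems(5) by (cases j) auto
  have IH: "holds edges valuation (i, P) \<psi> \<longleftrightarrow> P ! Suc k" if "good i P" for P
    using FBox.IH[OF k(3) FBox.prems(2) _ that] FBox.prems(3,5) j by simp
  show ?case
  proof
    assume h: "holds edges valuation (j, T) (FBox \<psi>)"
    show "T ! k"
    proof (rule ccontr)
      assume "\<not> T ! k"
      then have "selectable (ts ! k) (T ! k)" using k nth_ts by (simp add: selectable_def)
      then obtain P where P: "good i P" "no_clash ts T P" "\<not> unmet (ts ! k) (if Suc k < len \<phi> then Some (P ! Suc k) else None)"
        using good_challenge[OF FBox.prems(4)[unfolded j] k(1)] by blast
      have "\<not> P ! Suc k" using P(3) k1 k nth_ts by (auto simp: unmet_def)
      moreover have "((j, T), (i, P)) \<in> edges" using P j by (auto simp: edges_def)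
      ultimately show False using h IH[OF P(1)] by auto
    qed
  next
    assume t: "T ! k"
    have "holds edges valuation (i, P) \<psi>" if "good i P" "no_clash ts T P" for P
    proof -
      have "\<not> clash (ts ! k) (T ! k) (Some (P ! Suc k))"
        using that(2)[unfolded no_clash_def, rule_format, of k] k(1) k1 by simp
      then have "P ! Suc k" using t k nth_ts by (auto simp: clash_def)
      then show ?thesis using IH[OF that(1)] by simp
    qed
    then show "holds edges valuation (j, T) (FBox \<psi>)" by (auto simp: edges_def j)
  qed
next
  case (FDia \<psi>)
  have k: "k < len \<phi>" "tokens \<phi> ! k = TOp ODia" "drop (k + 1) (tokens \<phi>) = tokens \<psi> @ u"
    using drop_tokens_nth[of k "tokens \<phi>" "TOp ODia"] FDia.prems(1) by simp_all
  have k1: "Suc k < len \<phi>" using k(3) len_pos[of \<psi>] by (metis Suc_eq_plus1 append_is_Nil_conv drop_eq_Nil length_greater_0_conv not_le)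
  obtain i where j: "j = Suc i" using FDia.prems(5) by (cases j) auto
  have IH: "holds edges valuation (i, P) \<psi> \<longleftrightarrow> P ! Suc k" if "good i P" for P
    using FDia.IH[OF k(3) FDia.prems(2) _ that] FDia.prems(3,5) j by simp
  show ?case
  proof
    assume "holds edges valuation (j, T) (FDia \<psi>)"
    then obtain P where P: "good i P" "no_clash ts T P" "holds edges valuation (i, P) \<psi>" by (auto simp: edges_def j)
    then have p: "P ! Suc k" using IH by simp
    have "\<not> clash (ts ! k) (T ! k) (Some (P ! Suc k))"
      using P(2)[unfolded no_clash_def, rule_format, of k] k(1) k1 by simp
    then show "T ! k" using p k nth_ts by (auto simp: clash_def)
  next
    assume "T ! k"
    then have "selectable (ts ! k) (T ! k)" using k nth_ts by (simp add: selectable_def)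
    then obtain P where P: "good i P" "no_clash ts T P" "\<not> unmet (ts ! k) (if Suc k < len \<phi> then Some (P ! Suc k) else None)"
      using good_challenge[OF FDia.prems(4)[unfolded j] k(1)] by blast
    have "P ! Suc k" using P(3) k1 k nth_ts by (auto simp: unmet_def)
    moreover have "((j, T), (i, P)) \<in> edges" using P j by (auto simp: edges_def)
    ultimately show "holds edges valuation (j, T) (FDia \<psi>)" using IH[OF P(1)] by auto
  qed
next
  case FTrue
  then show ?case using FTrue.prems(3)[OF FTrue.prems(4)] by simp
next
  case FFalse
  then show ?case using FFalse.prems(3)[OF FFalse.prems(4)] by simp
qed

lemma good_satisfiable:
  assumes "good (len \<phi> - 1) T" "T ! 0"
  shows "satisfiable \<phi>"
proof -
  have "holds edges valuation (len \<phi> - 1, T) \<phi> \<longleftrightarrow> T ! 0"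
    by (rule truth[where u="[]"]) (use good_consistent assms(1) modal_depth_less[of \<phi>] in simp_all)
  then have h: "holds edges valuation (len \<phi> - 1, T) \<phi>" using assms(2) by simp
  have "kripke_frame UNIV edges" by (simp add: kripke_frame_def)
  then have "satisfiable_over TYPE(nat \<times> bool list) \<phi>"
    unfolding satisfiable_over_def using h UNIV_I by blast
  then show ?thesis by (rule satisfiable_if_satisfiable_over)
qed

section \<open>A model as a winning strategy\<close>

lemma at_modal:
  assumes i: "i < len \<phi>" and t: "tokens \<phi> ! i = TOp c" "c = OBox \<or> c = ODia"
  shows "Suc i < len \<phi> \<and> (\<exists>\<psi>. \<forall>w. labels R \<pi> w \<phi> ! i = holds R \<pi> w (if c = OBox then FBox \<psi> else FDia \<psi>) \<and>
      labels R \<pi> w \<phi> ! Suc i = holds R \<pi> w \<psi>)"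
proof -
  obtain \<chi> u where o: "drop i (tokens \<phi>) = tokens \<chi> @ u" "\<And>w. \<exists>r. drop i (labels R \<pi> w \<phi>) = labels R \<pi> w \<chi> @ r"
    using occurrence[OF i, of R \<pi>] t(1) by (metis token.distinct(3))
  have "\<exists>us. tokens \<chi> = TOp c # us"
    using o(1) t(1) i len_pos[of \<chi>] by (metis Cons_nth_drop_Suc append_Cons length_greater_0_conv list.exhaust list.inject)
  then obtain \<psi> where \<psi>: "\<chi> = (if c = OBox then FBox \<psi> else FDia \<psi>)" "tokens \<chi> = TOp c # tokens \<psi>"
    using t(2) by (cases \<chi>) (auto simp: var_tokens_def)
  have "Suc 0 \<le> len \<psi>" by (rule Suc_leI[OF len_pos])
  then have "length (drop i (tokens \<phi>)) \<ge> 2" unfolding o(1) \<psi>(2) length_append list.size by linarith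
  then have s: "Suc i < len \<phi>" by simp
  have "labels R \<pi> w \<phi> ! i = holds R \<pi> w \<chi> \<and> labels R \<pi> w \<phi> ! Suc i = holds R \<pi> w \<psi>" for w
  proof -
    obtain r where r: "drop i (labels R \<pi> w \<phi>) = labels R \<pi> w \<chi> @ r" using o(2) by blast
    obtain l where l: "labels R \<pi> w \<psi> = holds R \<pi> w \<psi> # l" using labels_0[of R \<pi> w \<psi>] by blast
    have "labels R \<pi> w \<chi> = holds R \<pi> w \<chi> # labels R \<pi> w \<psi>" unfolding \<psi>(1) by (cases "c = OBox") simp_all
    then have d: "drop i (labels R \<pi> w \<phi>) = holds R \<pi> w \<chi> # holds R \<pi> w \<psi> # (l @ r)"
      unfolding r l by (simp only: append_Cons)
    have n: "i \<le> length (labels R \<pi> w \<phi>)" using i by simp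
    have "labels R \<pi> w \<phi> ! i = drop i (labels R \<pi> w \<phi>) ! 0" "labels R \<pi> w \<phi> ! Suc i = drop i (labels R \<pi> w \<phi>) ! 1"
      unfolding nth_drop[OF n] by simp_all
    then show ?thesis unfolding d by simp
  qed
  note l = this
  show ?thesis by (intro conjI s exI[of _ \<psi>] allI) (simp_all only: \<psi>(1)[symmetric] l)
qed

lemma at_variable:
  assumes i: "i < len \<phi>" and t: "tokens \<phi> ! i = TVar"
  shows "\<exists>n. digits (drop (Suc i) ts) = bin n \<and> labels R \<pi> w \<phi> ! i = \<pi> n w"
proof -
  obtain \<chi> u where o: "drop i (tokens \<phi>) = tokens \<chi> @ u" "digit_free u" "\<exists>r. drop i (labels R \<pi> w \<phi>) = labels R \<pi> w \<chi> @ r"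
    using occurrence[OF i, of R \<pi>] t(1) by (metis token.distinct(5))
  have "\<exists>us. tokens \<chi> = TVar # us"
    using o(1) t(1) i len_pos[of \<chi>] by (metis Cons_nth_drop_Suc append_Cons length_greater_0_conv list.exhaust list.inject)
  then obtain n where n: "\<chi> = Atom n" by (cases \<chi>) (auto simp: var_tokens_def)
  have "drop (i + 1) (tokens \<phi>) = map TDigit (bin n) @ u"
    using drop_tokens_nth[of i "tokens \<phi>" TVar] o(1) n by (simp add: var_tokens_def)
  then have "digits (drop (Suc i) ts) = bin n" using digits_tokens[OF o(2), of "bin n"] by (simp add: ts_def drop_map)
  moreover obtain r where "drop i (labels R \<pi> w \<phi>) = \<pi> n w # r" using o(3) n by auto
  then have "labels R \<pi> w \<phi> ! i = \<pi> n w" using i by (metis length_labels less_imp_le_nat nth_drop add.right_neutral nth_Cons_0)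
  ultimately show ?thesis by blast
qed

lemma labels_no_clash:
  assumes wv: "(w, v) \<in> R"
  shows "no_clash ts (labels R \<pi> w \<phi>) (labels R \<pi> v \<phi>)"
  unfolding no_clash_def
proof (intro allI impI)
  fix i assume "i < length ts"
  then have i: "i < len \<phi>" by simp
  show "\<not> clash (ts ! i) (labels R \<pi> w \<phi> ! i) (if Suc i < length ts then Some (labels R \<pi> v \<phi> ! Suc i) else None)"
  proof (cases "\<exists>c. tokens \<phi> ! i = TOp c \<and> (c = OBox \<or> c = ODia)")
    case True
    then obtain c where c: "tokens \<phi> ! i = TOp c" "c = OBox \<or> c = ODia" by blast
    obtain \<psi> where s: "Suc i < len \<phi>" and "labels R \<pi> w \<phi> ! i = holds R \<pi> w (if c = OBox then FBox \<psi> else FDia \<psi>)"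
      "labels R \<pi> v \<phi> ! Suc i = holds R \<pi> v \<psi>" using at_modal[OF i c, of R \<pi>] by blast
    then show ?thesis using c wv nth_ts[OF i] by (auto simp: clash_def)
  next
    case False
    then show ?thesis using nth_ts[OF i] by (auto simp: clash_def)
  qed
qed

lemma labels_challenge:
  assumes i: "i < len \<phi>" and s: "selectable (ts ! i) (labels R \<pi> w \<phi> ! i)"
  shows "\<exists>v. (w, v) \<in> R \<and> \<not> unmet (ts ! i) (if Suc i < len \<phi> then Some (labels R \<pi> v \<phi> ! Suc i) else None)"
proof -
  obtain c where c: "tokens \<phi> ! i = TOp c" "c = OBox \<or> c = ODia"
    using s nth_ts[OF i] by (auto simp: selectable_def)
  obtain \<psi> where si: "Suc i < len \<phi>" and l: "\<And>w. labels R \<pi> w \<phi> ! i = holds R \<pi> w (if c = OBox then FBox \<psi> else FDia \<psi>)"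
      "\<And>v. labels R \<pi> v \<phi> ! Suc i = holds R \<pi> v \<psi>" using at_modal[OF i c, of R \<pi>] by blast
  show ?thesis
  proof (cases "c = OBox")
    case True
    then have "\<not> holds R \<pi> w (FBox \<psi>)" using s c l(1)[of w] nth_ts[OF i] by (simp add: selectable_def)
    then obtain v where "(w, v) \<in> R" "\<not> holds R \<pi> v \<psi>" by auto
    then show ?thesis using True c si l(2)[of v] nth_ts[OF i] by (intro exI[of _ v]) (simp add: unmet_def)
  next
    case False
    then have "holds R \<pi> w (FDia \<psi>)" using s c l(1)[of w] nth_ts[OF i] by (simp add: selectable_def)
    then obtain v where "(w, v) \<in> R" "holds R \<pi> v \<psi>" by auto
    then show ?thesis using False c si l(2)[of v] nth_ts[OF i] by (intro exI[of _ v]) (simp add: unmet_def)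
  qed
qed

lemma labels_scan: "scan_ok S (zip ts (labels R \<pi> w \<phi>))"
  using scan_ok_tokens[OF conn, of "labels R \<pi> w \<phi>"] consistent_labels[of \<phi> R \<pi> w] by (simp add: labelled_def ts_def)

lemma labels_var: "\<not> var_bad (cells ts (labels R \<pi> w \<phi>) C None)"
proof
  let ?xs = "cells ts (labels R \<pi> w \<phi>) C None"
  assume "var_bad ?xs"
  then obtain i j where ij: "marked_var ?xs i" "marked_var ?xs j" "name_at ?xs i = name_at ?xs j" "label_at ?xs i \<noteq> label_at ?xs j"
    using var_bad_witness by blast
  have m: "k < len \<phi> \<and> tokens \<phi> ! k = TVar \<and> label_at ?xs k = labels R \<pi> w \<phi> ! k" if "marked_var ?xs k" for k
    using that by (auto simp: marked_var_def nth_cells nth_ts label_at_def)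
  have l: "length (labels R \<pi> w \<phi>) = length ts" by simp
  obtain n where n: "digits (drop (Suc i) ts) = bin n" "labels R \<pi> w \<phi> ! i = \<pi> n w"
    using at_variable[of i R \<pi> w] m[OF ij(1)] by blast
  obtain n' where n': "digits (drop (Suc j) ts) = bin n'" "labels R \<pi> w \<phi> ! j = \<pi> n' w"
    using at_variable[of j R \<pi> w] m[OF ij(2)] by blast
  have "bin n = bin n'" using ij(3) n n' unfolding name_at_cells[OF l] by simp
  then have "n = n'" by (rule bin_inj)
  then show False using ij(4) m[OF ij(1)] m[OF ij(2)] n n' by simp
qed

text \<open>The truth values at a world win from there: a demand is answered by the truth values at
  a witnessing successor. When no rounds are left there are no next labels, so neither
  \<open>clash\<close> nor \<open>unmet\<close> can occur.\<close>

lemma labels_win: "length C = len \<phi> \<Longrightarrow> wins S ts j (labels R \<pi> w \<phi>) C"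
proof (induction j arbitrary: w C)
  case 0
  have l: "length (labels R \<pi> w \<phi>) = length ts" by simp
  have no: "nth_next (cells ts (labels R \<pi> w \<phi>) C None) i = None" for i
    by (simp add: nth_next_def nth_cells)
  have "\<not> snd (modal_pass (cells ts (labels R \<pi> w \<phi>) C None))"
  proof -
    have "\<not> clashes (cells ts (labels R \<pi> w \<phi>) C None)" unfolding clashes_def no by (simp add: clash_def)
    moreover have "\<not> unmet t None" for t by (simp add: unmet_def)
    ultimately show ?thesis using modal_pass_unseen modal_pass_chosen no by metis
  qed
  then show ?case by (rule wins_0[OF l labels_scan labels_var])
next
  case (Suc j)
  let ?T = "labels R \<pi> w \<phi>"
  have l: "length ?T = length ts" by simp
  have "\<exists>P. length P = length ts \<and> (\<forall>C'. length C' = length ts \<longrightarrow>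
         \<not> snd (modal_pass (cells ts ?T C (Some P))) \<and> wins S ts j P C')"
    if sel: "\<exists>i. i < length ts \<and> C ! i \<and> selectable (ts ! i) (?T ! i)"
  proof -
    have seen: "fst (modal_pass (cells ts ?T C p))" for p unfolding seen_cells by (rule sel)
    \<comment> \<open>\<open>chosen\<close> depends on labels and marks only, so the decisive
      position is known before the labels of the successor are fixed; \<open>None\<close> stands in
      for them.\<close>
    obtain k where k: "chosen (cells ts ?T C None) k" "\<forall>i'. chosen (cells ts ?T C None) i' \<longrightarrow> i' \<le> k"
      using modal_pass_chosen[OF seen] by blast
    then have k': "k < len \<phi>" "selectable (ts ! k) (?T ! k)" unfolding chosen_cells by simp_all
    obtain v where v: "(w, v) \<in> R" "\<not> unmet (ts ! k) (if Suc k < len \<phi> then Some (labels R \<pi> v \<phi> ! Suc k) else None)"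
      using labels_challenge[OF k'] by blast
    let ?P = "labels R \<pi> v \<phi>"
    let ?xs = "cells ts ?T C (Some ?P)"
    obtain i where i: "chosen ?xs i" "\<forall>i'. chosen ?xs i' \<longrightarrow> i' \<le> i"
      "snd (modal_pass ?xs) \<longleftrightarrow> clashes ?xs \<or> unmet (fst (?xs ! i)) (nth_next ?xs i)"
      using modal_pass_chosen[OF seen] by blast
    have "i = k" using i(1,2) k unfolding chosen_cells by (intro antisym) blast+
    moreover have "\<not> clashes ?xs" using labels_no_clash[OF v(1)] clashes_cells by blast
    moreover have "nth_next ?xs k = (if Suc k < len \<phi> then Some (?P ! Suc k) else None)" "fst (?xs ! k) = ts ! k"
      using k'(1) by (simp_all add: nth_next_cells nth_cells)
    ultimately have "\<not> snd (modal_pass ?xs)" using i(3) v(2) by simp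
    then show ?thesis using Suc.IH[of _ v] by (intro exI[of _ ?P]) simp
  qed
  note sel = this
  show ?case unfolding wins_Suc[OF l] by (intro conjI impI labels_scan labels_var sel)
qed

lemma satisfiable_good:
  assumes "satisfiable \<phi>"
  shows "\<exists>T. good (len \<phi> - 1) T \<and> T ! 0"
proof -
  obtain R :: "(nat \<times> nat) set" and \<pi> w where h: "holds R \<pi> w \<phi>"
    using assms unfolding satisfiable_def satisfiable_over_def by blast
  have "good (len \<phi> - 1) (labels R \<pi> w \<phi>)" unfolding good_def by (intro conjI allI impI length_labels labels_win)
  then show ?thesis using h by (intro exI[of _ "labels R \<pi> w \<phi>"]) (simp add: nth_labels_0)
qed

end

theorem play_satisfiable:
  "quantify (length us) (length us) (\<lambda>play. fst (play_value S us play) \<and> play \<noteq> [] \<and> fst (hd play) ! 0) \<longleftrightarrow>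
    (\<exists>\<phi>. us = map Some (tokens \<phi>) \<and> connectives \<phi> \<subseteq> S \<and> satisfiable \<phi>)"
proof (cases us)
  case Nil
  have "us \<noteq> map Some (tokens \<phi>)" for \<phi> using Nil len_pos[of \<phi>] by auto
  then show ?thesis by (simp add: Nil)
next
  case (Cons u us')
  obtain j where j: "length us = Suc j" using Cons by simp
  have e: "(fst (play_value S us ((T, C) # rest)) \<and> (T, C) # rest \<noteq> [] \<and> fst (hd ((T, C) # rest)) ! 0)
      \<longleftrightarrow> T ! 0 \<and> fst (play_value S us ((T, C) # rest))" for T C rest by auto
  have q: "quantify (length us) (length us) (\<lambda>play. fst (play_value S us play) \<and> play \<noteq> [] \<and> fst (hd play) ! 0) \<longleftrightarrow>
      (\<exists>T. length T = length us \<and> (\<forall>C. length C = length us \<longrightarrow> T ! 0 \<and> wins S us j T C))"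
    unfolding j quantify.simps e quantify_conj unfolding wins_def j ..
  show ?thesis
  proof
    assume "quantify (length us) (length us) (\<lambda>play. fst (play_value S us play) \<and> play \<noteq> [] \<and> fst (hd play) ! 0)"
    then obtain T where T: "length T = length us" "\<And>C. length C = length us \<Longrightarrow> T ! 0 \<and> wins S us j T C"
      unfolding q by blast
    have w: "wins S us j T (replicate (length us) False)" "T ! 0" using T(2)[of "replicate (length us) False"] by simp_all
    have "scan_ok S (zip us T)" using w(1) unfolding wins_unfold[OF T(1)] by blast
    then obtain \<phi> where \<phi>: "map fst (zip us T) = map Some (tokens \<phi>)" "connectives \<phi> \<subseteq> S"
      using scan_ok_parses by blast
    have us: "us = map Some (tokens \<phi>)" using \<phi>(1) T(1) by simp
    interpret game S \<phi> by unfold_locales (rule \<phi>(2))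
    have "good j T" unfolding good_def ts_def us[symmetric] using T us by simp
    moreover have "j = len \<phi> - 1" using j us by simp
    ultimately have "satisfiable \<phi>" using good_satisfiable w(2) by blast
    then show "\<exists>\<phi>. us = map Some (tokens \<phi>) \<and> connectives \<phi> \<subseteq> S \<and> satisfiable \<phi>" using us \<phi>(2) by blast
  next
    assume "\<exists>\<phi>. us = map Some (tokens \<phi>) \<and> connectives \<phi> \<subseteq> S \<and> satisfiable \<phi>"
    then obtain \<phi> where us: "us = map Some (tokens \<phi>)" and \<phi>: "connectives \<phi> \<subseteq> S" "satisfiable \<phi>" by blast
    interpret game S \<phi> by unfold_locales (rule \<phi>(1))
    obtain T where "good (len \<phi> - 1) T" "T ! 0" using satisfiable_good[OF \<phi>(2)] by blast
    moreover have "j = len \<phi> - 1" using j us by simp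
    ultimately show "quantify (length us) (length us) (\<lambda>play. fst (play_value S us play) \<and> play \<noteq> [] \<and> fst (hd play) ! 0)"
      unfolding q good_def ts_def us[symmetric] using us by auto
  qed
qed

section \<open>Evaluating quantified bits in polynomial space\<close>

text \<open>Here \<open>False\<close> is an existential and \<open>True\<close> a universal quantifier, outermost first. The bits
  are stacked, so the innermost one comes first.\<close>

fun quant_value :: "bool list \<Rightarrow> (bool list \<Rightarrow> bool) \<Rightarrow> bool list \<Rightarrow> bool" where
  "quant_value [] F ys = F ys"
| "quant_value (q # qs) F ys =
     (if q then \<forall>b. quant_value qs F (b # ys) else \<exists>b. quant_value qs F (b # ys))"

text \<open>The assignment to be tried after the value \<open>v\<close> was obtained: the innermost bit that is still
  unset and whose quantifier is not yet decided by \<open>v\<close> is set, and the bits inside it are cleared.\<close>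

fun next_bits :: "bool \<Rightarrow> bool list \<Rightarrow> bool list \<Rightarrow> bool list option" where
  "next_bits v (q # qs) (b # ys) =
     (if \<not> b \<and> v = q then Some (True # ys) else map_option ((#) False) (next_bits v qs ys))"
| "next_bits v _ _ = None"

abbreviation follows :: "(bool list \<Rightarrow> bool) \<Rightarrow> bool list \<Rightarrow> (bool list \<times> bool list) set" where
  "follows F qs \<equiv> {(y, y'). next_bits (F y) qs y = Some y'}"

text \<open>The value at the last assignment visited within a block of quantifiers equals the value
  of the block. Hence no intermediate results are stored: this value alone tells whether the next
  outer quantifier is decided. \<open>low\<close> holds the quantifiers outside the block, and the
  last equation says that the counter then advances only there, with the block cleared.\<close>

lemma follows_quant_value:
  "\<exists>y. (replicate (length us) False @ ys, y) \<in> (follows F (rev us @ low))\<^sup>* \<and> F y = quant_value us F ys \<and>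
     next_bits (F y) (rev us @ low) y = map_option ((@) (replicate (length us) False)) (next_bits (F y) low ys)"
proof (induction us arbitrary: ys low)
  case Nil
  then show ?case by (intro exI[of _ ys]) (simp add: map_option.identity[unfolded id_def])
next
  case (Cons q us)
  let ?z = "replicate (length us) False" and ?P = "rev us @ q # low"
  have P: "rev (q # us) @ low = ?P" by simp
  have z: "replicate (length (q # us)) False @ ys = ?z @ False # ys" by (simp add: replicate_app_Cons_same)
  have comp: "map_option ((@) ?z) (map_option ((#) False) w) = map_option ((@) (replicate (length (q # us)) False)) w" for w
    by (cases w) (simp_all add: replicate_app_Cons_same)
  obtain y0 where y0: "(?z @ False # ys, y0) \<in> (follows F ?P)\<^sup>*" "F y0 = quant_value us F (False # ys)"
    "next_bits (F y0) ?P y0 = map_option ((@) ?z) (next_bits (F y0) (q # low) (False # ys))"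
    using Cons.IH[of "False # ys" "q # low"] by blast
  show ?case
  proof (cases "F y0 = q")
    \<comment> \<open>The undecided case: a universal bit with value true so far, or an existential
      one with value false, so the second value of the bit has to be tried.\<close>
    case True
    then have "next_bits (F y0) ?P y0 = Some (?z @ True # ys)" using y0(3) by simp
    then have s: "(y0, ?z @ True # ys) \<in> follows F ?P" by blast
    obtain y1 where y1: "(?z @ True # ys, y1) \<in> (follows F ?P)\<^sup>*" "F y1 = quant_value us F (True # ys)"
      "next_bits (F y1) ?P y1 = map_option ((@) ?z) (next_bits (F y1) (q # low) (True # ys))"
      using Cons.IH[of "True # ys" "q # low"] by blast
    have r: "(?z @ False # ys, y1) \<in> (follows F ?P)\<^sup>*"
      by (rule rtrancl_trans[OF rtrancl_into_rtrancl[OF y0(1) s] y1(1)])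
    have "quant_value (q # us) F ys = F y1" using True y0(2) y1(2) by (cases q) (auto simp: all_bool_eq ex_bool_eq)
    moreover have "next_bits (F y1) ?P y1 = map_option ((@) (replicate (length (q # us)) False)) (next_bits (F y1) low ys)"
      unfolding y1(3) comp[symmetric] by simp
    ultimately show ?thesis unfolding P z using r by blast
  next
    case False
    have "quant_value (q # us) F ys = F y0" using False y0(2) by (cases q) (auto simp: all_bool_eq ex_bool_eq)
    moreover have "next_bits (F y0) ?P y0 = map_option ((@) (replicate (length (q # us)) False)) (next_bits (F y0) low ys)"
      unfolding y0(3) comp[symmetric] using False by simp
    ultimately show ?thesis unfolding P z using y0(1) by blast
  qed
qed

text \<open>Register 8 doubles as a flag: it loses its value as soon as a bit is set, and the rest
  of the first loop then idles. Register 17 counts the bits passed, which the second loop pushes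
  back cleared. If the value survives, no further assignment has to be tried, and popping register 7
  ends the evaluation.\<close>

definition advance :: prog where
  "advance =
     For 5 (Case 8 (\<lambda>v. if v = 1 then Skip else Case 5 (\<lambda>q. Case 6 (\<lambda>b.
       if b = 2 \<and> v = q then Pop 6 ;; Push 6 3 ;; Pop 8 else Pop 6 ;; Push 17 2)))) ;;
     For 5 (Case 17 (\<lambda>w. if w = 1 then Skip else Pop 17 ;; Push 6 2)) ;;
     Case 8 (\<lambda>v. if v = 1 then Skip else Pop 7)"

lemma writes_advance: "writes advance \<subseteq> {6, 7, 8, 17}" "fors advance \<subseteq> {5}"
  unfolding advance_def by (auto split: if_splits)

lemma wf_advance: "18 \<le> k \<Longrightarrow> 4 \<le> K \<Longrightarrow> wf_prog k K advance"
  unfolding advance_def by (auto split: if_splits)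

lemma bit_eq: "bit b = bit c \<longleftrightarrow> b = c" "bit b = 2 \<longleftrightarrow> \<not> b" "bit b = 3 \<longleftrightarrow> b" "bit b \<noteq> 1" "bit b \<noteq> Suc 0"
  by (simp_all add: bit_def)

lemma advance_scan:
  assumes "length qs = length ys" "s 6 = map bit ys" "s 8 = [bit v]" "s 17 = w"
  defines "body \<equiv> Case 8 (\<lambda>v. if v = 1 then Skip else Case 5 (\<lambda>q. Case 6 (\<lambda>b.
       if b = 2 \<and> v = q then Pop 6 ;; Push 6 3 ;; Pop 8 else Pop 6 ;; Push 17 2)))"
  shows "case next_bits v qs ys of
      None \<Rightarrow> loop (sem body) 5 (map bit qs) s 6 = [] \<and> loop (sem body) 5 (map bit qs) s 8 = [bit v] \<and>
        loop (sem body) 5 (map bit qs) s 17 = replicate (length qs) 2 @ w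
    | Some z \<Rightarrow> (\<exists>n z'. n \<le> length qs \<and> z = replicate n False @ z' \<and> loop (sem body) 5 (map bit qs) s 6 = map bit z' \<and>
        loop (sem body) 5 (map bit qs) s 8 = [] \<and> loop (sem body) 5 (map bit qs) s 17 = replicate n 2 @ w)"
  using assms(1-4)
proof (induction qs ys arbitrary: s w rule: list_induct2)
  case Nil
  then show ?case by simp
next
  case (Cons q qs b ys)
  let ?L = "loop (sem body) 5 (map bit qs)"
  have stop: "?L s' 6 = s' 6 \<and> ?L s' 8 = s' 8 \<and> ?L s' 17 = s' 17" if e: "s' 8 = []" for s'
  proof -
    let ?I = "\<lambda>(l :: nat list) (t :: store). t 8 = [] \<and> t 6 = s' 6 \<and> t 17 = s' 17"
    have "?I [] (?L s')"
    proof (rule loop_induct[where P="?I"])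
      show "?I (map bit qs) s'" using e by simp
      fix a l t assume "?I (a # l) t"
      then show "?I l (sem body (t(5 := a # l)))" by (simp add: body_def peek_def)
    qed
    then show ?thesis using e by simp
  qed
  show ?case
  proof (cases "\<not> b \<and> v = q")
    case True
    let ?s = "sem body (s(5 := bit q # map bit qs))"
    have s: "?s 8 = []" "?s 6 = map bit (True # ys)" "?s 17 = w"
      using True Cons.prems by (simp_all add: body_def peek_def bit_eq)
    have "loop (sem body) 5 (map bit (q # qs)) s = ?L ?s" by simp
    then show ?thesis using True stop[of ?s, OF s(1)] s by (simp add: exI[of _ "0::nat"])
  next
    case False
    let ?s = "sem body (s(5 := bit q # map bit qs))"
    have s: "?s 8 = [bit v]" "?s 6 = map bit ys" "?s 17 = 2 # w"
      using False Cons.prems by (auto simp: body_def peek_def bit_eq)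
    have l: "loop (sem body) 5 (map bit (q # qs)) s = ?L ?s" by simp
    have nb: "next_bits v (q # qs) (b # ys) = map_option ((#) False) (next_bits v qs ys)"
      using False by (simp only: next_bits.simps if_False)
    note IH = Cons.IH[of ?s "2 # w", OF s(2,1,3)]
    show ?thesis
    proof (cases "next_bits v qs ys")
      case None
      then show ?thesis using IH unfolding l nb by (simp add: replicate_app_Cons_same)
    next
      case (Some z)
      then obtain n z' where n: "n \<le> length qs" "z = replicate n False @ z'" "?L ?s 6 = map bit z'" "?L ?s 8 = []"
          "?L ?s 17 = replicate n 2 @ 2 # w" using IH by (simp only: option.case) blast
      then show ?thesis unfolding l nb Some option.map option.case
        by (intro exI[of _ "Suc n"] exI[of _ z']) (simp add: replicate_app_Cons_same)
    qed
  qed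
qed

lemma advance_refill:
  assumes "s 17 = replicate n 2" "n \<le> length l"
  defines "body \<equiv> Case 17 (\<lambda>w. if w = 1 then Skip else Pop 17 ;; Push 6 2)"
  shows "loop (sem body) 5 l s 17 = [] \<and> loop (sem body) 5 l s 6 = replicate n 2 @ s 6"
  using assms(1,2)
proof (induction l arbitrary: s n)
  case Nil
  then show ?case by simp
next
  case (Cons a l)
  show ?case
  proof (cases n)
    case 0
    have "sem body (s(5 := a # l)) 17 = replicate 0 2" "sem body (s(5 := a # l)) 6 = s 6"
      using 0 Cons.prems by (simp_all add: body_def peek_def)
    then show ?thesis using Cons.IH[of _ 0] 0 by simp
  next
    case (Suc m)
    have "sem body (s(5 := a # l)) 17 = replicate m 2" "sem body (s(5 := a # l)) 6 = 2 # s 6"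
      using Suc Cons.prems by (simp_all add: body_def peek_def)
    then show ?thesis using Cons.IH[of _ m] Cons.prems Suc by (simp add: replicate_app_Cons_same)
  qed
qed

lemma sem_advance:
  assumes "length qs = length ys" "s 5 = map bit qs" "s 6 = map bit ys" "s 8 = [bit v]" "s 17 = []"
  shows "case next_bits v qs ys of
      None \<Rightarrow> sem advance s 7 = tl (s 7) \<and> sem advance s 8 = [bit v]
    | Some z \<Rightarrow> sem advance s = s(6 := map bit z, 8 := [])"
proof -
  define body where "body = Case 8 (\<lambda>v. if v = 1 then Skip else Case 5 (\<lambda>q. Case 6 (\<lambda>b.
       if b = 2 \<and> v = q then Pop 6 ;; Push 6 3 ;; Pop 8 else Pop 6 ;; Push 17 2)))"
  define refill where "refill = Case 17 (\<lambda>w. if w = 1 then Skip else Pop 17 ;; Push 6 2)"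
  define s1 where "s1 = sem (For 5 body) s"
  define s2 where "s2 = sem (For 5 refill) s1"
  have adv: "sem advance s = sem (Case 8 (\<lambda>v. if v = 1 then Skip else Pop 7)) s2"
    by (simp only: advance_def sem.simps s1_def s2_def body_def refill_def)
  note scan = advance_scan[OF assms(1,3-5), folded body_def, folded assms(2)]
  have w1: "writes body \<subseteq> {6, 8, 17}" unfolding body_def by (auto split: if_splits)
  have w2: "writes refill \<subseteq> {6, 17}" unfolding refill_def by (auto split: if_splits)
  have o1: "s1 r = s r" if "r \<notin> {6, 8, 17}" for r unfolding s1_def using w1 that by (intro sem_unchanged) auto
  have o2: "s2 r = s1 r" if "r \<notin> {6, 17}" for r unfolding s2_def using w2 that by (intro sem_unchanged) auto
  have l1: "s1 r = loop (sem body) 5 (s 5) s r" if "r \<noteq> 5" for r using that by (simp add: s1_def)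
  have l2: "s2 r = loop (sem refill) 5 (s1 5) s1 r" if "r \<noteq> 5" for r using that by (simp add: s2_def)
  have len: "length (s1 5) = length qs" using o1[of 5] assms(2) by simp
  show ?thesis
  proof (cases "next_bits v qs ys")
    case None
    then have "s1 8 = [bit v]" "s1 17 = replicate (length qs) 2" using scan l1 by simp_all
    then have "s2 8 = [bit v]" using o2 by simp
    moreover have "s2 7 = s 7" using o1 o2 by simp
    ultimately show ?thesis unfolding adv None option.case by (simp add: peek_def bit_eq)
  next
    case (Some z)
    then obtain n z' where n: "n \<le> length qs" "z = replicate n False @ z'" "s1 6 = map bit z'" "s1 8 = []"
      "s1 17 = replicate n 2" using scan l1 by simp blast
    have "s2 17 = []" "s2 6 = map bit z"
      using advance_refill[where s=s1 and n=n and l="s1 5", folded refill_def, OF n(5)] len n l2 by (simp_all add: bit_def)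
    then have "s2 r = (s(6 := map bit z, 8 := [])) r" for r
      using o1[of r] o2[of r] n(4) o2[of 8] assms(5) by (cases "r \<in> {6, 8, 17}") auto
    then have "s2 = s(6 := map bit z, 8 := [])" by blast
    then show ?thesis unfolding adv Some option.case by (simp add: peek_def)
  qed
qed

lemma length_next_bits: "next_bits v qs ys = Some z \<Longrightarrow> length z = length ys"
  by (induction v qs ys arbitrary: z rule: next_bits.induct) (auto split: if_splits)

text \<open>Each pass starts from the initial store with only register 6 replaced, by a list of the
  same length. Therefore one polynomial bounds the cost and the store of all the exponentially many
  passes.\<close>

theorem quant_value_PSPACE:
  assumes k: "18 \<le> k" "4 \<le> K" and tame: "tame k K init" "tame k K leaf"
    and init: "\<And>x. sem init (init_store x) 5 = map bit (P x)" "\<And>x. sem init (init_store x) 6 = map bit (replicate (length (P x)) False)"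
      "\<And>x. sem init (init_store x) 7 = [3]" "\<And>x. sem init (init_store x) 8 = []" "\<And>x. sem init (init_store x) 17 = []"
    and leaf: "\<And>x y s. length y = length (P x) \<Longrightarrow> s = (sem init (init_store x))(6 := map bit y) \<Longrightarrow>
      sem leaf s = s(8 := [bit (F x y)])"
  shows "{x. quant_value (rev (P x)) (F x) []} \<in> PSPACE"
proof -
  define q where "q = leaf ;; advance"
  have K2: "2 \<le> K" using k by simp
  have "tame k K advance"
    using writes_advance k by (intro tame_simple wf_advance) auto
  then have tq: "tame k K q" unfolding q_def using tame_Seq[OF K2 tame(2)] by blast
  obtain f :: "nat poly" where f: "\<And>s. valid_store K s \<Longrightarrow> cost q s + total k {} (sem q s) \<le> poly f (total k {} s)"
    using tq unfolding tame_def by blast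
  obtain g :: "nat poly" where g: "\<And>x. cost init (init_store x) + total k {} (sem init (init_store x)) \<le> poly g (length x)"
    using tame_cost[OF tame(1)] k by auto
  define c where "c = poly (g + f \<circ>\<^sub>p g)"
  have c_def: "c n = poly g n + poly f (poly g n)" for n unfolding c_def poly_add poly_pcompose ..
  have wf: "wf_prog k K init" "wf_prog k K q" using tame(1) tq unfolding tame_def by blast+
  show ?thesis
  proof (rule PSPACE_prog[where k=k and K=K and p=init and q=q and go=7 and res=8 and c=c])
    show "poly_bounded c" unfolding \<open>c = poly (g + f \<circ>\<^sub>p g)\<close> by (rule poly_bounded_poly)
    fix x
    let ?s0 = "sem init (init_store x)" and ?P = "P x"
    define st where "st y = ?s0(6 := map bit y)" for y
    define Q where "Q s \<longleftrightarrow> (\<exists>J S. S 0 = s \<and>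
      (\<forall>j < J. peek (S j) 7 = 3 \<and> S (Suc j) = sem q (S j) \<and> cost q (S j) \<le> c (length x)) \<and>
      (\<forall>j \<le> J. \<forall>r < k. length (S j r) \<le> c (length x)) \<and>
      peek (S J) 7 \<noteq> 3 \<and> (peek (S J) 8 = 3 \<longleftrightarrow> x \<in> {x. quant_value (rev (P x)) (F x) []}))" for s
    have tot: "total k {} (st y) = total k {} ?s0" if "length y = length ?P" for y
      unfolding total_def st_def using that init(2)[of x] by (intro sum.cong) auto
    have v0: "valid_store K ?s0" by (rule valid_sem[OF K2 wf(1) valid_init_store[OF k(2)]])
    have v: "valid_store K (st y)" for y
      unfolding st_def using k(2) by (intro valid_upd[OF v0]) (auto simp: bit_def)
    have Q: "Q s" if st: "peek s 7 = 3" "cost q s \<le> c (length x)" "\<And>r. r < k \<Longrightarrow> length (s r) \<le> c (length x)" "Q (sem q s)" for s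
    proof -
      obtain J S where S: "S 0 = sem q s"
        "\<forall>j < J. peek (S j) 7 = 3 \<and> S (Suc j) = sem q (S j) \<and> cost q (S j) \<le> c (length x)"
        "\<forall>j \<le> J. \<forall>r < k. length (S j r) \<le> c (length x)"
        "peek (S J) 7 \<noteq> 3" "peek (S J) 8 = 3 \<longleftrightarrow> x \<in> {x. quant_value (rev (P x)) (F x) []}"
        using st(4) unfolding Q_def by blast
      define S' where "S' j = (case j of 0 \<Rightarrow> s | Suc i \<Rightarrow> S i)" for j
      have S': "S' 0 = s" "S' (Suc i) = S i" for i by (simp_all add: S'_def)
      have a: "peek (S' j) 7 = 3 \<and> S' (Suc j) = sem q (S' j) \<and> cost q (S' j) \<le> c (length x)" if "j < Suc J" for j
        using that S(1,2) st(1,2) by (cases j) (simp_all add: S')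
      have b: "length (S' j r) \<le> c (length x)" if "j \<le> Suc J" "r < k" for j r
        using that S(3) st(3) by (cases j) (simp_all add: S')
      have "peek (S' (Suc J)) 7 \<noteq> 3 \<and> (peek (S' (Suc J)) 8 = 3 \<longleftrightarrow> x \<in> {x. quant_value (rev (P x)) (F x) []})"
        using S(4,5) by (simp only: S') simp
      then show ?thesis unfolding Q_def using a b S'(1) by blast
    qed
    have gx: "total k {} ?s0 \<le> poly g (length x)" using g[of x] by linarith
    have fx: "cost q (st y) + total k {} (sem q (st y)) \<le> poly f (poly g (length x))" if "length y = length ?P" for y
      using f[OF v, of y] poly_nat_mono[OF gx, of f] unfolding tot[OF that] by linarith
    have cst: "cost q (st y) \<le> c (length x)" "\<And>r. r < k \<Longrightarrow> length (st y r) \<le> c (length x)"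
      "\<And>r. r < k \<Longrightarrow> length (sem q (st y) r) \<le> c (length x)" if "length y = length ?P" for y
    proof -
      show "cost q (st y) \<le> c (length x)" using fx[OF that] unfolding c_def by linarith
      fix r assume "r < k"
      then show "length (st y r) \<le> c (length x)" "length (sem q (st y) r) \<le> c (length x)"
        using length_le_total[of r k "st y"] length_le_total[of r k "sem q (st y)"] fx[OF that] tot[OF that] gx
        unfolding c_def by linarith+
    qed
    have adv: "case next_bits (F x y) ?P y of
        None \<Rightarrow> sem q (st y) 7 = [] \<and> sem q (st y) 8 = [bit (F x y)] | Some z \<Rightarrow> sem q (st y) = st z"
      if y: "length y = length ?P" for y
    proof -
      have l: "sem leaf (st y) = (st y)(8 := [bit (F x y)])" by (rule leaf[OF y st_def])
      have h: "sem q (st y) = sem advance ((st y)(8 := [bit (F x y)]))" unfolding q_def sem.simps l ..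
      have "(st y)(8 := [bit (F x y)], 6 := map bit z, 8 := []) = st z" for z
        using init(4)[of x] by (auto simp: st_def fun_eq_iff)
      then show ?thesis
        using sem_advance[of ?P y "(st y)(8 := [bit (F x y)])" "F x y"] y init[of x]
        unfolding h by (simp add: st_def split: option.splits)
    qed
    have pk: "peek (st y) 7 = 3" for y using init(3)[of x] by (simp add: st_def peek_def)
    obtain y where y: "(replicate (length ?P) False, y) \<in> (follows (F x) ?P)\<^sup>*" "F x y = quant_value (rev ?P) (F x) []"
        "next_bits (F x y) ?P y = None"
      using follows_quant_value[of "rev ?P" "[]" "F x" "[]"] by auto
    \<comment> \<open>Backwards along the run of the counter: \<open>Q\<close> for the store after a
      pass gives \<open>Q\<close> for the store before it.\<close>
    have "length y' = length ?P \<longrightarrow> Q (st y')" if "(y', y) \<in> (follows (F x) ?P)\<^sup>*" for y'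
      using that
    proof (induction rule: converse_rtrancl_induct)
      case base
      show ?case
      proof
        assume ly: "length y = length ?P"
        let ?t = "sem q (st y)"
        have t: "?t 7 = []" "?t 8 = [bit (F x y)]" using adv[OF ly] unfolding y(3) by simp_all
        have "Q ?t" unfolding Q_def
          by (rule exI[of _ 0], rule exI[of _ "\<lambda>_. ?t"]) (use cst(3)[OF ly] t y(2) in \<open>simp add: peek_def bit_eq\<close>)
        then show "Q (st y)" using Q[OF pk cst(1)[OF ly] cst(2)[OF ly]] by blast
      qed
    next
      case (step y1 y2)
      show ?case
      proof
        assume ly: "length y1 = length ?P"
        have nb: "next_bits (F x y1) ?P y1 = Some y2" using step(1) by blast
        then have "sem q (st y1) = st y2" using adv[OF ly] by simp
        then have "Q (sem q (st y1))" using step.IH length_next_bits[OF nb] ly by simp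
        then show "Q (st y1)" using Q[OF pk cst(1)[OF ly] cst(2)[OF ly]] by blast
      qed
    qed
    from this[OF y(1)] have "Q (st (replicate (length ?P) False))" by simp
    moreover have "st (replicate (length ?P) False) = ?s0" unfolding st_def init(2)[symmetric] by simp
    moreover have "cost init (init_store x) \<le> c (length x)" using g[of x] unfolding c_def by linarith
    ultimately show "\<exists>J S. S 0 = ?s0 \<and> cost init (init_store x) \<le> c (length x) \<and>
      (\<forall>j < J. peek (S j) 7 = 3 \<and> S (Suc j) = sem q (S j) \<and> cost q (S j) \<le> c (length x)) \<and>
      (\<forall>j \<le> J. \<forall>r < k. length (S j r) \<le> c (length x)) \<and>
      peek (S J) 7 \<noteq> 3 \<and> (peek (S J) 8 = 3 \<longleftrightarrow> x \<in> {x. quant_value (rev (P x)) (F x) []})"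
      unfolding Q_def by simp
  qed (use wf k in simp_all)
qed

section \<open>Checking a play\<close>

text \<open>The initial 1 acts as a top digit, so lists of different lengths get different numbers:
  four bits give 16 to 31, fewer give less than 16. It is also the value read from an empty
  register, which thus represents the empty list.\<close>

definition code_num :: "bool list \<Rightarrow> nat" where
  "code_num g = foldr (\<lambda>b v. 2 * v + (if b then 1 else 0)) g 1"

lemma code_num_simps [simp]: "code_num [] = 1" "code_num (b # g) = 2 * code_num g + (if b then 1 else 0)"
  by (simp_all add: code_num_def)

lemma code_num_bounds: "2 ^ length g \<le> code_num g \<and> code_num g < 2 * 2 ^ length g"
  by (induction g) auto

lemma code_num_neq_0 [simp]: "code_num g = 0 \<longleftrightarrow> False"
  by (induction g) auto

lemma code_num_inj: "code_num g = code_num h \<Longrightarrow> g = h"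
proof (induction g arbitrary: h)
  case Nil
  then show ?case by (cases h) (auto split: if_splits)
next
  case (Cons b g)
  then obtain c h' where h: "h = c # h'" by (cases h) (auto split: if_splits)
  have "b = c \<and> code_num g = code_num h'"
    using Cons.prems unfolding h code_num_simps by (cases b; cases c; simp; presburger)
  then show ?case using Cons.IH h by blast
qed

definition tok_of :: "nat \<Rightarrow> token option" where
  "tok_of v = (if \<exists>t. code_num (token_code t) = v then Some (THE t. code_num (token_code t) = v) else None)"

lemma tok_of_Some: "tok_of v = Some t \<longleftrightarrow> v = code_num (token_code t)"
proof -
  have "(THE t'. code_num (token_code t') = code_num (token_code t)) = t" for t
    by (rule the_equality) (auto dest: code_num_inj token_code_inj)
  then show ?thesis unfolding tok_of_def by auto
qed

text \<open>
  A state collects the scanning mode (0 after an error), the number of marked variables met, the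
  symbol of the next label of the previous cell, the label of the first marked variable, the variable
  verdict, the two results of the modal pass, the label last read, and the value of the rest of the play.
\<close>

type_synonym lstate = "nat \<times> nat \<times> nat \<times> bool \<times> bool \<times> bool \<times> bool \<times> bool \<times> bool"

definition lstates :: "lstate set" where
  "lstates = {..4} \<times> {..2} \<times> {..3} \<times> UNIV"

definition enc_state :: "lstate \<Rightarrow> nat" where "enc_state q = 2 + to_nat q"
definition dec_state :: "nat \<Rightarrow> lstate" where "dec_state v = from_nat (v - 2)"
text \<open>The whole state is a single symbol, so that one \<open>Case\<close> can branch on it;
  the alphabet must contain these symbols besides the token numbers up to 31.\<close>

definition num_syms :: nat where "num_syms = Suc (Max (insert 31 (enc_state ` lstates)))"

lemma dec_enc_state [simp]: "dec_state (enc_state q) = q"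
  by (simp add: dec_state_def enc_state_def)

lemma num_syms: "31 < num_syms" "q \<in> lstates \<Longrightarrow> enc_state q < num_syms"
proof -
  have "finite lstates" unfolding lstates_def by simp
  then show "31 < num_syms" "q \<in> lstates \<Longrightarrow> enc_state q < num_syms"
    unfolding num_syms_def less_Suc_eq_le by (intro Max_ge; auto)+
qed

text \<open>\<open>Case\<close> supplies a program for every symbol, also for those that code no
  admissible state. \<open>Skip\<close> keeps these branches well-formed.\<close>

definition set_state :: "lstate \<Rightarrow> prog" where
  "set_state q = (if q \<in> lstates then Clr 13 ;; Push 13 (enc_state q) else Skip)"

primrec push_all :: "nat \<Rightarrow> nat list \<Rightarrow> prog" where
  "push_all r [] = Skip"
| "push_all r (a # l) = push_all r l ;; Push r a"

lemma sem_push_all [simp]: "sem (push_all r l) s = s(r := l @ s r)"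
  by (induction l) auto

lemma writes_push_all [simp]: "writes (push_all r l) = (if l = [] then {} else {r})" "fors (push_all r l) = {}"
  by (induction l) auto

lemma wf_push_all: "r < k \<Longrightarrow> (\<forall>a \<in> set l. 2 \<le> a \<and> a < K) \<Longrightarrow> wf_prog k K (push_all r l)"
  by (induction l) auto

lemma sem_set_state: "q \<in> lstates \<Longrightarrow> sem (set_state q) s = s(13 := [enc_state q])"
  by (simp add: set_state_def)

lemma writes_set_state [simp]: "writes (set_state q) = (if q \<in> lstates then {13} else {})" "fors (set_state q) = {}"
  by (auto simp: set_state_def)

lemma wf_set_state [simp]: "wf_prog 19 num_syms (set_state q)"
  using num_syms(2) by (simp add: set_state_def enc_state_def)

lemma bit_bounds [simp]: "2 \<le> bit b" "bit b < num_syms" "Suc 0 < bit b" "bit b \<le> 3"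
  using num_syms(1) by (auto simp: bit_def)

abbreviation opt_of :: "nat \<Rightarrow> bool option" where
  "opt_of v \<equiv> if v = 1 then None else Some (v = 3)"

abbreviation lst_of :: "nat \<Rightarrow> bool list" where
  "lst_of v \<equiv> if v = 1 then [] else [v = 3]"

text \<open>
  Register 2 holds the tokens, the last one on top, 3 and 4 copies that serve as loop bounds, 5 the
  quantifiers and 6 the quantified bits, 7 is nonempty until the evaluation ends, 8 the value. Of the
  round under consideration, 10 holds the marks, 11 the labels of the next world and 12 the labels read,
  13 the state, 14 the stack of labels, 15 and 16 the names of two variables; 9 restores register 6.
\<close>

definition scan_prog :: "connective set \<Rightarrow> token option \<Rightarrow> bool \<Rightarrow> bool \<Rightarrow> nat \<Rightarrow> lstate \<Rightarrow> bool list \<Rightarrow> prog" where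
  "scan_prog S t b c p q zs = (case q of (m, n, x, lo, vb, seen, bad, lab, r) \<Rightarrow>
     let seen' = (seen \<or> c \<and> selectable t b);
         bad' = (bad \<or> clash t b (opt_of x) \<or> c \<and> selectable t b \<and> \<not> seen \<and> unmet t (opt_of x))
     in case (if m = 0 then None else scan_step S t b (zs, m)) of
         None \<Rightarrow> set_state (0, n, p, lo, vb, seen', bad', b, r)
       | Some (zs', m') \<Rightarrow> push_all 14 (map bit zs') ;; set_state (m', n, p, lo, vb, seen', bad', b, r))"

text \<open>An exhausted name reads as 1, which differs from both bits, so names of different
  lengths are told apart. The loop over register 4 makes as many passes as there are tokens, enough
  for any name.\<close>

definition compare :: prog where
  "compare = For 4 (Case 15 (\<lambda>u. Case 16 (\<lambda>v. (if u = v then Skip else Clr 17 ;; Push 17 2) ;; Pop 15 ;; Pop 16)))"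

definition var_prog :: "token option \<Rightarrow> bool \<Rightarrow> bool \<Rightarrow> lstate \<Rightarrow> prog" where
  "var_prog t b c q = (case q of (m, n, x, lo, vb, z) \<Rightarrow>
     if n = 0 then
       (case t of Some (TDigit d) \<Rightarrow> Push 15 (bit d)
        | _ \<Rightarrow> if t = Some TVar \<and> c then set_state (m, 1, x, b, vb, z) else Clr 15)
     else if n = 1 then
       (case t of Some (TDigit d) \<Rightarrow> Push 16 (bit d)
        | _ \<Rightarrow> if t = Some TVar \<and> c
            then compare ;; Case 17 (\<lambda>e. set_state (m, 2, x, lo, e = 1 \<and> lo \<noteq> b, z)) ;; Clr 15 ;; Clr 16 ;; Clr 17
            else Clr 16)
     else Skip)"

definition scan_cell :: "connective set \<Rightarrow> prog" where
  "scan_cell S = Case 2 (\<lambda>t. Case 6 (\<lambda>b. Case 10 (\<lambda>c. Case 11 (\<lambda>p. Case 13 (\<lambda>v. Case 14 (\<lambda>z1. Pop 14 ;;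
     Case 14 (\<lambda>z2. Pop 14 ;; scan_prog S (tok_of t) (b = 3) (c = 3) p (dec_state v) (lst_of z1 @ lst_of z2))))))))"

definition var_cell :: prog where
  "var_cell = Case 2 (\<lambda>t. Case 6 (\<lambda>b. Case 10 (\<lambda>c. Case 13 (\<lambda>v. var_prog (tok_of t) (b = 3) (c = 3) (dec_state v)))))"

definition move_cell :: prog where
  "move_cell = Case 6 (\<lambda>b. Pop 6 ;; Push 9 (bit (b = 3)) ;; Push 12 (bit (b = 3))) ;; Pop 10 ;; Pop 11"

definition cell_prog :: "connective set \<Rightarrow> prog" where
  "cell_prog S = scan_cell S ;; var_cell ;; move_cell"

lemma writes_scan_cell: "writes (scan_cell S) \<subseteq> {13, 14}" "fors (scan_cell S) = {}"
proof -
  have "writes (scan_prog S t b c p q zs) \<subseteq> {13, 14}" "fors (scan_prog S t b c p q zs) = {}" for t b c p q zs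
    unfolding scan_prog_def Let_def
    by (auto split: prod.splits option.splits if_splits)
  then show "writes (scan_cell S) \<subseteq> {13, 14}" "fors (scan_cell S) = {}"
    unfolding scan_cell_def by (simp_all add: UN_subset_iff)
qed

lemma wf_scan_cell: "wf_prog 19 num_syms (scan_cell S)"
proof -
  have "wf_prog 19 num_syms (scan_prog S t b c p q zs)" for t b c p q zs
    unfolding scan_prog_def Let_def by (auto split: prod.split option.split intro!: wf_push_all)
  then show ?thesis unfolding scan_cell_def by simp
qed

lemma writes_compare: "writes compare \<subseteq> {15, 16, 17}" "fors compare = {4}"
  unfolding compare_def by (auto split: if_splits)

lemma wf_compare: "wf_prog 19 num_syms compare"
  unfolding compare_def using num_syms(1) by auto

lemma writes_var_cell: "writes var_cell \<subseteq> {13, 15, 16, 17}" "fors var_cell \<subseteq> {4}"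
proof -
  have "writes (var_prog t b c q) \<subseteq> {13, 15, 16, 17}" "fors (var_prog t b c q) \<subseteq> {4}" for t b c q
    unfolding var_prog_def using subsetD[OF writes_compare(1)]
    by (auto simp: writes_compare(2) split: prod.splits option.splits token.splits if_splits)
  then show "writes var_cell \<subseteq> {13, 15, 16, 17}" "fors var_cell \<subseteq> {4}"
    unfolding var_cell_def by (simp_all add: UN_subset_iff)
qed

lemma wf_var_cell: "wf_prog 19 num_syms var_cell"
proof -
  have "wf_prog 19 num_syms (var_prog t b c q)" for t b c q
    unfolding var_prog_def using wf_compare by (auto split: prod.split option.split token.split)
  then show ?thesis unfolding var_cell_def by simp
qed

lemma cell_prog_frame: "writes (cell_prog S) \<subseteq> {6, 9, 10, 11, 12, 13, 14, 15, 16, 17}" "fors (cell_prog S) \<subseteq> {4}"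
  "wf_prog 19 num_syms (cell_prog S)"
  unfolding cell_prog_def move_cell_def using writes_scan_cell[of S] writes_var_cell wf_scan_cell wf_var_cell by auto

lemma sem_compare:
  assumes "s 15 = map bit u" "s 16 = map bit v" "length u \<le> length (s 4)" "length v \<le> length (s 4)" "s 17 = []"
  shows "sem compare s 17 = (if u = v then [] else [2])"
proof -
  define body where "body = Case 15 (\<lambda>u. Case 16 (\<lambda>v. (if u = v then Skip else Clr 17 ;; Push 17 2) ;; Pop 15 ;; Pop 16))"
  have "loop (sem body) 4 l s 17 = (if s 17 = [] \<and> u = v then [] else [2])"
    if "s 15 = map bit u" "s 16 = map bit v" "length u \<le> length l" "length v \<le> length l" "s 17 = [] \<or> s 17 = [2]" for l s u v
    using that
  proof (induction l arbitrary: s u v)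
    case Nil
    then show ?case by auto
  next
    case (Cons a l)
    let ?s = "sem body (s(4 := a # l))"
    have s: "?s 15 = map bit (tl u)" "?s 16 = map bit (tl v)"
      using Cons.prems(1,2) by (simp_all add: body_def map_tl)
    have e: "?s 17 = (if peek s 15 = peek s 16 then s 17 else [2])" by (simp add: body_def peek_def)
    have "peek s 15 = peek s 16 \<and> tl u = tl v \<longleftrightarrow> u = v"
      unfolding peek_def Cons.prems(1,2) by (cases u; cases v) (auto simp: bit_eq dest: sym)
    moreover have "length (tl u) \<le> length l" "length (tl v) \<le> length l" using Cons.prems(3,4) by auto
    moreover have "?s 17 = [] \<or> ?s 17 = [2]" using e Cons.prems(5) by simp
    ultimately show ?case using Cons.IH[of ?s "tl u" "tl v", OF s] e by auto
  qed
  from this[OF assms(1-4)] show ?thesis using assms(5) unfolding compare_def body_def by simp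
qed

section \<open>Correctness of the program for one cell\<close>

definition summary :: "connective set \<Rightarrow> bool \<Rightarrow> bool \<Rightarrow> cell list \<Rightarrow> lstate" where
  "summary S lab r xs =
     (case scan S (map (\<lambda>x. (fst x, fst (snd x))) xs) of None \<Rightarrow> 0 | Some z \<Rightarrow> snd z,
      fst (var_pass xs), case next_label xs of None \<Rightarrow> 1 | Some b \<Rightarrow> bit b,
      fst (snd (snd (var_pass xs))), var_bad xs, fst (modal_pass xs), snd (modal_pass xs),
      case xs of [] \<Rightarrow> lab | x # _ \<Rightarrow> fst (snd x), r)"

text \<open>Simulation relation between a store and the cells read so far. \<open>lab\<close> and
  \<open>r\<close> stem from the later rounds of the play, which are evaluated first. Register 14 is
  left open after a scanning error, when mode 0 has already decided.\<close>

definition matches :: "connective set \<Rightarrow> bool \<Rightarrow> bool \<Rightarrow> cell list \<Rightarrow> store \<Rightarrow> bool" where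
  "matches S lab r xs s \<longleftrightarrow> s 13 = [enc_state (summary S lab r xs)] \<and>
     (\<forall>zs m. scan S (map (\<lambda>x. (fst x, fst (snd x))) xs) = Some (zs, m) \<longrightarrow> s 14 = map bit zs) \<and>
     s 15 = map bit (fst (snd (var_pass xs))) \<and> s 16 = map bit (fst (snd (snd (snd (var_pass xs))))) \<and> s 17 = []"

lemma scan_mode: "scan S xs = Some (zs, m) \<Longrightarrow> m \<in> {1, 2, 3, 4}"
proof (cases xs)
  case (Cons x xs')
  assume "scan S xs = Some (zs, m)"
  then obtain z where "scan_step S (fst x) (snd x) z = Some (zs, m)" using Cons by (auto simp: bind_eq_Some_conv)
  then show ?thesis
    by (cases "(S, fst x, snd x, z)" rule: scan_step.cases) (auto split: if_splits)
qed simp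

lemma var_step_bounds:
  assumes "fst st \<le> 2"
  shows "fst (var_step t b c st) \<le> 2"
    "length (fst (snd (var_step t b c st))) \<le> Suc (length (fst (snd st)))"
    "length (fst (snd (snd (snd (var_step t b c st))))) \<le> Suc (length (fst (snd (snd (snd st)))))"
  using assms by (cases "(t, b, c, st)" rule: var_step.cases; simp)+

lemma var_pass_bounds:
  "fst (var_pass xs) \<le> 2 \<and> length (fst (snd (var_pass xs))) \<le> length xs \<and> length (fst (snd (snd (snd (var_pass xs))))) \<le> length xs"
proof (induction xs)
  case (Cons x xs)
  obtain t b c p where x: "x = (t, b, c, p)" by (metis prod_cases4)
  show ?case unfolding x var_pass.simps
    using var_step_bounds[of "var_pass xs" t b c] Cons.IH by simp
qed simp

text \<open>No connective has more than two operands; this is why \<open>scan_cell\<close> pops two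
  labels and leaves the rest of the stack in place.\<close>

lemma scan_step_take:
  "scan_step S t b (zs, m) = map_option (\<lambda>z. (fst z @ drop 2 zs, snd z)) (scan_step S t b (take 2 zs, m))"
proof -
  have a: "arity c \<le> 2" for c by (cases c) simp_all
  show ?thesis
  proof (cases "(S, t, b, zs, m)" rule: scan_step.cases)
    case (4 S c b zs m)
    have "arity c \<le> length (take 2 zs) \<longleftrightarrow> arity c \<le> length zs" "take (arity c) (take 2 zs) = take (arity c) zs"
      using a[of c] by (auto simp: min_def)
    moreover have "drop (arity c) (take 2 zs) @ drop 2 zs = drop (arity c) zs"
      using a[of c] by (metis append_take_drop_id drop_append drop_drop drop_take le_add_diff_inverse2)
    ultimately show ?thesis using 4 by simp
  qed simp_all
qed

lemma summary_in_lstates: "summary S lab r xs \<in> lstates"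
proof -
  have "(case scan S ys of None \<Rightarrow> 0 | Some z \<Rightarrow> snd z) \<le> (4 :: nat)" for ys
    using scan_mode[of S ys] by (auto split: option.split)
  moreover have "(case next_label xs of None \<Rightarrow> 1 | Some b \<Rightarrow> bit b) \<le> 3" by (auto split: option.split)
  ultimately show ?thesis unfolding lstates_def summary_def using var_pass_bounds[of xs] by simp
qed

lemma lstates_iff [simp]: "(m, n, x, z) \<in> lstates \<longleftrightarrow> m \<le> 4 \<and> n \<le> 2 \<and> x \<le> 3"
  by (simp add: lstates_def)

definition head_opt :: "bool list \<Rightarrow> bool option" where
  "head_opt ps = (case ps of [] \<Rightarrow> None | p # _ \<Rightarrow> Some p)"

text \<open>A state halfway through a cell: the components of the scan and of the modal pass already
  include the new cell, while those of the variable pass still belong to \<open>xs\<close>, because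
  \<open>var_cell\<close> has yet to run.\<close>

lemma sem_scan_cell:
  assumes m: "matches S lab r xs s"
    and s: "s 2 = t # l" "s 6 = bit b # y" "s 10 = bit c # cs" "s 11 = map bit ps"
  defines "xs' \<equiv> (tok_of t, b, c, head_opt ps) # xs"
  shows "sem (scan_cell S) s 13 = [enc_state (fst (summary S lab r xs'), fst (var_pass xs), fst (snd (snd (summary S lab r xs'))),
      fst (snd (snd (var_pass xs))), var_bad xs, fst (modal_pass xs'), snd (modal_pass xs'), b, r)]"
    and "scan S (map (\<lambda>x. (fst x, fst (snd x))) xs') = Some (zs', m') \<Longrightarrow> sem (scan_cell S) s 14 = map bit zs'"
proof -
  let ?l = "\<lambda>xs. map (\<lambda>x. (fst x, fst (snd x))) xs"
  define p where "p = (case head_opt ps of None \<Rightarrow> 1 | Some b \<Rightarrow> bit b)"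
  define z where "z = lst_of (peek s 14) @ lst_of (peek (s(14 := tl (s 14))) 14)"
  define s1 where "s1 = s(14 := tl (tl (s 14)))"
  let ?q = "(fst (summary S lab r xs'), fst (var_pass xs), p,
      fst (snd (snd (var_pass xs))), var_bad xs, fst (modal_pass xs'), snd (modal_pass xs'), b, r)"
  have p: "fst (snd (snd (summary S lab r xs'))) = p"
    by (simp add: summary_def xs'_def next_label_def p_def)
  have q: "?q \<in> lstates"
    using summary_in_lstates[of S lab r xs'] var_pass_bounds[of xs]
    unfolding lstates_iff by (simp add: summary_def xs'_def next_label_def p_def lstates_def)
  have peeks: "peek s 2 = t" "peek s 6 = bit b" "peek s 10 = bit c" "peek s 11 = p" "peek s 13 = enc_state (summary S lab r xs)"
    using s m by (simp_all add: peek_def matches_def p_def head_opt_def split: list.split)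
  have e: "sem (scan_cell S) s = sem (scan_prog S (tok_of t) b c p (summary S lab r xs) z) s1"
    unfolding scan_cell_def by (simp add: peeks bit_eq z_def s1_def)
  have next_label: "opt_of (case next_label xs of None \<Rightarrow> 1 | Some b \<Rightarrow> bit b) = next_label xs"
    by (simp add: bit_eq split: option.split)
  have seen: "fst (modal_pass xs') \<longleftrightarrow> fst (modal_pass xs) \<or> c \<and> selectable (tok_of t) b"
    "snd (modal_pass xs') \<longleftrightarrow> snd (modal_pass xs) \<or> clash (tok_of t) b (next_label xs) \<or>
     c \<and> selectable (tok_of t) b \<and> \<not> fst (modal_pass xs) \<and> unmet (tok_of t) (next_label xs)"
    unfolding xs'_def by (rule modal_pass_Cons)+
  have prog: "scan_prog S (tok_of t) b c p (summary S lab r xs) z =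
      (case (if fst (summary S lab r xs) = 0 then None else scan_step S (tok_of t) b (z, fst (summary S lab r xs))) of
         None \<Rightarrow> set_state (0, snd ?q)
       | Some (zs', m') \<Rightarrow> push_all 14 (map bit zs') ;; set_state (m', snd ?q))"
    unfolding scan_prog_def summary_def Let_def prod.case next_label fst_conv snd_conv seen by (rule refl)
  have scan': "scan S (?l xs') = Option.bind (scan S (?l xs)) (scan_step S (tok_of t) b)"
    by (simp add: xs'_def)
  have mode': "fst (summary S lab r xs') = (case scan S (?l xs') of None \<Rightarrow> 0 | Some z \<Rightarrow> snd z)"
    by (simp only: summary_def fst_conv)
  have main: "sem (scan_cell S) s 13 = [enc_state ?q] \<and> (\<forall>zs' m'. scan S (?l xs') = Some (zs', m') \<longrightarrow> sem (scan_cell S) s 14 = map bit zs')"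
  proof (cases "scan S (?l xs)")
    case None
    then have n: "scan S (?l xs') = None" unfolding scan' by simp
    have "fst (summary S lab r xs) = 0" using None by (simp add: summary_def)
    then have "sem (scan_cell S) s = sem (set_state ?q) s1" unfolding e prog using mode' n by simp
    then show ?thesis using n sem_set_state[OF q] by simp
  next
    case (Some w)
    then obtain zs m0 where w: "scan S (?l xs) = Some (zs, m0)" by (cases w) simp
    have m0: "fst (summary S lab r xs) = m0" "m0 \<noteq> 0" using w scan_mode[OF w] by (auto simp: summary_def)
    have s14: "s 14 = map bit zs" using m w by (simp add: matches_def)
    have z: "z = take 2 zs" unfolding z_def peek_def s14
      by (cases zs; cases "tl zs") (auto simp: bit_eq)
    have s1: "s1 14 = map bit (drop 2 zs)" by (simp add: s1_def s14 drop_map numeral_2_eq_2 drop_Suc map_tl)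
    have st: "scan S (?l xs') = map_option (\<lambda>v. (fst v @ drop 2 zs, snd v)) (scan_step S (tok_of t) b (z, m0))"
      unfolding scan' w z by (simp only: Option.bind.simps) (rule scan_step_take)
    show ?thesis
    proof (cases "scan_step S (tok_of t) b (z, m0)")
      case None
      then have n: "scan S (?l xs') = None" unfolding st by simp
      have "sem (scan_cell S) s = sem (set_state ?q) s1" unfolding e prog m0(1) None using mode' n by simp
      then show ?thesis using n sem_set_state[OF q] by simp
    next
      case (Some v)
      obtain zs1 m1 where v: "v = (zs1, m1)" by (cases v)
      have n: "scan S (?l xs') = Some (zs1 @ drop 2 zs, m1)" unfolding st Some v by simp
      have "sem (scan_cell S) s = sem (set_state ?q) (s1(14 := map bit zs1 @ s1 14))"
        unfolding e prog m0(1) Some v using m0(2) mode' n by simp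
      then have "sem (scan_cell S) s = (s1(14 := map bit zs1 @ s1 14))(13 := [enc_state ?q])"
        unfolding sem_set_state[OF q] .
      then show ?thesis unfolding n using s1 by simp
    qed
  qed
  show "sem (scan_cell S) s 13 = [enc_state (fst (summary S lab r xs'), fst (var_pass xs), fst (snd (snd (summary S lab r xs'))),
      fst (snd (snd (var_pass xs))), var_bad xs, fst (modal_pass xs'), snd (modal_pass xs'), b, r)]"
    unfolding p using main by (rule conjunct1)
  show "scan S (?l xs') = Some (zs', m') \<Longrightarrow> sem (scan_cell S) s 14 = map bit zs'"
    using main by blast
qed

lemma sem_var_prog:
  assumes "m \<le> 4" "n \<le> 2" "x \<le> 3"
    and s: "s 13 = [enc_state (m, n, x, lo, vb, z)]" "s 15 = map bit old" "s 16 = map bit cur" "s 17 = []"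
    and len: "length old \<le> length (s 4)" "length cur \<le> length (s 4)"
    and step: "var_step t b c (n, old, lo, cur, vb) = (n', old', lo', cur', vb')"
  shows "sem (var_prog t b c (m, n, x, lo, vb, z)) s 13 = [enc_state (m, n', x, lo', vb', z)] \<and>
    sem (var_prog t b c (m, n, x, lo, vb, z)) s 15 = map bit old' \<and>
    sem (var_prog t b c (m, n, x, lo, vb, z)) s 16 = map bit cur' \<and>
    sem (var_prog t b c (m, n, x, lo, vb, z)) s 17 = []"
proof -
  have c17: "sem compare s 17 = (if old = cur then [] else [2])" by (rule sem_compare[OF s(2,3) len s(4)])
  have c: "peek (sem compare s) 17 = 1 \<longleftrightarrow> old = cur" unfolding peek_def c17 by simp
  consider "n = 0" | "n = 1" | "n = 2" using assms(2) by linarith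
  then show ?thesis
  proof cases
    case 1
    then show ?thesis using assms
      by (cases "(t, b, c, (n, old, lo, cur, vb))" rule: var_step.cases) (auto simp: var_prog_def sem_set_state)
  next
    case 2
    show ?thesis
    proof (cases "t = Some TVar \<and> c")
      case True
      have st: "n' = 2" "old' = []" "lo' = lo" "cur' = []" "vb' \<longleftrightarrow> old = cur \<and> lo \<noteq> b" using step 2 True by auto
      have "var_prog t b c (m, n, x, lo, vb, z) =
          compare ;; Case 17 (\<lambda>e. set_state (m, 2, x, lo, e = 1 \<and> lo \<noteq> b, z)) ;; Clr 15 ;; Clr 16 ;; Clr 17"
        using True 2 by (simp add: var_prog_def)
      then show ?thesis unfolding st using assms(1,3) by (simp add: sem_set_state c[unfolded One_nat_def])
    next
      case False
      then show ?thesis using 2 assms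
        by (cases "(t, b, c, (n, old, lo, cur, vb))" rule: var_step.cases) (auto simp: var_prog_def)
    qed
  next
    case 3
    then show ?thesis using s step by (simp add: var_prog_def var_step2)
  qed
qed

lemma sem_cell_prog:
  assumes m: "matches S lab r xs s" and len: "length xs \<le> length (s 4)"
    and s: "s 2 = t # l" "s 6 = bit b # y" "s 10 = bit c # cs" "s 11 = map bit ps"
  shows "matches S lab r ((tok_of t, b, c, head_opt ps) # xs) (sem (cell_prog S) s) \<and>
    sem (cell_prog S) s 6 = y \<and> sem (cell_prog S) s 9 = bit b # s 9 \<and> sem (cell_prog S) s 10 = cs \<and>
    sem (cell_prog S) s 11 = map bit (tl ps) \<and> sem (cell_prog S) s 12 = bit b # s 12"
proof -
  let ?xs = "(tok_of t, b, c, head_opt ps) # xs"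
  define s1 where "s1 = sem (scan_cell S) s"
  define s2 where "s2 = sem var_cell s1"
  have s3: "sem (cell_prog S) s = sem move_cell s2" by (simp add: cell_prog_def s1_def s2_def)
  have o1: "s1 i = s i" if "i \<notin> {13, 14}" for i unfolding s1_def using writes_scan_cell(1)[of S] that by (intro sem_unchanged) auto
  have o2: "s2 i = s1 i" if "i \<notin> {13, 15, 16, 17}" for i unfolding s2_def using writes_var_cell(1) that by (intro sem_unchanged) auto
  obtain n old lo cur vb where v: "var_pass xs = (n, old, lo, cur, vb)" by (metis prod_cases5)
  obtain n' old' lo' cur' vb' where v': "var_step (tok_of t) b c (n, old, lo, cur, vb) = (n', old', lo', cur', vb')"
    by (metis prod_cases5)
  have vx: "var_pass ?xs = (n', old', lo', cur', vb')" using v v' by simp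
  define q where "q = summary S lab r ?xs"
  obtain m0 x0 where q: "q = (m0, n', x0, lo', vb', fst (modal_pass ?xs), snd (modal_pass ?xs), b, r)"
    unfolding q_def summary_def var_bad_def vx by simp
  have q': "m0 \<le> 4" "n \<le> 2" "x0 \<le> 3"
    using summary_in_lstates[of S lab r ?xs] var_pass_bounds[of xs] unfolding q_def[symmetric] q v by simp_all
  have len': "length old \<le> length (s1 4)" "length cur \<le> length (s1 4)"
    using var_pass_bounds[of xs] len o1[of 4] unfolding v by simp_all
  have a13: "s1 13 = [enc_state (m0, n, x0, lo, vb, fst (modal_pass ?xs), snd (modal_pass ?xs), b, r)]"
    using sem_scan_cell(1)[OF m s] unfolding s1_def q_def[symmetric] q v var_bad_def fst_conv snd_conv .
  have a15: "s1 15 = map bit old" "s1 16 = map bit cur" "s1 17 = []"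
    using m o1 unfolding matches_def v by simp_all
  have pk: "peek s1 2 = t" "peek s1 6 = bit b" "peek s1 10 = bit c"
    "peek s1 13 = enc_state (m0, n, x0, lo, vb, fst (modal_pass ?xs), snd (modal_pass ?xs), b, r)"
    using s o1 a13 by (simp_all add: peek_def)
  have "s2 = sem (var_prog (tok_of t) b c (m0, n, x0, lo, vb, fst (modal_pass ?xs), snd (modal_pass ?xs), b, r)) s1"
    unfolding s2_def var_cell_def sem.simps pk dec_enc_state bit_eq ..
  then have b: "s2 13 = [enc_state q]" "s2 15 = map bit old'" "s2 16 = map bit cur'" "s2 17 = []"
    using sem_var_prog[OF q' a13 a15 len' v'] unfolding q by simp_all
  have "s2 14 = map bit zs" if "scan S (map (\<lambda>x. (fst x, fst (snd x))) ?xs) = Some (zs, m')" for zs m'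
    using sem_scan_cell(2)[OF m s that] o2[of 14] unfolding s1_def by simp
  then have "matches S lab r ?xs s2" unfolding matches_def vx fst_conv snd_conv using b unfolding q_def by blast
  then have "matches S lab r ?xs (sem move_cell s2)" unfolding matches_def move_cell_def by simp
  moreover have "s2 i = s i" if "i \<in> {6, 9, 10, 11, 12}" for i using that o1[of i] o2[of i] by auto
  ultimately show ?thesis unfolding s3 using s by (simp add: move_cell_def peek_def bit_eq map_tl)
qed

fun gather :: "nat list \<Rightarrow> bool list \<Rightarrow> bool list \<Rightarrow> bool list \<Rightarrow> cell list \<Rightarrow> cell list" where
  "gather (t # l) (b # bs) (c # cs) ps xs = gather l bs cs (tl ps) ((tok_of t, b, c, head_opt ps) # xs)"
| "gather _ _ _ _ xs = xs"

lemma sem_sweep: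
  assumes "length bs = length l" "length cs = length l" "matches S lab r xs s" "length xs + length l \<le> length (s 4)"
    "s 6 = map bit bs @ y" "s 10 = map bit cs" "s 11 = map bit ps"
  defines "s' \<equiv> loop (sem (cell_prog S)) 2 l s"
  shows "matches S lab r (gather l bs cs ps xs) s' \<and> s' 6 = y \<and> s' 9 = map bit (rev bs) @ s 9 \<and> s' 10 = [] \<and>
    s' 11 = map bit (drop (length l) ps) \<and> s' 12 = map bit (rev bs) @ s 12"
  using assms(1-7) unfolding s'_def
proof (induction l arbitrary: bs cs ps xs s)
  case Nil
  then show ?case by simp
next
  case (Cons t l)
  obtain b bs' where bs: "bs = b # bs'" using Cons.prems(1) by (cases bs) auto
  obtain c cs' where cs: "cs = c # cs'" using Cons.prems(2) by (cases cs) auto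
  let ?s = "s(2 := t # l)"
  let ?t = "sem (cell_prog S) ?s"
  have m: "matches S lab r xs ?s" using Cons.prems(3) by (simp add: matches_def)
  have l4: "length xs \<le> length (?s 4)" using Cons.prems(4) by simp
  have s: "?s 2 = t # l" "?s 6 = bit b # map bit bs' @ y" "?s 10 = bit c # map bit cs'" "?s 11 = map bit ps"
    using Cons.prems(5-7) bs cs by simp_all
  have t4: "?t 4 = ?s 4" using cell_prog_frame(1)[of S] by (intro sem_unchanged) auto
  note c = sem_cell_prog[OF m l4 s]
  have len: "length bs' = length l" "length cs' = length l" using Cons.prems(1,2) bs cs by simp_all
  have "length ((tok_of t, b, c, head_opt ps) # xs) + length l \<le> length (?t 4)" using Cons.prems(4) t4 by simp
  note IH = Cons.IH[where bs=bs' and cs=cs' and ps="tl ps" and s="?t" and xs="(tok_of t, b, c, head_opt ps) # xs", OF len _ this]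
  show ?case unfolding bs cs loop.simps gather.simps using IH c by (simp add: drop_Suc)
qed

section \<open>Programs for a round and for a whole play\<close>

definition transfer :: "nat \<Rightarrow> nat \<Rightarrow> nat \<Rightarrow> nat \<Rightarrow> prog" where
  "transfer i a d e = For i (Case a (\<lambda>b. Pop a ;; Push d (bit (b = 3)) ;; Push e (bit (b = 3))))"

lemma sem_transfer:
  assumes d: "distinct [i, a, d, e]" and s: "s a = map bit u @ y" "length u = length (s i)"
  shows "sem (transfer i a d e) s = s(a := y, d := map bit (rev u) @ s d, e := map bit (rev u) @ s e)"
proof -
  define f where "f = sem (Case a (\<lambda>b. Pop a ;; Push d (bit (b = 3)) ;; Push e (bit (b = 3))))"
  have f: "f t = t(a := w, d := bit b # t d, e := bit b # t e)" if "t a = bit b # w" for t b w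
    using that d by (simp add: f_def peek_def bit_eq)
  have "(loop f i l s)(i := z) = s(a := y, d := map bit (rev u) @ s d, e := map bit (rev u) @ s e, i := z)"
    if "s a = map bit u @ y" "length u = length l" for l s u z
    using that
  proof (induction l arbitrary: s u)
    case Nil
    then show ?case by auto
  next
    case (Cons x l)
    obtain b u' where u: "u = b # u'" using Cons.prems(2) by (cases u) auto
    define t where "t = f (s(i := x # l))"
    have t: "t = s(i := x # l, a := map bit u' @ y, d := bit b # s d, e := bit b # s e)"
      unfolding t_def using f[of "s(i := x # l)" b "map bit u' @ y"] Cons.prems(1) d u by simp
    have "t a = map bit u' @ y" "length u' = length l" using t d Cons.prems(2) u by simp_all
    from Cons.IH[where s=t and u=u', OF this] show ?case unfolding loop.simps t_def[symmetric] u
      by (rule trans) (use d in \<open>auto simp: t fun_eq_iff\<close>)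
  qed
  from this[where s=s and u=u and l="s i" and z="s i", OF s] have "sem (transfer i a d e) s =
      s(a := y, d := map bit (rev u) @ s d, e := map bit (rev u) @ s e, i := s i)"
    by (simp add: transfer_def f_def)
  also have "\<dots> = s(a := y, d := map bit (rev u) @ s d, e := map bit (rev u) @ s e)"
    using d by (auto simp: fun_eq_iff)
  finally show ?thesis .
qed

definition conclude :: "lstate \<Rightarrow> bool \<Rightarrow> lstate" where
  "conclude q one = (case q of (m, n, x, lo, vb, seen, bad, lab, r) \<Rightarrow>
     (1, 0, 1, False, False, False, False, lab, one \<and> m \<noteq> 0 \<and> m \<noteq> 2 \<and> m \<noteq> 3 \<and> \<not> vb \<and> (seen \<longrightarrow> \<not> bad \<and> r)))"

definition finish :: prog where
  "finish = Case 13 (\<lambda>v. Case 14 (\<lambda>z1. Pop 14 ;; Case 14 (\<lambda>z2. set_state (conclude (dec_state v) (z1 \<noteq> 1 \<and> z2 = 1))))) ;;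
     Clr 14 ;; Clr 15 ;; Clr 16"

definition top_label :: "bool \<Rightarrow> cell list \<Rightarrow> bool" where
  "top_label lab xs = (case xs of [] \<Rightarrow> lab | x # _ \<Rightarrow> fst (snd x))"

lemma summary_Nil: "summary S lab r [] = (1, 0, 1, False, False, False, False, lab, r)"
  by (simp add: summary_def next_label_def var_bad_def)

lemma conclude_in_lstates: "conclude q one \<in> lstates"
  unfolding conclude_def by (auto split: prod.splits)

text \<open>After a round the store again matches the empty cell list, now carrying the value and
  the first label of that round. This makes rounds composable.\<close>

lemma sem_finish:
  assumes m: "matches S lab r xs s"
  shows "matches S (top_label lab xs) (block_value S xs r) [] (sem finish s)"
proof -
  let ?ys = "map (\<lambda>x. (fst x, fst (snd x))) xs"
  define one where "one = (peek s 14 \<noteq> 1 \<and> peek (s(14 := tl (s 14))) 14 = 1)"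
  have c: "conclude (summary S lab r xs) one =
      (1, 0, 1, False, False, False, False, top_label lab xs, one \<and> (case scan S ?ys of None \<Rightarrow> 0 | Some z \<Rightarrow> snd z) \<notin> {0, 2, 3}
        \<and> \<not> var_bad xs \<and> (fst (modal_pass xs) \<longrightarrow> \<not> snd (modal_pass xs) \<and> r))"
    by (simp add: conclude_def summary_def top_label_def)
  have "(one \<and> (case scan S ?ys of None \<Rightarrow> 0 | Some z \<Rightarrow> snd z) \<notin> {0, 2, 3}) \<longleftrightarrow> scan_ok S ?ys"
  proof (cases "scan S ?ys")
    case None
    then show ?thesis by (simp add: scan_ok_def)
  next
    case (Some w)
    then obtain zs m0 where w: "scan S ?ys = Some (zs, m0)" by (cases w) simp
    have s14: "s 14 = map bit zs" using m w by (simp add: matches_def)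
    have "one \<longleftrightarrow> (\<exists>z. zs = [z])" unfolding one_def peek_def s14
      by (cases zs; cases "tl zs") (auto simp: bit_eq)
    then show ?thesis unfolding scan_ok_def w using scan_mode[OF w] by auto
  qed
  then have v: "conclude (summary S lab r xs) one = summary S (top_label lab xs) (block_value S xs r) []"
    unfolding c summary_Nil block_value_def by blast
  have p: "peek s 13 = enc_state (summary S lab r xs)" using m by (simp add: peek_def matches_def)
  have s17: "s 17 = []" using m by (simp add: matches_def)
  have "sem finish s = (s(14 := tl (s 14), 13 := [enc_state (conclude (summary S lab r xs) one)]))(14 := [], 15 := [], 16 := [])"
    unfolding finish_def sem.simps p dec_enc_state one_def[symmetric] sem_set_state[OF conclude_in_lstates] ..
  then show ?thesis unfolding matches_def v using s17 by simp
qed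

text \<open>Marks are quantified after labels and lie above them on register 6. Moving them to
  register 10 reverses them into the right-to-left order of the tokens; register 9 keeps all bits
  for restoring 6. The labels collected in 12 become, in register 11, the successor labels for the
  preceding round.\<close>

definition block_prog :: "connective set \<Rightarrow> prog" where
  "block_prog S = transfer 2 6 10 9 ;; For 2 (cell_prog S) ;; finish ;; transfer 2 12 11 17 ;; Clr 17"

text \<open>The initial state is the summary of no cells, with the value true of the empty play.
  Finally the loop over the quantifiers, of which there are as many as bits, moves the bits back
  from 9 to 6, so that only register 8 has changed.\<close>

definition leaf_prog :: "connective set \<Rightarrow> prog" where
  "leaf_prog S = set_state (1, 0, 1, False, False, False, False, False, True) ;; For 3 (block_prog S) ;;
     Case 13 (\<lambda>v. case dec_state v of (m, n, x, lo, vb, seen, bad, lab, r) \<Rightarrow> Push 8 (bit (r \<and> lab))) ;;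
     Clr 13 ;; Clr 11 ;; transfer 5 9 6 17 ;; Clr 17"

lemma writes_finish: "writes finish \<subseteq> {13, 14, 15, 16}" "fors finish = {}"
  unfolding finish_def by auto

lemma transfer_frame: "writes (transfer i a d e) \<subseteq> {a, d, e}" "fors (transfer i a d e) = {i}"
  unfolding transfer_def by auto

lemma wf_transfer: "i < 19 \<Longrightarrow> a < 19 \<Longrightarrow> d < 19 \<Longrightarrow> e < 19 \<Longrightarrow> distinct [i, a, d, e] \<Longrightarrow> wf_prog 19 num_syms (transfer i a d e)"
  unfolding transfer_def by auto

lemma block_prog_frame: "writes (block_prog S) \<subseteq> {6, 9, 10, 11, 12, 13, 14, 15, 16, 17}" "fors (block_prog S) \<subseteq> {2, 4}"
  "wf_prog 19 num_syms (block_prog S)"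
proof -
  have "wf_prog 19 num_syms finish" unfolding finish_def by simp
  moreover have "2 \<notin> writes (cell_prog S)" "2 \<notin> fors (cell_prog S)" using cell_prog_frame[of S] by auto
  ultimately show "wf_prog 19 num_syms (block_prog S)"
    unfolding block_prog_def using cell_prog_frame(3)[of S] by (simp add: wf_transfer)
  show "writes (block_prog S) \<subseteq> {6, 9, 10, 11, 12, 13, 14, 15, 16, 17}" "fors (block_prog S) \<subseteq> {2, 4}"
    unfolding block_prog_def using cell_prog_frame[of S] subsetD[OF writes_finish(1)] transfer_frame(1)[of 2 6 10 9] transfer_frame(1)[of 2 12 11 17]
    by (auto simp: transfer_frame(2) writes_finish(2))
qed

lemma leaf_prog_frame: "writes (leaf_prog S) \<subseteq> {6, 8, 9, 10, 11, 12, 13, 14, 15, 16, 17}" "fors (leaf_prog S) \<subseteq> {2, 3, 4, 5}"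
  "wf_prog 19 num_syms (leaf_prog S)"
proof -
  have "3 \<notin> writes (block_prog S)" "3 \<notin> fors (block_prog S)" using block_prog_frame[of S] by auto
  then show "wf_prog 19 num_syms (leaf_prog S)"
    unfolding leaf_prog_def using block_prog_frame(3)[of S] by (simp add: wf_transfer split: prod.split)
  show "writes (leaf_prog S) \<subseteq> {6, 8, 9, 10, 11, 12, 13, 14, 15, 16, 17}" "fors (leaf_prog S) \<subseteq> {2, 3, 4, 5}"
    unfolding leaf_prog_def using block_prog_frame[of S] transfer_frame(1)[of 5 9 6 17]
    by (auto simp: transfer_frame(2) split: prod.splits)
qed

lemma gather_eq:
  assumes "length bs = length l" "length cs = length l"
  shows "gather l bs cs ps xs = rev (map (\<lambda>i. (tok_of (l ! i), bs ! i, cs ! i, if i < length ps then Some (ps ! i) else None)) [0..<length l]) @ xs"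
  using assms
proof (induction l arbitrary: bs cs ps xs)
  case (Cons t l)
  obtain b bs' where bs: "bs = b # bs'" using Cons.prems(1) by (cases bs) auto
  obtain c cs' where cs: "cs = c # cs'" using Cons.prems(2) by (cases cs) auto
  have len: "length bs' = length l" "length cs' = length l" using Cons.prems bs cs by simp_all
  have up: "[0..<length (t # l)] = 0 # map Suc [0..<length l]" by (simp add: map_Suc_upt upt_conv_Cons del: upt_Suc)
  have h: "head_opt ps = (if 0 < length ps then Some (ps ! 0) else None)" by (cases ps) (simp_all add: head_opt_def)
  show ?case unfolding bs cs gather.simps Cons.IH[OF len] up by (auto simp: h o_def nth_tl)
qed simp

lemma gather_cells:
  assumes "length T = length ts" "length C = length ts" "\<And>P. p = Some P \<Longrightarrow> length P = length ts"
  shows "gather (rev ts) (rev T) (rev C) (case p of None \<Rightarrow> [] | Some P \<Rightarrow> rev P) [] = cells (map tok_of ts) T C p"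
proof (rule nth_equalityI)
  fix i assume i: "i < length (gather (rev ts) (rev T) (rev C) (case p of None \<Rightarrow> [] | Some P \<Rightarrow> rev P) [])"
  then have n: "i < length ts" using assms by (simp add: gather_eq)
  moreover have "length ts - Suc i < length ts" using n by simp
  ultimately show "gather (rev ts) (rev T) (rev C) (case p of None \<Rightarrow> [] | Some P \<Rightarrow> rev P) [] ! i = cells (map tok_of ts) T C p ! i"
    using assms by (simp add: gather_eq rev_map[symmetric] rev_nth nth_cells split: option.split)
qed (use assms in \<open>simp add: gather_eq\<close>)

abbreviation prev_labels :: "bool list option \<Rightarrow> bool list" where
  "prev_labels p \<equiv> (case p of None \<Rightarrow> [] | Some P \<Rightarrow> rev P)"

lemma sem_block_prog:
  assumes m: "matches S lab r [] s" and s: "s 2 = rev ts" "length (s 4) = length ts" "s 6 = map bit (C @ rev T) @ y"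
      "s 10 = []" "s 11 = map bit (prev_labels p)" "s 12 = []"
    and len: "length T = length ts" "length C = length ts" "\<And>P. p = Some P \<Longrightarrow> length P = length ts"
  defines "xs \<equiv> cells (map tok_of ts) T C p"
  shows "matches S (top_label lab xs) (block_value S xs r) [] (sem (block_prog S) s)" (is ?A)
    and "sem (block_prog S) s 6 = y" "sem (block_prog S) s 9 = map bit (rev (C @ rev T)) @ s 9"
      "sem (block_prog S) s 10 = []" "sem (block_prog S) s 11 = map bit (rev T)" "sem (block_prog S) s 12 = []"
proof -
  define s1 where "s1 = sem (transfer 2 6 10 9) s"
  define s2 where "s2 = sem (For 2 (cell_prog S)) s1"
  define s3 where "s3 = sem finish s2"
  define s4 where "s4 = sem (transfer 2 12 11 17) s3"
  have fin: "sem (block_prog S) s = s4(17 := [])"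
    unfolding block_prog_def sem.simps s1_def s2_def s3_def s4_def ..
  have s1: "s1 = s(6 := map bit (rev T) @ y, 10 := map bit (rev C) @ s 10, 9 := map bit (rev C) @ s 9)"
    unfolding s1_def by (rule sem_transfer) (use s len in simp_all)
  have m1: "matches S lab r [] s1" using m unfolding s1 matches_def by simp
  have "length (rev T) = length (rev ts)" "length (rev C) = length (rev ts)" "length [] + length (rev ts) \<le> length (s1 4)"
    "s1 6 = map bit (rev T) @ y" "s1 10 = map bit (rev C)" "s1 11 = map bit (prev_labels p)"
    using s len unfolding s1 by simp_all
  note sweep = sem_sweep[OF this(1,2) m1 this(3-6)]
  have s12: "s1 2 = rev ts" and s12': "s1 12 = []" unfolding s1 using s by simp_all
  have l2: "s2 i = loop (sem (cell_prog S)) 2 (rev ts) s1 i" if "i \<noteq> 2" for i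
    unfolding s2_def using that s12 by simp
  have g: "gather (rev ts) (rev T) (rev C) (prev_labels p) [] = xs" unfolding xs_def by (rule gather_cells[OF len])
  have "length (prev_labels p) \<le> length ts" using len(3) by (cases p) simp_all
  then have d: "drop (length (rev ts)) (prev_labels p) = []" by simp
  have m2: "matches S lab r xs s2" using sweep unfolding g matches_def by (simp add: l2)
  have v2: "s2 6 = y" "s2 9 = map bit T @ s1 9" "s2 10 = []" "s2 11 = []" "s2 12 = map bit T"
    using sweep s12' unfolding d by (simp_all add: l2)
  have o3: "s3 i = s2 i" if "i \<notin> {13, 14, 15, 16}" for i
    unfolding s3_def using writes_finish(1) that by (intro sem_unchanged) blast
  have m3: "matches S (top_label lab xs) (block_value S xs r) [] s3" unfolding s3_def by (rule sem_finish[OF m2])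
  have "s2 2 = s1 2" using cell_prog_frame(1)[of S] unfolding s2_def by (intro sem_unchanged) auto
  then have s32: "s3 2 = rev ts" using o3 s12 by simp
  have s4: "s4 = s3(12 := [], 11 := map bit (rev T) @ s3 11, 17 := map bit (rev T) @ s3 17)"
    unfolding s4_def by (rule sem_transfer) (use o3 v2 s32 len in simp_all)
  show ?A using m3 unfolding fin s4 matches_def by simp
  show "sem (block_prog S) s 6 = y" "sem (block_prog S) s 9 = map bit (rev (C @ rev T)) @ s 9"
      "sem (block_prog S) s 10 = []" "sem (block_prog S) s 11 = map bit (rev T)" "sem (block_prog S) s 12 = []"
    unfolding fin s4 using o3 v2 by (simp_all add: s1)
qed

definition play_bits :: "(bool list \<times> bool list) list \<Rightarrow> bool list" where
  "play_bits rp = concat (map (\<lambda>(T, C). C @ rev T) rp)"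

definition play_label :: "(bool list \<times> bool list) list \<Rightarrow> bool" where
  "play_label play \<longleftrightarrow> play \<noteq> [] \<and> fst (hd play) ! 0"

lemma snd_play_value: "snd (play_value S us play) = (case play of [] \<Rightarrow> None | x # _ \<Rightarrow> Some (fst x))"
  by (cases play) simp_all

text \<open>The last round is on top of register 6, and \<open>play_value\<close> needs the later
  rounds first. So \<open>rp\<close> lists the rounds still on the stack, the last one first, and
  \<open>rest\<close> those already evaluated.\<close>

lemma sem_blocks:
  assumes "length l = length rp" "\<And>T C. (T, C) \<in> set (rp @ rest) \<Longrightarrow> length T = length ts \<and> length C = length ts" "ts \<noteq> []"
    "matches S (play_label rest) (fst (play_value S (map tok_of ts) rest)) [] s" "s 2 = rev ts" "length (s 4) = length ts"
    "s 6 = map bit (play_bits rp) @ y" "s 10 = []" "s 11 = map bit (prev_labels (snd (play_value S (map tok_of ts) rest)))" "s 12 = []"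
  defines "s' \<equiv> loop (sem (block_prog S)) 3 l s"
  shows "matches S (play_label (rev rp @ rest)) (fst (play_value S (map tok_of ts) (rev rp @ rest))) [] s' \<and>
    s' 6 = y \<and> s' 9 = map bit (rev (play_bits rp)) @ s 9 \<and> s' 10 = [] \<and> s' 12 = []"
  using assms(1-10) unfolding s'_def
proof (induction l rp arbitrary: s rest rule: list_induct2)
  case Nil
  then show ?case by (simp add: play_bits_def)
next
  case (Cons a l x rp)
  obtain T C where x: "x = (T, C)" by (cases x)
  have lens: "length T = length ts" "length C = length ts" using Cons.prems(1)[of T C] x by simp_all
  let ?p = "snd (play_value S (map tok_of ts) rest)"
  have p: "length P = length ts" if "?p = Some P" for P
    using that Cons.prems(1) unfolding snd_play_value by (cases rest) (auto simp: prod_eq_iff)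
  let ?xs = "cells (map tok_of ts) T C ?p"
  define u where "u = s(3 := a # l)"
  define t where "t = sem (block_prog S) u"
  have m: "matches S (play_label rest) (fst (play_value S (map tok_of ts) rest)) [] u"
    using Cons.prems(3) by (simp add: matches_def u_def)
  have s: "u 2 = rev ts" "length (u 4) = length ts" "u 6 = map bit (C @ rev T) @ map bit (play_bits rp) @ y"
      "u 10 = []" "u 11 = map bit (prev_labels ?p)" "u 12 = []"
    using Cons.prems(4-9) by (simp_all add: x play_bits_def u_def)
  note b = sem_block_prog[OF m s lens p, folded t_def]
  have v: "play_value S (map tok_of ts) (x # rest) = (block_value S ?xs (fst (play_value S (map tok_of ts) rest)), Some T)"
    by (simp add: x)
  have tl: "top_label (play_label rest) ?xs = play_label (x # rest)"
  proof -
    have "?xs \<noteq> []" using Cons.prems(2) by (simp add: cells_def)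
    then have "top_label (play_label rest) ?xs = fst (snd (?xs ! 0))" unfolding top_label_def by (cases ?xs) simp_all
    also have "\<dots> = T ! 0" using Cons.prems(2) by (simp add: nth_cells)
    finally show ?thesis by (simp add: play_label_def x)
  qed
  have o: "t i = u i" if "i \<notin> {6, 9, 10, 11, 12, 13, 14, 15, 16, 17}" for i
    unfolding t_def using block_prog_frame(1)[of S] that by (intro sem_unchanged) blast
  have t: "matches S (play_label (x # rest)) (fst (play_value S (map tok_of ts) (x # rest))) [] t"
    unfolding v fst_conv tl[symmetric] by (rule b(1))
  have t2: "t 2 = rev ts" "length (t 4) = length ts" "t 6 = map bit (play_bits rp) @ y" "t 10 = []"
    "t 11 = map bit (prev_labels (snd (play_value S (map tok_of ts) (x # rest))))" "t 12 = []"
    using o[of 2] o[of 4] s(1,2) b(2-6) unfolding v by simp_all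
  have "length T' = length ts \<and> length C' = length ts" if "(T', C') \<in> set (rp @ x # rest)" for T' C'
    using that Cons.prems(1)[of T' C'] by auto
  from Cons.IH[of "x # rest" t, OF this Cons.prems(2) t t2]
  show ?case unfolding loop.simps u_def[symmetric] t_def[symmetric] using b(3) by (simp add: x play_bits_def u_def)
qed

theorem sem_leaf_prog:
  assumes rp: "length rp = length ts" "\<And>T C. (T, C) \<in> set rp \<Longrightarrow> length T = length ts \<and> length C = length ts"
    and s: "s 2 = rev ts" "length (s 3) = length ts" "length (s 4) = length ts" "length (s 5) = length (play_bits rp)"
      "s 6 = map bit (play_bits rp)" "\<And>i. 8 \<le> i \<Longrightarrow> i \<le> 17 \<Longrightarrow> s i = []"
  shows "sem (leaf_prog S) s = s(8 := [bit (fst (play_value S (map tok_of ts) (rev rp)) \<and> play_label (rev rp))])"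
proof -
  define s1 where "s1 = s(13 := [enc_state (1, 0, 1, False, False, False, False, False, True)])"
  define s2 where "s2 = sem (For 3 (block_prog S)) s1"
  let ?v = "fst (play_value S (map tok_of ts) (rev rp))" and ?l = "play_label (rev rp)"
  have m1: "matches S (play_label []) (fst (play_value S (map tok_of ts) [])) [] s1"
    using s(6) by (simp add: matches_def summary_Nil play_label_def s1_def)
  have v: "matches S ?l ?v [] s2 \<and> s2 6 = [] \<and> s2 9 = map bit (rev (play_bits rp)) \<and> s2 10 = [] \<and> s2 12 = []"
  proof (cases "ts = []")
    case True
    then have "rp = []" "s1 3 = []" using rp(1) s(2) by (simp_all add: s1_def)
    then show ?thesis unfolding s2_def using m1 s(5,6) by (simp add: play_bits_def s1_def matches_def)
  next
    case False
    have l: "s2 i = loop (sem (block_prog S)) 3 (s1 3) s1 i" if "i \<noteq> 3" for i unfolding s2_def using that by simp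
    have "length (s1 3) = length rp" "\<And>T C. (T, C) \<in> set (rp @ []) \<Longrightarrow> length T = length ts \<and> length C = length ts"
      using s(2) rp by (simp_all add: s1_def)
    moreover have "s1 2 = rev ts" "length (s1 4) = length ts" "s1 6 = map bit (play_bits rp) @ []" "s1 10 = []"
      "s1 11 = map bit (prev_labels (snd (play_value S (map tok_of ts) [])))" "s1 12 = []"
      using s by (simp_all add: s1_def)
    ultimately show ?thesis
      using sem_blocks[of "s1 3" rp "[]" ts S s1 "[]"] False m1 s(6) unfolding matches_def by (simp add: l s1_def)
  qed
  have o: "s2 i = s1 i" if "i \<notin> {6, 9, 10, 11, 12, 13, 14, 15, 16, 17}" for i
    unfolding s2_def using block_prog_frame(1)[of S] that by (intro sem_unchanged) auto
  have p: "peek s2 13 = enc_state (1, 0, 1, False, False, False, False, ?l, ?v)"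
    using v by (simp add: peek_def matches_def summary_Nil)
  define s3 where "s3 = s2(8 := bit (?v \<and> ?l) # s2 8, 13 := [], 11 := [])"
  have "sem (transfer 5 9 6 17) s3 = s3(9 := [], 6 := map bit (rev (rev (play_bits rp))) @ s3 6, 17 := map bit (rev (rev (play_bits rp))) @ s3 17)"
    by (rule sem_transfer) (use v o[of 5] s(4) in \<open>simp_all add: s3_def s1_def\<close>)
  moreover have "sem (leaf_prog S) s = sem (transfer 5 9 6 17 ;; Clr 17) s3"
  proof -
    have a: "sem (set_state (1, 0, 1, False, False, False, False, False, True)) s = s1"
      unfolding s1_def by (rule sem_set_state) simp
    have b: "sem (Case 13 (\<lambda>v. case dec_state v of (m, n, x, lo, vb, seen, bad, lab, r) \<Rightarrow> Push 8 (bit (r \<and> lab)))) s2 =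
        s2(8 := bit (?v \<and> ?l) # s2 8)"
      unfolding sem.simps(5) p dec_enc_state prod.case sem.simps(2) ..
    show ?thesis unfolding leaf_prog_def sem.simps(6) a s2_def[symmetric] b sem.simps(4) s3_def ..
  qed
  ultimately have "sem (leaf_prog S) s = s3(9 := [], 6 := map bit (play_bits rp) @ s3 6, 17 := [])"
    by (simp only: sem.simps(4,6) rev_rev_ident fun_upd_upd)
  also have "\<dots> = s(8 := [bit (?v \<and> ?l)])"
  proof
    fix i
    have e: "s2 8 = []" "s2 14 = []" "s2 15 = []" "s2 16 = []" "s2 17 = []"
      using v o[of 8] s(6) by (simp_all add: matches_def s1_def)
    show "(s3(9 := [], 6 := map bit (play_bits rp) @ s3 6, 17 := [])) i = (s(8 := [bit (?v \<and> ?l)])) i"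
    proof (cases "i \<in> {6, 8, 9, 10, 11, 12, 13, 14, 15, 16, 17}")
      case True
      then show ?thesis using v e s(5,6) by (auto simp: s3_def)
    next
      case False
      then show ?thesis using o[of i] by (simp add: s3_def s1_def)
    qed
  qed
  finally show ?thesis .
qed

subsection \<open>Membership in PSPACE\<close>

text \<open>The input is read from its end, and groups of four bits are collected as a number in
  register 18. Leftover bits at the front produce the symbol 4, which is no token number, so an
  input of the wrong length shows up as an invalid token.\<close>

definition read_prog :: prog where
  "read_prog = For 0 (Case 0 (\<lambda>b. Case 18 (\<lambda>v. let w = 2 * v + (if b = 3 then 1 else 0) in
       Clr 18 ;; (if w < 16 then Push 18 w else if w < 32 then Push 1 w else Skip)))) ;;
     Case 18 (\<lambda>v. if v = 1 then Skip else Push 1 4) ;; Clr 18"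

definition copy_prog :: prog where
  "copy_prog = For 1 (Case 1 (\<lambda>t. if t = 1 then Skip else Push 2 t ;; Push 3 t ;; Push 4 t))"

definition fill_prog :: "nat \<Rightarrow> prog" where
  "fill_prog a = For 2 (Push 5 a ;; Push 6 2)"

definition init_prog :: prog where
  "init_prog = read_prog ;; copy_prog ;; For 3 (fill_prog 2 ;; fill_prog 3) ;; Push 7 3"

definition symbols :: "bool list \<Rightarrow> nat list" where
  "symbols x = sem read_prog (init_store x) 1"

lemma read_prog_frame: "writes read_prog \<subseteq> {1, 18}" "fors read_prog = {0}" "wf_prog 19 num_syms read_prog"
  unfolding read_prog_def Let_def using num_syms(1) by (auto split: if_splits)

lemma copy_prog_frame: "writes copy_prog \<subseteq> {2, 3, 4}" "fors copy_prog = {1}" "wf_prog 19 num_syms copy_prog"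
  unfolding copy_prog_def using num_syms(1) by (auto split: if_splits)

lemma tame_init_prog: "tame 19 num_syms init_prog"
proof -
  have K: "2 \<le> num_syms" using num_syms(1) by simp
  have "tame 19 num_syms read_prog" "tame 19 num_syms copy_prog"
    using read_prog_frame copy_prog_frame by (intro tame_simple[OF K]; auto)+
  moreover have "tame 19 num_syms (For 3 (fill_prog 2 ;; fill_prog 3) ;; Push 7 3)"
    using num_syms(1) by (intro tame_simple[OF K]) (auto simp: fill_prog_def)
  ultimately show ?thesis unfolding init_prog_def by (rule tame_Seq[OF K _ tame_Seq[OF K]])
qed

lemma sem_read_prog:
  "\<exists>gs p. x = p @ concat gs \<and> (\<forall>g \<in> set gs. length g = 4) \<and> length p < 4 \<and>
     sem read_prog (init_store x) = (init_store x)(1 := (if p = [] then [] else [4]) @ map code_num gs)"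
proof -
  define f where "f = sem (Case 0 (\<lambda>b. Case 18 (\<lambda>v. let w = 2 * v + (if b = 3 then 1 else 0) in
       Clr 18 ;; (if w < 16 then Push 18 w else if w < 32 then Push 1 w else Skip))))"
  define s1 where "s1 = (loop f 0 (init_store x 0) (init_store x))(0 := init_store x 0)"
  define P where "P l s \<longleftrightarrow> (\<exists>gs p rest. x = rest @ p @ concat gs \<and> l = rev (map bit rest) \<and> (\<forall>g \<in> set gs. length g = 4) \<and>
     length p < 4 \<and> s 18 = (if p = [] then [] else [code_num p]) \<and> s 1 = map code_num gs)" for l and s :: store
  have "P [] (loop f 0 (init_store x 0) (init_store x))"
  proof (rule loop_induct[where P=P])
    show "P (init_store x 0) (init_store x)" unfolding P_def
      by (rule exI[of _ "[]"], rule exI[of _ "[]"], rule exI[of _ x]) (simp add: init_store_def)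
    fix a l s assume "P (a # l) s"
    then obtain gs p rest where h: "x = rest @ p @ concat gs" "a # l = rev (map bit rest)" "\<forall>g \<in> set gs. length g = 4"
      "length p < 4" "s 18 = (if p = [] then [] else [code_num p])" "s 1 = map code_num gs" unfolding P_def by blast
    obtain b rest' where r: "rest = rest' @ [b]" using h(2) by (cases rest rule: rev_cases) auto
    have a: "a = bit b" "l = rev (map bit rest')" using h(2) unfolding r by simp_all
    have pk: "peek (s(0 := a # l)) 18 = code_num p" using h(5) by (simp add: peek_def)
    have w: "2 * code_num p + (if b then 1 else 0) = code_num (b # p)" by simp
    have e: "f (s(0 := a # l)) = sem (if code_num (b # p) < 16 then Push 18 (code_num (b # p))
        else if code_num (b # p) < 32 then Push 1 (code_num (b # p)) else Skip) (s(0 := a # l, 18 := []))"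
      unfolding f_def sem.simps Let_def pk by (simp only: peek_def fun_upd_same list.case a bit_eq w)
    show "P l (f (s(0 := a # l)))"
    proof (cases "length (b # p) = 4")
      case True
      then have "16 \<le> code_num (b # p)" "code_num (b # p) < 32" using code_num_bounds[of "b # p"] by simp_all
      then show ?thesis unfolding e P_def
        by (intro exI[of _ "(b # p) # gs"] exI[of _ "[]"] exI[of _ rest']) (use h r a True in simp)
    next
      case False
      then have l: "length (b # p) < 4" using h(4) by simp
      have "(2 :: nat) ^ length (b # p) \<le> 2 ^ 3" using l by (intro power_increasing) auto
      then have "code_num (b # p) < 16" using code_num_bounds[of "b # p"] by simp
      then show ?thesis unfolding e P_def
        by (intro exI[of _ gs] exI[of _ "b # p"] exI[of _ rest']) (use h r a l in simp)
    qed
  qed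
  then obtain gs p where h: "x = p @ concat gs" "\<forall>g \<in> set gs. length g = 4" "length p < 4"
      "s1 18 = (if p = [] then [] else [code_num p])" "s1 1 = map code_num gs"
    unfolding P_def s1_def by auto
  have n1: "code_num p \<noteq> 1" if "p \<noteq> []"
    using that code_num_inj[of p "[]"] by auto
  have e: "sem read_prog (init_store x) = (sem (Case 18 (\<lambda>v. if v = 1 then Skip else Push 1 4)) s1)(18 := [])"
    unfolding read_prog_def sem.simps f_def[unfolded sem.simps, symmetric] s1_def by simp
  have 1: "sem read_prog (init_store x) 1 = (if p = [] then [] else [4]) @ map code_num gs"
    unfolding e using h(4,5) n1 by (simp add: peek_def)
  have "sem read_prog (init_store x) i = ((init_store x)(1 := (if p = [] then [] else [4]) @ map code_num gs)) i" for i
  proof -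
    consider "i = 1" | "i = 18" | "i \<notin> {1, 18}" by blast
    then show ?thesis
    proof cases
      case 1
      then show ?thesis using \<open>sem read_prog (init_store x) 1 = _\<close> by simp
    next
      case 2
      then show ?thesis unfolding e by (simp add: init_store_def)
    next
      case 3
      then have "sem read_prog (init_store x) i = init_store x i"
        using read_prog_frame(1) by (intro sem_unchanged) auto
      then show ?thesis using 3 by simp
    qed
  qed
  then show ?thesis using h(1-3) by blast
qed

lemma symbols_tokens: "map tok_of (symbols x) = map Some ts \<longleftrightarrow> x = concat (map token_code ts)"
  and symbols_neq_1: "a \<in> set (symbols x) \<Longrightarrow> a \<noteq> 1"
  and sem_read_prog_symbols: "sem read_prog (init_store x) = (init_store x)(1 := symbols x)"
proof -
  obtain gs p where h: "x = p @ concat gs" "\<forall>g \<in> set gs. length g = 4" "length p < 4"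
     "sem read_prog (init_store x) = (init_store x)(1 := (if p = [] then [] else [4]) @ map code_num gs)"
    using sem_read_prog by blast
  have s: "symbols x = (if p = [] then [] else [4]) @ map code_num gs" unfolding symbols_def h(4) by simp
  show "sem read_prog (init_store x) = (init_store x)(1 := symbols x)" unfolding h(4) s ..
  have n1: "code_num g \<noteq> 1" if "length g = 4" for g using code_num_bounds[of g] that by simp
  show "a \<in> set (symbols x) \<Longrightarrow> a \<noteq> 1" unfolding s using h(2) n1 by (auto split: if_splits simp del: One_nat_def)
  have n4: "tok_of 4 \<noteq> Some t" for t
    unfolding tok_of_Some using code_num_bounds[of "token_code t"] token_code_length[of t] by simp
  show "map tok_of (symbols x) = map Some ts \<longleftrightarrow> x = concat (map token_code ts)"
  proof (cases "p = []")
    case True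
    have "map tok_of (map code_num gs) = map Some ts \<longleftrightarrow> gs = map token_code ts"
    proof (induction gs arbitrary: ts)
      case (Cons g gs)
      show ?case
      proof (cases ts)
        case (Cons t ts')
        have "tok_of (code_num g) = Some t \<longleftrightarrow> g = token_code t" unfolding tok_of_Some using code_num_inj by blast
        then show ?thesis using Cons.IH[of ts'] local.Cons by simp
      qed simp
    qed auto
    moreover have "concat gs = concat (map token_code ts) \<longleftrightarrow> gs = map token_code ts"
    proof
      have len: "length (concat gs) = 4 * length gs" if "\<forall>g \<in> set gs. length g = 4" for gs :: "bool list list"
        using that by (induction gs) auto
      assume c: "concat gs = concat (map token_code ts)"
      have "\<forall>g \<in> set (map token_code ts). length g = 4" using token_code_length by simp
      then have "length gs = length (map token_code ts)" using len[OF h(2)] len c by (metis mult_left_cancel zero_neq_numeral)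
      moreover have "length a = length b" if "(a, b) \<in> set (zip gs (map token_code ts))" for a b
      proof -
        have "a \<in> set gs" "b \<in> set (map token_code ts)" using that set_zip_leftD set_zip_rightD by metis+
        then show ?thesis using h(2) token_code_length by auto
      qed
      ultimately show "gs = map token_code ts" using c concat_injective[of gs "map token_code ts"] by blast
    qed simp
    moreover have s': "symbols x = map code_num gs" and x: "x = concat gs" using s h(1) True by simp_all
    ultimately show ?thesis unfolding s' by (simp add: x)
  next
    case False
    have "map tok_of (symbols x) \<noteq> map Some ts"
    proof
      assume "map tok_of (symbols x) = map Some ts"
      then have "tok_of 4 \<in> Some ` set ts" unfolding s using False by (cases ts) auto
      then show False using n4 by force
    qed
    moreover have "x \<noteq> concat (map token_code ts)"
    proof
      assume c: "x = concat (map token_code ts)"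
      have "length (concat gs) = 4 * length gs" using h(2) by (induction gs) auto
      moreover have "length (concat (map token_code ts)) = 4 * length ts"
        using token_code_length by (induction ts) auto
      ultimately have "length p + 4 * length gs = 4 * length ts" using c h(1) by (metis length_append)
      then have "length p mod 4 = 0" by presburger
      then show False using h(3) False by simp
    qed
    ultimately show ?thesis by blast
  qed
qed

definition pattern :: "nat \<Rightarrow> bool list" where
  "pattern N = concat (replicate N (replicate N True @ replicate N False))"

lemma concat_replicate_commute: "concat (replicate n w) @ w @ z = w @ concat (replicate n w) @ z"
  by (induction n) auto

lemma sem_copy_prog:
  assumes "\<And>a. a \<in> set (s 1) \<Longrightarrow> a \<noteq> 1" "i \<in> {2, 3, 4}" "s i = []"
  shows "sem copy_prog s i = rev (s 1)"
proof -
  define f where "f = sem (Case 1 (\<lambda>t. if t = 1 then Skip else Push 2 t ;; Push 3 t ;; Push 4 t))"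
  let ?P = "\<lambda>l (t :: store). (\<forall>a \<in> set l. a \<noteq> 1) \<and> rev l @ t i = rev (s 1)"
  have "?P [] (loop f 1 (s 1) s)"
  proof (rule loop_induct[where P="?P"])
    show "?P (s 1) s" using assms by simp
    fix a l t assume "?P (a # l) t"
    then show "?P l (f (t(1 := a # l)))" using assms(2) by (auto simp: f_def peek_def)
  qed
  then show ?thesis using assms(2) by (auto simp: copy_prog_def f_def)
qed

lemma sem_fill_prog: "sem (fill_prog a) s 5 = replicate (length (s 2)) a @ s 5"
  "sem (fill_prog a) s 6 = replicate (length (s 2)) 2 @ s 6" "sem (fill_prog a) s 2 = s 2"
proof -
  let ?P = "\<lambda>(l :: nat list) (t :: store). replicate (length l) a @ t 5 = replicate (length (s 2)) a @ s 5 \<and>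
    replicate (length l) 2 @ t 6 = replicate (length (s 2)) 2 @ s 6"
  have "?P [] (loop (sem (Push 5 a ;; Push 6 2)) 2 (s 2) s)"
    by (rule loop_induct[where P="?P"]) (simp_all add: replicate_app_Cons_same)
  then show "sem (fill_prog a) s 5 = replicate (length (s 2)) a @ s 5"
    "sem (fill_prog a) s 6 = replicate (length (s 2)) 2 @ s 6" "sem (fill_prog a) s 2 = s 2"
    by (simp_all add: fill_prog_def)
qed

lemma sem_init_prog:
  defines "N x \<equiv> length (symbols x)"
  shows "sem init_prog (init_store x) 5 = map bit (pattern (N x))" (is ?A)
    and "sem init_prog (init_store x) 6 = map bit (replicate (length (pattern (N x))) False)" (is ?B)
    and "sem init_prog (init_store x) 7 = [3]"
    and "i \<in> {2, 3, 4} \<Longrightarrow> sem init_prog (init_store x) i = rev (symbols x)"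
    and "8 \<le> i \<Longrightarrow> i \<le> 17 \<Longrightarrow> sem init_prog (init_store x) i = []"
proof -
  define s0 where "s0 = sem copy_prog (sem read_prog (init_store x))"
  define f where "f = sem (fill_prog 2 ;; fill_prog 3)"
  define w where "w = replicate (N x) (3 :: nat) @ replicate (N x) 2"
  define s1 where "s1 = sem (For 3 (fill_prog 2 ;; fill_prog 3)) s0"
  have e: "sem init_prog (init_store x) = s1(7 := 3 # s1 7)"
    by (simp add: init_prog_def s1_def s0_def)
  have r: "sem read_prog (init_store x) i = []" if "i \<notin> {0, 1}" for i
    using that unfolding sem_read_prog_symbols by (simp add: init_store_def)
  have r1: "sem read_prog (init_store x) 1 = symbols x" unfolding sem_read_prog_symbols by simp
  have s0: "s0 i = rev (symbols x)" if "i \<in> {2, 3, 4}" for i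
    unfolding s0_def using sem_copy_prog[of "sem read_prog (init_store x)" i] that r1 r[of i] symbols_neq_1[of _ x] by auto
  have s0': "s0 i = []" if "i \<notin> {0, 1, 2, 3, 4}" for i
  proof -
    have "s0 i = sem read_prog (init_store x) i"
      unfolding s0_def using copy_prog_frame(1) that by (intro sem_unchanged) auto
    then show ?thesis using r that by simp
  qed
  have wr: "writes (For 3 (fill_prog 2 ;; fill_prog 3)) = {5, 6}" by (auto simp: fill_prog_def)
  have s1: "s1 i = s0 i" if "i \<notin> {5, 6}" for i unfolding s1_def using that wr by (intro sem_unchanged) simp
  let ?P = "\<lambda>(l :: nat list) (t :: store). t 2 = s0 2 \<and> concat (replicate (length l) w) @ t 5 = concat (replicate (N x) w) \<and>
    concat (replicate (length l) (map (\<lambda>_. 2) w)) @ t 6 = concat (replicate (N x) (map (\<lambda>_. 2) w))"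
  have "?P [] (loop f 3 (s0 3) s0)"
  proof (rule loop_induct[where P="?P"])
    show "?P (s0 3) s0" using s0[of 3] s0'[of 5] s0'[of 6] by (simp add: N_def)
    fix a l t assume P: "?P (a # l) t"
    have l2: "length (t 2) = N x" using P s0[of 2] by (simp add: N_def)
    have g: "f (t(3 := a # l)) 5 = w @ t 5" "f (t(3 := a # l)) 6 = map (\<lambda>_. 2) w @ t 6" "f (t(3 := a # l)) 2 = t 2"
      unfolding f_def sem.simps sem_fill_prog using l2 by (simp_all add: w_def map_replicate_const replicate_add)
    show "?P l (f (t(3 := a # l)))" unfolding g
      using P by (simp add: concat_replicate_commute)
  qed
  then have v: "s1 5 = concat (replicate (N x) w)" "s1 6 = concat (replicate (N x) (map (\<lambda>_. 2) w))"
    unfolding s1_def by (simp_all add: f_def)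
  have p: "map bit (pattern (N x)) = concat (replicate (N x) w)"
    unfolding pattern_def w_def by (simp add: map_concat bit_def)
  show ?A unfolding e p using v by simp
  have "map bit (replicate (length (pattern (N x))) False) = map (\<lambda>_. 2) (map bit (pattern (N x)))"
    by (simp add: map_replicate_const bit_def)
  also have "\<dots> = concat (replicate (N x) (map (\<lambda>_. 2) w))" unfolding p by (simp add: map_concat)
  finally show ?B unfolding e using v by simp
  show "sem init_prog (init_store x) 7 = [3]" unfolding e using s1[of 7] s0'[of 7] by simp
  show "i \<in> {2, 3, 4} \<Longrightarrow> sem init_prog (init_store x) i = rev (symbols x)" unfolding e using s1[of i] s0[of i] by auto
  show "8 \<le> i \<Longrightarrow> i \<le> 17 \<Longrightarrow> sem init_prog (init_store x) i = []" unfolding e using s1[of i] s0'[of i] by auto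
qed

section \<open>Bit lists as plays\<close>

lemma quant_value_replicate:
  "quant_value (replicate n False @ qs) F ys \<longleftrightarrow> (\<exists>T. length T = n \<and> quant_value qs F (rev T @ ys))"
  "quant_value (replicate n True @ qs) F ys \<longleftrightarrow> (\<forall>T. length T = n \<longrightarrow> quant_value qs F (rev T @ ys))"
proof (induction n arbitrary: ys)
  case (Suc n)
  case 1
  have "quant_value (replicate (Suc n) False @ qs) F ys \<longleftrightarrow> (\<exists>b T. length T = n \<and> quant_value qs F (rev T @ b # ys))"
    using Suc(1) by simp
  also have "\<dots> \<longleftrightarrow> (\<exists>T. length T = Suc n \<and> quant_value qs F (rev T @ ys))"
    unfolding length_Suc_conv by (rule iffI; clarsimp; force)
  finally show ?case .
  case 2
  have "quant_value (replicate (Suc n) True @ qs) F ys \<longleftrightarrow> (\<forall>b T. length T = n \<longrightarrow> quant_value qs F (rev T @ b # ys))"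
    using Suc(2) by simp
  also have "\<dots> \<longleftrightarrow> (\<forall>T. length T = Suc n \<longrightarrow> quant_value qs F (rev T @ ys))"
    unfolding length_Suc_conv by (rule iffI; clarsimp; force)
  finally show ?case .
qed simp_all

lemma quant_value_quantify:
  "quant_value (concat (replicate j (replicate N False @ replicate N True))) F ys \<longleftrightarrow>
     quantify N j (\<lambda>play. F (play_bits (rev play) @ ys))"
proof (induction j arbitrary: ys)
  case 0
  then show ?case by (simp add: play_bits_def)
next
  case (Suc j)
  let ?Q = "\<lambda>T C. quantify N j (\<lambda>play. F (play_bits (rev play) @ C @ rev T @ ys))"
  \<comment> \<open>The marks of a round arrive on the bit stack in reverse order; reversal permutes
    the lists of length \<open>N\<close> over which the quantifier ranges.\<close>
  have r: "(\<forall>C :: bool list. length C = N \<longrightarrow> ?Q T (rev C)) \<longleftrightarrow> (\<forall>C. length C = N \<longrightarrow> ?Q T C)" for T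
    by (metis length_rev rev_rev_ident)
  have "quant_value (concat (replicate (Suc j) (replicate N False @ replicate N True))) F ys \<longleftrightarrow>
      (\<exists>T. length T = N \<and> (\<forall>C. length C = N \<longrightarrow> ?Q T (rev C)))"
    by (simp add: quant_value_replicate Suc.IH)
  then show ?case unfolding r by (simp add: play_bits_def)
qed

lemma rev_pattern: "rev (pattern N) = concat (replicate N (replicate N False @ replicate N True))"
  unfolding pattern_def rev_concat by simp

fun split_plays :: "nat \<Rightarrow> nat \<Rightarrow> bool list \<Rightarrow> (bool list \<times> bool list) list" where
  "split_plays N 0 y = []"
| "split_plays N (Suc n) y = (rev (take N (drop N y)), take N y) # split_plays N n (drop N (drop N y))"

lemma split_plays:
  assumes "length y = n * (N + N)"
  shows "length (split_plays N n y) = n \<and> play_bits (split_plays N n y) = y \<and>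
    (\<forall>(T, C) \<in> set (split_plays N n y). length T = N \<and> length C = N)"
  using assms
proof (induction n arbitrary: y)
  case (Suc n)
  have "length (drop N (drop N y)) = n * (N + N)" using Suc.prems by simp
  moreover have "take N y @ take N (drop N y) @ drop (N + N) y = y" by (metis append_take_drop_id drop_drop)
  ultimately show ?case using Suc.IH[of "drop N (drop N y)"] Suc.prems by (simp add: play_bits_def)
qed (simp add: play_bits_def)

lemma split_plays_play_bits:
  "(\<And>T C. (T, C) \<in> set rp \<Longrightarrow> length T = N \<and> length C = N) \<Longrightarrow> split_plays N (length rp) (play_bits rp) = rp"
proof (induction rp)
  case (Cons x rp)
  obtain T C where x: "x = (T, C)" by (cases x)
  have l: "length T = N" "length C = N" using Cons.prems[of T C] x by simp_all
  have "play_bits (x # rp) = C @ rev T @ play_bits rp" by (simp add: play_bits_def x)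
  moreover have "split_plays N (length rp) (play_bits rp) = rp" by (rule Cons.IH, rule Cons.prems) simp
  ultimately show ?case using l x by simp
qed simp

lemma quantify_cong:
  "(\<And>play. length play = j \<Longrightarrow> (\<And>T C. (T, C) \<in> set play \<Longrightarrow> length T = N \<and> length C = N) \<Longrightarrow> G play = H play) \<Longrightarrow>
     quantify N j G = quantify N j H"
proof (induction j arbitrary: G H)
  case (Suc j)
  have "quantify N j (\<lambda>rest. G ((T, C) # rest)) = quantify N j (\<lambda>rest. H ((T, C) # rest))"
    if "length T = N" "length C = N" for T C
    by (rule Suc.IH, rule Suc.prems) (use that in auto)
  then show ?case by (auto simp: quantify.simps)
qed simp

definition leaf_value :: "connective set \<Rightarrow> bool list \<Rightarrow> bool list \<Rightarrow> bool" where
  "leaf_value S x y = (let N = length (symbols x); play = rev (split_plays N N y) in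
     fst (play_value S (map tok_of (symbols x)) play) \<and> play_label play)"

lemma length_pattern: "length (pattern N) = N * (N + N)"
  unfolding pattern_def by (simp add: length_concat sum_list_replicate)

text \<open>There is no separate syntax check: on an input that encodes no formula over
  \<open>S\<close>, no labelling passes the scan, so the game is lost there as on an unsatisfiable
  formula.\<close>

theorem modal_sat_PSPACE: "modal_sat S \<in> PSPACE"
proof -
  have "{x. quant_value (rev (pattern (length (symbols x)))) (leaf_value S x) []} \<in> PSPACE"
  proof (rule quant_value_PSPACE[where k=19 and K=num_syms and init=init_prog and leaf="leaf_prog S"])
    show "tame 19 num_syms (leaf_prog S)"
    proof (rule tame_simple)
      have "writes (leaf_prog S) \<inter> fors (leaf_prog S) \<subseteq> {6, 8, 9, 10, 11, 12, 13, 14, 15, 16, 17} \<inter> {2, 3, 4, 5}"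
        by (rule Int_mono[OF leaf_prog_frame(1,2)])
      then show "writes (leaf_prog S) \<inter> fors (leaf_prog S) = {}" by simp
    qed (use leaf_prog_frame[of S] num_syms(1) in auto)
    fix x y s
    let ?N = "length (symbols x)"
    assume y: "length y = length (pattern ?N)" and s: "s = (sem init_prog (init_store x))(6 := map bit y)"
    let ?rp = "split_plays ?N ?N y"
    have rp: "length ?rp = ?N" "play_bits ?rp = y" "\<And>T C. (T, C) \<in> set ?rp \<Longrightarrow> length T = ?N \<and> length C = ?N"
      using split_plays[of y ?N ?N] y unfolding length_pattern by auto
    have "s 2 = rev (symbols x)" "length (s 3) = ?N" "length (s 4) = ?N" "length (s 5) = length (play_bits ?rp)"
      "s 6 = map bit (play_bits ?rp)" "\<And>i. 8 \<le> i \<Longrightarrow> i \<le> 17 \<Longrightarrow> s i = []"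
      unfolding s rp(2) using y by (simp_all add: sem_init_prog(1,4,5))
    from sem_leaf_prog[OF rp(1,3) this, of S] show "sem (leaf_prog S) s = s(8 := [bit (leaf_value S x y)])"
      unfolding leaf_value_def Let_def .
  qed (use num_syms(1) tame_init_prog in \<open>simp_all add: sem_init_prog\<close>)
  also have "{x. quant_value (rev (pattern (length (symbols x)))) (leaf_value S x) []} = modal_sat S"
  proof -
    have "quant_value (rev (pattern (length (symbols x)))) (leaf_value S x) [] \<longleftrightarrow> x \<in> modal_sat S" for x
    proof -
      let ?us = "map tok_of (symbols x)" and ?N = "length (symbols x)"
      have "quant_value (rev (pattern ?N)) (leaf_value S x) [] \<longleftrightarrow>
          quantify ?N ?N (\<lambda>play. leaf_value S x (play_bits (rev play)))"
        unfolding rev_pattern quant_value_quantify by simp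
      also have "\<dots> \<longleftrightarrow> quantify ?N ?N (\<lambda>play. fst (play_value S ?us play) \<and> play_label play)"
      proof (rule quantify_cong)
        fix play :: "(bool list \<times> bool list) list"
        assume p: "length play = ?N" "\<And>T C. (T, C) \<in> set play \<Longrightarrow> length T = ?N \<and> length C = ?N"
        have "split_plays ?N (length (rev play)) (play_bits (rev play)) = rev play"
          by (rule split_plays_play_bits) (use p(2) in simp)
        then show "leaf_value S x (play_bits (rev play)) = (fst (play_value S ?us play) \<and> play_label play)"
          unfolding leaf_value_def Let_def using p(1) by simp
      qed
      also have "\<dots> \<longleftrightarrow> (\<exists>\<phi>. ?us = map Some (tokens \<phi>) \<and> connectives \<phi> \<subseteq> S \<and> satisfiable \<phi>)"
        using play_satisfiable[of ?us S] unfolding length_map play_label_def .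
      also have "\<dots> \<longleftrightarrow> x \<in> modal_sat S"
        unfolding symbols_tokens modal_sat_def modal_lang_def encode_def by blast
      finally show ?thesis .
    qed
    then show ?thesis by blast
  qed
  finally show ?thesis .
qed

theorem theorem7:
  fixes S :: "connective set"
  assumes "{ONeg, OAnd, OBox} \<subseteq> S \<or> {ONeg, OAnd, ODia} \<subseteq> S \<or>
           {ONeg, OOr, OBox} \<subseteq> S \<or> {ONeg, OOr, ODia} \<subseteq> S \<or>
           {OAtNeg, OAnd, OOr, OBox, ODia} \<subseteq> S"
  shows "PSPACE_complete (modal_sat S)"
  unfolding PSPACE_complete_def
  using modal_sat_PSPACE PSPACE_hard[OF iffD2[OF adequate_def assms]] by blast

end
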